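(* Assume that (A1)–(A5), as written out in the context, hold. Then the cumulative reward $R(t)$ satisfies $$\frac{R(t)}{\mathbb{E} R(t)} \to 1 \quad \text{almost surely as } t \to \infty.$$
   Context: Setting. $X=(X(t):t\ge 0)$ is a right-continuous Markov jump process on a finite set $S$, $|S|=d<\infty$, with time-dependent rate matrices $Q(t)=(Q(t,x,y):x,y\in S)$ (nonnegative off-diagonal entries, rows summing to $0$) and initial distribution $\mu$. Let $T_j$ be the time of the $j$th jump of $X$, $Y_j=X(T_j)$ for $j\ge1$, $Y_0=X(0)$, and $J(t)$ the number of jumps of $X$ in $[0,t]$. Given $X$, $N=(N(t):t\ge0)$ is a Poisson counting process with intensity $(\beta(t,X(t)):t\ge 0)$ and event times $(\Lambda_k:k\ge1)$. Let $0=t_0<t_1<t_2<\cdots$ be deterministic times with $t_i\to\infty$, and $n(t)=\sup\{i\ge0:t_i\le t\}$. Conditional on $X$ and $N$, the lump-sum rewards $\mathscr G(T_k,Y_{k-1},Y_k)$, $\mathscr H(t_k,X(t_k))$, $\mathscr K(\Lambda_k,X(\Lambda_k))$, $k\ge1$, are independent with respective conditional distribution functions $G(T_k,Y_{k-1},Y_k,\cdot)$, $H(t_k,X(t_k),\cdot)$, $K(\Lambda_k,X(\Lambda_k),\cdot)$, where $G(t,x,y,\cdot)$, $H(t,x,\cdot)$, $K(t,x,\cdot)$ ($t\ge0$, $x,y\in S$) are given families of distribution functions. The cumulative reward is $$R(t)=\int_0^t r(s,X(s))\,ds+\sum_{j=1}^{J(t)}\mathscr G(T_j,Y_{j-1},Y_j)+\sum_{i=1}^{n(t)}\mathscr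 H(t_i,X(t_i))+\sum_{k=1}^{N(t)}\mathscr K(\Lambda_k,X(\Lambda_k)).$$ Assumptions. (A1) For $x,y\in S$, $z\in\mathbb R$, the functions $Q(\cdot,x,y)$, $r(\cdot,x)$, $G(\cdot,x,y,z)$, $K(\cdot,x,z)$, $\beta(\cdot,x)$ are measurable. (A2) $\mathcal B=\{(x,y):Q(t,x,y)>0\}$ does not depend on $t$, and $Q(1)$ (hence every $Q(t)$) is an irreducible rate matrix. (A3) For each $(x,y)\in\mathcal B$, $0<\inf_{t\ge0}Q(t,x,y)\le\sup_{t\ge0}Q(t,x,y)<\infty$. (A4) There is a finite-valued function $c=(c(x):x\in S)$ such that for all $x\in S$ (and $y \in S$): $0\le\inf_{t}r(t,x)\le\sup_t r(t,x)<\infty$; $0\le\inf_t\beta(t,x)\le\sup_t\beta(t,x)<\infty$; $\sup_t G(t,x,y,0-)=0$ and $\inf_t G(t,x,y,c(x))=1$; $\sup_t H(t,x,0-)=0$ and $\inf_t H(t,x,c(x))=1$; $\sup_t K(t,x,0-)=0$ and $\inf_t K(t,x,c(x))=1$ (i.e. lump-sum rewards take values in $[0,c(x)]$). Moreover, with $\gamma_1(t,x)=\sum_{y:(x,y)\in\mathcal B}Q(t,x,y)\int_0^\infty zG(t,x,y,dz)$, $\gamma_2(t,x)=\beta(t,x)\int_0^\infty zK(t,x,dz)$ and $\gamma=\gamma_1+\gamma_2$, one has $\inf_{t\ge0}r(t,x)+\inf_{t\ge0}\gamma(t,x)>0$ for all $x\in S$. (A5) $\inf\{t_i-t_{i-1}:i\ge1\}>0$.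 *)

theory Defs
  imports "HOL-Probability.Probability"
begin

section \<open>Rate matrices and distribution functions\<close>

definition rate_matrix :: "('s::finite \<Rightarrow> 's \<Rightarrow> real) \<Rightarrow> bool" where
  "rate_matrix q \<longleftrightarrow> (\<forall>x y. x \<noteq> y \<longrightarrow> 0 \<le> q x y) \<and> (\<forall>x. (\<Sum>y\<in>UNIV. q x y) = 0)"

text \<open>For a rate matrix the diagonal is nonpositive, so only pairs of distinct states occur here.\<close>

definition positive_pairs :: "('s \<Rightarrow> 's \<Rightarrow> real) \<Rightarrow> ('s \<times> 's) set" where
  "positive_pairs q = {(x, y). 0 < q x y}"

definition irreducible_rate_matrix :: "('s::finite \<Rightarrow> 's \<Rightarrow> real) \<Rightarrow> bool" where
  "irreducible_rate_matrix q \<longleftrightarrow> rate_matrix q \<and> (\<forall>x y. (x, y) \<in> (positive_pairs q)\<^sup>*)"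

definition distribution_function :: "(real \<Rightarrow> real) \<Rightarrow> bool" where
  "distribution_function F \<longleftrightarrow> (\<exists>\<nu>. real_distribution \<nu> \<and> F = cdf \<nu>)"

definition left_limit :: "(real \<Rightarrow> real) \<Rightarrow> real \<Rightarrow> real" where
  "left_limit F a = Lim (at_left a) F"

definition positive_mean :: "(real \<Rightarrow> real) \<Rightarrow> real" where
  "positive_mean F = (LINT z:{0..}|interval_measure F. z)"

text \<open>Time-dependent data live on \<open>{0..}\<close>; values at negative times are irrelevant.\<close>

abbreviation measurable_in_time :: "(real \<Rightarrow> real) \<Rightarrow> bool" where
  "measurable_in_time f \<equiv> f \<in> borel_measurable (restrict_space borel {0..})"

text \<open>Infima and suprema over time are taken in the extended reals, where they always exist.\<close>

abbreviation inf_time :: "(real \<Rightarrow> real) \<Rightarrow> ereal" where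
  "inf_time f \<equiv> (INF t\<in>{0..}. ereal (f t))"

abbreviation sup_time :: "(real \<Rightarrow> real) \<Rightarrow> ereal" where
  "sup_time f \<equiv> (SUP t\<in>{0..}. ereal (f t))"

section \<open>Paths\<close>

text \<open>Right-continuity with respect to the discrete topology on the value space.\<close>

definition right_continuous_path :: "(real \<Rightarrow> 'v) \<Rightarrow> bool" where
  "right_continuous_path p \<longleftrightarrow> (\<forall>t\<ge>0. \<forall>\<^sub>F s in at_right t. p s = p t)"

definition jumps :: "(real \<Rightarrow> 'v) \<Rightarrow> real set" where
  "jumps p = {t. 0 < t \<and> \<not> (\<forall>\<^sub>F s in at_left t. p s = p t)}"

definition jump_path :: "(real \<Rightarrow> 'v) \<Rightarrow> bool" where
  "jump_path p \<longleftrightarrow> right_continuous_path p \<and> (\<forall>t\<ge>0. finite (jumps p \<inter> {0..t}))"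

definition num_jumps :: "(real \<Rightarrow> 'v) \<Rightarrow> real \<Rightarrow> nat" where
  "num_jumps p t = card (jumps p \<inter> {0..t})"

definition counting_path :: "(real \<Rightarrow> nat) \<Rightarrow> bool" where
  "counting_path n \<longleftrightarrow> n 0 = 0 \<and> mono_on {0..} n \<and> right_continuous_path n"

text \<open>The \<open>k\<close>-th event time of a counting path \<open>n\<close>. It is finite iff \<open>event_occurs n k\<close>;
  otherwise the infimum is over the empty set and the value of \<open>event_time n k\<close> is meaningless.\<close>

definition event_occurs :: "(real \<Rightarrow> nat) \<Rightarrow> nat \<Rightarrow> bool" where
  "event_occurs n k \<longleftrightarrow> (\<exists>t\<ge>0. k \<le> n t)"

definition event_time :: "(real \<Rightarrow> nat) \<Rightarrow> nat \<Rightarrow> real" where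
  "event_time n k = Inf {t. 0 \<le> t \<and> k \<le> n t}"

text \<open>With this definition \<open>jump_time p 0 = 0\<close>, hence \<open>embedded p 0 = p 0\<close>.\<close>

definition jump_time :: "(real \<Rightarrow> 'v) \<Rightarrow> nat \<Rightarrow> real" where
  "jump_time p j = event_time (num_jumps p) j"

definition embedded :: "(real \<Rightarrow> 'v) \<Rightarrow> nat \<Rightarrow> 'v" where
  "embedded p j = p (jump_time p j)"

section \<open>The processes\<close>

text \<open>The sigma-algebra generated by \<open>Z t\<close>, \<open>t \<in> I\<close>, for a process with values in a countable
  discrete space.\<close>

definition generated :: "'w measure \<Rightarrow> real set \<Rightarrow> (real \<Rightarrow> 'w \<Rightarrow> 'v::countable) \<Rightarrow> 'w measure" where
  "generated M I Z = sigma (space M) {Z t -` A \<inter> space M | t A. t \<in> I}"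

text \<open>The transition matrices of the rate matrices \<open>Q\<close> are determined by Kolmogorov's forward
  equation, in integrated form because \<open>Q\<close> is only assumed measurable in time.\<close>

definition transition_matrices ::
  "(real \<Rightarrow> 's::finite \<Rightarrow> 's \<Rightarrow> real) \<Rightarrow> (real \<Rightarrow> real \<Rightarrow> 's \<Rightarrow> 's \<Rightarrow> real) \<Rightarrow> bool" where
  "transition_matrices Q P \<longleftrightarrow> (\<forall>s t x y. 0 \<le> s \<and> s \<le> t \<longrightarrow>
     set_integrable lborel {s..t} (\<lambda>u. \<Sum>z\<in>UNIV. P s u x z * Q u z y) \<and>
     P s t x y = (if x = y then 1 else 0) + (LBINT u:{s..t}. \<Sum>z\<in>UNIV. P s u x z * Q u z y))"

definition markov_jump_process ::
  "'w measure \<Rightarrow> (real \<Rightarrow> 's::finite \<Rightarrow> 's \<Rightarrow> real) \<Rightarrow> 's pmf \<Rightarrow> (real \<Rightarrow> 'w \<Rightarrow> 's) \<Rightarrow> bool" where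
  "markov_jump_process M Q \<mu> X \<longleftrightarrow>
     (\<forall>t\<ge>0. rate_matrix (Q t)) \<and>
     (\<forall>t\<ge>0. X t \<in> measurable M (count_space UNIV)) \<and>
     (\<forall>w\<in>space M. jump_path (\<lambda>t. X t w)) \<and>
     distr M (count_space UNIV) (X 0) = measure_pmf \<mu> \<and>
     (\<exists>P. transition_matrices Q P \<and>
       (\<forall>s t y. 0 \<le> s \<and> s \<le> t \<longrightarrow>
         (AE w in M. real_cond_exp M (generated M {0..s} X)
             (indicator {w' \<in> space M. X t w' = y}) w = P s t (X s w) y)))"

text \<open>Conditionally on \<open>X\<close>, increments of \<open>N\<close> over consecutive intervals are independent and
  Poisson distributed with the integrated intensity as mean. The mean may be \<open>0\<close>, which
  \<^const>\<open>poisson_pmf\<close> does not admit; hence the explicit mass function, with \<open>0 ^ 0 = 1\<close>.\<close>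

definition conditional_poisson_process ::
  "'w measure \<Rightarrow> (real \<Rightarrow> 's::finite \<Rightarrow> real) \<Rightarrow> (real \<Rightarrow> 'w \<Rightarrow> 's) \<Rightarrow> (real \<Rightarrow> 'w \<Rightarrow> nat) \<Rightarrow> bool" where
  "conditional_poisson_process M \<beta> X N \<longleftrightarrow>
     (\<forall>t\<ge>0. N t \<in> measurable M (count_space UNIV)) \<and>
     (\<forall>w\<in>space M. counting_path (\<lambda>t. N t w)) \<and>
     (\<forall>(m::nat) (s::nat \<Rightarrow> real) (k::nat \<Rightarrow> nat).
       0 \<le> s 0 \<and> (\<forall>i<m. s i \<le> s (Suc i)) \<longrightarrow>
       (AE w in M. real_cond_exp M (generated M {0..} X)
           (indicator {w' \<in> space M. \<forall>i<m. N (s (Suc i)) w' - N (s i) w' = k i}) w =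
         (\<Prod>i<m. let a = (LBINT u:{s i..s (Suc i)}. \<beta> u (X u w))
                 in exp (- a) * a ^ k i / fact (k i))))"

text \<open>\<open>GG j\<close>, \<open>HH i\<close>, \<open>KK k\<close> (indices from \<open>1\<close> on) are the lump-sum rewards at the \<open>j\<close>-th jump of
  \<open>X\<close>, at \<open>ts i\<close> and at the \<open>k\<close>-th event of \<open>N\<close>. Given \<open>X\<close> and \<open>N\<close> they are independent, that is,
  the conditional joint distribution functions of finite subfamilies are products. Nothing is
  required where one of the jumps or events involved never occurs.\<close>

definition lump_sum_rewards ::
  "'w measure \<Rightarrow> (real \<Rightarrow> 'w \<Rightarrow> 's::finite) \<Rightarrow> (real \<Rightarrow> 'w \<Rightarrow> nat) \<Rightarrow> (nat \<Rightarrow> real) \<Rightarrow>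
   (real \<Rightarrow> 's \<Rightarrow> 's \<Rightarrow> real \<Rightarrow> real) \<Rightarrow> (real \<Rightarrow> 's \<Rightarrow> real \<Rightarrow> real) \<Rightarrow> (real \<Rightarrow> 's \<Rightarrow> real \<Rightarrow> real) \<Rightarrow>
   (nat \<Rightarrow> 'w \<Rightarrow> real) \<Rightarrow> (nat \<Rightarrow> 'w \<Rightarrow> real) \<Rightarrow> (nat \<Rightarrow> 'w \<Rightarrow> real) \<Rightarrow> bool" where
  "lump_sum_rewards M X N ts G H K GG HH KK \<longleftrightarrow>
     (\<forall>k\<ge>1. GG k \<in> borel_measurable M \<and> HH k \<in> borel_measurable M \<and> KK k \<in> borel_measurable M) \<and>
     (\<forall>A B C (zg::nat \<Rightarrow> real) (zh::nat \<Rightarrow> real) (zk::nat \<Rightarrow> real).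
       finite A \<and> finite B \<and> finite C \<and> A \<subseteq> {1..} \<and> B \<subseteq> {1..} \<and> C \<subseteq> {1..} \<longrightarrow>
       (AE w in M.
         (\<forall>j\<in>A. event_occurs (num_jumps (\<lambda>t. X t w)) j) \<and>
         (\<forall>k\<in>C. event_occurs (\<lambda>t. N t w) k) \<longrightarrow>
         real_cond_exp M (generated M {0..} (\<lambda>t w'. (X t w', N t w')))
           (indicator {w' \<in> space M. (\<forall>j\<in>A. GG j w' \<le> zg j) \<and> (\<forall>i\<in>B. HH i w' \<le> zh i) \<and>
                                     (\<forall>k\<in>C. KK k w' \<le> zk k)}) w =
         (\<Prod>j\<in>A. G (jump_time (\<lambda>t. X t w) j) (embedded (\<lambda>t. X t w) (j - 1))
                   (embedded (\<lambda>t. X t w) j) (zg j)) *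
         (\<Prod>i\<in>B. H (ts i) (X (ts i) w) (zh i)) *
         (\<Prod>k\<in>C. K (event_time (\<lambda>t. N t w) k) (X (event_time (\<lambda>t. N t w) k) w) (zk k))))"

definition reward_times :: "(nat \<Rightarrow> real) \<Rightarrow> bool" where
  "reward_times ts \<longleftrightarrow> ts 0 = 0 \<and> strict_mono ts \<and> filterlim ts at_top sequentially"

definition cumulative_reward ::
  "(real \<Rightarrow> 's::finite \<Rightarrow> real) \<Rightarrow> (nat \<Rightarrow> real) \<Rightarrow> (real \<Rightarrow> 'w \<Rightarrow> 's) \<Rightarrow> (real \<Rightarrow> 'w \<Rightarrow> nat) \<Rightarrow>
   (nat \<Rightarrow> 'w \<Rightarrow> real) \<Rightarrow> (nat \<Rightarrow> 'w \<Rightarrow> real) \<Rightarrow> (nat \<Rightarrow> 'w \<Rightarrow> real) \<Rightarrow> real \<Rightarrow> 'w \<Rightarrow> real" where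
  "cumulative_reward r ts X N GG HH KK t w =
     (LBINT s:{0..t}. r s (X s w)) +
     (\<Sum>j = 1..num_jumps (\<lambda>s. X s w) t. GG j w) +
     (\<Sum>i = 1..Sup {i. ts i \<le> t}. HH i w) +
     (\<Sum>k = 1..N t w. KK k w)"

section \<open>The assumptions\<close>

definition assumption_A1 where
  "assumption_A1 Q r G K \<beta> \<longleftrightarrow>
     (\<forall>(x::'s::finite) (y::'s) (z::real).
       measurable_in_time (\<lambda>t. Q t x y) \<and> measurable_in_time (\<lambda>t. r t x) \<and>
       measurable_in_time (\<lambda>t. G t x y z) \<and> measurable_in_time (\<lambda>t. K t x z) \<and>
       measurable_in_time (\<lambda>t. \<beta> t x))"

definition assumption_A2 :: "(real \<Rightarrow> 's::finite \<Rightarrow> 's \<Rightarrow> real) \<Rightarrow> bool" where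
  "assumption_A2 Q \<longleftrightarrow>
     (\<forall>s\<ge>0. \<forall>t\<ge>0. positive_pairs (Q s) = positive_pairs (Q t)) \<and> irreducible_rate_matrix (Q 1)"

definition assumption_A3 :: "(real \<Rightarrow> 's::finite \<Rightarrow> 's \<Rightarrow> real) \<Rightarrow> bool" where
  "assumption_A3 Q \<longleftrightarrow> (\<forall>(x, y)\<in>positive_pairs (Q 1).
     0 < inf_time (\<lambda>t. Q t x y) \<and> inf_time (\<lambda>t. Q t x y) \<le> sup_time (\<lambda>t. Q t x y) \<and>
     sup_time (\<lambda>t. Q t x y) < \<infinity>)"

definition jump_reward_rate ::
  "(real \<Rightarrow> 's::finite \<Rightarrow> 's \<Rightarrow> real) \<Rightarrow> (real \<Rightarrow> 's \<Rightarrow> 's \<Rightarrow> real \<Rightarrow> real) \<Rightarrow> real \<Rightarrow> 's \<Rightarrow> real" where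
  "jump_reward_rate Q G t x =
     (\<Sum>y | (x, y) \<in> positive_pairs (Q t). Q t x y * positive_mean (G t x y))"

definition event_reward_rate ::
  "(real \<Rightarrow> 's::finite \<Rightarrow> real) \<Rightarrow> (real \<Rightarrow> 's \<Rightarrow> real \<Rightarrow> real) \<Rightarrow> real \<Rightarrow> 's \<Rightarrow> real" where
  "event_reward_rate \<beta> K t x = \<beta> t x * positive_mean (K t x)"

definition assumption_A4 ::
  "(real \<Rightarrow> 's::finite \<Rightarrow> 's \<Rightarrow> real) \<Rightarrow> (real \<Rightarrow> 's \<Rightarrow> real) \<Rightarrow> (real \<Rightarrow> 's \<Rightarrow> real) \<Rightarrow>
   (real \<Rightarrow> 's \<Rightarrow> 's \<Rightarrow> real \<Rightarrow> real) \<Rightarrow> (real \<Rightarrow> 's \<Rightarrow> real \<Rightarrow> real) \<Rightarrow> (real \<Rightarrow> 's \<Rightarrow> real \<Rightarrow> real) \<Rightarrow> bool"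
where
  "assumption_A4 Q r \<beta> G H K \<longleftrightarrow>
     (\<exists>c :: 's \<Rightarrow> real. \<forall>x y.
       0 \<le> inf_time (\<lambda>t. r t x) \<and> inf_time (\<lambda>t. r t x) \<le> sup_time (\<lambda>t. r t x) \<and>
       sup_time (\<lambda>t. r t x) < \<infinity> \<and>
       0 \<le> inf_time (\<lambda>t. \<beta> t x) \<and> inf_time (\<lambda>t. \<beta> t x) \<le> sup_time (\<lambda>t. \<beta> t x) \<and>
       sup_time (\<lambda>t. \<beta> t x) < \<infinity> \<and>
       sup_time (\<lambda>t. left_limit (G t x y) 0) = 0 \<and> inf_time (\<lambda>t. G t x y (c x)) = 1 \<and>
       sup_time (\<lambda>t. left_limit (H t x) 0) = 0 \<and> inf_time (\<lambda>t. H t x (c x)) = 1 \<and>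
       sup_time (\<lambda>t. left_limit (K t x) 0) = 0 \<and> inf_time (\<lambda>t. K t x (c x)) = 1) \<and>
     (\<forall>x. 0 < inf_time (\<lambda>t. r t x) +
               inf_time (\<lambda>t. jump_reward_rate Q G t x + event_reward_rate \<beta> K t x))"

definition assumption_A5 :: "(nat \<Rightarrow> real) \<Rightarrow> bool" where
  "assumption_A5 ts \<longleftrightarrow> 0 < (INF i\<in>{1..}. ereal (ts i - ts (i - 1)))"

end

theory Submission
  imports Defs
begin

text \<open>
Irreducibility and the two-sided bounds on the rates give a Doeblin minorization over unit time, so
that the jump process forgets its past at a geometric rate, in the strong multiplicative sense
\<open>P(A \<inter> {X t = x}) \<le> (1 + C * \<rho> ^ k) * P(A) * P(X t = x)\<close> for events \<open>A\<close> that lie \<open>k\<close> time units before \<open>t\<close>.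
Being multiplicative, the estimate passes from indicators to numbers of jumps and of Poisson events
in intervals (approximate along fine grids and let the mesh tend to zero), then from intervals to
Borel functions of the event times (compare measures on the line), and finally to the rewards,
which may be replaced by their conditional means. Hence the reward earned in unit time blocks has
geometrically decaying correlations, and the variance of \<open>R(n)\<close> is at most linear in \<open>n\<close>.
By (A4) the mean of \<open>R(n)\<close> grows at least linearly, since every state has probability bounded
away from zero after time one. So the variances of \<open>R(n\<^sup>2) / E R(n\<^sup>2)\<close> are summable, which gives
convergence along the squares, and the monotonicity of \<open>R\<close> fills the gaps between them.
\<close>

section \<open>Step paths, their jumps, and the inverse relation of counts and event times\<close>

section \<open>Paths\<close>

text \<open>A variance bound needs only upper bounds on mixed moments, so a one-sided estimate
  suffices. It is kept in the form \<open>E(U V) \<le> \<kappa> * E U * E V\<close> for nonnegative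
  \<open>U\<close>, \<open>V\<close>: this passes to sums over cells and to limits without loss,
  whereas an additive error per pair of cells would grow with the square of their number. The price
  is a lower bound on \<open>P(X t = x)\<close>, available from time one on. A reward law is merely
  measurable in time, so a reward cannot be read off at the grid point next to its event. This is
  why counts come first and functions of event times are reached through measures on the line. One
  scheme serves all lump sums: jumps, Poisson events and deterministic reward times are counting
  processes whose events carry labels (a pair of states, or the current state) and rewards. The
  integral part is its analogue with Lebesgue measure in place of the counts. The four parts are
  never decorrelated from each other: the variance of a sum of four is at most four times the sum of
  the variances.\<close>

lemma right_continuous_pathD:
  assumes "right_continuous_path p" "0 \<le> t"
  obtains d where "0 < d" "\<And>s. t \<le> s \<Longrightarrow> s < t + d \<Longrightarrow> p s = p t"
proof -
  have "\<forall>\<^sub>F s in at_right t. p s = p t"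
    using assms by (auto simp: right_continuous_path_def)
  then obtain b where "b > t" "\<forall>y>t. y < b \<longrightarrow> p y = p t"
    unfolding eventually_at_right_field by blast
  then show ?thesis
    by (intro that[of "b - t"]) (force simp: order_le_less)+
qed

text \<open>Compactness of \<open>{s..t}\<close> in the form of the bisection principle
  \<open>Bolzano\<close>: every point has a neighbourhood on which the path is constant, to its
  right by right-continuity, to its left because it is no jump. At \<open>s\<close> itself nothing
  is known on the left, but the subintervals of \<open>{s..t}\<close> around \<open>s\<close> start
  there.\<close>

lemma no_jump_const:
  assumes rc: "right_continuous_path p" and "0 \<le> s" "s \<le> t" and nj: "jumps p \<inter> {s<..t} = {}"
  shows "p s = p t"
proof -
  let ?P = "\<lambda>u v. s \<le> u \<and> v \<le> t \<longrightarrow> p u = p v"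
  from \<open>s \<le> t\<close> have "?P s t"
  proof (induct rule: Bolzano[where P = ?P])
    case (trans a b c)
    then show ?case by auto
  next
    case (local x)
    with \<open>0 \<le> s\<close> have "0 \<le> x" by auto
    from right_continuous_pathD[OF rc this] obtain d
      where d: "0 < d" "\<And>u. x \<le> u \<Longrightarrow> u < x + d \<Longrightarrow> p u = p x" by blast
    show ?case
    proof (cases "x = s")
      case True
      show ?thesis
      proof (intro exI[of _ d] conjI allI impI)
        fix a b assume *: "a \<le> x \<and> x \<le> b \<and> b - a < d" "s \<le> a \<and> b \<le> t"
        then have "a = x" using True by auto
        then show "p a = p b" using * d(2)[of b] by auto
      qed (use d(1) in auto)
    next
      case False
      with local nj have "x \<notin> jumps p" by auto
      with False local \<open>0 \<le> s\<close> have "\<forall>\<^sub>F s in at_left x. p s = p x"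
        by (auto simp: jumps_def)
      then obtain e where e: "e < x" "\<forall>y>e. y < x \<longrightarrow> p y = p x"
        unfolding eventually_at_left_field by blast
      have px: "p y = p x" if "e < y" "y < x + d" for y
      proof (cases "y < x")
        case True
        with e(2) that show ?thesis by blast
      next
        case False
        then show ?thesis using d(2)[of y] that by simp
      qed
      show ?thesis
      proof (intro exI[of _ "min d (x - e)"] conjI allI impI)
        fix a b assume *: "a \<le> x \<and> x \<le> b \<and> b - a < min d (x - e)"
        then have "b - a < d" "b - a < x - e" "a \<le> x" "x \<le> b" by auto
        then have "e < a" "a < x + d" "e < b" "b < x + d" using e(1) d(1) by linarith+
        then show "p a = p b" using px[of a] px[of b] by simp
      qed (use d(1) e(1) in auto)
    qed
  qed
  then show ?thesis by simp
qed

lemma counting_path_mono: "counting_path c \<Longrightarrow> 0 \<le> s \<Longrightarrow> s \<le> t \<Longrightarrow> c s \<le> c t"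
  by (auto simp: counting_path_def intro: mono_onD)

lemma event_occursI: "0 \<le> t \<Longrightarrow> k \<le> c t \<Longrightarrow> event_occurs c k"
  by (auto simp: event_occurs_def)

text \<open>Right-continuity makes the infimum in \<open>event_time\<close> attained, so that event
  times are the generalised inverse of the counting path. Nearly everything said later about event
  times goes through this equivalence; \<open>event_occurs\<close> excludes the infimum of the empty
  set.\<close>

lemma event_time_le_iff:
  assumes c: "counting_path c" and occ: "event_occurs c k"
  shows "0 \<le> event_time c k" and "k \<le> c (event_time c k)"
    and "0 \<le> t \<Longrightarrow> event_time c k \<le> t \<longleftrightarrow> k \<le> c t"
proof -
  let ?S = "{t. 0 \<le> t \<and> k \<le> c t}"
  have ne: "?S \<noteq> {}" using occ by (auto simp: event_occurs_def)
  have bdd: "bdd_below ?S" by (intro bdd_belowI[of _ 0]) auto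
  show nn: "0 \<le> event_time c k" unfolding event_time_def
    using ne by (intro cInf_greatest) auto
  obtain d where d: "0 < d" "\<And>s. event_time c k \<le> s \<Longrightarrow> s < event_time c k + d \<Longrightarrow> c s = c (event_time c k)"
    using right_continuous_pathD[of c "event_time c k"] c nn by (auto simp: counting_path_def)
  obtain s where s: "s \<in> ?S" "s < event_time c k + d"
    using cInf_lessD[OF ne, of "event_time c k + d"] d(1) by (auto simp: event_time_def)
  moreover have "event_time c k \<le> s"
    unfolding event_time_def using s bdd by (intro cInf_lower) auto
  ultimately show k: "k \<le> c (event_time c k)" using d(2)[of s] by simp
  show "event_time c k \<le> t \<longleftrightarrow> k \<le> c t" if "0 \<le> t"
  proof
    assume "event_time c k \<le> t"
    with k counting_path_mono[OF c nn] show "k \<le> c t" by force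
  next
    assume "k \<le> c t"
    then show "event_time c k \<le> t"
      unfolding event_time_def using that bdd by (intro cInf_lower) auto
  qed
qed

lemma event_time_in_Ioc_iff:
  assumes c: "counting_path c" and occ: "event_occurs c k" and st: "0 \<le> s" "s \<le> t"
  shows "event_time c k \<in> {s<..t} \<longleftrightarrow> k \<in> {c s<..c t}"
  using event_time_le_iff(3)[OF c occ, of s] event_time_le_iff(3)[OF c occ, of t] st by auto

context
  fixes p :: "real \<Rightarrow> 'v"
  assumes p: "jump_path p"
begin

lemma finite_jumps: "finite (jumps p \<inter> {a..b})"
proof (cases "0 \<le> b")
  case True
  have "jumps p \<inter> {a..b} \<subseteq> jumps p \<inter> {0..b}" by (auto simp: jumps_def)
  moreover have "finite (jumps p \<inter> {0..b})" using True p by (simp add: jump_path_def)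
  ultimately show ?thesis by (rule finite_subset)
next
  case False
  then have "jumps p \<inter> {a..b} = {}" by (auto simp: jumps_def)
  then show ?thesis by simp
qed

lemma num_jumps_split:
  assumes "0 \<le> s" "s \<le> t"
  shows "num_jumps p t = num_jumps p s + card (jumps p \<inter> {s<..t})"
proof -
  have "jumps p \<inter> {0..t} = jumps p \<inter> {0..s} \<union> jumps p \<inter> {s<..t}" using assms by auto
  moreover have "finite (jumps p \<inter> {s<..t})"
    by (rule finite_subset[OF _ finite_jumps[of s t]]) auto
  ultimately show ?thesis unfolding num_jumps_def
    using finite_jumps by (simp add: card_Un_disjoint disjoint_iff)
qed

lemma num_jumps_eqD:
  assumes "0 \<le> s" "s \<le> t" "num_jumps p t = num_jumps p s"
  shows "p s = p t"
proof -
  have "finite (jumps p \<inter> {s<..t})"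
    by (rule finite_subset[OF _ finite_jumps[of s t]]) auto
  with num_jumps_split[OF assms(1,2)] assms(3) have "jumps p \<inter> {s<..t} = {}" by simp
  then show ?thesis using p assms by (intro no_jump_const) (auto simp: jump_path_def)
qed

lemma counting_path_num_jumps: "counting_path (num_jumps p)"
  unfolding counting_path_def
proof (intro conjI)
  have "jumps p \<inter> {0..0} = {}" by (auto simp: jumps_def)
  then show "num_jumps p 0 = 0" by (simp add: num_jumps_def)
  show "mono_on {0..} (num_jumps p)"
  proof (rule mono_onI)
    fix r s :: real assume "r \<in> {0..}" "s \<in> {0..}" "r \<le> s"
    then show "num_jumps p r \<le> num_jumps p s" using num_jumps_split[of r s] by simp
  qed
  show "right_continuous_path (num_jumps p)"
    unfolding right_continuous_path_def
  proof (intro allI impI)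
    fix t :: real assume t: "0 \<le> t"
    \<comment> \<open>The other jumps nearby form a finite, hence closed set, so some neighbourhood
      of \<open>t\<close> avoids them.\<close>
    let ?S = "jumps p \<inter> {t..t+1} - {t}"
    have "finite ?S" by (intro finite_Diff finite_jumps)
    then have "open (- ?S)" by (intro open_Compl finite_imp_closed)
    moreover have "t \<in> - ?S" by auto
    ultimately obtain e where e: "e > 0" "ball t e \<subseteq> - ?S" by (meson openE)
    show "\<forall>\<^sub>F s in at_right t. num_jumps p s = num_jumps p t"
      unfolding eventually_at_right_field
    proof (intro exI[of _ "t + min e 1"] conjI allI impI)
      fix s assume s: "t < s" "s < t + min e 1"
      have "jumps p \<inter> {t<..s} = {}"
      proof (rule ccontr)
        assume "jumps p \<inter> {t<..s} \<noteq> {}"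
        then obtain u where u: "u \<in> jumps p" "t < u" "u \<le> s" by auto
        then have "u \<in> ball t e" using s by (auto simp: dist_real_def)
        with e u s show False by auto
      qed
      then show "num_jumps p s = num_jumps p t"
        using num_jumps_split[OF t, of s] s by auto
    qed (use e(1) in auto)
  qed
qed

text \<open>Since the last jump up to time \<open>t\<close> the count has not changed, hence neither
  has the path.\<close>

lemma path_at_jump_time:
  assumes "0 \<le> t"
  shows "embedded p (num_jumps p t) = p t"
proof -
  note C = counting_path_num_jumps
  let ?k = "num_jumps p t"
  have occ: "event_occurs (num_jumps p) ?k" using assms by (auto intro: event_occursI)
  note E = event_time_le_iff[OF C occ]
  have "event_time (num_jumps p) ?k \<le> t" using E(3)[of t] assms by simp
  moreover from this have "?k = num_jumps p (event_time (num_jumps p) ?k)"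
    using E(1,2) counting_path_mono[OF C, of _ t] by (simp add: le_antisym)
  ultimately show ?thesis
    unfolding embedded_def jump_time_def using E(1) by (intro num_jumps_eqD) auto
qed

text \<open>Jumps come one at a time: just before its \<open>j\<close>th jump time the path has
  fewer than \<open>j\<close> jumps, and a short interval ending there contains at most one.\<close>

lemma num_jumps_jump_time:
  assumes occ: "event_occurs (num_jumps p) j"
  shows "num_jumps p (jump_time p j) = j"
proof (cases "j = 0")
  case True
  have "event_time (num_jumps p) 0 \<le> 0"
    using event_time_le_iff(3)[OF counting_path_num_jumps occ, of 0] True by simp
  then have "jump_time p j = 0"
    using event_time_le_iff(1)[OF counting_path_num_jumps occ] True by (simp add: jump_time_def)
  then show ?thesis using True counting_path_num_jumps by (simp add: counting_path_def)
next
  case False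
  note C = counting_path_num_jumps
  note E = event_time_le_iff[OF C occ]
  let ?T = "event_time (num_jumps p) j"
  have T: "0 < ?T"
  proof (rule ccontr)
    assume "\<not> 0 < ?T"
    then have "?T = 0" using E(1) by simp
    with E(2) C False show False by (simp add: counting_path_def)
  qed
  have "open (- (jumps p \<inter> {0..?T} - {?T}))"
    using finite_jumps[of 0 ?T] by (intro open_Compl finite_imp_closed) auto
  moreover have "?T \<in> - (jumps p \<inter> {0..?T} - {?T})" by auto
  ultimately obtain e where e: "e > 0" "ball ?T e \<subseteq> - (jumps p \<inter> {0..?T} - {?T})" by (meson openE)
  \<comment> \<open>So close to \<open>?T\<close> that no other jump lies in between, and cut off at
    \<open>0\<close> because counts are meaningful at nonnegative times only.\<close>
  define u where "u = max 0 (?T - e/2)"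
  have u: "0 \<le> u" "u < ?T" using T e by (auto simp: u_def)
  have "jumps p \<inter> {u<..?T} \<subseteq> {?T}"
  proof
    fix x assume x: "x \<in> jumps p \<inter> {u<..?T}"
    then have "x \<in> ball ?T e" using e u by (auto simp: dist_real_def u_def)
    with e x u show "x \<in> {?T}" by auto
  qed
  then have "card (jumps p \<inter> {u<..?T}) \<le> 1"
    using card_mono[of "{?T}"] by fastforce
  moreover have "num_jumps p u < j" using E(3)[of u] u by auto
  ultimately have "num_jumps p ?T \<le> j" using num_jumps_split[of u ?T] u by auto
  with E(2) show ?thesis by (simp add: jump_time_def)
qed

text \<open>Between two successive jump times the path is constant. If it took the same value at the
  second one, that time would be no jump in the sense of \<open>jumps\<close>; the jump counted on
  \<open>{?S<..?T}\<close> would then come strictly earlier, against the minimality of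
  \<open>?T\<close>.\<close>

lemma embedded_Suc_neq:
  assumes occ: "event_occurs (num_jumps p) (Suc j)"
  shows "embedded p j \<noteq> embedded p (Suc j)"
proof
  assume eq: "embedded p j = embedded p (Suc j)"
  note C = counting_path_num_jumps
  have occ': "event_occurs (num_jumps p) j" using occ by (auto simp: event_occurs_def intro: Suc_leD)
  let ?T = "jump_time p (Suc j)" let ?S = "jump_time p j"
  have S: "0 \<le> ?S" and T: "0 \<le> ?T"
    using event_time_le_iff(1)[OF C] occ occ' by (auto simp: jump_time_def)
  have NT: "num_jumps p ?T = Suc j" "num_jumps p ?S = j"
    using num_jumps_jump_time occ occ' by auto
  have ST: "?S < ?T" using NT S T counting_path_mono[OF C, of ?T ?S] by force
  have c: "p u = p ?S" if "?S \<le> u" "u < ?T" for u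
  proof -
    have "num_jumps p u < Suc j"
      using event_time_le_iff(3)[OF C occ, of u] that S by (simp add: jump_time_def not_le[symmetric])
    moreover have "num_jumps p u \<ge> j" using counting_path_mono[OF C S that(1)] NT by simp
    ultimately show ?thesis using that S NT by (intro num_jumps_eqD[symmetric]) auto
  qed
  have "\<forall>\<^sub>F u in at_left ?T. p u = p ?T"
    unfolding eventually_at_left_field
  proof (intro exI[of _ ?S] conjI allI impI)
    fix u assume "?S < u" "u < ?T"
    then show "p u = p ?T" using c[of u] eq by (simp add: embedded_def)
  qed (rule ST)
  then have nT: "?T \<notin> jumps p" by (simp add: jumps_def)
  have "card (jumps p \<inter> {?S<..?T}) = 1"
    using num_jumps_split[OF S, of ?T] ST NT by simp
  then obtain u where u: "jumps p \<inter> {?S<..?T} = {u}" by (auto simp: card_1_singleton_iff)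
  then have "u \<in> jumps p" "?S < u" "u \<le> ?T" by auto
  with nT have "u < ?T" by (cases "u = ?T") auto
  then have "num_jumps p u < Suc j"
    using event_time_le_iff(3)[OF C occ, of u] S \<open>?S < u\<close>
    by (simp add: jump_time_def not_le[symmetric])
  then have "card (jumps p \<inter> {?S<..u}) = 0"
    using num_jumps_split[OF S, of u] NT \<open>?S < u\<close> by simp
  moreover have "finite (jumps p \<inter> {?S<..u})"
    by (rule finite_subset[OF _ finite_jumps[of ?S u]]) auto
  ultimately have "jumps p \<inter> {?S<..u} = {}" by simp
  with \<open>u \<in> jumps p\<close> \<open>?S < u\<close> show False by auto
qed

end

text \<open>Cells so short that every event time in them is followed by a constant piece of \<open>p\<close> reaching
  beyond the cell.\<close>

lemma short_cells:
  assumes c: "counting_path c" and p: "right_continuous_path p" and b: "0 \<le> b"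
  obtains d where "0 < d"
    "\<And>s t k. 0 \<le> s \<Longrightarrow> s \<le> t \<Longrightarrow> t \<le> b \<Longrightarrow> t - s < d \<Longrightarrow> k \<in> {c s<..c t} \<Longrightarrow> p (event_time c k) = p t"
proof -
  have "\<exists>d>0. \<forall>s. event_time c k \<le> s \<and> s < event_time c k + d \<longrightarrow> p s = p (event_time c k)"
    if "k \<le> c b" for k
  proof -
    have "0 \<le> event_time c k"
      using event_time_le_iff(1)[OF c event_occursI[of b k c, OF b that]] .
    from right_continuous_pathD[OF p this] show ?thesis by metis
  qed
  then obtain d where d: "\<And>k. k \<le> c b \<Longrightarrow> 0 < d k"
    "\<And>k s. k \<le> c b \<Longrightarrow> event_time c k \<le> s \<Longrightarrow> s < event_time c k + d k \<Longrightarrow> p s = p (event_time c k)"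
    by metis
  show ?thesis
  \<comment> \<open>Only finitely many indices occur up to time \<open>b\<close>, each with its own
    constant piece of length \<open>d k\<close>. The index \<open>0\<close> is among them, so the
    minimum is over a nonempty set.\<close>
  proof (rule that[of "Min (d ` {..c b})"])
    show "0 < Min (d ` {..c b})" using d(1) by (subst Min_gr_iff) auto
    fix s t k assume *: "0 \<le> s" "s \<le> t" "t \<le> b" "t - s < Min (d ` {..c b})" "k \<in> {c s<..c t}"
    then have kb: "k \<le> c b" using counting_path_mono[OF c, of t b] by auto
    then have "t - s < d k" using * by (subst (asm) Min_gr_iff) auto
    moreover have "event_time c k \<in> {s<..t}"
      using event_time_in_Ioc_iff[OF c event_occursI[of b k c, OF b kb], of s t] * by auto
    ultimately show "p (event_time c k) = p t" using d(2)[OF kb, of t] by auto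
  qed
qed

text \<open>\<open>short_cells\<close> is applied with the counting path itself as the step path:
  with two jumps in a cell, the count at the first of them would already equal the count at the end
  of the cell, whereas it exceeds the initial count by exactly one.\<close>

lemma short_cells_jumps:
  assumes p: "jump_path p" and b: "0 \<le> b"
  obtains d where "0 < d"
    "\<And>s t. 0 \<le> s \<Longrightarrow> s \<le> t \<Longrightarrow> t \<le> b \<Longrightarrow> t - s < d \<Longrightarrow> num_jumps p t \<le> Suc (num_jumps p s)"
proof -
  note C = counting_path_num_jumps[OF p]
  obtain d where d: "0 < d" "\<And>s t k. 0 \<le> s \<Longrightarrow> s \<le> t \<Longrightarrow> t \<le> b \<Longrightarrow> t - s < d \<Longrightarrow>
      k \<in> {num_jumps p s<..num_jumps p t} \<Longrightarrow> num_jumps p (event_time (num_jumps p) k) = num_jumps p t"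
    using short_cells[OF C, of "num_jumps p" b] C b by (auto simp: counting_path_def)
  show ?thesis
  proof (rule that[OF d(1)], rule ccontr)
    fix s t assume *: "0 \<le> s" "s \<le> t" "t \<le> b" "t - s < d" "\<not> num_jumps p t \<le> Suc (num_jumps p s)"
    then have "num_jumps p (jump_time p (Suc (num_jumps p s))) = num_jumps p t"
      unfolding jump_time_def by (intro d(2)) auto
    moreover have "event_occurs (num_jumps p) (Suc (num_jumps p s))"
      using * by (intro event_occursI[of t]) auto
    ultimately show False using num_jumps_jump_time[OF p] * by auto
  qed
qed

section \<open>Counts of events by label, and how to read them off at the ends of short
  cells\<close>

definition label_count :: "(real \<Rightarrow> nat) \<Rightarrow> (nat \<Rightarrow> 'l) \<Rightarrow> 'l \<Rightarrow> real \<Rightarrow> real \<Rightarrow> nat" where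
  "label_count c L l s t = card {k \<in> {c s<..c t}. L k = l}"

lemma label_count_split:
  assumes "c s \<le> c t" "c t \<le> c u"
  shows "label_count c L l s u = label_count c L l s t + label_count c L l t u"
proof -
  have "{k \<in> {c s<..c u}. L k = l} = {k \<in> {c s<..c t}. L k = l} \<union> {k \<in> {c t<..c u}. L k = l}"
    using assms by auto
  then show ?thesis unfolding label_count_def
    by (simp add: card_Un_disjoint disjoint_iff)
qed

lemma label_count_le: "label_count c L l s t \<le> c t - c s"
  unfolding label_count_def by (rule order.trans[OF card_mono[of "{c s<..c t}"]]) auto

lemma sum_label_count_cells:
  assumes c: "counting_path c" and "0 \<le> s 0" and "\<And>i. i < n \<Longrightarrow> s i \<le> s (Suc i)"
  shows "(\<Sum>i<n. label_count c L l (s i) (s (Suc i))) = label_count c L l (s 0) (s n)"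
  using assms(3)
proof (induct n)
  case 0
  then show ?case by (simp add: label_count_def)
next
  case (Suc n)
  note prem = Suc.prems
  have m: "k \<le> n \<longrightarrow> s 0 \<le> s k" for k
  proof (induct k)
    case (Suc k)
    then show ?case using prem[of k] by force
  qed simp
  have "c (s 0) \<le> c (s n)" "c (s n) \<le> c (s (Suc n))"
    using Suc.prems[of n] m[of n] assms(2) counting_path_mono[OF c] by auto
  then have "label_count c L l (s 0) (s (Suc n))
      = label_count c L l (s 0) (s n) + label_count c L l (s n) (s (Suc n))"
    by (rule label_count_split)
  moreover have "(\<Sum>i<n. label_count c L l (s i) (s (Suc i))) = label_count c L l (s 0) (s n)"
    using prem by (intro Suc.hyps) auto
  ultimately show ?case by simp
qed

text \<open>In a short cell every event sees the state that is still present at the right end, so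
  counts by state depend only on the path at the two ends. This is what makes grid approximations
  computable from laws at fixed times.\<close>

lemma label_count_short_cells:
  assumes c: "counting_path c" and p: "right_continuous_path p" and b: "0 \<le> b"
  obtains d where "0 < d"
    "\<And>s t l. 0 \<le> s \<Longrightarrow> s \<le> t \<Longrightarrow> t \<le> b \<Longrightarrow> t - s < d \<Longrightarrow>
      label_count c (\<lambda>k. p (event_time c k)) l s t = (if p t = l then c t - c s else 0)"
proof -
  obtain d where d: "0 < d" "\<And>s t k. 0 \<le> s \<Longrightarrow> s \<le> t \<Longrightarrow> t \<le> b \<Longrightarrow> t - s < d \<Longrightarrow>
      k \<in> {c s<..c t} \<Longrightarrow> p (event_time c k) = p t"
    using short_cells[OF assms] by metis
  show ?thesis
  proof (rule that[OF d(1)])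
    fix s t l assume *: "0 \<le> s" "s \<le> t" "t \<le> b" "t - s < d"
    then have "{k \<in> {c s<..c t}. p (event_time c k) = l} = (if p t = l then {c s<..c t} else {})"
      using d(2)[of s t] by auto
    then show "label_count c (\<lambda>k. p (event_time c k)) l s t = (if p t = l then c t - c s else 0)"
      by (simp add: label_count_def)
  qed
qed

abbreviation jump_label :: "(real \<Rightarrow> 'v) \<Rightarrow> nat \<Rightarrow> 'v \<times> 'v" where
  "jump_label p k \<equiv> (embedded p (k - 1), embedded p k)"

text \<open>A short cell contains at most one jump. A jump is therefore visible as a difference of
  the two end states, and its label is the pair of these states.\<close>

lemma label_count_short_cells_jumps:
  assumes p: "jump_path p" and b: "0 \<le> b"
  obtains d where "0 < d"
    "\<And>s t l. 0 \<le> s \<Longrightarrow> s \<le> t \<Longrightarrow> t \<le> b \<Longrightarrow> t - s < d \<Longrightarrow>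
      label_count (num_jumps p) (jump_label p) l s t = of_bool (p s \<noteq> p t \<and> l = (p s, p t)) \<and>
      num_jumps p t - num_jumps p s = of_bool (p s \<noteq> p t)"
proof -
  obtain d where d: "0 < d"
      "\<And>s t. 0 \<le> s \<Longrightarrow> s \<le> t \<Longrightarrow> t \<le> b \<Longrightarrow> t - s < d \<Longrightarrow> num_jumps p t \<le> Suc (num_jumps p s)"
    using short_cells_jumps[OF assms] by metis
  show ?thesis
  proof (rule that[OF d(1)])
    fix s t l assume *: "0 \<le> s" "s \<le> t" "t \<le> b" "t - s < d"
    have le: "num_jumps p s \<le> num_jumps p t"
      using counting_path_mono[OF counting_path_num_jumps[OF p]] * by auto
    show "label_count (num_jumps p) (jump_label p) l s t = of_bool (p s \<noteq> p t \<and> l = (p s, p t)) \<and>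
      num_jumps p t - num_jumps p s = of_bool (p s \<noteq> p t)"
    proof (cases "num_jumps p t = num_jumps p s")
      case True
      then have "p s = p t" using num_jumps_eqD[OF p, of s t] * by simp
      then show ?thesis using True by (simp add: label_count_def)
    next
      case False
      then have k: "num_jumps p t = Suc (num_jumps p s)" using d(2)[of s t] * le by auto
      have e: "embedded p (num_jumps p s) = p s" "embedded p (Suc (num_jumps p s)) = p t"
        using path_at_jump_time[OF p, of s] path_at_jump_time[OF p, of t] * k by auto
      have "event_occurs (num_jumps p) (Suc (num_jumps p s))"
        using * k by (intro event_occursI[of t]) auto
      from embedded_Suc_neq[OF p this] have ne: "p s \<noteq> p t" using e by simp
      have int: "{num_jumps p s<..Suc (num_jumps p s)} = {Suc (num_jumps p s)}" by auto
      have set: "{k \<in> {num_jumps p s<..num_jumps p t}. jump_label p k = l} =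
         (if l = (p s, p t) then {Suc (num_jumps p s)} else {})"
        unfolding k int by (auto simp: e)
      have "label_count (num_jumps p) (jump_label p) l s t = of_bool (l = (p s, p t))"
        unfolding label_count_def set by (cases "l = (p s, p t)") simp_all
      moreover have "num_jumps p t - num_jumps p s = 1" unfolding k by simp
      ultimately show ?thesis using ne by auto
    qed
  qed
qed

section \<open>Comparison of finite measures on the line through half-open intervals\<close>

section \<open>Measures on the line\<close>

text \<open>An inequality is not preserved under complements, so it cannot be carried from intervals
  to Borel sets by a Dynkin argument. The proof replaces it by an equation, which can.\<close>

lemma measure_le_of_Ioc_le:
  fixes \<mu> \<nu> :: "real measure"
  assumes "finite_borel_measure \<mu>" "finite_borel_measure \<nu>"
    and le: "\<And>a b. a \<le> b \<Longrightarrow> emeasure \<mu> {a<..b} \<le> emeasure \<nu> {a<..b}"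
  shows "\<mu> \<le> \<nu>"
proof -
  interpret mu: finite_borel_measure \<mu> by fact
  interpret nu: finite_borel_measure \<nu> by fact
  define F where "F x = cdf \<nu> x - cdf \<mu> x" for x
  have mono: "F x \<le> F y" if "x \<le> y" for x y
  proof -
    have "cdf \<mu> y - cdf \<mu> x \<le> cdf \<nu> y - cdf \<nu> x"
      using le[OF that] mu.emeasure_Ioc[OF that] nu.emeasure_Ioc[OF that] nu.cdf_nondecreasing[OF that]
      by simp
    then show ?thesis by (simp add: F_def)
  qed
  have rc: "continuous (at_right a) F" for a
    unfolding F_def by (intro continuous_diff mu.cdf_is_right_cont nu.cdf_is_right_cont)
  have bot: "(F \<longlongrightarrow> 0) at_bot"
    using tendsto_diff[OF nu.cdf_lim_at_bot mu.cdf_lim_at_bot] by (simp add: F_def[abs_def])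
  have top: "(F \<longlongrightarrow> measure \<nu> (space \<nu>) - measure \<mu> (space \<mu>)) at_top"
    using tendsto_diff[OF nu.cdf_lim_at_top mu.cdf_lim_at_top] by (simp add: F_def[abs_def])
  have nonneg: "0 \<le> F x" for x
    using bot by (rule tendsto_upperbound) (auto simp: eventually_at_bot_linorder mono intro!: exI[of _ x])
  have top0: "0 \<le> measure \<nu> (space \<nu>) - measure \<mu> (space \<mu>)"
    using top by (rule tendsto_lowerbound) (auto simp: nonneg)
  \<comment> \<open>\<open>\<nu>\<close> is the sum of \<open>\<mu>\<close> and the measure generated by the difference of the distribution functions.\<close>
  let ?l = "interval_measure F"
  have fin: "finite_borel_measure ?l"
    by (rule finite_borel_measure_interval_measure[OF mono rc bot top top0])
  interpret l: finite_borel_measure ?l by fact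
  have cdf_l: "cdf ?l = F" by (rule cdf_interval_measure[OF mono rc bot])
  \<comment> \<open>Complements are computed by subtraction in the reals, unions in the extended
    reals, so the equation is needed in both forms.\<close>
  have conv: "emeasure \<nu> A = emeasure \<mu> A + emeasure ?l A \<longleftrightarrow> measure \<nu> A = measure \<mu> A + measure ?l A" for A
  proof -
    have "ennreal (measure \<mu> A) + ennreal (measure ?l A) = ennreal (measure \<mu> A + measure ?l A)"
      by (rule ennreal_plus[symmetric]) auto
    then show ?thesis
      unfolding mu.emeasure_eq_measure nu.emeasure_eq_measure l.emeasure_eq_measure
      by (simp only: ennreal_inj measure_nonneg add_nonneg_nonneg)
  qed
  let ?G = "range (\<lambda>(a, b). {a<..b::real})"
  have eq: "emeasure \<nu> A = emeasure \<mu> A + emeasure ?l A" if "A \<in> sigma_sets UNIV ?G" for A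
  proof (rule sigma_sets_induct_disjoint[OF _ _ that])
    show "Int_stable ?G" by (auto simp: Int_stable_def)
    show "?G \<subseteq> Pow UNIV" by auto
  next
    fix A assume "A \<in> ?G"
    then obtain a b where A: "A = {a<..b}" by auto
    show "emeasure \<nu> A = emeasure \<mu> A + emeasure ?l A"
    proof (cases "a \<le> b")
      case True
      have "0 \<le> cdf \<mu> b - cdf \<mu> a" "0 \<le> F b - F a"
        using mu.cdf_nondecreasing[OF True] mono[OF True] by auto
      then show ?thesis
        unfolding A mu.emeasure_Ioc[OF True] nu.emeasure_Ioc[OF True] l.emeasure_Ioc[OF True] cdf_l
        by (subst ennreal_plus[symmetric]) (auto simp: F_def)
    qed (simp add: A)
  next
    fix A assume A: "A \<in> sigma_sets UNIV ?G" and IH: "emeasure \<nu> A = emeasure \<mu> A + emeasure ?l A"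
    have B: "A \<in> sets borel" using A by (simp add: borel_sigma_sets_Ioc)
    have "emeasure ?l UNIV = ennreal (measure \<nu> (space \<nu>) - measure \<mu> (space \<mu>))"
      by (rule interval_measure_UNIV[OF mono rc bot top top0])
    then have t: "measure \<nu> UNIV = measure \<mu> UNIV + measure ?l UNIV"
      using top0 unfolding l.emeasure_eq_measure mu.borel_UNIV nu.borel_UNIV by simp
    have "measure \<mu> (UNIV - A) = measure \<mu> UNIV - measure \<mu> A"
      using B mu.finite_measure_compl[of A] by (simp add: mu.borel_UNIV mu.M_is_borel)
    moreover have "measure \<nu> (UNIV - A) = measure \<nu> UNIV - measure \<nu> A"
      using B nu.finite_measure_compl[of A] by (simp add: nu.borel_UNIV nu.M_is_borel)
    moreover have "measure ?l (UNIV - A) = measure ?l UNIV - measure ?l A"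
      using B l.finite_measure_compl[of A] by simp
    ultimately show "emeasure \<nu> (UNIV - A) = emeasure \<mu> (UNIV - A) + emeasure ?l (UNIV - A)"
      using t IH unfolding conv by linarith
  next
    fix A :: "nat \<Rightarrow> real set"
    assume d: "disjoint_family A" and A: "range A \<subseteq> sigma_sets UNIV ?G"
      and IH: "\<And>i. emeasure \<nu> (A i) = emeasure \<mu> (A i) + emeasure ?l (A i)"
    have "range A \<subseteq> sets \<mu>" "range A \<subseteq> sets \<nu>" "range A \<subseteq> sets ?l"
      using A mu.M_is_borel nu.M_is_borel by (simp_all add: borel_sigma_sets_Ioc)
    then show "emeasure \<nu> (\<Union> (range A)) = emeasure \<mu> (\<Union> (range A)) + emeasure ?l (\<Union> (range A))"
      using d by (simp add: suminf_emeasure[symmetric] IH suminf_add[symmetric])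
  qed simp
  have "emeasure \<mu> A \<le> emeasure \<nu> A" for A
  proof (cases "A \<in> sets borel")
    case True
    then show ?thesis using eq[of A] by (simp add: borel_sigma_sets_Ioc)
  next
    case False
    then show ?thesis using mu.M_is_borel by (simp add: emeasure_notin_sets)
  qed
  then show ?thesis
    using mu.M_is_borel nu.M_is_borel mu.borel_UNIV nu.borel_UNIV by (simp add: le_measure_iff le_fun_def)
qed

lemma nn_integral_le_of_Ioc_le:
  fixes \<mu> \<nu> :: "real measure"
  assumes "finite_borel_measure \<mu>" "finite_borel_measure \<nu>"
    and le: "\<And>a b. a \<le> b \<Longrightarrow> emeasure \<mu> {a<..b} \<le> emeasure \<nu> {a<..b}"
  shows "(\<integral>\<^sup>+x. f x \<partial>\<mu>) \<le> (\<integral>\<^sup>+x. f x \<partial>\<nu>)"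
  using measure_le_of_Ioc_le[OF assms] assms(1,2)
  by (intro nn_integral_mono_measure) (auto simp: finite_borel_measure_def finite_borel_measure_axioms_def)

section \<open>Joint measurability of right-continuous families\<close>

text \<open>The added \<open>1\<close> keeps the approximation strictly above \<open>z\<close>, as
  the punctured limit along \<open>at_right z\<close> demands.\<close>

lemma floor_approx_right:
  fixes z :: real
  shows "z < (of_int \<lfloor>real (Suc n) * z\<rfloor> + 1) / real (Suc n)"
    and "(\<lambda>n. (of_int \<lfloor>real (Suc n) * z\<rfloor> + 1) / real (Suc n)) \<longlonglongrightarrow> z"
proof -
  have *: "z < (of_int \<lfloor>real (Suc n) * z\<rfloor> + 1) / real (Suc n)"
    "(of_int \<lfloor>real (Suc n) * z\<rfloor> + 1) / real (Suc n) \<le> z + inverse (real (Suc n))" for n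
  proof -
    have "real (Suc n) * z < of_int \<lfloor>real (Suc n) * z\<rfloor> + 1" by linarith
    then show "z < (of_int \<lfloor>real (Suc n) * z\<rfloor> + 1) / real (Suc n)"
      by (simp add: pos_less_divide_eq mult.commute)
    have "of_int \<lfloor>real (Suc n) * z\<rfloor> + 1 \<le> real (Suc n) * z + 1" by linarith
    also have "\<dots> = (z + inverse (real (Suc n))) * real (Suc n)" by (simp add: field_simps)
    finally show "(of_int \<lfloor>real (Suc n) * z\<rfloor> + 1) / real (Suc n) \<le> z + inverse (real (Suc n))"
      by (simp add: pos_divide_le_eq)
  qed
  show "z < (of_int \<lfloor>real (Suc n) * z\<rfloor> + 1) / real (Suc n)" by (rule *)
  have "(\<lambda>n. z + inverse (real (Suc n))) \<longlonglongrightarrow> z + 0"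
    by (intro tendsto_add tendsto_const LIMSEQ_inverse_real_of_nat)
  then have lim: "(\<lambda>n. z + inverse (real (Suc n))) \<longlonglongrightarrow> z" by simp
  show "(\<lambda>n. (of_int \<lfloor>real (Suc n) * z\<rfloor> + 1) / real (Suc n)) \<longlonglongrightarrow> z"
    by (rule tendsto_sandwich[OF _ _ tendsto_const lim]) (intro always_eventually allI less_imp_le *; fail)+
qed

text \<open>With the second argument replaced by a countably valued approximation from the right,
  only sections are involved, and these are measurable; right-continuity recovers the function in
  the limit. It serves for distribution functions in their threshold as well as for step paths in
  time.\<close>

lemma measurable_right_continuous_pair:
  fixes f :: "'a \<Rightarrow> real \<Rightarrow> real"
  assumes meas: "\<And>z. (\<lambda>x. f x z) \<in> borel_measurable N"
    and rc: "\<And>x z. x \<in> space N \<Longrightarrow> (f x \<longlongrightarrow> f x z) (at_right z)"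
  shows "(\<lambda>(x, z). f x z) \<in> borel_measurable (N \<Otimes>\<^sub>M borel)"
proof -
  define g where "g n z = (of_int \<lfloor>real (Suc n) * z\<rfloor> + 1) / real (Suc n)" for n and z :: real
  have lim: "(\<lambda>n. f (fst p) (g n (snd p))) \<longlonglongrightarrow> f (fst p) (snd p)"
    if "p \<in> space (N \<Otimes>\<^sub>M (borel::real measure))" for p
  proof (rule filterlim_compose[where g="f (fst p)"])
    show "(f (fst p) \<longlongrightarrow> f (fst p) (snd p)) (at_right (snd p))"
      using that by (intro rc) (auto simp: space_pair_measure)
    show "filterlim (\<lambda>n. g n (snd p)) (at_right (snd p)) sequentially"
      unfolding filterlim_at g_def
    proof (intro conjI floor_approx_right(2) always_eventually allI)
      fix n
      show "(of_int \<lfloor>real (Suc n) * snd p\<rfloor> + 1) / real (Suc n) \<in> {snd p<..}"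
        using floor_approx_right(1) by blast
      show "(of_int \<lfloor>real (Suc n) * snd p\<rfloor> + 1) / real (Suc n) \<noteq> snd p"
        by (rule floor_approx_right(1)[THEN less_imp_neq, THEN not_sym])
    qed
  qed
  have meas': "(\<lambda>p. f (fst p) (g n (snd p))) \<in> borel_measurable (N \<Otimes>\<^sub>M borel)" for n
  proof -
    have "(\<lambda>p. f (fst p) ((of_int i + 1) / real (Suc n))) \<in> borel_measurable (N \<Otimes>\<^sub>M borel)" for i :: int
      by (rule measurable_compose[OF measurable_fst meas])
    moreover have "(\<lambda>p. \<lfloor>real (Suc n) * snd p\<rfloor>) \<in> measurable (N \<Otimes>\<^sub>M borel) (count_space UNIV)"
      by measurable
    ultimately have "(\<lambda>p. f (fst p) ((of_int \<lfloor>real (Suc n) * snd p\<rfloor> + 1) / real (Suc n)))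
        \<in> borel_measurable (N \<Otimes>\<^sub>M borel)"
      by (rule measurable_compose_countable)
    then show ?thesis by (simp only: g_def)
  qed
  have "(\<lambda>p. f (fst p) (snd p)) \<in> borel_measurable (N \<Otimes>\<^sub>M borel)"
    by (rule borel_measurable_LIMSEQ_real[OF lim meas'])
  then show ?thesis by (simp add: case_prod_beta')
qed

lemma cdf_tendsto_right:
  assumes "distribution_function F"
  shows "(F \<longlongrightarrow> F z) (at_right z)"
proof -
  obtain \<nu> where "real_distribution \<nu>" "F = cdf \<nu>"
    using assms by (auto simp: distribution_function_def)
  then show ?thesis
    using finite_borel_measure.cdf_is_right_cont[OF real_distribution.finite_borel_measure_M, of \<nu> z]
    by (simp add: continuous_within)
qed

lemma distribution_function_bounds:
  assumes "distribution_function F"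
  shows "0 \<le> F z" "F z \<le> 1" "mono F"
proof -
  obtain \<nu> where \<nu>: "real_distribution \<nu>" "F = cdf \<nu>"
    using assms by (auto simp: distribution_function_def)
  note fb = real_distribution.finite_borel_measure_M[OF \<nu>(1)]
  show "0 \<le> F z" unfolding \<nu>(2) by (rule finite_borel_measure.cdf_nonneg[OF fb])
  show "F z \<le> 1" unfolding \<nu>(2) by (rule real_distribution.cdf_bounded_prob[OF \<nu>(1)])
  show "mono F" unfolding \<nu>(2) by (auto intro: monoI finite_borel_measure.cdf_nondecreasing[OF fb])
qed

section \<open>Layer cake\<close>

text \<open>Rewards are accessible only through the conditional probabilities of threshold events,
  and this identity writes a reward as an integral of such events. Negative \<open>x\<close> give
  zero on both sides, by the convention of \<open>ennreal\<close>.\<close>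

lemma layer_cake_min:
  fixes x c :: real
  assumes "0 \<le> c"
  shows "ennreal (min c x) = (\<integral>\<^sup>+z\<in>{0..<c}. ennreal (1 - of_bool (x \<le> z)) \<partial>lborel)"
proof -
  have "(\<integral>\<^sup>+z\<in>{0..<c}. ennreal (1 - of_bool (x \<le> z)) \<partial>lborel)
      = (\<integral>\<^sup>+z. indicator {0..<max 0 (min c x)} z \<partial>lborel)"
    by (intro nn_integral_cong) (auto split: split_indicator)
  also have "\<dots> = ennreal (min c x)" by (auto simp: max_def ennreal_neg)
  finally show ?thesis by simp
qed

text \<open>The mean of a law on \<open>{0..c}\<close>, written through its tail. In this form
  measurability in a parameter of \<open>F\<close> follows from joint measurability of the
  distribution functions.\<close>

definition mean_below :: "real \<Rightarrow> (real \<Rightarrow> real) \<Rightarrow> ennreal" where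
  "mean_below c F = (\<integral>\<^sup>+z\<in>{0..<c}. ennreal (1 - F z) \<partial>lborel)"

lemma mean_below_le:
  assumes "distribution_function F" "0 \<le> c"
  shows "mean_below c F \<le> ennreal c"
proof -
  have "mean_below c F \<le> (\<integral>\<^sup>+z. indicator {0..<c} z \<partial>lborel)"
    unfolding mean_below_def using distribution_function_bounds(1)[OF assms(1)]
    by (intro nn_integral_mono) (auto split: split_indicator simp: ennreal_le_1)
  also have "\<dots> = ennreal c" using assms by simp
  finally show ?thesis .
qed

text \<open>The measure \<open>interval_measure F\<close> is the law with distribution function
  \<open>F\<close>. The left limit at \<open>0\<close> is its mass on the negative half-line, and
  the value at \<open>c\<close> excludes mass beyond \<open>c\<close>; on \<open>{0..c}\<close> the
  layer cake and Fubini apply.\<close>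

lemma positive_mean_eq_mean_below:
  assumes F: "distribution_function F" and "0 \<le> c"
    and neg: "left_limit F 0 \<le> 0" and c: "1 \<le> F c"
  shows "ennreal (positive_mean F) = mean_below c F"
    and "z < 0 \<Longrightarrow> F z = 0" and "c \<le> z \<Longrightarrow> F z = 1"
proof -
  obtain \<nu> where \<nu>: "real_distribution \<nu>" "F = cdf \<nu>"
    using F by (auto simp: distribution_function_def)
  interpret real_distribution \<nu> by fact
  have "left_limit F 0 = measure \<nu> {..<0}"
    unfolding left_limit_def \<nu>(2) using cdf_at_left[of 0] by (intro tendsto_Lim) auto
  with neg have m0: "measure \<nu> {..<0} = 0" using measure_nonneg[of \<nu> "{..<0}"] by simp
  have neg': "F z = 0" if "z < 0" for z
  proof -
    have "measure \<nu> {..z} \<le> measure \<nu> {..<0}" using that by (intro finite_measure_mono) auto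
    then show ?thesis using m0 measure_nonneg[of \<nu> "{..z}"] by (simp add: \<nu>(2) cdf_def)
  qed
  show "z < 0 \<Longrightarrow> F z = 0" by (rule neg')
  have Fc: "F z = 1" if "c \<le> z" for z
    using c distribution_function_bounds(2)[OF F, of z] monoD[OF distribution_function_bounds(3)[OF F] that]
    by simp
  show "c \<le> z \<Longrightarrow> F z = 1" by (rule Fc)
  have im: "interval_measure F = \<nu>"
  proof (rule cdf_unique)
    have 1: "\<And>x y. x \<le> y \<Longrightarrow> F x \<le> F y" using distribution_function_bounds(3)[OF F] by (auto dest: monoD)
    have 2: "\<And>a. continuous (at_right a) F" using cdf_tendsto_right[OF F] by (simp add: continuous_within)
    have 3: "(F \<longlongrightarrow> 0) at_bot" "(F \<longlongrightarrow> 1) at_top" unfolding \<nu>(2) by (rule cdf_lim_at_bot cdf_lim_at_top_prob)+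
    show "real_distribution (interval_measure F)"
      by (rule real_distribution_interval_measure[OF 1 2 3(1) 3(2)])
    show "cdf (interval_measure F) = cdf \<nu>" using cdf_interval_measure[OF 1 2 3(1)] by (simp add: \<nu>(2))
  qed fact
  have AE0: "AE z in \<nu>. 0 \<le> z"
    using m0 by (intro AE_I[of _ _ "{..<0}"]) (auto simp: emeasure_eq_measure)
  have "measure \<nu> {c<..} = 0"
  proof -
    have "{c<..} = space \<nu> - {..c}" by auto
    then have "measure \<nu> {c<..} = 1 - measure \<nu> {..c}" using prob_compl[of "{..c}"] by simp
    then show ?thesis using Fc[of c] by (simp add: \<nu>(2) cdf_def)
  qed
  then have AEc: "AE z in \<nu>. z \<le> c"
    by (intro AE_I[of _ _ "{c<..}"]) (auto simp: emeasure_eq_measure)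
  have "integrable \<nu> (\<lambda>z. z)"
    using AE0 AEc by (intro integrable_const_bound[of _ c]) (auto simp: abs_le_iff elim: eventually_elim2)
  then have int: "set_integrable \<nu> {0..} (\<lambda>z. z)"
    unfolding set_integrable_def by (intro integrable_mult_indicator) auto
  have "ennreal (positive_mean F) = (\<integral>\<^sup>+z\<in>{0..}. ennreal z \<partial>\<nu>)"
    unfolding positive_mean_def im set_lebesgue_integral_def
    using int by (subst nn_integral_eq_integral[symmetric])
      (auto simp: set_integrable_def intro!: nn_integral_cong split: split_indicator)
  also have "\<dots> = (\<integral>\<^sup>+x. ennreal (min c x) \<partial>\<nu>)"
    using AE0 AEc by (intro nn_integral_cong_AE, eventually_elim) (auto simp: min_def)
  also have "\<dots> = (\<integral>\<^sup>+x. (\<integral>\<^sup>+z\<in>{0..<c}. ennreal (1 - of_bool (x \<le> z)) \<partial>lborel) \<partial>\<nu>)"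
    using layer_cake_min[OF \<open>0 \<le> c\<close>] by simp
  also have "\<dots> = (\<integral>\<^sup>+z. (\<integral>\<^sup>+x. ennreal (1 - of_bool (x \<le> z)) * indicator {0..<c} z \<partial>\<nu>) \<partial>lborel)"
  proof -
    interpret P: pair_sigma_finite \<nu> lborel ..
    show ?thesis by (intro P.Fubini'[symmetric]) simp
  qed
  also have "\<dots> = (\<integral>\<^sup>+z\<in>{0..<c}. ennreal (1 - F z) \<partial>lborel)"
  proof (intro nn_integral_cong)
    fix z
    have "(\<integral>\<^sup>+x. ennreal (1 - of_bool (x \<le> z)) \<partial>\<nu>) = (\<integral>\<^sup>+x. indicator {z<..} x \<partial>\<nu>)"
      by (intro nn_integral_cong) (auto split: split_indicator)
    also have "\<dots> = emeasure \<nu> {z<..}" by simp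
    also have "{z<..} = space \<nu> - {..z}" by auto
    also have "emeasure \<nu> \<dots> = ennreal (1 - F z)"
      unfolding emeasure_eq_measure by (subst prob_compl) (auto simp: \<nu>(2) cdf_def)
    finally show "(\<integral>\<^sup>+x. ennreal (1 - of_bool (x \<le> z)) * indicator {0..<c} z \<partial>\<nu>)
        = ennreal (1 - F z) * indicator {0..<c} z"
      by (simp add: nn_integral_multc)
  qed
  finally show "ennreal (positive_mean F) = mean_below c F" by (simp add: mean_below_def)
qed

section \<open>Rewards attached to events: passage from conditional laws to conditional
  means\<close>

section \<open>Marked counting processes\<close>

lemma measurable_count_space_pred:
  "f \<in> measurable M (count_space UNIV) \<Longrightarrow> Measurable.pred M (\<lambda>w. P (f w))"
  by (rule measurable_compose[of f M "count_space UNIV"]) simp_all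

lemma
  fixes C :: "real \<Rightarrow> 'w \<Rightarrow> nat"
  assumes C_meas: "\<And>t. 0 \<le> t \<Longrightarrow> C t \<in> measurable F (count_space UNIV)"
    and C_path: "\<And>w. w \<in> space F \<Longrightarrow> counting_path (\<lambda>t. C t w)"
  shows sets_event_occurs: "{w \<in> space F. event_occurs (\<lambda>t. C t w) k} \<in> sets F" (is "?O \<in> _")
    and measurable_event_time: "(\<lambda>w. event_time (\<lambda>t. C t w) k) \<in> borel_measurable F"
proof -
  have "?O = (\<Union>n. {w \<in> space F. k \<le> C (real n) w})"
  proof safe
    fix w assume w: "w \<in> space F" "event_occurs (\<lambda>t. C t w) k"
    then obtain t where t: "0 \<le> t" "k \<le> C t w" by (auto simp: event_occurs_def)
    obtain n where "t \<le> real n" using real_arch_simple by blast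
    then have "k \<le> C (real n) w" using counting_path_mono[OF C_path[OF w(1)] t(1), of "real n"] t by simp
    then show "w \<in> (\<Union>n. {w \<in> space F. k \<le> C (real n) w})" using w by blast
  next
    fix n w assume "k \<le> C (real n) w"
    then show "event_occurs (\<lambda>t. C t w) k" unfolding event_occurs_def by (intro exI[of _ "real n"]) simp
  qed
  moreover have S: "{w \<in> space F. k \<le> C t w} \<in> sets F" if "0 \<le> t" for t
    using measurable_count_space_pred[OF C_meas[OF that], of "\<lambda>n. k \<le> n"] by simp
  ultimately show O: "?O \<in> sets F" by (simp add: sets.countable_UN)
  show "(\<lambda>w. event_time (\<lambda>t. C t w) k) \<in> borel_measurable F"
  proof (subst borel_measurable_iff_le, intro allI)
    fix a :: real
    \<comment> \<open>Where the event never occurs, the event time is the constant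
      \<open>Inf {}\<close>, and whatever its value is, that part of the set is either all of the
      complement of \<open>?O\<close> or empty.\<close>
    have "{w \<in> space F. event_time (\<lambda>t. C t w) k \<le> a}
        = (if 0 \<le> a then {w \<in> space F. k \<le> C a w} else {}) \<union> (if Inf {} \<le> a then space F - ?O else {})"
      (is "?A = ?B")
    proof (rule set_eqI)
      fix w
      show "w \<in> ?A \<longleftrightarrow> w \<in> ?B"
      proof (cases "w \<in> space F \<and> event_occurs (\<lambda>t. C t w) k")
        case True
        have "event_time (\<lambda>t. C t w) k \<le> a \<longleftrightarrow> 0 \<le> a \<and> k \<le> C a w"
          using event_time_le_iff(1)[OF C_path, of w k] event_time_le_iff(3)[OF C_path, of w k a] True by force
        then show ?thesis using True by simp
      next
        case False
        then have "event_time (\<lambda>t. C t w) k = Inf {}" "w \<in> space F \<Longrightarrow> 0 \<le> a \<Longrightarrow> \<not> k \<le> C a w" if "w \<in> space F"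
          using that unfolding event_time_def event_occurs_def by (auto intro!: arg_cong[of _ _ Inf])
        then show ?thesis using False by (cases "w \<in> space F") auto
      qed
    qed
    then show "?A \<in> sets F" using S[of a] O by auto
  qed
qed

lemma sum_Ioc_eq_suminf:
  fixes f :: "nat \<Rightarrow> ennreal"
  shows "(\<Sum>k\<in>{a<..b}. f k) = (\<Sum>k. if a < k \<and> k \<le> b then f k else 0)"
proof -
  have "(\<Sum>k. if a < k \<and> k \<le> b then f k else 0) = (\<Sum>k\<in>{a<..b}. if a < k \<and> k \<le> b then f k else 0)"
    by (rule suminf_finite) auto
  then show ?thesis by simp
qed

lemma nn_integral_suminf_times_suminf:
  fixes f g :: "nat \<Rightarrow> 'a \<Rightarrow> ennreal"
  assumes [measurable]: "\<And>k. f k \<in> borel_measurable M" "\<And>k. g k \<in> borel_measurable M"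
  shows "(\<integral>\<^sup>+w. (\<Sum>k. f k w) * (\<Sum>k. g k w) \<partial>M) = (\<Sum>j. \<Sum>k. \<integral>\<^sup>+w. f j w * g k w \<partial>M)"
proof -
  have "(\<integral>\<^sup>+w. (\<Sum>k. f k w) * (\<Sum>k. g k w) \<partial>M) = (\<integral>\<^sup>+w. (\<Sum>j. \<Sum>k. f j w * g k w) \<partial>M)"
    by (simp only: ennreal_suminf_cmult ennreal_suminf_multc)
  also have "\<dots> = (\<Sum>j. \<integral>\<^sup>+w. (\<Sum>k. f j w * g k w) \<partial>M)"
    by (intro nn_integral_suminf) measurable
  also have "\<dots> = (\<Sum>j. \<Sum>k. \<integral>\<^sup>+w. f j w * g k w \<partial>M)"
    by (intro suminf_cong nn_integral_suminf) measurable
  finally show ?thesis .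
qed

text \<open>\<open>F\<close> is the information given by \<open>X\<close> and \<open>N\<close>,
  \<open>C\<close> one of the three counting processes determined by it, \<open>L k\<close> the
  label and \<open>W k\<close> the reward of the \<open>k\<close>th event, and \<open>D t l\<close>
  the conditional law of a reward earned at time \<open>t\<close> under label \<open>l\<close>.
  Labels are pairs of states for jumps and single states otherwise.\<close>

locale marked_counting = prob_space M for M :: "'w measure" +
  fixes F :: "'w measure" and C :: "real \<Rightarrow> 'w \<Rightarrow> nat" and L :: "nat \<Rightarrow> 'w \<Rightarrow> 'l::finite"
    and W :: "nat \<Rightarrow> 'w \<Rightarrow> real" and D :: "real \<Rightarrow> 'l \<Rightarrow> real \<Rightarrow> real" and c :: real
  assumes subalg: "subalgebra M F"
    and C_meas: "\<And>t. 0 \<le> t \<Longrightarrow> C t \<in> measurable F (count_space UNIV)"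
    and C_path: "\<And>w. w \<in> space M \<Longrightarrow> counting_path (\<lambda>t. C t w)"
    and L_meas: "\<And>k. 1 \<le> k \<Longrightarrow> L k \<in> measurable F (count_space UNIV)"
    and W_meas: "\<And>k. 1 \<le> k \<Longrightarrow> W k \<in> borel_measurable M"
    and D_meas: "\<And>l z. measurable_in_time (\<lambda>t. D t l z)"
    and D_df: "\<And>t l. 0 \<le> t \<Longrightarrow> distribution_function (D t l)"
    and D_neg: "\<And>t l z. 0 \<le> t \<Longrightarrow> z < 0 \<Longrightarrow> D t l z = 0"
    and D_c: "\<And>t l z. 0 \<le> t \<Longrightarrow> c \<le> z \<Longrightarrow> D t l z = 1"
    and c: "0 \<le> c"
    and cond: "\<And>A z. finite A \<Longrightarrow> A \<subseteq> {1..} \<Longrightarrow>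
      AE w in M. (\<forall>k\<in>A. event_occurs (\<lambda>t. C t w) k) \<longrightarrow>
        real_cond_exp M F (indicator {w' \<in> space M. \<forall>k\<in>A. W k w' \<le> z k}) w
          = (\<Prod>k\<in>A. D (event_time (\<lambda>t. C t w) k) (L k w) (z k))"
begin

abbreviation "\<tau> k w \<equiv> event_time (\<lambda>t. C t w) k"

definition "occ k = {w \<in> space M. event_occurs (\<lambda>t. C t w) k}"
text \<open>The \<open>max 0\<close> only matters for events that never occur: their event time is a junk value, which may be
  negative, while \<open>D\<close> is meaningful at nonnegative times only.\<close>

definition "p k z w = D (max 0 (\<tau> k w)) (L k w) z"
definition "m k w = mean_below c (D (max 0 (\<tau> k w)) (L k w))"
text \<open>The cap gives a bound valid at every point. By \<open>AE_reward_bounds\<close> it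
  changes nothing almost surely where the event occurs.\<close>

definition "V k w = ennreal (min c (W k w))"
text \<open>The event that the \<open>k\<close>th event time falls into \<open>{s<..t}\<close>,
  expressed by counts. It belongs to \<open>F\<close>, so conditional laws can be integrated over
  it.\<close>

definition "block k s t = {w \<in> space M. C s w < k \<and> k \<le> C t w}"

lemma space_F: "space F = space M" using subalg by (simp add: subalgebra_def)

lemma sets_F: "A \<in> sets F \<Longrightarrow> A \<in> sets M" using subalg by (auto simp: subalgebra_def)

lemma occ_sets: "occ k \<in> sets F"
  unfolding occ_def using sets_event_occurs[of C F k] C_meas C_path by (simp add: space_F)

lemma \<tau>_meas: "\<tau> k \<in> borel_measurable F"
  using measurable_event_time[of C F k] C_meas C_path by (simp add: space_F)

lemma C_meas': "0 \<le> t \<Longrightarrow> C t \<in> measurable M (count_space UNIV)"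
  using C_meas measurable_from_subalg[OF subalg] by blast

lemma L_meas': "1 \<le> k \<Longrightarrow> L k \<in> measurable M (count_space UNIV)"
  using L_meas measurable_from_subalg[OF subalg] by blast

lemma \<tau>_meas': "\<tau> k \<in> borel_measurable M"
  using \<tau>_meas measurable_from_subalg[OF subalg] by blast

lemma block_sets: "0 \<le> s \<Longrightarrow> 0 \<le> t \<Longrightarrow> block k s t \<in> sets F"
proof -
  assume st: "0 \<le> s" "0 \<le> t"
  have "Measurable.pred F (\<lambda>w. C s w < k)" "Measurable.pred F (\<lambda>w. k \<le> C t w)"
    using C_meas st by (auto intro: measurable_count_space_pred)
  then show ?thesis unfolding block_def space_F[symmetric] by measurable
qed

lemma block_occ: "0 \<le> t \<Longrightarrow> block k s t \<subseteq> occ k"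
  by (auto simp: block_def occ_def intro: event_occursI)

lemma D_max_meas: "(\<lambda>t. D (max 0 t) l z) \<in> borel_measurable borel"
  by (rule measurable_compose[OF _ D_meas]) (auto intro!: measurable_restrict_space2)

lemma p_meas: "1 \<le> k \<Longrightarrow> p k z \<in> borel_measurable F"
  unfolding p_def
proof (rule measurable_compose_countable[where f="\<lambda>l w. D (max 0 (\<tau> k w)) l z"])
  fix l show "(\<lambda>w. D (max 0 (\<tau> k w)) l z) \<in> borel_measurable F"
    by (rule measurable_compose[OF \<tau>_meas D_max_meas])
qed (rule L_meas)

lemma p_meas': "1 \<le> k \<Longrightarrow> p k z \<in> borel_measurable M"
  using p_meas measurable_from_subalg[OF subalg] by blast

lemma p_bounds: "0 \<le> p k z w" "p k z w \<le> 1"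
  unfolding p_def using distribution_function_bounds[OF D_df] by auto

lemma p_joint: "1 \<le> k \<Longrightarrow> (\<lambda>(w, z). p k z w) \<in> borel_measurable (M \<Otimes>\<^sub>M borel)"
proof (rule measurable_right_continuous_pair[where f="\<lambda>w z. p k z w"])
  fix w z
  show "((\<lambda>z. p k z w) \<longlongrightarrow> p k z w) (at_right z)"
    unfolding p_def by (rule cdf_tendsto_right[OF D_df]) simp
qed (rule p_meas')

lemma m_eq: "m k w = (\<integral>\<^sup>+z\<in>{0..<c}. ennreal (1 - p k z w) \<partial>lborel)"
  by (simp add: m_def p_def mean_below_def)

lemma V_eq: "V k w = (\<integral>\<^sup>+z\<in>{0..<c}. ennreal (1 - of_bool (W k w \<le> z)) \<partial>lborel)"
  unfolding V_def by (rule layer_cake_min[OF c])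

lemma m_le: "m k w \<le> ennreal c"
  unfolding m_def by (rule mean_below_le[OF D_df c]) simp

lemma V_le: "V k w \<le> ennreal c"
  unfolding V_def by (auto intro: ennreal_leI)

lemma V_meas: "1 \<le> k \<Longrightarrow> V k \<in> borel_measurable M"
  unfolding V_def using W_meas[of k] by measurable

lemma mean_meas: "(\<lambda>u. mean_below c (D (max 0 u) l)) \<in> borel_measurable borel"
proof -
  have "(\<lambda>(u, z). D (max 0 u) l z) \<in> borel_measurable (borel \<Otimes>\<^sub>M borel)"
    by (rule measurable_right_continuous_pair[OF D_max_meas cdf_tendsto_right[OF D_df]]) simp
  then have [measurable]: "(\<lambda>(u, z). D (max 0 u) l z) \<in> borel_measurable (borel \<Otimes>\<^sub>M lborel)" by simp
  show ?thesis unfolding mean_below_def by measurable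
qed

lemma m_meas: "1 \<le> k \<Longrightarrow> m k \<in> borel_measurable M"
  unfolding m_def
proof (rule measurable_compose_countable[where f="\<lambda>l w. mean_below c (D (max 0 (\<tau> k w)) l)"])
  fix l show "(\<lambda>w. mean_below c (D (max 0 (\<tau> k w)) l)) \<in> borel_measurable M"
    by (rule measurable_compose[OF \<tau>_meas' mean_meas])
qed (rule L_meas')

lemma integrable_bounded_one:
  fixes g :: "'w \<Rightarrow> real"
  assumes "g \<in> borel_measurable M" "\<And>w. 0 \<le> g w" "\<And>w. g w \<le> 1" "A \<in> sets M"
  shows "integrable M (\<lambda>w. indicator A w * g w)"
  using assms by (intro integrable_const_bound[of _ 1] AE_I2) (auto split: split_indicator)

text \<open>The defining property of conditional expectation on \<open>A\<close>. The inclusions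
  \<open>A \<subseteq> occ k\<close> are what the guard in \<open>cond\<close> asks for: on
  \<open>A\<close> all events involved occur, and their times are not junk values.\<close>

lemma cond_integral:
  assumes fin: "finite B" "B \<subseteq> {1..}" and A: "A \<in> sets F" "\<And>k. k \<in> B \<Longrightarrow> A \<subseteq> occ k"
  shows "(\<integral>w. indicator A w * (\<Prod>k\<in>B. of_bool (W k w \<le> z k)) \<partial>M) = (\<integral>w. indicator A w * (\<Prod>k\<in>B. p k (z k) w) \<partial>M)"
proof -
  interpret S: sigma_finite_subalgebra M F
    by (intro finite_measure_subalgebra_is_sigma_finite) (simp add: finite_measure_subalgebra_def
        finite_measure_subalgebra_axioms_def subalg finite_measure_axioms)
  let ?S = "{w' \<in> space M. \<forall>k\<in>B. W k w' \<le> z k}"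
  have S: "?S \<in> sets M"
  proof (rule sets.sets_Collect_finite_All[OF _ fin(1)])
    fix k assume "k \<in> B"
    then have "W k \<in> borel_measurable M" using fin by (intro W_meas) auto
    then show "{w \<in> space M. W k w \<le> z k} \<in> sets M" by measurable
  qed
  have "(\<integral>w. indicator A w * (\<Prod>k\<in>B. of_bool (W k w \<le> z k)) \<partial>M) = (\<integral>w\<in>A. indicat_real ?S w \<partial>M)"
    unfolding set_lebesgue_integral_def
  proof (intro Bochner_Integration.integral_cong refl)
    fix w assume "w \<in> space M"
    have "(\<Prod>k\<in>B. of_bool (W k w \<le> z k)) = (of_bool (\<forall>k\<in>B. W k w \<le> z k) :: real)"
      using fin(1) by (induct B) auto
    then show "indicator A w * (\<Prod>k\<in>B. of_bool (W k w \<le> z k)) = indicat_real A w *\<^sub>R (indicator ?S w :: real)"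
      using \<open>w \<in> space M\<close> by (simp split: split_indicator)
  qed
  also have "\<dots> = (\<integral>w\<in>A. real_cond_exp M F (indicator ?S) w \<partial>M)"
    using S A(1) by (intro S.real_cond_exp_intA integrable_real_indicator) (auto simp: emeasure_eq_measure)
  also have "\<dots> = (\<integral>w. indicator A w * (\<Prod>k\<in>B. p k (z k) w) \<partial>M)"
    unfolding set_lebesgue_integral_def
  proof (rule integral_cong_AE)
    show "(\<lambda>w. indicat_real A w *\<^sub>R real_cond_exp M F (indicat_real ?S) w) \<in> borel_measurable M"
      using sets_F[OF A(1)] by measurable
    have "p k (z k) \<in> borel_measurable M" if "k \<in> B" for k using that fin by (intro p_meas') auto
    then show "(\<lambda>w. indicat_real A w * (\<Prod>k\<in>B. p k (z k) w)) \<in> borel_measurable M"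
      using sets_F[OF A(1)] by measurable
    show "AE w in M. indicat_real A w *\<^sub>R real_cond_exp M F (indicat_real ?S) w
        = indicat_real A w * (\<Prod>k\<in>B. p k (z k) w)"
      using cond[OF fin, of z]
    proof eventually_elim
      case (elim w)
      show ?case
      proof (cases "w \<in> A")
        case True
        then have o: "\<forall>k\<in>B. event_occurs (\<lambda>t. C t w) k" and "w \<in> space M"
          using A(2) sets.sets_into_space[OF A(1)] by (auto simp: occ_def space_F)
        then have "\<forall>k\<in>B. 0 \<le> \<tau> k w" using event_time_le_iff(1)[OF C_path] by blast
        then have "(\<Prod>k\<in>B. p k (z k) w) = (\<Prod>k\<in>B. D (\<tau> k w) (L k w) (z k))"
          by (intro prod.cong) (auto simp: p_def max_def)
        then show ?thesis using elim o by simp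
      qed simp
    qed
  qed
  finally show ?thesis .
qed

text \<open>Conditional laws are given for \<open>\<le>\<close>, the layer cake needs
  \<open>>\<close>. Expanding \<open>(1 - a) * (1 - b)\<close> reduces this to the three integrals
  of \<open>cond_integral\<close>; because of the signs it is carried out in the reals.\<close>

lemma cond_integral_gt:
  assumes jk: "1 \<le> j" "1 \<le> k" "j \<noteq> k" and A: "A \<in> sets F" "A \<subseteq> occ j" "A \<subseteq> occ k"
  shows "(\<integral>\<^sup>+w. indicator A w * ennreal (1 - of_bool (W j w \<le> z')) * ennreal (1 - of_bool (W k w \<le> z)) \<partial>M)
      = (\<integral>\<^sup>+w. indicator A w * ennreal (1 - p j z' w) * ennreal (1 - p k z w) \<partial>M)"
proof -
  have AM: "A \<in> sets M" by (rule sets_F[OF A(1)])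
  note [measurable] = W_meas[OF jk(1)] W_meas[OF jk(2)] p_meas'[OF jk(1)] p_meas'[OF jk(2)] AM
  define zz where "zz i = (if i = j then z' else z)" for i
  have expand: "(\<integral>\<^sup>+w. indicator A w * ennreal (1 - a w) * ennreal (1 - b w) \<partial>M)
      = ennreal ((\<integral>w. indicator A w \<partial>M) - (\<integral>w. indicator A w * a w \<partial>M) - (\<integral>w. indicator A w * b w \<partial>M)
          + (\<integral>w. indicator A w * (a w * b w) \<partial>M))"
    if [measurable]: "a \<in> borel_measurable M" "b \<in> borel_measurable M"
      and ab: "\<And>w. 0 \<le> a w" "\<And>w. a w \<le> 1" "\<And>w. 0 \<le> b w" "\<And>w. b w \<le> 1" for a b :: "'w \<Rightarrow> real"
  proof -
    have ab': "0 \<le> a w * b w" "a w * b w \<le> 1" for w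
      using ab[of w] by (auto intro: mult_le_one)
    have i: "integrable M (\<lambda>w. indicat_real A w)" "integrable M (\<lambda>w. indicator A w * a w)"
      "integrable M (\<lambda>w. indicator A w * b w)" "integrable M (\<lambda>w. indicator A w * (a w * b w))"
      using integrable_bounded_one[of "\<lambda>_. 1" A] integrable_bounded_one[of a A]
        integrable_bounded_one[of b A] integrable_bounded_one[of "\<lambda>w. a w * b w" A] ab ab' by auto
    have "(\<integral>\<^sup>+w. indicator A w * ennreal (1 - a w) * ennreal (1 - b w) \<partial>M)
        = (\<integral>\<^sup>+w. ennreal (indicator A w - indicator A w * a w - indicator A w * b w + indicator A w * (a w * b w)) \<partial>M)"
      using ab by (intro nn_integral_cong) (auto split: split_indicator simp: ennreal_mult[symmetric] algebra_simps)
    also have "\<dots> = ennreal (\<integral>w. indicator A w - indicator A w * a w - indicator A w * b w + indicator A w * (a w * b w) \<partial>M)"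
    proof (rule nn_integral_eq_integral)
      show "integrable M (\<lambda>w. indicat_real A w - indicator A w * a w - indicator A w * b w + indicator A w * (a w * b w))"
        using i by simp
      have "0 \<le> (1 - a w) * (1 - b w)" for w using ab[of w] by simp
      then show "AE w in M. 0 \<le> indicat_real A w - indicator A w * a w - indicator A w * b w + indicator A w * (a w * b w)"
        by (intro AE_I2) (auto split: split_indicator simp: algebra_simps)
    qed
    finally show ?thesis using i by simp
  qed
  have "(\<integral>w. indicator A w * of_bool (W j w \<le> z') \<partial>M) = (\<integral>w. indicator A w * p j z' w \<partial>M)"
    using cond_integral[of "{j}" A "\<lambda>_. z'"] jk A by simp
  moreover have "(\<integral>w. indicator A w * of_bool (W k w \<le> z) \<partial>M) = (\<integral>w. indicator A w * p k z w \<partial>M)"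
    using cond_integral[of "{k}" A "\<lambda>_. z"] jk A by simp
  moreover have "(\<integral>w. indicator A w * (of_bool (W j w \<le> z') * of_bool (W k w \<le> z)) \<partial>M)
      = (\<integral>w. indicator A w * (p j z' w * p k z w) \<partial>M)"
  proof -
    have "zz j = z'" "zz k = z" using jk by (auto simp: zz_def)
    then show ?thesis using cond_integral[of "{j, k}" A zz] jk A by auto
  qed
  moreover have "(\<lambda>w. of_bool (W i w \<le> x) :: real) \<in> borel_measurable M" if "i = j \<or> i = k" for i x
    using that unfolding of_bool_def by auto
  ultimately show ?thesis
    using expand[of "\<lambda>w. of_bool (W j w \<le> z')" "\<lambda>w. of_bool (W k w \<le> z)"] expand[of "p j z'" "p k z"] p_bounds
    by simp
qed

lemma cond_integral_gt1:
  assumes k: "1 \<le> k" and A: "A \<in> sets F" "A \<subseteq> occ k"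
  shows "(\<integral>\<^sup>+w. indicator A w * ennreal (1 - of_bool (W k w \<le> z)) \<partial>M)
      = (\<integral>\<^sup>+w. indicator A w * ennreal (1 - p k z w) \<partial>M)"
proof -
  have AM: "A \<in> sets M" by (rule sets_F[OF A(1)])
  note [measurable] = W_meas[OF k] p_meas'[OF k] AM
  have expand: "(\<integral>\<^sup>+w. indicator A w * ennreal (1 - a w) \<partial>M)
      = ennreal ((\<integral>w. indicator A w \<partial>M) - (\<integral>w. indicator A w * a w \<partial>M))"
    if [measurable]: "a \<in> borel_measurable M" and ab: "\<And>w. 0 \<le> a w" "\<And>w. a w \<le> 1" for a :: "'w \<Rightarrow> real"
  proof -
    have i: "integrable M (\<lambda>w. indicat_real A w)" "integrable M (\<lambda>w. indicator A w * a w)"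
      using integrable_bounded_one[of "\<lambda>_. 1" A] integrable_bounded_one[of a A] ab by auto
    have "(\<integral>\<^sup>+w. indicator A w * ennreal (1 - a w) \<partial>M) = (\<integral>\<^sup>+w. ennreal (indicator A w - indicator A w * a w) \<partial>M)"
      by (intro nn_integral_cong) (auto split: split_indicator)
    also have "\<dots> = ennreal (\<integral>w. indicator A w - indicator A w * a w \<partial>M)"
      using i ab by (intro nn_integral_eq_integral) (auto split: split_indicator)
    finally show ?thesis using i by simp
  qed
  have "(\<integral>w. indicator A w * of_bool (W k w \<le> z) \<partial>M) = (\<integral>w. indicator A w * p k z w \<partial>M)"
    using cond_integral[of "{k}" A "\<lambda>_. z"] k A by simp
  moreover have "(\<lambda>w. of_bool (W k w \<le> z) :: real) \<in> borel_measurable M"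
    unfolding of_bool_def by measurable
  ultimately show ?thesis
    using expand[of "\<lambda>w. of_bool (W k w \<le> z)"] expand[of "p k z"] p_bounds by simp
qed

lemma swap_level_integral:
  assumes [measurable]: "U \<in> borel_measurable M" "(\<lambda>(w, z). v w z) \<in> borel_measurable (M \<Otimes>\<^sub>M borel)"
  shows "(\<integral>\<^sup>+w. U w * (\<integral>\<^sup>+z\<in>{0..<c}. v w z \<partial>lborel) \<partial>M)
      = (\<integral>\<^sup>+z\<in>{0..<c}. (\<integral>\<^sup>+w. U w * v w z \<partial>M) \<partial>lborel)"
proof -
  interpret P: pair_sigma_finite M lborel ..
  have [measurable]: "(\<lambda>(w, z). v w z) \<in> borel_measurable (M \<Otimes>\<^sub>M lborel)" by simp
  have v1: "v w \<in> borel_measurable borel" if "w \<in> space M" for w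
    using measurable_Pair2[OF assms(2) that] by simp
  have "(\<integral>\<^sup>+w. U w * (\<integral>\<^sup>+z\<in>{0..<c}. v w z \<partial>lborel) \<partial>M)
      = (\<integral>\<^sup>+w. (\<integral>\<^sup>+z. U w * (v w z * indicator {0..<c} z) \<partial>lborel) \<partial>M)"
    using v1 by (intro nn_integral_cong) (simp add: nn_integral_cmult)
  also have "\<dots> = (\<integral>\<^sup>+z. (\<integral>\<^sup>+w. U w * (v w z * indicator {0..<c} z) \<partial>M) \<partial>lborel)"
    by (intro P.Fubini'[symmetric]) measurable
  also have "\<dots> = (\<integral>\<^sup>+z\<in>{0..<c}. (\<integral>\<^sup>+w. U w * v w z \<partial>M) \<partial>lborel)"
    by (intro nn_integral_cong) (auto split: split_indicator)
  finally show ?thesis .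
qed

lemma v_joint: "1 \<le> k \<Longrightarrow> (\<lambda>(w, z). ennreal (1 - of_bool (W k w \<le> z))) \<in> borel_measurable (M \<Otimes>\<^sub>M borel)"
proof -
  assume "1 \<le> k"
  then have [measurable]: "W k \<in> borel_measurable M" by (rule W_meas)
  show ?thesis unfolding of_bool_def by measurable
qed

lemma q_joint: "1 \<le> k \<Longrightarrow> (\<lambda>(w, z). ennreal (1 - p k z w)) \<in> borel_measurable (M \<Otimes>\<^sub>M borel)"
  using p_joint[of k] by measurable

text \<open>Conditional independence in the form used for mixed moments. The layer cake is applied
  to the two factors in turn, so that only the joint law of two threshold events enters. For
  \<open>j = k\<close> a conditional second moment would appear instead of the product of the
  means.\<close>

lemma cond_mean2:
  assumes jk: "1 \<le> j" "1 \<le> k" "j \<noteq> k" and A: "A \<in> sets F" "A \<subseteq> occ j" "A \<subseteq> occ k"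
  shows "(\<integral>\<^sup>+w. indicator A w * V j w * V k w \<partial>M) = (\<integral>\<^sup>+w. indicator A w * m j w * m k w \<partial>M)"
proof -
  have [measurable]: "A \<in> sets M" by (rule sets_F[OF A(1)])
  note [measurable] = V_meas[OF jk(1)] V_meas[OF jk(2)] m_meas[OF jk(1)] m_meas[OF jk(2)]
  let ?v = "\<lambda>k w z. ennreal (1 - of_bool (W k w \<le> z))" and ?q = "\<lambda>k w z. ennreal (1 - p k z w)"
  have [measurable]: "(\<lambda>w. ?v k w z) \<in> borel_measurable M" "(\<lambda>w. ?q k w z) \<in> borel_measurable M" for z
    using measurable_Pair1[OF v_joint[OF jk(2)], of z] measurable_Pair1[OF q_joint[OF jk(2)], of z] by simp_all
  \<comment> \<open>The threshold event of \<open>W k\<close> at the fixed level \<open>z\<close>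
    stays as a factor while \<open>V j\<close> is replaced by \<open>m j\<close>.\<close>
  have inner: "(\<integral>\<^sup>+w. indicator A w * V j w * ?v k w z \<partial>M) = (\<integral>\<^sup>+w. indicator A w * m j w * ?q k w z \<partial>M)" for z
  proof -
    have "(\<integral>\<^sup>+w. indicator A w * V j w * ?v k w z \<partial>M)
        = (\<integral>\<^sup>+w. (indicator A w * ?v k w z) * (\<integral>\<^sup>+z'\<in>{0..<c}. ?v j w z' \<partial>lborel) \<partial>M)"
      unfolding V_eq by (intro nn_integral_cong) (simp add: ac_simps)
    also have "\<dots> = (\<integral>\<^sup>+z'\<in>{0..<c}. (\<integral>\<^sup>+w. indicator A w * ?v k w z * ?v j w z' \<partial>M) \<partial>lborel)"
      by (intro swap_level_integral v_joint jk) measurable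
    also have "\<dots> = (\<integral>\<^sup>+z'\<in>{0..<c}. (\<integral>\<^sup>+w. indicator A w * ?q k w z * ?q j w z' \<partial>M) \<partial>lborel)"
      using jk A by (simp only: cond_integral_gt not_sym)
    also have "\<dots> = (\<integral>\<^sup>+w. (indicator A w * ?q k w z) * (\<integral>\<^sup>+z'\<in>{0..<c}. ?q j w z' \<partial>lborel) \<partial>M)"
      by (intro swap_level_integral[symmetric] q_joint jk) measurable
    also have "\<dots> = (\<integral>\<^sup>+w. indicator A w * m j w * ?q k w z \<partial>M)"
      unfolding m_eq by (intro nn_integral_cong) (simp add: ac_simps)
    finally show ?thesis .
  qed
  have "(\<integral>\<^sup>+w. indicator A w * V j w * V k w \<partial>M)
      = (\<integral>\<^sup>+w. (indicator A w * V j w) * (\<integral>\<^sup>+z\<in>{0..<c}. ?v k w z \<partial>lborel) \<partial>M)"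
    by (simp only: V_eq[of k])
  also have "\<dots> = (\<integral>\<^sup>+z\<in>{0..<c}. (\<integral>\<^sup>+w. indicator A w * V j w * ?v k w z \<partial>M) \<partial>lborel)"
    by (intro swap_level_integral v_joint jk) measurable
  also have "\<dots> = (\<integral>\<^sup>+z\<in>{0..<c}. (\<integral>\<^sup>+w. indicator A w * m j w * ?q k w z \<partial>M) \<partial>lborel)"
    by (simp only: inner)
  also have "\<dots> = (\<integral>\<^sup>+w. (indicator A w * m j w) * (\<integral>\<^sup>+z\<in>{0..<c}. ?q k w z \<partial>lborel) \<partial>M)"
    by (intro swap_level_integral[symmetric] q_joint jk) measurable
  also have "\<dots> = (\<integral>\<^sup>+w. indicator A w * m j w * m k w \<partial>M)"
    by (simp only: m_eq[of k])
  finally show ?thesis .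
qed

lemma cond_mean1:
  assumes k: "1 \<le> k" and A: "A \<in> sets F" "A \<subseteq> occ k"
  shows "(\<integral>\<^sup>+w. indicator A w * V k w \<partial>M) = (\<integral>\<^sup>+w. indicator A w * m k w \<partial>M)"
proof -
  have [measurable]: "A \<in> sets M" by (rule sets_F[OF A(1)])
  have "(\<integral>\<^sup>+w. indicator A w * V k w \<partial>M)
      = (\<integral>\<^sup>+z\<in>{0..<c}. (\<integral>\<^sup>+w. indicator A w * ennreal (1 - of_bool (W k w \<le> z)) \<partial>M) \<partial>lborel)"
    unfolding V_eq by (intro swap_level_integral v_joint k) measurable
  also have "\<dots> = (\<integral>\<^sup>+z\<in>{0..<c}. (\<integral>\<^sup>+w. indicator A w * ennreal (1 - p k z w) \<partial>M) \<partial>lborel)"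
    by (simp only: cond_integral_gt1[OF k A])
  also have "\<dots> = (\<integral>\<^sup>+w. indicator A w * m k w \<partial>M)"
    unfolding m_eq by (intro swap_level_integral[symmetric] q_joint k) measurable
  finally show ?thesis .
qed

text \<open>The conditional law has no mass outside \<open>{0..c}\<close>, so integrating it over
  \<open>occ k\<close> shows that bad values have probability zero. Negative values are exhausted by
  the thresholds \<open>- inverse (real (Suc n))\<close>.\<close>

lemma AE_reward_bounds:
  assumes k: "1 \<le> k"
  shows "AE w in M. event_occurs (\<lambda>t. C t w) k \<longrightarrow> 0 \<le> W k w \<and> W k w \<le> c"
proof -
  note [measurable] = W_meas[OF k] sets_F[OF occ_sets[of k]]
  have E: "prob (occ k \<inter> {w \<in> space M. W k w \<le> z}) = (\<integral>w. indicator (occ k) w * p k z w \<partial>M)" for z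
  proof -
    have "prob (occ k \<inter> {w \<in> space M. W k w \<le> z}) = (\<integral>w. indicator (occ k \<inter> {w \<in> space M. W k w \<le> z}) w \<partial>M)"
      by simp
    also have "\<dots> = (\<integral>w. indicator (occ k) w * of_bool (W k w \<le> z) \<partial>M)"
      by (intro Bochner_Integration.integral_cong) (auto split: split_indicator)
    finally show ?thesis using cond_integral[of "{k}" "occ k" "\<lambda>_. z"] k occ_sets by simp
  qed
  have "AE w in M. \<not> (w \<in> occ k \<and> W k w \<le> - inverse (real (Suc n)))" for n
  proof -
    have "prob (occ k \<inter> {w \<in> space M. W k w \<le> - inverse (real (Suc n))}) = 0"
      unfolding E p_def by (subst D_neg) auto
    then have "occ k \<inter> {w \<in> space M. W k w \<le> - inverse (real (Suc n))} \<in> null_sets M"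
      by (intro null_setsI) (auto simp: emeasure_eq_measure)
    from AE_not_in[OF this] show ?thesis by (auto elim: eventually_mono)
  qed
  then have 1: "AE w in M. \<forall>n. \<not> (w \<in> occ k \<and> W k w \<le> - inverse (real (Suc n)))"
    unfolding AE_all_countable by blast
  have "prob (occ k \<inter> {w \<in> space M. W k w \<le> c}) = prob (occ k)"
    unfolding E p_def by (subst D_c) auto
  then have "prob (occ k - (occ k \<inter> {w \<in> space M. W k w \<le> c})) = 0"
    by (subst finite_measure_Diff) auto
  then have "occ k - (occ k \<inter> {w \<in> space M. W k w \<le> c}) \<in> null_sets M"
    by (intro null_setsI) (auto simp: emeasure_eq_measure)
  from AE_not_in[OF this] have 2: "AE w in M. w \<in> occ k \<longrightarrow> w \<in> space M \<longrightarrow> W k w \<le> c"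
    by (auto elim: eventually_mono)
  show ?thesis
    using 1 2 AE_space
  proof eventually_elim
    case (elim w)
    show ?case
    proof
      assume "event_occurs (\<lambda>t. C t w) k"
      then have o: "w \<in> occ k" using elim by (simp add: occ_def)
      have "0 \<le> W k w"
      proof (rule ccontr)
        assume "\<not> 0 \<le> W k w"
        then obtain n where "inverse (real (Suc n)) < - W k w" using reals_Archimedean[of "- W k w"] by auto
        then show False using elim(1) o by (auto simp: not_le dest: spec[of _ n])
      qed
      then show "0 \<le> W k w \<and> W k w \<le> c" using elim o by auto
    qed
  qed
qed

end

section \<open>Sums of rewards over time intervals and their moments\<close>

context marked_counting
begin

definition "reward_sum s t w = (\<Sum>k\<in>{C s w<..C t w}. V k w)"
definition "mean_sum s t w = (\<Sum>k\<in>{C s w<..C t w}. m k w)"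
definition "label_sum l f s t w = (\<Sum>k\<in>{C s w<..C t w}. if L k w = l then f (\<tau> k w) else (0::ennreal))"
definition "LC l s t w = (of_nat (label_count (\<lambda>t. C t w) (\<lambda>k. L k w) l s t) :: ennreal)"

text \<open>A sum with random limits becomes a series of fixed terms weighted by events of
  \<open>F\<close>, and integrals can be taken term by term. The shift to \<open>Suc k\<close>
  leaves the indices from one on, where labels and rewards are given.\<close>

lemma block_sum:
  fixes X :: "nat \<Rightarrow> 'w \<Rightarrow> ennreal"
  assumes "w \<in> space M"
  shows "(\<Sum>k\<in>{C s w<..C t w}. X k w) = (\<Sum>k. indicator (block (Suc k) s t) w * X (Suc k) w)"
proof -
  let ?f = "\<lambda>k. if C s w < k \<and> k \<le> C t w then X k w else 0"
  have "(\<Sum>k\<in>{C s w<..C t w}. X k w) = suminf ?f" by (rule sum_Ioc_eq_suminf)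
  also have "\<dots> = (\<Sum>k. ?f (k + 1)) + (\<Sum>i<1. ?f i)" by (rule suminf_offset) simp
  also have "\<dots> = (\<Sum>k. ?f (k + 1))" by simp
  also have "\<dots> = (\<Sum>k. indicator (block (Suc k) s t) w * X (Suc k) w)"
    using assms by (intro suminf_cong) (auto simp: block_def)
  finally show ?thesis .
qed

lemma block_sets': "0 \<le> s \<Longrightarrow> 0 \<le> t \<Longrightarrow> block k s t \<in> sets M"
  by (rule sets_F[OF block_sets])

lemma block_sum_meas:
  fixes X :: "nat \<Rightarrow> 'w \<Rightarrow> ennreal"
  assumes "\<And>k. 1 \<le> k \<Longrightarrow> X k \<in> borel_measurable M" "0 \<le> s" "0 \<le> t"
  shows "(\<lambda>w. \<Sum>k\<in>{C s w<..C t w}. X k w) \<in> borel_measurable M"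
proof (subst measurable_cong[OF block_sum])
  have [measurable]: "X (Suc k) \<in> borel_measurable M" "block (Suc k) s t \<in> sets M" for k
    using assms block_sets' by auto
  show "(\<lambda>w. \<Sum>k. indicator (block (Suc k) s t) w * X (Suc k) w) \<in> borel_measurable M" by measurable
qed

lemma label_sum_term_meas:
  assumes f: "f \<in> borel_measurable borel" and k: "1 \<le> k"
  shows "(\<lambda>w. if L k w = l then f (\<tau> k w) else (0::ennreal)) \<in> borel_measurable M"
proof -
  have [measurable]: "(\<lambda>w. f (\<tau> k w)) \<in> borel_measurable M" by (rule measurable_compose[OF \<tau>_meas' f])
  have [measurable]: "Measurable.pred M (\<lambda>w. L k w = l)"
    by (rule measurable_count_space_pred[OF L_meas'[OF k]])
  show ?thesis by measurable
qed

lemma label_sum_meas: "f \<in> borel_measurable borel \<Longrightarrow> 0 \<le> s \<Longrightarrow> 0 \<le> t \<Longrightarrow> label_sum l f s t \<in> borel_measurable M"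
  unfolding label_sum_def by (rule block_sum_meas[OF label_sum_term_meas])

lemma LC_eq: "LC l s t w = label_sum l (\<lambda>_. 1) s t w"
  unfolding LC_def label_sum_def label_count_def
  by (simp add: sum.If_cases Int_def of_nat_sum[symmetric])

lemma LC_meas: "0 \<le> s \<Longrightarrow> 0 \<le> t \<Longrightarrow> LC l s t \<in> borel_measurable M"
  unfolding LC_eq by (rule label_sum_meas) auto

lemma nn_integral_reward_sum: 
  assumes "0 \<le> s" "s \<le> t"
  shows "(\<integral>\<^sup>+w. reward_sum s t w \<partial>M) = (\<integral>\<^sup>+w. mean_sum s t w \<partial>M)"
proof -
  have meas[measurable]: "block (Suc k) s t \<in> sets M" "V (Suc k) \<in> borel_measurable M" "m (Suc k) \<in> borel_measurable M" for k
    using assms block_sets' V_meas m_meas by auto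
  have "(\<integral>\<^sup>+w. reward_sum s t w \<partial>M) = (\<integral>\<^sup>+w. (\<Sum>k. indicator (block (Suc k) s t) w * V (Suc k) w) \<partial>M)"
    unfolding reward_sum_def by (intro nn_integral_cong block_sum)
  also have "\<dots> = (\<Sum>k. \<integral>\<^sup>+w. indicator (block (Suc k) s t) w * V (Suc k) w \<partial>M)"
    by (intro nn_integral_suminf) measurable
  also have "\<dots> = (\<Sum>k. \<integral>\<^sup>+w. indicator (block (Suc k) s t) w * m (Suc k) w \<partial>M)"
    using assms by (intro suminf_cong cond_mean1 block_sets block_occ) auto
  also have "\<dots> = (\<integral>\<^sup>+w. (\<Sum>k. indicator (block (Suc k) s t) w * m (Suc k) w) \<partial>M)"
    by (intro nn_integral_suminf[symmetric]) measurable
  also have "\<dots> = (\<integral>\<^sup>+w. mean_sum s t w \<partial>M)"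
    unfolding mean_sum_def by (intro nn_integral_cong block_sum[symmetric])
  finally show ?thesis .
qed

text \<open>No event falls into both time intervals, so only pairs of distinct indices contribute,
  and for these conditional means may replace the rewards in both factors at once.\<close>

lemma nn_integral_reward_sum_reward_sum: 
  assumes st: "0 \<le> s" "s \<le> t" "t \<le> s'" "s' \<le> t'"
  shows "(\<integral>\<^sup>+w. reward_sum s t w * reward_sum s' t' w \<partial>M) = (\<integral>\<^sup>+w. mean_sum s t w * mean_sum s' t' w \<partial>M)"
proof -
  let ?B = "\<lambda>k. block (Suc k) s t" and ?B' = "\<lambda>k. block (Suc k) s' t'"
  have meas[measurable]: "?B k \<in> sets M" "?B' k \<in> sets M" "V (Suc k) \<in> borel_measurable M" "m (Suc k) \<in> borel_measurable M" for k
    using assms block_sets' V_meas m_meas by auto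
  have "(\<integral>\<^sup>+w. reward_sum s t w * reward_sum s' t' w \<partial>M)
      = (\<integral>\<^sup>+w. (\<Sum>k. indicator (?B k) w * V (Suc k) w) * (\<Sum>k. indicator (?B' k) w * V (Suc k) w) \<partial>M)"
    unfolding reward_sum_def by (intro nn_integral_cong arg_cong2[of _ _ _ _ "(*)"] block_sum)
  also have "\<dots> = (\<Sum>j. \<Sum>k. \<integral>\<^sup>+w. (indicator (?B j) w * V (Suc j) w) * (indicator (?B' k) w * V (Suc k) w) \<partial>M)"
    by (intro nn_integral_suminf_times_suminf) measurable
  also have "\<dots> = (\<Sum>j. \<Sum>k. \<integral>\<^sup>+w. (indicator (?B j) w * m (Suc j) w) * (indicator (?B' k) w * m (Suc k) w) \<partial>M)"
  proof (intro suminf_cong)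
    fix j k
    have ind: "(indicator (?B j) w * x) * (indicator (?B' k) w * y) = indicator (?B j \<inter> ?B' k) w * x * y"
      for w and x y :: ennreal by (auto split: split_indicator)
    show "(\<integral>\<^sup>+w. (indicator (?B j) w * V (Suc j) w) * (indicator (?B' k) w * V (Suc k) w) \<partial>M)
        = (\<integral>\<^sup>+w. (indicator (?B j) w * m (Suc j) w) * (indicator (?B' k) w * m (Suc k) w) \<partial>M)"
    proof (cases "j = k")
      case True
      have "?B j \<inter> ?B' j = {}"
      proof (rule ccontr)
        assume "?B j \<inter> ?B' j \<noteq> {}"
        then obtain w where w: "w \<in> space M" "Suc j \<le> C t w" "C s' w < Suc j" by (auto simp: block_def)
        then have "C t w \<le> C s' w" using counting_path_mono[OF C_path, of w t s'] st by simp
        with w show False by simp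
      qed
      then show ?thesis unfolding ind using True by simp
    next
      case False
      have "?B j \<inter> ?B' k \<subseteq> occ (Suc j)" "?B j \<inter> ?B' k \<subseteq> occ (Suc k)"
        using block_occ[of t "Suc j" s] block_occ[of t' "Suc k" s'] st by auto
      then show ?thesis unfolding ind using False st
        by (intro cond_mean2 sets.Int block_sets) auto
    qed
  qed
  also have "\<dots> = (\<integral>\<^sup>+w. (\<Sum>k. indicator (?B k) w * m (Suc k) w) * (\<Sum>k. indicator (?B' k) w * m (Suc k) w) \<partial>M)"
    by (intro nn_integral_suminf_times_suminf[symmetric]) measurable
  also have "\<dots> = (\<integral>\<^sup>+w. mean_sum s t w * mean_sum s' t' w \<partial>M)"
    unfolding mean_sum_def by (intro nn_integral_cong arg_cong2[of _ _ _ _ "(*)"] block_sum[symmetric])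
  finally show ?thesis .
qed

text \<open>Weighting the event times with label \<open>l\<close> in \<open>{s<..t}\<close> by \<open>U\<close> gives a measure on the line, so that bounds
  known for intervals extend to integrals of Borel functions of the event times.\<close>

definition "event_measure U l s t = distr (density (count_space UNIV \<Otimes>\<^sub>M M)
    (\<lambda>(k, w). U w * (indicator (block (Suc k) s t) w * (if L (Suc k) w = l then 1 else 0))))
    borel (\<lambda>(k, w). \<tau> (Suc k) w)"

lemma nn_integral_event_measure:
  assumes U: "U \<in> borel_measurable M" and f: "f \<in> borel_measurable borel" and st: "0 \<le> s" "0 \<le> t"
  shows "(\<integral>\<^sup>+x. f x \<partial>event_measure U l s t) = (\<integral>\<^sup>+w. U w * label_sum l f s t w \<partial>M)"
proof -
  note [measurable] = U f
  have [measurable]: "block (Suc k) s t \<in> sets M" "\<tau> (Suc k) \<in> borel_measurable M"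
    "Measurable.pred M (\<lambda>w. L (Suc k) w = l)" for k
    using st block_sets' \<tau>_meas' measurable_count_space_pred[OF L_meas'[of "Suc k"]] by auto
  have m1 [measurable]: "(\<lambda>(k, w). \<tau> (Suc k) w) \<in> borel_measurable (count_space UNIV \<Otimes>\<^sub>M M)"
    by (rule measurable_pair_measure_countable1) auto
  have m2 [measurable]: "(\<lambda>(k, w). U w * (indicator (block (Suc k) s t) w * (if L (Suc k) w = l then 1 else 0 :: ennreal)))
      \<in> borel_measurable (count_space UNIV \<Otimes>\<^sub>M M)"
    by (rule measurable_pair_measure_countable1) auto
  have m3 [measurable]: "(\<lambda>(k, w). f (\<tau> (Suc k) w)) \<in> borel_measurable (count_space UNIV \<Otimes>\<^sub>M M)"
    by (rule measurable_pair_measure_countable1) auto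
  have "(\<integral>\<^sup>+x. f x \<partial>event_measure U l s t) = (\<integral>\<^sup>+(k, w). U w * (indicator (block (Suc k) s t) w * (if L (Suc k) w = l then 1 else 0)) * f (\<tau> (Suc k) w) \<partial>(count_space UNIV \<Otimes>\<^sub>M M))"
    unfolding event_measure_def
    by (subst nn_integral_distr, simp, simp, subst nn_integral_density)
      (auto intro!: nn_integral_cong m3[unfolded case_prod_beta'] simp: case_prod_beta')
  also have "\<dots> = (\<integral>\<^sup>+k. \<integral>\<^sup>+w. U w * (indicator (block (Suc k) s t) w * (if L (Suc k) w = l then 1 else 0)) * f (\<tau> (Suc k) w) \<partial>M \<partial>count_space UNIV)"
    by (subst nn_integral_fst[symmetric]) (auto intro!: measurable_pair_measure_countable1)
  also have "\<dots> = (\<Sum>k. \<integral>\<^sup>+w. U w * (indicator (block (Suc k) s t) w * (if L (Suc k) w = l then 1 else 0)) * f (\<tau> (Suc k) w) \<partial>M)"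
    by (rule nn_integral_count_space_nat)
  also have "\<dots> = (\<Sum>k. \<integral>\<^sup>+w. U w * (indicator (block (Suc k) s t) w * (if L (Suc k) w = l then f (\<tau> (Suc k) w) else 0)) \<partial>M)"
    by (intro suminf_cong nn_integral_cong) (auto split: split_indicator)
  also have "\<dots> = (\<integral>\<^sup>+w. (\<Sum>k. U w * (indicator (block (Suc k) s t) w * (if L (Suc k) w = l then f (\<tau> (Suc k) w) else 0))) \<partial>M)"
    by (intro nn_integral_suminf[symmetric]) measurable
  also have "\<dots> = (\<integral>\<^sup>+w. U w * label_sum l f s t w \<partial>M)"
    unfolding label_sum_def ennreal_suminf_cmult by (intro nn_integral_cong arg_cong2[of _ _ _ _ "(*)"] block_sum[symmetric] refl)
  finally show ?thesis .
qed

lemma label_sum_indicator: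
  assumes w: "w \<in> space M" and st: "0 \<le> s" "s \<le> t"
  shows "label_sum l (indicator {a<..b}) s t w
      = (if max s a \<le> min t b then LC l (max s a) (min t b) w else 0)"
proof -
  note path = C_path[OF w]
  have tau: "\<tau> k w \<in> {s<..t}" if "k \<in> {C s w<..C t w}" for k
    using event_time_in_Ioc_iff[OF path event_occursI[of t k], of s t] that st by auto
  have "label_sum l (indicator {a<..b}) s t w = of_nat (card {k \<in> {C s w<..C t w}. L k w = l \<and> \<tau> k w \<in> {a<..b}})"
  proof -
    have "label_sum l (indicator {a<..b}) s t w = (\<Sum>k\<in>{C s w<..C t w}. if L k w = l \<and> \<tau> k w \<in> {a<..b} then 1 else 0)"
      unfolding label_sum_def by (intro sum.cong) (auto split: split_indicator)
    also have "\<dots> = of_nat (card ({C s w<..C t w} \<inter> {k. L k w = l \<and> \<tau> k w \<in> {a<..b}}))"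
      by (simp add: sum.If_cases)
    also have "{C s w<..C t w} \<inter> {k. L k w = l \<and> \<tau> k w \<in> {a<..b}} = {k \<in> {C s w<..C t w}. L k w = l \<and> \<tau> k w \<in> {a<..b}}"
      by auto
    finally show ?thesis .
  qed
  also have "\<dots> = (if max s a \<le> min t b then LC l (max s a) (min t b) w else 0)"
  proof (cases "max s a \<le> min t b")
    case True
    have "k \<in> {C s w<..C t w} \<and> \<tau> k w \<in> {a<..b} \<longleftrightarrow> k \<in> {C (max s a) w<..C (min t b) w}" for k
    proof
      assume *: "k \<in> {C s w<..C t w} \<and> \<tau> k w \<in> {a<..b}"
      then have "\<tau> k w \<in> {max s a<..min t b}" using tau[of k] by auto
      moreover have "event_occurs (\<lambda>t. C t w) k" using * st by (intro event_occursI[of t]) auto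
      ultimately show "k \<in> {C (max s a) w<..C (min t b) w}"
        using event_time_in_Ioc_iff[OF path, of k "max s a" "min t b"] True st by auto
    next
      assume *: "k \<in> {C (max s a) w<..C (min t b) w}"
      have "event_occurs (\<lambda>t. C t w) k"
        using * st True by (intro event_occursI[of "min t b"]) auto
      then have t: "\<tau> k w \<in> {max s a<..min t b}" and
        i: "\<tau> k w \<in> {s<..t} \<longleftrightarrow> k \<in> {C s w<..C t w}"
        using event_time_in_Ioc_iff[OF path, of k "max s a" "min t b"] 
          event_time_in_Ioc_iff[OF path, of k s t] True st * by auto
      then show "k \<in> {C s w<..C t w} \<and> \<tau> k w \<in> {a<..b}" by auto
    qed
    then have "{k \<in> {C s w<..C t w}. L k w = l \<and> \<tau> k w \<in> {a<..b}} = {k \<in> {C (max s a) w<..C (min t b) w}. L k w = l}"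
      by blast
    then show ?thesis using True by (simp add: LC_def label_count_def)
  next
    case False
    then have e: "{k \<in> {C s w<..C t w}. L k w = l \<and> \<tau> k w \<in> {a<..b}} = {}" using tau by fastforce
    show ?thesis unfolding e using False by (simp only: if_False card.empty of_nat_0)
  qed
  finally show ?thesis .
qed

lemma finite_borel_measure_event_measure:
  assumes U: "U \<in> borel_measurable M" and st: "0 \<le> s" "0 \<le> t" and fin: "(\<integral>\<^sup>+w. U w * LC l s t w \<partial>M) < \<infinity>"
  shows "finite_borel_measure (event_measure U l s t)"
proof -
  have "emeasure (event_measure U l s t) UNIV = (\<integral>\<^sup>+x. 1 \<partial>event_measure U l s t)"
    by (simp add: event_measure_def)
  also have "\<dots> = (\<integral>\<^sup>+w. U w * LC l s t w \<partial>M)"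
    unfolding LC_eq using U st by (intro nn_integral_event_measure) auto
  finally show ?thesis
    using fin by (auto simp: finite_borel_measure_def finite_borel_measure_axioms_def event_measure_def intro!: finite_measureI)
qed

lemma emeasure_event_measure_Ioc:
  assumes U: "U \<in> borel_measurable M" and st: "0 \<le> s" "s \<le> t"
  shows "emeasure (event_measure U l s t) {a<..b}
      = (if max s a \<le> min t b then \<integral>\<^sup>+w. U w * LC l (max s a) (min t b) w \<partial>M else 0)"
proof -
  have "emeasure (event_measure U l s t) {a<..b} = (\<integral>\<^sup>+x. indicator {a<..b} x \<partial>event_measure U l s t)"
    by (simp add: event_measure_def)
  also have "\<dots> = (\<integral>\<^sup>+w. U w * label_sum l (indicator {a<..b}) s t w \<partial>M)"
    using U st by (intro nn_integral_event_measure) auto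
  also have "\<dots> = (\<integral>\<^sup>+w. U w * (if max s a \<le> min t b then LC l (max s a) (min t b) w else 0) \<partial>M)"
    using st by (intro nn_integral_cong) (simp add: label_sum_indicator)
  finally show ?thesis
    by (cases "max s a \<le> min t b") (simp_all only: if_True if_False mult_zero_right nn_integral_const mult_zero_left)
qed

text \<open>Both sides are integrals of \<open>f\<close> against measures on the line, with weight
  \<open>U\<close> on the left and constant weight \<open>\<kappa>\<close> on the right; the
  hypothesis \<open>le\<close> is their comparison on intervals. The weight is arbitrary so that the
  lemma can treat the two factors of a product one after the other.\<close>

lemma nn_integral_times_label_sum_le:
  assumes U: "U \<in> borel_measurable M" and f: "f \<in> borel_measurable borel" and st: "0 \<le> s" "s \<le> t"
    and fin: "(\<integral>\<^sup>+w. U w * LC l s t w \<partial>M) < \<infinity>" "(\<integral>\<^sup>+w. LC l s t w \<partial>M) < \<infinity>" "\<kappa> < \<infinity>"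
    and le: "\<And>a b. s \<le> a \<Longrightarrow> a \<le> b \<Longrightarrow> b \<le> t \<Longrightarrow> (\<integral>\<^sup>+w. U w * LC l a b w \<partial>M) \<le> \<kappa> * (\<integral>\<^sup>+w. LC l a b w \<partial>M)"
  shows "(\<integral>\<^sup>+w. U w * label_sum l f s t w \<partial>M) \<le> \<kappa> * (\<integral>\<^sup>+w. label_sum l f s t w \<partial>M)"
proof -
  have t: "0 \<le> t" using st by simp
  have LC: "(\<integral>\<^sup>+w. \<kappa> * LC l a b w \<partial>M) = \<kappa> * (\<integral>\<^sup>+w. LC l a b w \<partial>M)" if "0 \<le> a" "0 \<le> b" for a b
    using LC_meas[OF that] by (rule nn_integral_cmult)
  have "(\<integral>\<^sup>+x. f x \<partial>event_measure U l s t) \<le> (\<integral>\<^sup>+x. f x \<partial>event_measure (\<lambda>_. \<kappa>) l s t)"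
  proof (rule nn_integral_le_of_Ioc_le)
    show "finite_borel_measure (event_measure U l s t)" using U st t fin by (intro finite_borel_measure_event_measure)
    show "finite_borel_measure (event_measure (\<lambda>_. \<kappa>) l s t)"
      using st t fin LC[OF st(1) t] by (intro finite_borel_measure_event_measure) (auto simp: ennreal_mult_less_top)
    fix a b :: real assume "a \<le> b"
    have le': "(\<integral>\<^sup>+w. U w * LC l (max s a) (min t b) w \<partial>M) \<le> (\<integral>\<^sup>+w. \<kappa> * LC l (max s a) (min t b) w \<partial>M)"
      if "max s a \<le> min t b" using that st t by (subst LC) (auto intro!: le)
    have "emeasure (event_measure U l s t) {a<..b} = (if max s a \<le> min t b then \<integral>\<^sup>+w. U w * LC l (max s a) (min t b) w \<partial>M else 0)"
      by (rule emeasure_event_measure_Ioc[OF U st])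
    also have "\<dots> \<le> (if max s a \<le> min t b then \<integral>\<^sup>+w. \<kappa> * LC l (max s a) (min t b) w \<partial>M else 0)"
      using le' by (simp only: if_split) simp
    also have "\<dots> = emeasure (event_measure (\<lambda>_. \<kappa>) l s t) {a<..b}"
      by (rule emeasure_event_measure_Ioc[OF _ st, symmetric]) simp
    finally show "emeasure (event_measure U l s t) {a<..b} \<le> emeasure (event_measure (\<lambda>_. \<kappa>) l s t) {a<..b}" .
  qed
  also have "\<dots> = (\<integral>\<^sup>+w. \<kappa> * label_sum l f s t w \<partial>M)" using st t f by (intro nn_integral_event_measure) auto
  also have "\<dots> = \<kappa> * (\<integral>\<^sup>+w. label_sum l f s t w \<partial>M)" by (intro nn_integral_cmult label_sum_meas f st t)
  finally show ?thesis using nn_integral_event_measure[OF U f st(1) t] by simp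
qed

text \<open>The same comparison with the roles exchanged: now the smaller measure has the density
  \<open>q\<close> on \<open>{s<..t}\<close>, the larger one is the mean measure of the event
  times.\<close>

lemma nn_integral_label_sum_ge:
  assumes f: "f \<in> borel_measurable borel" and st: "0 \<le> s" "s \<le> t"
    and fin: "(\<integral>\<^sup>+w. LC l s t w \<partial>M) < \<infinity>" and q: "q \<in> borel_measurable borel"
    and ge: "\<And>a b. s \<le> a \<Longrightarrow> a \<le> b \<Longrightarrow> b \<le> t \<Longrightarrow> (\<integral>\<^sup>+x\<in>{a<..b}. q x \<partial>lborel) \<le> (\<integral>\<^sup>+w. LC l a b w \<partial>M)"
  shows "(\<integral>\<^sup>+x\<in>{s<..t}. q x * f x \<partial>lborel) \<le> (\<integral>\<^sup>+w. label_sum l f s t w \<partial>M)"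
proof -
  have t: "0 \<le> t" using st by simp
  note [measurable] = q f
  let ?n = "density lborel (\<lambda>x. q x * indicator {s<..t} x)"
  have em: "emeasure ?n A = (\<integral>\<^sup>+x\<in>A \<inter> {s<..t}. q x \<partial>lborel)" if "A \<in> sets borel" for A
    using that by (subst emeasure_density) (auto intro!: nn_integral_cong split: split_indicator)
  have "(\<integral>\<^sup>+x\<in>{s<..t}. q x * f x \<partial>lborel) = (\<integral>\<^sup>+x. f x \<partial>?n)"
    by (subst nn_integral_density) (auto intro!: nn_integral_cong split: split_indicator)
  also have "\<dots> \<le> (\<integral>\<^sup>+x. f x \<partial>event_measure (\<lambda>_. 1) l s t)"
  proof (rule nn_integral_le_of_Ioc_le)
    have "emeasure ?n UNIV < \<infinity>"
      using em[of UNIV] ge[of s t] st fin by (auto intro: order.strict_trans1)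
    then show "finite_borel_measure ?n"
      by (auto simp: finite_borel_measure_def finite_borel_measure_axioms_def intro!: finite_measureI)
    show "finite_borel_measure (event_measure (\<lambda>_. 1) l s t)"
      using st t fin by (intro finite_borel_measure_event_measure) auto
    fix a b :: real assume "a \<le> b"
    have "{a<..b} \<inter> {s<..t} = {max s a<..min t b}" by auto
    then have "emeasure ?n {a<..b} = (\<integral>\<^sup>+x\<in>{max s a<..min t b}. q x \<partial>lborel)"
      using em[of "{a<..b}"] by simp
    also have "\<dots> \<le> (if max s a \<le> min t b then \<integral>\<^sup>+w. 1 * LC l (max s a) (min t b) w \<partial>M else 0)"
      using ge[of "max s a" "min t b"] by (cases "max s a \<le> min t b") auto
    also have "\<dots> = emeasure (event_measure (\<lambda>_. 1) l s t) {a<..b}"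
      by (rule emeasure_event_measure_Ioc[OF _ st, symmetric]) simp
    finally show "emeasure ?n {a<..b} \<le> emeasure (event_measure (\<lambda>_. 1) l s t) {a<..b}" .
  qed
  also have "\<dots> = (\<integral>\<^sup>+w. 1 * label_sum l f s t w \<partial>M)" using st t f by (intro nn_integral_event_measure) auto
  finally show ?thesis by simp
qed

abbreviation "g l \<equiv> (\<lambda>u. mean_below c (D (max 0 u) l))"

lemma mean_sum_eq: "mean_sum s t w = (\<Sum>l\<in>UNIV. label_sum l (g l) s t w)"
proof -
  have "(\<Sum>l\<in>UNIV. label_sum l (g l) s t w) = (\<Sum>k\<in>{C s w<..C t w}. \<Sum>l\<in>UNIV. if L k w = l then g l (\<tau> k w) else 0)"
    unfolding label_sum_def by (rule sum.swap)
  also have "\<dots> = mean_sum s t w"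
    unfolding mean_sum_def m_def by (intro sum.cong) auto
  finally show ?thesis by simp
qed

lemma LC_le: "LC l s t w \<le> of_nat (C t w - C s w)"
  unfolding LC_def using label_count_le[of "\<lambda>t. C t w" _ l s t] by simp

lemma label_sum_le: "label_sum l (g l) s t w \<le> ennreal c * of_nat (C t w - C s w)"
proof -
  have "label_sum l (g l) s t w \<le> (\<Sum>k\<in>{C s w<..C t w}. ennreal c)"
    unfolding label_sum_def using mean_below_le[OF D_df c] by (intro sum_mono) auto
  then show ?thesis by (simp add: mult.commute)
qed

theorem reward_sum_mixing:
  assumes st: "0 \<le> s" "s \<le> t" "t \<le> s'" "s' \<le> t'" and \<kappa>: "\<kappa> < \<infinity>"
    and fin: "(\<integral>\<^sup>+w. of_nat (C t w - C s w) \<partial>M) < \<infinity>" "(\<integral>\<^sup>+w. of_nat (C t' w - C s' w) \<partial>M) < \<infinity>"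
      "(\<integral>\<^sup>+w. of_nat (C t w - C s w) * of_nat (C t' w - C s' w) \<partial>M) < \<infinity>"
    and mix: "\<And>l l' a b a' b'. s \<le> a \<Longrightarrow> a \<le> b \<Longrightarrow> b \<le> t \<Longrightarrow> s' \<le> a' \<Longrightarrow> a' \<le> b' \<Longrightarrow> b' \<le> t' \<Longrightarrow>
      (\<integral>\<^sup>+w. LC l a b w * LC l' a' b' w \<partial>M) \<le> \<kappa> * (\<integral>\<^sup>+w. LC l a b w \<partial>M) * (\<integral>\<^sup>+w. LC l' a' b' w \<partial>M)"
  shows "(\<integral>\<^sup>+w. reward_sum s t w * reward_sum s' t' w \<partial>M) \<le> \<kappa> * (\<integral>\<^sup>+w. reward_sum s t w \<partial>M) * (\<integral>\<^sup>+w. reward_sum s' t' w \<partial>M)"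
proof -
  let ?\<Delta> = "\<lambda>w. of_nat (C t w - C s w) :: ennreal" and ?\<Delta>' = "\<lambda>w. of_nat (C t' w - C s' w) :: ennreal"
  have pos: "0 \<le> t" "0 \<le> s'" "0 \<le> t'" using st by auto
  have mono: "C a w \<le> C b w" if "w \<in> space M" "0 \<le> a" "a \<le> b" for a b w
    using counting_path_mono[OF C_path[OF that(1)] that(2,3)] .
  have LC_le2: "LC l a b w \<le> of_nat (C y w - C x w)" if "x \<le> a" "a \<le> b" "b \<le> y" "0 \<le> x" "w \<in> space M" for l a b x y w
  proof -
    have "C b w - C a w \<le> C y w - C x w" 
      using mono[of w x a] mono[of w b y] that by linarith
    then have "(of_nat (C b w - C a w) :: ennreal) \<le> of_nat (C y w - C x w)" by (simp only: of_nat_le_iff)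
    with LC_le[of l a b w] show ?thesis by (rule order.trans)
  qed
  have LCfin: "(\<integral>\<^sup>+w. LC l s t w \<partial>M) < \<infinity>" "(\<integral>\<^sup>+w. LC l s' t' w \<partial>M) < \<infinity>" for l
    using fin(1,2) by (auto intro: order.strict_trans1[OF nn_integral_mono[OF LC_le]])
  \<comment> \<open>The count over \<open>{s<..t}\<close> is turned into a sum of conditional means
    at its event times; the other count acts as the weight, and the constant is
    \<open>\<kappa>\<close> times the integral of that weight.\<close>
  have step1: "(\<integral>\<^sup>+w. LC l' a' b' w * label_sum l (g l) s t w \<partial>M)
      \<le> \<kappa> * (\<integral>\<^sup>+w. LC l' a' b' w \<partial>M) * (\<integral>\<^sup>+w. label_sum l (g l) s t w \<partial>M)"
    if ab: "s' \<le> a'" "a' \<le> b'" "b' \<le> t'" for l l' a' b'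
  proof (rule nn_integral_times_label_sum_le[OF _ mean_meas st(1,2)])
    show "LC l' a' b' \<in> borel_measurable M" using ab pos by (intro LC_meas) auto
    have "(\<integral>\<^sup>+w. LC l' a' b' w * LC l s t w \<partial>M) \<le> (\<integral>\<^sup>+w. ?\<Delta> w * ?\<Delta>' w \<partial>M)"
    proof (rule nn_integral_mono)
      fix w assume "w \<in> space M"
      then have "LC l' a' b' w \<le> ?\<Delta>' w" "LC l s t w \<le> ?\<Delta> w"
        using ab st pos by (auto intro: LC_le2)
      then have "LC l' a' b' w * LC l s t w \<le> ?\<Delta>' w * ?\<Delta> w" by (intro mult_mono) auto
      then show "LC l' a' b' w * LC l s t w \<le> ?\<Delta> w * ?\<Delta>' w" by (simp add: mult.commute)
    qed
    then show "(\<integral>\<^sup>+w. LC l' a' b' w * LC l s t w \<partial>M) < \<infinity>" using fin(3) by (rule order.strict_trans1)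
    have "(\<integral>\<^sup>+w. LC l' a' b' w \<partial>M) \<le> (\<integral>\<^sup>+w. ?\<Delta>' w \<partial>M)"
      using ab pos by (intro nn_integral_mono LC_le2) auto
    then have "(\<integral>\<^sup>+w. LC l' a' b' w \<partial>M) < \<infinity>" using fin(2) by (rule order.strict_trans1)
    then show "\<kappa> * (\<integral>\<^sup>+w. LC l' a' b' w \<partial>M) < \<infinity>" using \<kappa> by (simp add: ennreal_mult_less_top)
    fix a b assume "s \<le> a" "a \<le> b" "b \<le> t"
    from mix[OF this ab, of l l']
    show "(\<integral>\<^sup>+w. LC l' a' b' w * LC l a b w \<partial>M) \<le> \<kappa> * (\<integral>\<^sup>+w. LC l' a' b' w \<partial>M) * (\<integral>\<^sup>+w. LC l a b w \<partial>M)"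
      by (simp add: ac_simps)
  qed (rule LCfin)
  \<comment> \<open>Now the sum just obtained is the weight, and the second count is turned into a
    sum of conditional means in the same way.\<close>
  have step2: "(\<integral>\<^sup>+w. label_sum l (g l) s t w * label_sum l' (g l') s' t' w \<partial>M)
      \<le> \<kappa> * (\<integral>\<^sup>+w. label_sum l (g l) s t w \<partial>M) * (\<integral>\<^sup>+w. label_sum l' (g l') s' t' w \<partial>M)" for l l'
  proof (rule nn_integral_times_label_sum_le[OF _ mean_meas pos(2) st(4)])
    show m: "label_sum l (g l) s t \<in> borel_measurable M" by (intro label_sum_meas mean_meas st pos)
    have \<Delta>m: "(\<lambda>w. of_nat (C t w - C s w) :: ennreal) \<in> borel_measurable M"
    proof -
      have [measurable]: "C t \<in> measurable M (count_space UNIV)" "C s \<in> measurable M (count_space UNIV)"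
        using st pos by (auto intro: C_meas')
      show ?thesis by measurable
    qed
    have "(\<integral>\<^sup>+w. label_sum l (g l) s t w * LC l' s' t' w \<partial>M) \<le> (\<integral>\<^sup>+w. ennreal c * (?\<Delta> w * ?\<Delta>' w) \<partial>M)"
    proof (rule nn_integral_mono)
      fix w assume "w \<in> space M"
      have "label_sum l (g l) s t w * LC l' s' t' w \<le> (ennreal c * ?\<Delta> w) * ?\<Delta>' w" by (intro mult_mono label_sum_le LC_le) auto
      then show "label_sum l (g l) s t w * LC l' s' t' w \<le> ennreal c * (?\<Delta> w * ?\<Delta>' w)" by (simp add: ac_simps)
    qed
    also have "\<dots> = ennreal c * (\<integral>\<^sup>+w. ?\<Delta> w * ?\<Delta>' w \<partial>M)"
    proof (rule nn_integral_cmult)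
      have [measurable]: "C t \<in> measurable M (count_space UNIV)" "C s \<in> measurable M (count_space UNIV)"
        "C t' \<in> measurable M (count_space UNIV)" "C s' \<in> measurable M (count_space UNIV)"
        using st pos by (auto intro: C_meas')
      show "(\<lambda>w. ?\<Delta> w * ?\<Delta>' w) \<in> borel_measurable M" by measurable
    qed
    also have "\<dots> < \<infinity>" using fin(3) by (simp add: ennreal_mult_less_top)
    finally show "(\<integral>\<^sup>+w. label_sum l (g l) s t w * LC l' s' t' w \<partial>M) < \<infinity>" .
    have "(\<integral>\<^sup>+w. label_sum l (g l) s t w \<partial>M) \<le> (\<integral>\<^sup>+w. ennreal c * ?\<Delta> w \<partial>M)" by (intro nn_integral_mono label_sum_le)
    also have "\<dots> = ennreal c * (\<integral>\<^sup>+w. ?\<Delta> w \<partial>M)" by (intro nn_integral_cmult \<Delta>m)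
    also have "\<dots> < \<infinity>" using fin(1) by (simp add: ennreal_mult_less_top)
    finally show "\<kappa> * (\<integral>\<^sup>+w. label_sum l (g l) s t w \<partial>M) < \<infinity>" using \<kappa> by (simp add: ennreal_mult_less_top)
    fix a' b' assume "s' \<le> a'" "a' \<le> b'" "b' \<le> t'"
    from step1[OF this, of l' l]
    show "(\<integral>\<^sup>+w. label_sum l (g l) s t w * LC l' a' b' w \<partial>M) \<le> \<kappa> * (\<integral>\<^sup>+w. label_sum l (g l) s t w \<partial>M) * (\<integral>\<^sup>+w. LC l' a' b' w \<partial>M)"
      by (simp add: ac_simps)
  qed (rule LCfin)
  have [measurable]: "label_sum l (g l) s t \<in> borel_measurable M" "label_sum l (g l) s' t' \<in> borel_measurable M" for l
    by (intro label_sum_meas mean_meas st pos)+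
  have "(\<integral>\<^sup>+w. reward_sum s t w * reward_sum s' t' w \<partial>M) = (\<integral>\<^sup>+w. (\<Sum>l\<in>UNIV. \<Sum>l'\<in>UNIV. label_sum l (g l) s t w * label_sum l' (g l') s' t' w) \<partial>M)"
    unfolding nn_integral_reward_sum_reward_sum[OF st] mean_sum_eq by (simp only: sum_product)
  also have "\<dots> = (\<Sum>l\<in>UNIV. \<Sum>l'\<in>UNIV. \<integral>\<^sup>+w. label_sum l (g l) s t w * label_sum l' (g l') s' t' w \<partial>M)"
    by (simp add: nn_integral_sum)
  also have "\<dots> \<le> (\<Sum>l\<in>UNIV. \<Sum>l'\<in>UNIV. \<kappa> * (\<integral>\<^sup>+w. label_sum l (g l) s t w \<partial>M) * (\<integral>\<^sup>+w. label_sum l' (g l') s' t' w \<partial>M))"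
    by (intro sum_mono step2)
  also have "\<dots> = \<kappa> * (\<Sum>l\<in>UNIV. \<integral>\<^sup>+w. label_sum l (g l) s t w \<partial>M) * (\<Sum>l\<in>UNIV. \<integral>\<^sup>+w. label_sum l (g l) s' t' w \<partial>M)"
    by (simp only: sum_distrib_left[where r=\<kappa>] sum_product)
  also have "\<dots> = \<kappa> * (\<integral>\<^sup>+w. reward_sum s t w \<partial>M) * (\<integral>\<^sup>+w. reward_sum s' t' w \<partial>M)"
    unfolding nn_integral_reward_sum[OF st(1,2)] nn_integral_reward_sum[OF pos(2) st(4)] mean_sum_eq by (simp add: nn_integral_sum)
  finally show ?thesis .
qed

text \<open>Here \<open>q l\<close> is a lower bound for the density of the mean number of
  \<open>l\<close>-events; multiplied by the mean reward per event it bounds the mean reward per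
  unit of time.\<close>

lemma reward_sum_ge:
  assumes st: "0 \<le> s" "s \<le> t" and fin: "(\<integral>\<^sup>+w. of_nat (C t w - C s w) \<partial>M) < \<infinity>"
    and q: "\<And>l. q l \<in> borel_measurable borel"
    and ge: "\<And>l a b. s \<le> a \<Longrightarrow> a \<le> b \<Longrightarrow> b \<le> t \<Longrightarrow> (\<integral>\<^sup>+x\<in>{a<..b}. q l x \<partial>lborel) \<le> (\<integral>\<^sup>+w. LC l a b w \<partial>M)"
  shows "(\<integral>\<^sup>+x\<in>{s<..t}. (\<Sum>l\<in>UNIV. q l x * mean_below c (D x l)) \<partial>lborel) \<le> (\<integral>\<^sup>+w. reward_sum s t w \<partial>M)"
proof -
  have [measurable]: "label_sum l (g l) s t \<in> borel_measurable M" for l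
    using st by (intro label_sum_meas mean_meas) auto
  note [measurable] = q mean_meas
  have "(\<integral>\<^sup>+x\<in>{s<..t}. (\<Sum>l\<in>UNIV. q l x * mean_below c (D x l)) \<partial>lborel)
      = (\<integral>\<^sup>+x. (\<Sum>l\<in>UNIV. q l x * g l x * indicator {s<..t} x) \<partial>lborel)"
    using st by (intro nn_integral_cong) (auto simp: sum_distrib_right max_def split: split_indicator)
  also have "\<dots> = (\<Sum>l\<in>UNIV. \<integral>\<^sup>+x\<in>{s<..t}. q l x * g l x \<partial>lborel)"
    by (rule nn_integral_sum) measurable
  also have "\<dots> \<le> (\<Sum>l\<in>UNIV. \<integral>\<^sup>+w. label_sum l (g l) s t w \<partial>M)"
    using fin by (intro sum_mono nn_integral_label_sum_ge mean_meas st q ge order.strict_trans1[OF nn_integral_mono[OF LC_le]])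
  also have "\<dots> = (\<integral>\<^sup>+w. reward_sum s t w \<partial>M)"
    unfolding nn_integral_reward_sum[OF st] mean_sum_eq by (simp add: nn_integral_sum)
  finally show ?thesis .
qed

end

section \<open>Generated sigma-algebras\<close>

lemma
  fixes Z :: "real \<Rightarrow> 'w \<Rightarrow> 'v::countable"
  shows space_generated: "space (generated M I Z) = space M"
    and sets_generated: "sets (generated M I Z) = sigma_sets (space M) {Z t -` A \<inter> space M | t A. t \<in> I}"
proof -
  have *: "{Z t -` A \<inter> space M | t A. t \<in> I} \<subseteq> Pow (space M)" by auto
  show "space (generated M I Z) = space M"
    unfolding generated_def by (rule space_measure_of[OF *])
  show "sets (generated M I Z) = sigma_sets (space M) {Z t -` A \<inter> space M | t A. t \<in> I}"
    unfolding generated_def by (rule sets_measure_of[OF *])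
qed

lemma subalgebra_generated:
  fixes Z :: "real \<Rightarrow> 'w \<Rightarrow> 'v::countable"
  assumes "\<And>t. t \<in> I \<Longrightarrow> Z t \<in> measurable M (count_space UNIV)"
  shows "subalgebra M (generated M I Z)"
proof -
  have "{Z t -` A \<inter> space M | t A. t \<in> I} \<subseteq> sets M"
    using assms by (auto simp: measurable_def)
  then show ?thesis
    unfolding subalgebra_def space_generated sets_generated
    by (simp add: sets.sigma_sets_subset)
qed

lemma measurable_generated:
  fixes Z :: "real \<Rightarrow> 'w \<Rightarrow> 'v::countable"
  assumes "t \<in> I"
  shows "Z t \<in> measurable (generated M I Z) (count_space UNIV)"
proof (rule measurableI)
  fix A :: "'v set"
  show "Z t -` A \<inter> space (generated M I Z) \<in> sets (generated M I Z)"
    unfolding space_generated sets_generated using assms by (intro sigma_sets.Basic) blast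
qed simp

lemma generated_mono:
  assumes "I \<subseteq> J"
  shows "sets (generated M I Z) \<subseteq> sets (generated M J Z)"
  unfolding sets_generated using assms by (intro sigma_sets_mono') blast

lemma set_integrable_const_Icc: "set_integrable lborel {s..t::real} (\<lambda>_. k::real)"
proof -
  have "integrable lborel (\<lambda>u. k * indicat_real {s..t} u)"
    by (intro integrable_mult_right integrable_real_indicator) (auto simp: emeasure_lborel_Icc_eq)
  then show ?thesis by (simp add: set_integrable_def mult.commute)
qed

lemma set_integral_const_Icc: "s \<le> t \<Longrightarrow> (LBINT u:{s..t::real}. k) = (k::real) * (t - s)"
  by (simp add: set_lebesgue_integral_def mult.commute)

section \<open>Geometric forgetting of the jump process, from the forward equation\<close>

section \<open>Mixing of a jump process with bounded rates\<close>

text \<open>The assumption \<open>markov\<close> is the Markov property integrated over events of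
  the past. Nonnegativity and unit row sums of \<open>P\<close> are deduced from it and hence known
  only for states of positive probability, which explains the recurring case distinction on
  \<open>prob (hit s x)\<close>. \<open>B\<close> is the set of pairs along which the rates stay
  above \<open>q\<close>.\<close>

locale bounded_jump_process = prob_space M for M :: "'w measure" +
  fixes X :: "real \<Rightarrow> 'w \<Rightarrow> 's::finite" and Q :: "real \<Rightarrow> 's \<Rightarrow> 's \<Rightarrow> real"
    and P :: "real \<Rightarrow> real \<Rightarrow> 's \<Rightarrow> 's \<Rightarrow> real" and \<Lambda> q :: real and B :: "('s \<times> 's) set"
  assumes X_meas: "\<And>t. 0 \<le> t \<Longrightarrow> X t \<in> measurable M (count_space UNIV)"
    and X_path: "\<And>w. w \<in> space M \<Longrightarrow> jump_path (\<lambda>t. X t w)"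
    and markov: "\<And>s t x y A. 0 \<le> s \<Longrightarrow> s \<le> t \<Longrightarrow> A \<in> sets (generated M {0..s} X) \<Longrightarrow>
      prob (A \<inter> {w \<in> space M. X s w = x} \<inter> {w \<in> space M. X t w = y})
        = prob (A \<inter> {w \<in> space M. X s w = x}) * P s t x y"
    and forward_integrable: "\<And>s t x y. 0 \<le> s \<Longrightarrow> s \<le> t \<Longrightarrow>
      set_integrable lborel {s..t} (\<lambda>u. \<Sum>z\<in>UNIV. P s u x z * Q u z y)"
    and forward: "\<And>s t x y. 0 \<le> s \<Longrightarrow> s \<le> t \<Longrightarrow>
      P s t x y = (if x = y then 1 else 0) + (LBINT u:{s..t}. \<Sum>z\<in>UNIV. P s u x z * Q u z y)"
    and Q_meas: "\<And>x y. measurable_in_time (\<lambda>t. Q t x y)"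
    and Q_nonneg: "\<And>t x y. 0 \<le> t \<Longrightarrow> x \<noteq> y \<Longrightarrow> 0 \<le> Q t x y"
    and Q_le: "\<And>t x y. 0 \<le> t \<Longrightarrow> \<bar>Q t x y\<bar> \<le> \<Lambda>"
    and Q_ge: "\<And>t x y. 0 \<le> t \<Longrightarrow> (x, y) \<in> B \<Longrightarrow> q \<le> Q t x y"
    and q: "0 < q" and \<Lambda>: "0 < \<Lambda>"
    and irreducible: "\<And>x y. (x, y) \<in> B\<^sup>*"
begin

abbreviation "hit t x \<equiv> {w \<in> space M. X t w = x}"
abbreviation "past s \<equiv> sets (generated M {0..s} X)"

lemma hit_sets: "0 \<le> t \<Longrightarrow> hit t x \<in> sets M"
  using measurable_count_space_pred[OF X_meas, of t "\<lambda>y. y = x"] by simp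

lemma subalgebra_past: "subalgebra M (generated M {0..s} X)"
  using X_meas by (intro subalgebra_generated) auto

lemma past_sets: "A \<in> past s \<Longrightarrow> A \<in> sets M"
  using subalgebra_past by (auto simp: subalgebra_def)

lemma past_mono: "s \<le> t \<Longrightarrow> A \<in> past s \<Longrightarrow> A \<in> past t"
  using generated_mono[of "{0..s}" "{0..t}" M X] by auto

lemma hit_past:
  assumes "0 \<le> u" "u \<le> s"
  shows "hit u x \<in> past s"
proof -
  have "X u \<in> measurable (generated M {0..s} X) (count_space UNIV)"
    using assms by (intro measurable_generated) auto
  from measurable_count_space_pred[OF this, of "\<lambda>y. y = x"] show ?thesis
    by (simp add: pred_def space_generated)
qed

lemma space_past: "space M \<in> past s"
  using sets.top[of "generated M {0..s} X"] by (simp add: space_generated)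

lemma prob_split:
  assumes "A \<in> sets M" "0 \<le> t"
  shows "prob A = (\<Sum>y\<in>UNIV. prob (A \<inter> hit t y))"
proof -
  have "prob A = prob (\<Union>y\<in>UNIV. A \<inter> hit t y)"
    using sets.sets_into_space[OF assms(1)] by (intro arg_cong[where f=prob]) auto
  also have "\<dots> = (\<Sum>y\<in>UNIV. prob (A \<inter> hit t y))"
    using assms hit_sets by (intro finite_measure_finite_Union) (auto simp: disjoint_family_on_def)
  finally show ?thesis .
qed

lemma markov1: "0 \<le> s \<Longrightarrow> s \<le> t \<Longrightarrow> prob (hit s x \<inter> hit t y) = prob (hit s x) * P s t x y"
  using markov[OF _ _ space_past, of s t x y] by (simp add: Int_absorb1 Collect_conj_eq[symmetric] Int_def)

lemma P_stochastic:
  assumes st: "0 \<le> s" "s \<le> t" and pos: "0 < prob (hit s x)"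
  shows "0 \<le> P s t x y" "P s t x y \<le> 1" "(\<Sum>y\<in>UNIV. P s t x y) = 1"
proof -
  have "0 \<le> prob (hit s x) * P s t x y" unfolding markov1[OF st, symmetric] by simp
  then show "0 \<le> P s t x y" using pos by (simp add: zero_le_mult_iff)
  have "prob (hit s x) * P s t x y \<le> prob (hit s x) * 1"
    unfolding markov1[OF st, symmetric] using hit_sets st by (auto intro!: finite_measure_mono)
  then show "P s t x y \<le> 1" using pos by simp
  have "prob (hit s x) * (\<Sum>y\<in>UNIV. P s t x y) = (\<Sum>y\<in>UNIV. prob (hit s x \<inter> hit t y))"
    by (simp add: markov1[OF st] sum_distrib_left)
  also have "\<dots> = prob (hit s x)" using prob_split[OF hit_sets, of s t x] st by simp
  finally show "(\<Sum>y\<in>UNIV. P s t x y) = 1" using pos by simp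
qed

lemma Q_meas': "(\<lambda>u. Q (max 0 u) x y) \<in> borel_measurable borel"
  by (rule measurable_compose[OF _ Q_meas]) (auto intro!: measurable_restrict_space2)

lemma set_integrable_Q:
  assumes "0 \<le> s"
  shows "set_integrable lborel {s..t} (\<lambda>u. Q u x y)"
proof -
  have "set_integrable lborel {s..t} (\<lambda>u. Q (max 0 u) x y)"
    unfolding set_integrable_def
  proof (rule Bochner_Integration.integrable_bound[of _ "\<lambda>u. indicator {s..t} u * \<Lambda>"])
    show "integrable lborel (\<lambda>u. indicat_real {s..t} u * \<Lambda>)"
      using set_integrable_const_Icc[of s t \<Lambda>] by (simp add: set_integrable_def)
    show "(\<lambda>u. indicat_real {s..t} u *\<^sub>R Q (max 0 u) x y) \<in> borel_measurable lborel"
      using Q_meas' by measurable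
    show "AE u in lborel. norm (indicat_real {s..t} u *\<^sub>R Q (max 0 u) x y) \<le> norm (indicat_real {s..t} u * \<Lambda>)"
      using Q_le[of "max 0 _"] \<Lambda> by (auto split: split_indicator)
  qed
  moreover have "set_integrable lborel {s..t} (\<lambda>u. Q (max 0 u) x y) = set_integrable lborel {s..t} (\<lambda>u. Q u x y)"
    using assms by (intro set_integrable_cong) (auto simp: max_def)
  ultimately show ?thesis by simp
qed

text \<open>In the forward equation the terms from other states are nonnegative, and the diagonal
  term is at least \<open>- \<Lambda>\<close>.\<close>

lemma P_stay:
  assumes st: "0 \<le> s" "s \<le> t" and pos: "0 < prob (hit s x)"
  shows "1 - \<Lambda> * (t - s) \<le> P s t x x"
proof -
  have "(LBINT u:{s..t}. - \<Lambda>) \<le> (LBINT u:{s..t}. \<Sum>z\<in>UNIV. P s u x z * Q u z x)"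
  proof (rule set_integral_mono)
    show "set_integrable lborel {s..t} (\<lambda>u. - \<Lambda>)" by (rule set_integrable_const_Icc)
    fix u assume u: "u \<in> {s..t}"
    then have Pu: "0 \<le> P s u x z" "P s u x x \<le> 1" for z using P_stochastic[OF st(1) _ pos, of u] by auto
    have "P s u x x * \<bar>Q u x x\<bar> \<le> 1 * \<Lambda>"
      using Pu Q_le[of u x x] u st by (intro mult_mono) auto
    moreover have "- (P s u x x * \<bar>Q u x x\<bar>) \<le> P s u x x * Q u x x"
      using mult_left_mono[OF abs_le_D2[OF order.refl, of "Q u x x"] Pu(1)[of x]] by simp
    moreover have "P s u x x * Q u x x \<le> (\<Sum>z\<in>UNIV. P s u x z * Q u z x)"
    proof -
      have "0 \<le> (\<Sum>z\<in>UNIV - {x}. P s u x z * Q u z x)"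
        using Pu Q_nonneg u st by (intro sum_nonneg mult_nonneg_nonneg) auto
      then show ?thesis by (simp add: sum.remove[of UNIV x])
    qed
    ultimately show "- \<Lambda> \<le> (\<Sum>z\<in>UNIV. P s u x z * Q u z x)" by linarith
  qed (rule forward_integrable[OF st])
  moreover have "(LBINT u:{s..t}. - \<Lambda>) = - \<Lambda> * (t - s)"
    using st by (simp add: set_lebesgue_integral_def mult.commute)
  ultimately show ?thesis using forward[OF st, of x x] by simp
qed

text \<open>Up to time \<open>u\<close> the process is still in \<open>x\<close> with probability at
  least \<open>1 - \<Lambda> * (t - s)\<close>, so at most \<open>\<Lambda> * (t - s)\<close> has
  reached \<open>y\<close>, and this mass leaves \<open>y\<close> at a rate of at most
  \<open>\<Lambda>\<close>. The loss is of second order in \<open>t - s\<close>: it disappears in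
  sums over fine grids, while the main terms add up to an integral of the rate.\<close>

lemma P_move:
  assumes st: "0 \<le> s" "s \<le> t" and pos: "0 < prob (hit s x)" and xy: "x \<noteq> y"
  shows "(1 - \<Lambda> * (t - s)) * (LBINT u:{s..t}. Q u x y) - \<Lambda>\<^sup>2 * (t - s)\<^sup>2 \<le> P s t x y"
proof -
  let ?h = "t - s"
  let ?f = "\<lambda>u. (1 - \<Lambda> * ?h) * Q u x y - \<Lambda> * (\<Lambda> * ?h)"
  have int1: "set_integrable lborel {s..t} (\<lambda>u. (1 - \<Lambda> * ?h) * Q u x y)"
    using set_integrable_Q[OF st(1), of t x y] by simp
  have int2: "set_integrable lborel {s..t} (\<lambda>u. \<Lambda> * (\<Lambda> * ?h))" by (rule set_integrable_const_Icc)
  have "(LBINT u:{s..t}. ?f u) \<le> (LBINT u:{s..t}. \<Sum>z\<in>UNIV. P s u x z * Q u z y)"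
  proof (rule set_integral_mono)
    show "set_integrable lborel {s..t} ?f" by (rule set_integral_diff(1)[OF int1 int2])
    fix u assume u: "u \<in> {s..t}"
    then have u0: "0 \<le> u" "s \<le> u" "u \<le> t" using st by auto
    note Pu = P_stochastic[OF st(1) u0(2) pos]
    have "\<Lambda> * (u - s) \<le> \<Lambda> * ?h" using \<Lambda> u0 by (intro mult_left_mono) auto
    with P_stay[OF st(1) u0(2) pos] have stay: "1 - \<Lambda> * ?h \<le> P s u x x" by linarith
    have "P s u x x + P s u x y \<le> (\<Sum>z\<in>UNIV. P s u x z)"
      using Pu(1) xy sum_mono2[of UNIV "{x, y}" "P s u x"] by simp
    then have Py: "P s u x y \<le> \<Lambda> * ?h" using stay Pu(3) by linarith
    have "(1 - \<Lambda> * ?h) * Q u x y \<le> P s u x x * Q u x y"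
      using stay Q_nonneg[OF u0(1) xy] by (rule mult_right_mono)
    moreover have "P s u x y * \<bar>Q u y y\<bar> \<le> (\<Lambda> * ?h) * \<Lambda>"
      using Py Pu(1)[of y] Q_le[OF u0(1), of y y] \<Lambda> st by (intro mult_mono) auto
    moreover have "- (P s u x y * \<bar>Q u y y\<bar>) \<le> P s u x y * Q u y y"
      using mult_left_mono[OF abs_le_D2[OF order.refl, of "Q u y y"] Pu(1)[of y]] by simp
    moreover have "P s u x x * Q u x y + P s u x y * Q u y y \<le> (\<Sum>z\<in>UNIV. P s u x z * Q u z y)"
    proof -
      have "0 \<le> (\<Sum>z\<in>UNIV - {x} - {y}. P s u x z * Q u z y)"
        using Pu Q_nonneg[OF u0(1)] by (intro sum_nonneg mult_nonneg_nonneg) auto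
      then show ?thesis using xy by (simp add: sum.remove[of UNIV x] sum.remove[of "UNIV - {x}" y])
    qed
    ultimately show "?f u \<le> (\<Sum>z\<in>UNIV. P s u x z * Q u z y)" by (simp add: mult.commute)
  qed (rule forward_integrable[OF st])
  also have "\<dots> = P s t x y" using forward[OF st, of x y] xy by simp
  also have "(LBINT u:{s..t}. ?f u) = (LBINT u:{s..t}. (1 - \<Lambda> * ?h) * Q u x y) - (LBINT u:{s..t}. \<Lambda> * (\<Lambda> * ?h))"
    by (rule set_integral_diff(2)[OF int1 int2])
  also have "(LBINT u:{s..t}. (1 - \<Lambda> * ?h) * Q u x y) = (1 - \<Lambda> * ?h) * (LBINT u:{s..t}. Q u x y)"
    by simp
  also have "(LBINT u:{s..t}. \<Lambda> * (\<Lambda> * ?h)) = \<Lambda>\<^sup>2 * ?h\<^sup>2"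
    using st by (simp add: set_lebesgue_integral_def power2_eq_square)
  finally show ?thesis .
qed

section \<open>Bounds for path probabilities given the past, and minorization over unit time\<close>

lemma prob_stay:
  assumes st: "0 \<le> s" "s \<le> t" and A: "A \<in> past s"
  shows "(1 - \<Lambda> * (t - s)) * prob (A \<inter> hit s x) \<le> prob (A \<inter> hit s x \<inter> hit t x)"
proof (cases "prob (hit s x) > 0")
  case True
  from mult_left_mono[OF P_stay[OF st True], of "prob (A \<inter> hit s x)"] show ?thesis
    unfolding markov[OF st A] by (simp add: mult.commute)
next
  case False
  then have "prob (hit s x) = 0" using measure_nonneg[of M "hit s x"] by linarith
  moreover have "prob (A \<inter> hit s x) \<le> prob (hit s x)"
    using past_sets[OF A] hit_sets st by (intro finite_measure_mono) auto
  ultimately have "prob (A \<inter> hit s x) = 0" using measure_nonneg[of M "A \<inter> hit s x"] by linarith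
  then show ?thesis by simp
qed

text \<open>The event \<open>A\<close> of the past is kept general so that the bounds for changes in
  successive cells can be multiplied, as the second moment of the number of jumps requires.\<close>

lemma prob_change:
  assumes st: "0 \<le> s" "s \<le> t" and A: "A \<in> past s"
  shows "prob (A \<inter> {w \<in> space M. X s w \<noteq> X t w}) \<le> \<Lambda> * (t - s) * prob A"
proof -
  have AM: "A \<in> sets M" by (rule past_sets[OF A])
  have t: "0 \<le> t" using st by simp
  let ?S = "\<Union>x\<in>UNIV. A \<inter> hit s x \<inter> hit t x"
  have SM: "?S \<in> sets M" using AM hit_sets st t by auto
  have "A \<inter> {w \<in> space M. X s w \<noteq> X t w} = A - ?S"
    using sets.sets_into_space[OF AM] by auto
  then have "prob (A \<inter> {w \<in> space M. X s w \<noteq> X t w}) = prob (A - ?S)" by (simp only:)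
  also have "\<dots> = prob A - prob ?S"
    using AM SM by (intro finite_measure_Diff) auto
  finally have "prob (A \<inter> {w \<in> space M. X s w \<noteq> X t w}) = prob A - prob ?S" .
  moreover have "prob ?S = (\<Sum>x\<in>UNIV. prob (A \<inter> hit s x \<inter> hit t x))"
    using AM hit_sets st t by (intro finite_measure_finite_Union) (auto simp: disjoint_family_on_def)
  moreover have "(\<Sum>x\<in>UNIV. (1 - \<Lambda> * (t - s)) * prob (A \<inter> hit s x)) \<le> (\<Sum>x\<in>UNIV. prob (A \<inter> hit s x \<inter> hit t x))"
    by (intro sum_mono prob_stay st A)
  moreover have "(\<Sum>x\<in>UNIV. (1 - \<Lambda> * (t - s)) * prob (A \<inter> hit s x)) = (1 - \<Lambda> * (t - s)) * prob A"
    using prob_split[OF AM st(1)] by (simp add: sum_distrib_left)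
  ultimately show ?thesis by (simp add: algebra_simps)
qed

lemma prob_step:
  assumes h: "0 < h" "\<Lambda> * h \<le> 1 / 2" "\<Lambda>\<^sup>2 * h \<le> q / 4" and s: "0 \<le> s" and A: "A \<in> past s"
    and xy: "(x, y) \<in> B \<union> Id"
  shows "min (1 / 2) (q * h / 4) * prob (A \<inter> hit s x) \<le> prob (A \<inter> hit s x \<inter> hit (s + h) y)"
proof (cases "prob (hit s x) > 0")
  case True
  have sh: "s \<le> s + h" using h by simp
  have "min (1 / 2) (q * h / 4) \<le> P s (s + h) x y"
  proof (cases "x = y")
    case True
    then show ?thesis using P_stay[OF s sh \<open>prob (hit s x) > 0\<close>] h(2) by simp
  next
    case False
    then have B: "(x, y) \<in> B" using xy by auto
    have "(LBINT u:{s..s + h}. q) \<le> (LBINT u:{s..s + h}. Q u x y)"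
    proof (rule set_integral_mono)
      show "set_integrable lborel {s..s + h} (\<lambda>u. q)" by (rule set_integrable_const_Icc)
      show "set_integrable lborel {s..s + h} (\<lambda>u. Q u x y)" by (rule set_integrable_Q[OF s])
    qed (use Q_ge[OF _ B] s in auto)
    moreover have "(LBINT u:{s..s + h}. q) = q * h"
      using h by (simp add: set_lebesgue_integral_def mult.commute)
    ultimately have "q * h \<le> (LBINT u:{s..s + h}. Q u x y)" by simp
    then have "(1 / 2) * (q * h) \<le> (1 - \<Lambda> * h) * (LBINT u:{s..s + h}. Q u x y)"
      using h q by (intro mult_mono) auto
    moreover have "\<Lambda>\<^sup>2 * h\<^sup>2 \<le> q * h / 4"
      using mult_right_mono[OF h(3), of h] h(1) by (simp add: power2_eq_square mult.assoc)
    ultimately show ?thesis using P_move[OF s sh \<open>prob (hit s x) > 0\<close> False] by simp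
  qed
  from mult_left_mono[OF this, of "prob (A \<inter> hit s x)"] show ?thesis
    unfolding markov[OF s sh A] by (simp add: mult.commute)
next
  case False
  then have "prob (hit s x) = 0" using measure_nonneg[of M "hit s x"] by linarith
  moreover have "prob (A \<inter> hit s x) \<le> prob (hit s x)"
    using past_sets[OF A] hit_sets s by (intro finite_measure_mono) auto
  ultimately have "prob (A \<inter> hit s x) = 0" using measure_nonneg[of M "A \<inter> hit s x"] by linarith
  then show ?thesis by simp
qed

lemma prob_steps:
  assumes h: "0 < h" "\<Lambda> * h \<le> 1 / 2" "\<Lambda>\<^sup>2 * h \<le> q / 4" and s: "0 \<le> s" and A: "A \<in> past s"
    and xy: "(x, y) \<in> (B \<union> Id) ^^ n"
  shows "min (1 / 2) (q * h / 4) ^ n * prob (A \<inter> hit s x) \<le> prob (A \<inter> hit s x \<inter> hit (s + real n * h) y)"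
  using xy
proof (induction n arbitrary: y)
  case 0
  then show ?case by (auto simp: Int_absorb2)
next
  case (Suc n)
  then obtain z where z: "(x, z) \<in> (B \<union> Id) ^^ n" "(z, y) \<in> B \<union> Id" by auto
  let ?\<eta> = "min (1 / 2) (q * h / 4)" and ?t = "s + real n * h"
  have t: "0 \<le> ?t" "s \<le> ?t" using s h by auto
  have A': "A \<inter> hit s x \<in> past ?t"
    using past_mono[OF t(2) A] hit_past[of s ?t x] s t by (intro sets.Int) auto
  have \<eta>: "0 \<le> ?\<eta>" using q h by simp
  have "?\<eta> ^ Suc n * prob (A \<inter> hit s x) \<le> ?\<eta> * prob (A \<inter> hit s x \<inter> hit ?t z)"
    using mult_left_mono[OF Suc.IH[OF z(1)] \<eta>] by (simp add: mult.assoc)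
  also have "\<dots> \<le> prob (A \<inter> hit s x \<inter> hit ?t z \<inter> hit (?t + h) y)"
    by (rule prob_step[OF h t(1) A' z(2)])
  also have "\<dots> \<le> prob (A \<inter> hit s x \<inter> hit (?t + h) y)"
    using past_sets[OF A] hit_sets s t h by (intro finite_measure_mono) auto
  also have "?t + h = s + real (Suc n) * h" by (simp add: algebra_simps)
  finally show ?case .
qed

text \<open>All pairs of states are joined by paths of one common length \<open>n\<close> with steps
  in \<open>B\<close> or standing still, and \<open>n\<close> steps of duration \<open>h\<close> fit
  into unit time, each contributing a factor of at least \<open>\<eta>\<close>.\<close>

lemma doeblin:
  obtains \<delta> where "0 < \<delta>" "\<delta> \<le> 1 / 2"
    "\<And>s t A y. 0 \<le> s \<Longrightarrow> s + 1 \<le> t \<Longrightarrow> A \<in> past s \<Longrightarrow> \<delta> * prob A \<le> prob (A \<inter> hit t y)"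
proof -
  have "\<exists>n. (x, y) \<in> B ^^ n" for x y using irreducible[of x y] by (auto simp: rtrancl_power)
  then obtain f where f: "(x, y) \<in> B ^^ f x y" for x y by metis
  define n where "n = Suc (\<Sum>x\<in>UNIV. \<Sum>y\<in>UNIV. f x y)"
  \<comment> \<open>Staying put for some steps makes all connecting paths equally long.\<close>
  have R: "(x, y) \<in> (B \<union> Id) ^^ n" for x y
  proof -
    have "f x y \<le> (\<Sum>y\<in>UNIV. f x y)" by (intro member_le_sum) auto
    also have "\<dots> \<le> (\<Sum>x\<in>UNIV. \<Sum>y\<in>UNIV. f x y)" by (rule member_le_sum[of x UNIV "\<lambda>x. \<Sum>y\<in>UNIV. f x y"]) auto
    finally have "f x y \<le> n" by (simp add: n_def)
    have sub: "B ^^ k \<subseteq> (B \<union> Id) ^^ k" for k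
      by (induct k) (simp, fastforce)
    have pad: "(x, y) \<in> (B \<union> Id) ^^ (f x y + j)" for j
    proof (induct j)
      case 0
      then show ?case using f[of x y] sub by auto
    next
      case (Suc j)
      then show ?case by auto
    qed
    from pad[of "n - f x y"] \<open>f x y \<le> n\<close> show ?thesis by simp
  qed
  \<comment> \<open>The last two bounds are the conditions of \<open>prob_step\<close>; the first
    makes \<open>n\<close> steps fit into unit time.\<close>
  define h where "h = min (1 / real n) (min (1 / (2 * \<Lambda>)) (q / (4 * \<Lambda>\<^sup>2)))"
  have n: "0 < n" by (simp add: n_def)
  have h: "0 < h" "\<Lambda> * h \<le> 1 / 2" "\<Lambda>\<^sup>2 * h \<le> q / 4" "real n * h \<le> 1"
  proof -
    show "0 < h" using n \<Lambda> q by (simp add: h_def)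
    have "h \<le> 1 / (2 * \<Lambda>)" "h \<le> q / (4 * \<Lambda>\<^sup>2)" "h \<le> 1 / real n" by (auto simp: h_def)
    then show "\<Lambda> * h \<le> 1 / 2" "\<Lambda>\<^sup>2 * h \<le> q / 4" "real n * h \<le> 1"
      using \<Lambda> n by (simp_all add: field_simps)
  qed
  define \<eta> where "\<eta> = min (1 / 2) (q * h / 4)"
  have \<eta>: "0 < \<eta>" "\<eta> \<le> 1 / 2" using q h by (auto simp: \<eta>_def)
  show ?thesis
  proof (rule that[of "\<eta> ^ n"])
    show "0 < \<eta> ^ n" using \<eta> by simp
    have "\<eta> ^ n \<le> \<eta> ^ 1" using \<eta> n by (intro power_decreasing) auto
    then show "\<eta> ^ n \<le> 1 / 2" using \<eta> by simp
    fix s t A y assume s: "0 \<le> s" "s + 1 \<le> t" and A: "A \<in> past s"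
    \<comment> \<open>Only the last stretch before \<open>t\<close> is used, starting from whatever
      state has been reached by then; this covers every \<open>t\<close> from \<open>s + 1\<close>
      on.\<close>
    let ?s = "t - real n * h"
    have s': "0 \<le> ?s" "s \<le> ?s" "0 \<le> t" using s h(4) by auto
    have A': "A \<in> past ?s" by (rule past_mono[OF s'(2) A])
    have "\<eta> ^ n * prob A = (\<Sum>x\<in>UNIV. \<eta> ^ n * prob (A \<inter> hit ?s x))"
      using prob_split[OF past_sets[OF A] s'(1)] by (simp add: sum_distrib_left)
    also have "\<dots> \<le> (\<Sum>x\<in>UNIV. prob (A \<inter> hit ?s x \<inter> hit (?s + real n * h) y))"
      unfolding \<eta>_def by (intro sum_mono prob_steps[OF h(1-3) s'(1) A' R])
    also have "\<dots> = (\<Sum>x\<in>UNIV. prob ((A \<inter> hit t y) \<inter> hit ?s x))"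
      by (simp add: Int_ac)
    also have "\<dots> = prob (A \<inter> hit t y)"
      using prob_split[of "A \<inter> hit t y" ?s] past_sets[OF A] hit_sets s' by simp
    finally show "\<eta> ^ n * prob A \<le> prob (A \<inter> hit t y)" .
  qed
qed

text \<open>A covariance, regarded as a signed measure in the state \<open>z\<close> of total mass
  zero. The transition matrices transport it in the same way as they transport laws.\<close>

definition "dev A t z = prob (A \<inter> hit t z) - prob A * prob (hit t z)"

lemma dev_step:
  assumes st: "0 \<le> s" "s \<le> t" and A: "A \<in> past s"
  shows "dev A t z = (\<Sum>x\<in>UNIV. dev A s x * P s t x z)"
proof -
  have AM: "A \<in> sets M" and t: "0 \<le> t" using past_sets[OF A] st by auto
  have "prob (A \<inter> hit t z) = (\<Sum>x\<in>UNIV. prob (A \<inter> hit s x) * P s t x z)"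
  proof -
    have "prob (A \<inter> hit t z) = (\<Sum>x\<in>UNIV. prob (A \<inter> hit t z \<inter> hit s x))"
      using AM hit_sets t by (intro prob_split st) auto
    then show ?thesis unfolding markov[OF st A, symmetric] by (simp add: Int_ac)
  qed
  moreover have "prob (hit t z) = (\<Sum>x\<in>UNIV. prob (hit s x) * P s t x z)"
    using prob_split[OF hit_sets[OF t] st(1), of z] unfolding markov1[OF st, symmetric] by (simp add: Int_ac)
  ultimately show ?thesis
    by (simp add: dev_def algebra_simps sum_subtractf sum_distrib_left)
qed

text \<open>Dobrushin's contraction: every relevant row of the transition matrix over unit time
  dominates \<open>\<delta>\<close> times counting measure, and this common part annihilates signed
  measures of total mass zero.\<close>

lemma dev_contraction:
  assumes \<delta>: "0 < \<delta>" "\<delta> \<le> 1 / 2"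
    "\<And>s t A y. 0 \<le> s \<Longrightarrow> s + 1 \<le> t \<Longrightarrow> A \<in> past s \<Longrightarrow> \<delta> * prob A \<le> prob (A \<inter> hit t y)"
    and s: "0 \<le> s" and A: "A \<in> past s"
  shows "(\<Sum>z\<in>UNIV. \<bar>dev A (s + 1) z\<bar>) \<le> (1 - \<delta>) * (\<Sum>x\<in>UNIV. \<bar>dev A s x\<bar>)"
proof -
  have AM: "A \<in> sets M" by (rule past_sets[OF A])
  have st: "s \<le> s + 1" by simp
  have sum0: "(\<Sum>x\<in>UNIV. dev A s x) = 0"
    unfolding dev_def sum_subtractf sum_distrib_left[symmetric]
    using prob_split[OF AM s] prob_split[OF sets.top s] by (simp add: prob_space Int_absorb1 Int_def)
  have zero: "dev A s x = 0" if "\<not> prob (hit s x) > 0" for x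
  proof -
    have "prob (hit s x) = 0" using that measure_nonneg[of M "hit s x"] by linarith
    moreover have "prob (A \<inter> hit s x) \<le> prob (hit s x)"
      using AM hit_sets s by (intro finite_measure_mono) auto
    ultimately show ?thesis using measure_nonneg[of M "A \<inter> hit s x"] by (simp add: dev_def)
  qed
  have Pd: "\<delta> \<le> P s (s + 1) x z" if pos: "prob (hit s x) > 0" for x z
  proof -
    have "\<delta> * prob (hit s x) \<le> prob (hit s x \<inter> hit (s + 1) z)"
      by (intro \<delta>(3)[OF s] hit_past s) auto
    then show ?thesis unfolding markov1[OF s st] using pos by (simp add: mult.commute)
  qed
  \<comment> \<open>The deviations sum to zero, hence \<open>\<delta>\<close> may be subtracted from the transition probabilities.\<close>
  have "(\<Sum>z\<in>UNIV. \<bar>dev A (s + 1) z\<bar>) = (\<Sum>z\<in>UNIV. \<bar>\<Sum>x\<in>UNIV. dev A s x * (P s (s + 1) x z - \<delta>)\<bar>)"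
  proof (intro sum.cong refl arg_cong[where f=abs])
    fix z
    have "(\<Sum>x\<in>UNIV. dev A s x * (P s (s + 1) x z - \<delta>))
        = (\<Sum>x\<in>UNIV. dev A s x * P s (s + 1) x z) - (\<Sum>x\<in>UNIV. dev A s x) * \<delta>"
      by (simp add: algebra_simps sum_subtractf sum_distrib_left)
    then show "dev A (s + 1) z = (\<Sum>x\<in>UNIV. dev A s x * (P s (s + 1) x z - \<delta>))"
      using dev_step[OF s st A] sum0 by simp
  qed
  also have "\<dots> \<le> (\<Sum>z\<in>UNIV. \<Sum>x\<in>UNIV. \<bar>dev A s x * (P s (s + 1) x z - \<delta>)\<bar>)"
    by (intro sum_mono sum_abs)
  also have "\<dots> = (\<Sum>x\<in>UNIV. \<Sum>z\<in>UNIV. \<bar>dev A s x * (P s (s + 1) x z - \<delta>)\<bar>)" by (rule sum.swap)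
  also have "\<dots> \<le> (\<Sum>x\<in>UNIV. (1 - \<delta>) * \<bar>dev A s x\<bar>)"
  proof (intro sum_mono)
    fix x
    show "(\<Sum>z\<in>UNIV. \<bar>dev A s x * (P s (s + 1) x z - \<delta>)\<bar>) \<le> (1 - \<delta>) * \<bar>dev A s x\<bar>"
    proof (cases "prob (hit s x) > 0")
      case True
      have "(\<Sum>z\<in>UNIV. \<bar>dev A s x * (P s (s + 1) x z - \<delta>)\<bar>) = \<bar>dev A s x\<bar> * (\<Sum>z\<in>UNIV. P s (s + 1) x z - \<delta>)"
        using Pd[OF True] by (simp add: abs_mult sum_distrib_left)
      also have "(\<Sum>z\<in>UNIV. P s (s + 1) x z - \<delta>) = 1 - real CARD('s) * \<delta>"
        using P_stochastic(3)[OF s st True] by (simp add: sum_subtractf)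
      also have "\<bar>dev A s x\<bar> * (1 - real CARD('s) * \<delta>) \<le> \<bar>dev A s x\<bar> * (1 - \<delta>)"
      proof (rule mult_left_mono)
        have "1 * \<delta> \<le> real CARD('s) * \<delta>"
          using \<delta>(1) by (intro mult_right_mono) (auto simp: Suc_le_eq)
        then show "1 - real CARD('s) * \<delta> \<le> 1 - \<delta>" by simp
      qed simp
      finally show ?thesis by (simp add: mult.commute)
    qed (simp add: zero)
  qed
  finally show ?thesis by (simp add: sum_distrib_left)
qed

text \<open>Iterated contraction gives an additive error of at most
  \<open>(1 - \<delta>) ^ k * (2 * prob A)\<close>. It becomes multiplicative through
  \<open>\<delta> \<le> prob (hit t x)\<close>, which is the origin of the constant
  \<open>2 / \<delta>\<close> and of the condition \<open>1 \<le> t\<close>.\<close>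

theorem psi_mixing:
  obtains \<delta> Cm \<rho> where "0 < \<delta>" "0 \<le> Cm" "0 < \<rho>" "\<rho> < 1"
    "\<And>t x. 1 \<le> t \<Longrightarrow> \<delta> \<le> prob (hit t x)"
    "\<And>s t A x k. 0 \<le> s \<Longrightarrow> s + real k \<le> t \<Longrightarrow> 1 \<le> t \<Longrightarrow> A \<in> past s \<Longrightarrow>
      prob (A \<inter> hit t x) \<le> (1 + Cm * \<rho> ^ k) * prob A * prob (hit t x)"
proof -
  obtain \<delta> where \<delta>: "0 < \<delta>" "\<delta> \<le> 1 / 2"
    "\<And>s t A y. 0 \<le> s \<Longrightarrow> s + 1 \<le> t \<Longrightarrow> A \<in> past s \<Longrightarrow> \<delta> * prob A \<le> prob (A \<inter> hit t y)"
    by (rule doeblin) blast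
  have low: "\<delta> \<le> prob (hit t x)" if "1 \<le> t" for t x
    using \<delta>(3)[of 0 t "space M" x] that space_past[of 0] by (simp add: prob_space Int_absorb1)
  have dev: "(\<Sum>z\<in>UNIV. \<bar>dev A (s + real k) z\<bar>) \<le> (1 - \<delta>) ^ k * (2 * prob A)"
    if s: "0 \<le> s" and A: "A \<in> past s" for A s k
  proof (induct k)
    case 0
    have AM: "A \<in> sets M" by (rule past_sets[OF A])
    have "(\<Sum>z\<in>UNIV. \<bar>dev A s z\<bar>) \<le> (\<Sum>z\<in>UNIV. prob (A \<inter> hit s z) + prob A * prob (hit s z))"
      unfolding dev_def by (intro sum_mono) (auto intro!: abs_leI)
    also have "\<dots> = 2 * prob A"
      unfolding sum.distrib sum_distrib_left[symmetric]
      using prob_split[OF AM s] prob_split[OF sets.top s] by (simp add: prob_space Int_absorb1 Int_def)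
    finally show ?case by simp
  next
    case (Suc k)
    have "(\<Sum>z\<in>UNIV. \<bar>dev A (s + real k + 1) z\<bar>) \<le> (1 - \<delta>) * (\<Sum>z\<in>UNIV. \<bar>dev A (s + real k) z\<bar>)"
      using s by (intro dev_contraction[OF \<delta>] past_mono[OF _ A]) auto
    also have "\<dots> \<le> (1 - \<delta>) * ((1 - \<delta>) ^ k * (2 * prob A))"
      using \<delta> by (intro mult_left_mono Suc) auto
    finally show ?case by (simp add: ac_simps)
  qed
  show ?thesis
  proof (rule that[of \<delta> "2 / \<delta>" "1 - \<delta>"])
    show "0 < \<delta>" "0 \<le> 2 / \<delta>" "0 < 1 - \<delta>" "1 - \<delta> < 1" using \<delta> by auto
    fix s t A x and k :: nat
    assume s: "0 \<le> s" "s + real k \<le> t" and t: "1 \<le> t" and A: "A \<in> past s"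
    \<comment> \<open>The contraction runs over the last \<open>k\<close> time units before
      \<open>t\<close>, so \<open>t - s\<close> need not be an integer.\<close>
    let ?s = "t - real k"
    have "A \<in> past ?s" using s by (intro past_mono[OF _ A]) auto
    from dev[OF _ this, of k] s have d: "(\<Sum>z\<in>UNIV. \<bar>dev A t z\<bar>) \<le> (1 - \<delta>) ^ k * (2 * prob A)" by simp
    have "dev A t x \<le> \<bar>dev A t x\<bar>" by simp
    also have "\<dots> \<le> (\<Sum>z\<in>UNIV. \<bar>dev A t z\<bar>)" by (rule member_le_sum[of x UNIV "\<lambda>z. \<bar>dev A t z\<bar>"]) auto
    also note d
    also have "(1 - \<delta>) ^ k * (2 * prob A) \<le> (1 - \<delta>) ^ k * (2 * prob A) * (prob (hit t x) / \<delta>)"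
    proof -
      have "1 \<le> prob (hit t x) / \<delta>" using low[OF t, of x] \<delta> by simp
      from mult_left_mono[OF this, of "(1 - \<delta>) ^ k * (2 * prob A)"] \<delta> show ?thesis by simp
    qed
    finally have "prob (A \<inter> hit t x) - prob A * prob (hit t x) \<le> (1 - \<delta>) ^ k * (2 * prob A) * (prob (hit t x) / \<delta>)"
      by (simp add: dev_def)
    then show "prob (A \<inter> hit t x) \<le> (1 + 2 / \<delta> * (1 - \<delta>) ^ k) * prob A * prob (hit t x)"
      by (simp add: algebra_simps)
  qed (rule low)
qed

end

section \<open>Counts as limits of sums over cells of shrinking width\<close>

section \<open>Approximating counts along grids\<close>

text \<open>There are \<open>Suc n\<close> cells, so the right end is
  \<open>grid a b n (Suc n)\<close> and the division is never by zero.\<close>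

definition grid :: "real \<Rightarrow> real \<Rightarrow> nat \<Rightarrow> nat \<Rightarrow> real" where
  "grid a b n i = a + (b - a) * (real i / real (Suc n))"

lemma grid_simps [simp]: "grid a b n 0 = a" "grid a b n (Suc n) = b"
  by (simp_all add: grid_def del: of_nat_Suc)

lemma grid_width: "grid a b n (Suc i) - grid a b n i = (b - a) / real (Suc n)"
  by (simp add: grid_def field_simps del: of_nat_Suc) (simp add: algebra_simps)

lemma grid_mono: "a \<le> b \<Longrightarrow> i \<le> j \<Longrightarrow> grid a b n i \<le> grid a b n j"
  unfolding grid_def by (intro add_left_mono mult_left_mono divide_right_mono) auto

lemma grid_bounds: "a \<le> b \<Longrightarrow> i \<le> Suc n \<Longrightarrow> a \<le> grid a b n i \<and> grid a b n i \<le> b"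
  using grid_mono[of a b 0 i n] grid_mono[of a b i "Suc n" n] by simp

lemma grid_fine:
  assumes "0 < d"
  obtains n0 where "\<And>n i. n0 \<le> n \<Longrightarrow> grid a b n (Suc i) - grid a b n i < d"
proof -
  have "(\<lambda>n. (b - a) / real (Suc n)) \<longlonglongrightarrow> 0"
    by (intro LIMSEQ_Suc lim_const_over_n)
  then have "\<forall>\<^sub>F n in sequentially. (b - a) / real (Suc n) < d"
    using assms by (rule order_tendstoD)
  then obtain n0 where "\<And>n. n0 \<le> n \<Longrightarrow> (b - a) / real (Suc n) < d"
    by (auto simp: eventually_sequentially)
  then show ?thesis by (intro that[of n0]) (simp only: grid_width)
qed

text \<open>\<open>Z l s t\<close> is an approximation of the number of \<open>l\<close>-events in \<open>{s<..t}\<close> whose integrals can be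
  computed from the law at the two times \<open>s\<close> and \<open>t\<close>. On each path it is exact on sufficiently short cells.\<close>

locale grid_counting = prob_space M for M :: "'w measure" +
  fixes C :: "real \<Rightarrow> 'w \<Rightarrow> nat" and L :: "nat \<Rightarrow> 'w \<Rightarrow> 'l" and Z :: "'l \<Rightarrow> real \<Rightarrow> real \<Rightarrow> 'w \<Rightarrow> ennreal"
  assumes path: "\<And>w. w \<in> space M \<Longrightarrow> counting_path (\<lambda>t. C t w)"
    and Z_meas: "\<And>l s t. 0 \<le> s \<Longrightarrow> s \<le> t \<Longrightarrow> Z l s t \<in> borel_measurable M"
    and Z_le: "\<And>l s t w. w \<in> space M \<Longrightarrow> 0 \<le> s \<Longrightarrow> s \<le> t \<Longrightarrow> Z l s t w \<le> of_nat (C t w - C s w)"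
    and exact: "\<And>w b. w \<in> space M \<Longrightarrow> 0 \<le> b \<Longrightarrow> \<exists>d>0. \<forall>s t l. 0 \<le> s \<and> s \<le> t \<and> t \<le> b \<and> t - s < d \<longrightarrow>
      Z l s t w = of_nat (label_count (\<lambda>t. C t w) (\<lambda>k. L k w) l s t)"
    and C_meas: "\<And>t. 0 \<le> t \<Longrightarrow> C t \<in> measurable M (count_space UNIV)"
    and C_fin: "\<And>s t. 0 \<le> s \<Longrightarrow> s \<le> t \<Longrightarrow> (\<integral>\<^sup>+w. of_nat (C t w - C s w) \<partial>M) < \<infinity>"
begin

definition "cnt l s t w = (of_nat (label_count (\<lambda>t. C t w) (\<lambda>k. L k w) l s t) :: ennreal)"
definition "Zsum l a b n w = (\<Sum>i<Suc n. Z l (grid a b n i) (grid a b n (Suc i)) w)"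

lemma Zsum_le:
  assumes w: "w \<in> space M" and ab: "0 \<le> a" "a \<le> b"
  shows "Zsum l a b n w \<le> of_nat (C b w - C a w)"
proof -
  have "Zsum l a b n w \<le> (\<Sum>i<Suc n. of_nat (C (grid a b n (Suc i)) w - C (grid a b n i) w))"
    unfolding Zsum_def
  proof (intro sum_mono Z_le w)
    fix i assume "i \<in> {..<Suc n}"
    then show "0 \<le> grid a b n i" using grid_bounds[of a b i n] ab by auto
    show "grid a b n i \<le> grid a b n (Suc i)" using ab by (intro grid_mono) auto
  qed
  also have "\<dots> = of_nat (\<Sum>i<Suc n. C (grid a b n (Suc i)) w - C (grid a b n i) w)" by simp
  also have "(\<Sum>i<Suc n. C (grid a b n (Suc i)) w - C (grid a b n i) w) = C (grid a b n (Suc n)) w - C (grid a b n 0) w"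
  proof -
    have mono: "C (grid a b n i) w \<le> C (grid a b n (Suc i)) w" if "i \<le> n" for i
      using grid_bounds[of a b i n] grid_mono[of a b i "Suc i" n] that ab
      by (intro counting_path_mono[OF path[OF w]]) auto
    have "m \<le> Suc n \<Longrightarrow> (\<Sum>i<m. C (grid a b n (Suc i)) w - C (grid a b n i) w) = C (grid a b n m) w - C (grid a b n 0) w
        \<and> C (grid a b n 0) w \<le> C (grid a b n m) w" for m
    proof (induct m)
      case (Suc m)
      then show ?case using mono[of m] by auto
    qed simp
    from this[of "Suc n"] show ?thesis by blast
  qed
  finally show ?thesis by simp
qed

lemma Zsum_eq:
  assumes w: "w \<in> space M" and ab: "0 \<le> a" "a \<le> b"
  shows "\<forall>\<^sub>F n in sequentially. Zsum l a b n w = cnt l a b w"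
proof -
  have b: "0 \<le> b" using ab by simp
  from exact[OF w b] obtain d where d: "0 < d" "\<And>s t l. 0 \<le> s \<Longrightarrow> s \<le> t \<Longrightarrow> t \<le> b \<Longrightarrow> t - s < d \<Longrightarrow>
      Z l s t w = of_nat (label_count (\<lambda>t. C t w) (\<lambda>k. L k w) l s t)" by blast
  obtain n0 where n0: "\<And>n i. n0 \<le> n \<Longrightarrow> grid a b n (Suc i) - grid a b n i < d"
    using grid_fine[OF d(1)] by metis
  show ?thesis
  proof (intro eventually_sequentiallyI)
    fix n assume n: "n0 \<le> n"
    have "Zsum l a b n w = (\<Sum>i<Suc n. of_nat (label_count (\<lambda>t. C t w) (\<lambda>k. L k w) l (grid a b n i) (grid a b n (Suc i))))"
      unfolding Zsum_def
    proof (intro sum.cong refl d(2) n0 n)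
      fix i assume "i \<in> {..<Suc n}"
      then show "0 \<le> grid a b n i" "grid a b n (Suc i) \<le> b"
        using grid_bounds[of a b i n] grid_bounds[of a b "Suc i" n] ab by auto
      show "grid a b n i \<le> grid a b n (Suc i)" using ab by (intro grid_mono) auto
    qed
    also have "\<dots> = of_nat (\<Sum>i<Suc n. label_count (\<lambda>t. C t w) (\<lambda>k. L k w) l (grid a b n i) (grid a b n (Suc i)))"
      by simp
    also have "(\<Sum>i<Suc n. label_count (\<lambda>t. C t w) (\<lambda>k. L k w) l (grid a b n i) (grid a b n (Suc i)))
        = label_count (\<lambda>t. C t w) (\<lambda>k. L k w) l (grid a b n 0) (grid a b n (Suc n))"
      using ab by (intro sum_label_count_cells path w grid_mono) auto
    finally show "Zsum l a b n w = cnt l a b w" by (simp add: cnt_def)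
  qed
qed

lemma Zsum_lim:
  assumes "w \<in> space M" "0 \<le> a" "a \<le> b"
  shows "(\<lambda>n. Zsum l a b n w) \<longlonglongrightarrow> cnt l a b w"
  using Zsum_eq[OF assms] by (rule tendsto_eventually)

lemma Z_grid_meas:
  assumes "0 \<le> a" "a \<le> b" "i < Suc n"
  shows "Z l (grid a b n i) (grid a b n (Suc i)) \<in> borel_measurable M"
  using grid_bounds[of a b i n] grid_mono[of a b i "Suc i" n] assms by (intro Z_meas) auto

lemma Zsum_meas: "0 \<le> a \<Longrightarrow> a \<le> b \<Longrightarrow> Zsum l a b n \<in> borel_measurable M"
  unfolding Zsum_def by (intro borel_measurable_sum Z_grid_meas) auto

lemma cnt_meas: "0 \<le> a \<Longrightarrow> a \<le> b \<Longrightarrow> cnt l a b \<in> borel_measurable M"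
  by (rule borel_measurable_LIMSEQ_order[OF Zsum_lim Zsum_meas])

lemma nn_integral_Zsum:
  assumes "0 \<le> a" "a \<le> b"
  shows "(\<integral>\<^sup>+w. Zsum l a b n w \<partial>M) = (\<Sum>i<Suc n. \<integral>\<^sup>+w. Z l (grid a b n i) (grid a b n (Suc i)) w \<partial>M)"
  unfolding Zsum_def using assms by (intro nn_integral_sum Z_grid_meas) auto

lemma nn_integral_Zsum_lim:
  assumes ab: "0 \<le> a" "a \<le> b"
  shows "(\<lambda>n. \<integral>\<^sup>+w. Zsum l a b n w \<partial>M) \<longlonglongrightarrow> (\<integral>\<^sup>+w. cnt l a b w \<partial>M)"
proof (rule nn_integral_dominated_convergence[where w="\<lambda>w. of_nat (C b w - C a w)"])
  have [measurable]: "C b \<in> measurable M (count_space UNIV)" "C a \<in> measurable M (count_space UNIV)"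
    using ab by (auto intro: C_meas)
  show "(\<lambda>w. of_nat (C b w - C a w) :: ennreal) \<in> borel_measurable M" by measurable
  show "Zsum l a b n \<in> borel_measurable M" for n by (rule Zsum_meas[OF ab])
  show "AE w in M. Zsum l a b n w \<le> of_nat (C b w - C a w)" for n by (intro AE_I2 Zsum_le ab)
  show "AE w in M. (\<lambda>n. Zsum l a b n w) \<longlonglongrightarrow> cnt l a b w" by (intro AE_I2 Zsum_lim ab)
qed (use cnt_meas[OF ab] C_fin[OF ab] in auto)

text \<open>Only first moments of counts are assumed finite, so the products on the left pass to the
  limit by Fatou, which is enough for an upper bound. On the right the means converge by domination.
  The estimate for pairs of cells is bilinear and sums up with the same
  \<open>\<kappa>\<close>.\<close>

theorem cnt_mixing:
  assumes ab: "0 \<le> a" "a \<le> b" "0 \<le> a'" "a' \<le> b'"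
    and \<kappa>: "\<kappa> < \<infinity>"
    and mix: "\<And>s t s' t'. a \<le> s \<Longrightarrow> s \<le> t \<Longrightarrow> t \<le> b \<Longrightarrow> a' \<le> s' \<Longrightarrow> s' \<le> t' \<Longrightarrow> t' \<le> b' \<Longrightarrow>
      (\<integral>\<^sup>+w. Z l s t w * Z l' s' t' w \<partial>M) \<le> \<kappa> * (\<integral>\<^sup>+w. Z l s t w \<partial>M) * (\<integral>\<^sup>+w. Z l' s' t' w \<partial>M)"
  shows "(\<integral>\<^sup>+w. cnt l a b w * cnt l' a' b' w \<partial>M) \<le> \<kappa> * (\<integral>\<^sup>+w. cnt l a b w \<partial>M) * (\<integral>\<^sup>+w. cnt l' a' b' w \<partial>M)"
proof -
  note [measurable] = Zsum_meas[OF ab(1,2)] Zsum_meas[OF ab(3,4)]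
  have fin: "(\<integral>\<^sup>+w. cnt l a b w \<partial>M) \<noteq> \<infinity>" if "0 \<le> a" "a \<le> b" for l a b
  proof -
    have "(\<integral>\<^sup>+w. cnt l a b w \<partial>M) \<le> (\<integral>\<^sup>+w. of_nat (C b w - C a w) \<partial>M)"
    proof (rule nn_integral_mono)
      fix w
      show "cnt l a b w \<le> of_nat (C b w - C a w)"
        unfolding cnt_def using label_count_le[of "\<lambda>t. C t w" "\<lambda>k. L k w" l a b] by simp
    qed
    then show ?thesis using C_fin[OF that] by auto
  qed
  have "(\<integral>\<^sup>+w. cnt l a b w * cnt l' a' b' w \<partial>M)
      = (\<integral>\<^sup>+w. liminf (\<lambda>n. Zsum l a b n w * Zsum l' a' b' n w) \<partial>M)"
  proof (intro nn_integral_cong)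
    fix w assume w: "w \<in> space M"
    have "\<forall>\<^sub>F n in sequentially. Zsum l a b n w * Zsum l' a' b' n w = cnt l a b w * cnt l' a' b' w"
      using Zsum_eq[OF w ab(1,2), of l] Zsum_eq[OF w ab(3,4), of l'] by eventually_elim simp
    then have "(\<lambda>n. Zsum l a b n w * Zsum l' a' b' n w) \<longlonglongrightarrow> cnt l a b w * cnt l' a' b' w"
      by (rule tendsto_eventually)
    then show "cnt l a b w * cnt l' a' b' w = liminf (\<lambda>n. Zsum l a b n w * Zsum l' a' b' n w)"
      using lim_imp_Liminf[OF sequentially_bot] by metis
  qed
  also have "\<dots> \<le> liminf (\<lambda>n. \<integral>\<^sup>+w. Zsum l a b n w * Zsum l' a' b' n w \<partial>M)"
    by (intro nn_integral_liminf) measurable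
  also have "\<dots> \<le> liminf (\<lambda>n. \<kappa> * (\<integral>\<^sup>+w. Zsum l a b n w \<partial>M) * (\<integral>\<^sup>+w. Zsum l' a' b' n w \<partial>M))"
  proof (intro Liminf_mono always_eventually allI)
    fix n
    let ?Z = "\<lambda>i. Z l (grid a b n i) (grid a b n (Suc i))" and ?Z' = "\<lambda>i. Z l' (grid a' b' n i) (grid a' b' n (Suc i))"
    have [measurable]: "?Z i \<in> borel_measurable M" "?Z' i \<in> borel_measurable M" if "i \<in> {..<Suc n}" for i
      using that ab Z_grid_meas by auto
    have "(\<integral>\<^sup>+w. Zsum l a b n w * Zsum l' a' b' n w \<partial>M) = (\<integral>\<^sup>+w. (\<Sum>i<Suc n. \<Sum>j<Suc n. ?Z i w * ?Z' j w) \<partial>M)"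
      unfolding Zsum_def sum_product ..
    also have "\<dots> = (\<Sum>i<Suc n. \<integral>\<^sup>+w. (\<Sum>j<Suc n. ?Z i w * ?Z' j w) \<partial>M)"
      by (rule nn_integral_sum) measurable
    also have "\<dots> = (\<Sum>i<Suc n. \<Sum>j<Suc n. \<integral>\<^sup>+w. ?Z i w * ?Z' j w \<partial>M)"
      by (intro sum.cong refl nn_integral_sum) measurable
    also have "\<dots> \<le> (\<Sum>i<Suc n. \<Sum>j<Suc n. \<kappa> * (\<integral>\<^sup>+w. ?Z i w \<partial>M) * (\<integral>\<^sup>+w. ?Z' j w \<partial>M))"
    proof (intro sum_mono mix)
      fix i j assume "i \<in> {..<Suc n}" "j \<in> {..<Suc n}"
      then show "a \<le> grid a b n i" "grid a b n (Suc i) \<le> b" "a' \<le> grid a' b' n j" "grid a' b' n (Suc j) \<le> b'"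
        using grid_bounds[of a b i n] grid_bounds[of a b "Suc i" n] grid_bounds[of a' b' j n]
          grid_bounds[of a' b' "Suc j" n] ab by auto
      show "grid a b n i \<le> grid a b n (Suc i)" "grid a' b' n j \<le> grid a' b' n (Suc j)"
        using ab by (auto intro: grid_mono)
    qed
    also have "\<dots> = \<kappa> * (\<integral>\<^sup>+w. Zsum l a b n w \<partial>M) * (\<integral>\<^sup>+w. Zsum l' a' b' n w \<partial>M)"
      unfolding nn_integral_Zsum[OF ab(1,2)] nn_integral_Zsum[OF ab(3,4)]
      by (simp only: sum_distrib_left[where r=\<kappa>] sum_product)
    finally show "(\<integral>\<^sup>+w. Zsum l a b n w * Zsum l' a' b' n w \<partial>M)
      \<le> \<kappa> * (\<integral>\<^sup>+w. Zsum l a b n w \<partial>M) * (\<integral>\<^sup>+w. Zsum l' a' b' n w \<partial>M)" .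
  qed
  also have "\<dots> = \<kappa> * (\<integral>\<^sup>+w. cnt l a b w \<partial>M) * (\<integral>\<^sup>+w. cnt l' a' b' w \<partial>M)"
  proof (intro lim_imp_Liminf sequentially_bot)
    have "(\<lambda>n. \<kappa> * (\<integral>\<^sup>+w. Zsum l a b n w \<partial>M)) \<longlonglongrightarrow> \<kappa> * (\<integral>\<^sup>+w. cnt l a b w \<partial>M)"
      using \<kappa> by (intro ennreal_tendsto_cmult nn_integral_Zsum_lim ab) auto
    then show "(\<lambda>n. \<kappa> * (\<integral>\<^sup>+w. Zsum l a b n w \<partial>M) * (\<integral>\<^sup>+w. Zsum l' a' b' n w \<partial>M))
        \<longlonglongrightarrow> \<kappa> * (\<integral>\<^sup>+w. cnt l a b w \<partial>M) * (\<integral>\<^sup>+w. cnt l' a' b' w \<partial>M)"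
    proof (rule tendsto_mult_ennreal)
      show "(\<lambda>n. \<integral>\<^sup>+w. Zsum l' a' b' n w \<partial>M) \<longlonglongrightarrow> (\<integral>\<^sup>+w. cnt l' a' b' w \<partial>M)"
        by (rule nn_integral_Zsum_lim[OF ab(3,4)])
    qed (use \<kappa> fin[OF ab(1,2)] fin[OF ab(3,4)] in \<open>auto simp: ennreal_mult_eq_top_iff\<close>)
  qed
  finally show ?thesis .
qed

text \<open>\<open>\<Phi>\<close> is an additive interval function, in the applications an integral
  of a rate. Over cells of width \<open>h\<close> the quadratic errors sum to
  \<open>K' * (b - a) * h\<close>, and \<open>1 - K * h\<close> tends to one, so in the limit only
  \<open>k * \<Phi> a b\<close> remains.\<close>

lemma cnt_ge:
  fixes \<Phi> :: "real \<Rightarrow> real \<Rightarrow> real"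
  assumes ab: "0 \<le> a" "a \<le> b"
    and ge: "\<And>s t. a \<le> s \<Longrightarrow> s \<le> t \<Longrightarrow> t \<le> b \<Longrightarrow>
      ennreal (k * (1 - K * (t - s)) * \<Phi> s t - K' * (t - s)\<^sup>2) \<le> (\<integral>\<^sup>+w. Z l s t w \<partial>M)"
    and add: "\<And>s t u. a \<le> s \<Longrightarrow> s \<le> t \<Longrightarrow> t \<le> u \<Longrightarrow> u \<le> b \<Longrightarrow> \<Phi> s u = \<Phi> s t + \<Phi> t u"
  shows "ennreal (k * \<Phi> a b) \<le> (\<integral>\<^sup>+w. cnt l a b w \<partial>M)"
proof (rule LIMSEQ_le)
  let ?h = "\<lambda>n. (b - a) / real (Suc n)"
  have h0: "?h \<longlonglongrightarrow> 0" by (intro LIMSEQ_Suc lim_const_over_n)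
  have "(\<lambda>n. k * (1 - K * ?h n) * \<Phi> a b - K' * ((b - a) * ?h n)) \<longlonglongrightarrow> k * (1 - K * 0) * \<Phi> a b - K' * ((b - a) * 0)"
    by (intro tendsto_intros h0)
  then show "(\<lambda>n. ennreal (k * (1 - K * ?h n) * \<Phi> a b - K' * ((b - a) * ?h n))) \<longlonglongrightarrow> ennreal (k * \<Phi> a b)"
    by (intro tendsto_ennrealI) simp
  show "(\<lambda>n. \<integral>\<^sup>+w. Zsum l a b n w \<partial>M) \<longlonglongrightarrow> (\<integral>\<^sup>+w. cnt l a b w \<partial>M)"
    by (rule nn_integral_Zsum_lim[OF ab])
  have "ennreal (k * (1 - K * ?h n) * \<Phi> a b - K' * ((b - a) * ?h n)) \<le> (\<integral>\<^sup>+w. Zsum l a b n w \<partial>M)" for n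
  proof -
    let ?x = "\<lambda>i. k * (1 - K * ?h n) * \<Phi> (grid a b n i) (grid a b n (Suc i)) - K' * (?h n)\<^sup>2"
    have tele: "m \<le> Suc n \<Longrightarrow> (\<Sum>i<m. \<Phi> (grid a b n i) (grid a b n (Suc i))) = \<Phi> a (grid a b n m)" for m
    proof (induct m)
      case 0
      show ?case using add[of a a a] ab by simp
    next
      case (Suc m)
      then have "a \<le> grid a b n m" "grid a b n m \<le> grid a b n (Suc m)" "grid a b n (Suc m) \<le> b"
        using grid_bounds[of a b m n] grid_bounds[of a b "Suc m" n] grid_mono[of a b m "Suc m" n] ab by auto
      from add[OF order.refl this] Suc show ?case by simp
    qed
    have "(\<Sum>i<Suc n. ?x i) = k * (1 - K * ?h n) * \<Phi> a b - real (Suc n) * (K' * (?h n)\<^sup>2)"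
      unfolding sum_subtractf sum_distrib_left[symmetric] tele[OF order.refl] by simp
    also have "real (Suc n) * (K' * (?h n)\<^sup>2) = K' * ((b - a) * ?h n)"
      by (simp add: power2_eq_square del: of_nat_Suc)
    finally have sum: "(\<Sum>i<Suc n. ?x i) = k * (1 - K * ?h n) * \<Phi> a b - K' * ((b - a) * ?h n)" .
    \<comment> \<open>Single terms may be negative and are sent to zero by \<open>ennreal\<close>,
      so the sum is taken apart only after passing to positive parts.\<close>
    have "ennreal (\<Sum>i<Suc n. ?x i) \<le> ennreal (\<Sum>i<Suc n. max 0 (?x i))"
      by (intro ennreal_leI sum_mono) simp
    also have "\<dots> = (\<Sum>i<Suc n. ennreal (max 0 (?x i)))" by (rule sum_ennreal[symmetric]) simp
    also have "\<dots> = (\<Sum>i<Suc n. ennreal (?x i))"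
      by (intro sum.cong refl) (simp add: max_def ennreal_neg)
    also have "\<dots> \<le> (\<Sum>i<Suc n. \<integral>\<^sup>+w. Z l (grid a b n i) (grid a b n (Suc i)) w \<partial>M)"
    proof (rule sum_mono)
      fix i assume "i \<in> {..<Suc n}"
      then have "a \<le> grid a b n i" "grid a b n i \<le> grid a b n (Suc i)" "grid a b n (Suc i) \<le> b"
        using grid_bounds[of a b i n] grid_bounds[of a b "Suc i" n] grid_mono[of a b i "Suc i" n] ab by auto
      from ge[OF this] show "ennreal (?x i) \<le> (\<integral>\<^sup>+w. Z l (grid a b n i) (grid a b n (Suc i)) w \<partial>M)"
        by (simp only: grid_width)
    qed
    also have "\<dots> = (\<integral>\<^sup>+w. Zsum l a b n w \<partial>M)" by (rule nn_integral_Zsum[OF ab, symmetric])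
    finally show ?thesis unfolding sum .
  qed
  then show "\<exists>N. \<forall>n\<ge>N. ennreal (k * (1 - K * ?h n) * \<Phi> a b - K' * ((b - a) * ?h n)) \<le> (\<integral>\<^sup>+w. Zsum l a b n w \<partial>M)"
    by blast
qed

end

section \<open>Measurability of path functionals\<close>

text \<open>The indicator of a state along a right-continuous step path is right-continuous, which
  gives joint measurability. The \<open>max 0\<close> extends the process constantly to negative
  times, where nothing is known about it.\<close>

lemma measurable_process_pair:
  fixes X :: "real \<Rightarrow> 'w \<Rightarrow> 's"
  assumes meas: "\<And>t. 0 \<le> t \<Longrightarrow> X t \<in> measurable F (count_space UNIV)"
    and path: "\<And>w. w \<in> space F \<Longrightarrow> right_continuous_path (\<lambda>t. X t w)"
  shows "Measurable.pred (F \<Otimes>\<^sub>M borel) (\<lambda>(w, t). X (max 0 t) w = x)"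
proof -
  have "(\<lambda>(w, t). of_bool (X (max 0 t) w = x) :: real) \<in> borel_measurable (F \<Otimes>\<^sub>M borel)"
  proof (rule measurable_right_continuous_pair)
    fix t
    have [measurable]: "Measurable.pred F (\<lambda>w. X (max 0 t) w = x)"
      by (rule measurable_count_space_pred[OF meas]) simp
    show "(\<lambda>w. of_bool (X (max 0 t) w = x) :: real) \<in> borel_measurable F"
      unfolding of_bool_def by measurable
  next
    fix w and t :: real assume w: "w \<in> space F"
    have "\<forall>\<^sub>F u in at_right t. X (max 0 u) w = X (max 0 t) w"
    proof (cases "0 \<le> t")
      case True
      have "\<forall>\<^sub>F u in at_right t. X u w = X t w" using path[OF w] True by (simp add: right_continuous_path_def)
      moreover have "\<forall>\<^sub>F u in at_right t. t < u" by (simp add: eventually_at_right_less)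
      ultimately show ?thesis
        by eventually_elim (use True in \<open>simp add: max_def\<close>)
    next
      case False
      have "\<forall>\<^sub>F u in at_right t. u < 0" using False by (intro eventually_at_right_field[THEN iffD2] exI[of _ 0]) auto
      then show ?thesis by eventually_elim (use False in \<open>simp add: max_def\<close>)
    qed
    then have "\<forall>\<^sub>F u in at_right t. (of_bool (X (max 0 u) w = x) :: real) = of_bool (X (max 0 t) w = x)"
      by eventually_elim simp
    then show "((\<lambda>u. of_bool (X (max 0 u) w = x) :: real) \<longlongrightarrow> of_bool (X (max 0 t) w = x)) (at_right t)"
      by (rule tendsto_eventually)
  qed
  then have [measurable]: "(\<lambda>p. of_bool (X (max 0 (snd p)) (fst p) = x) :: real) \<in> borel_measurable (F \<Otimes>\<^sub>M borel)"
    by (simp add: case_prod_beta')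
  have "Measurable.pred (F \<Otimes>\<^sub>M borel) (\<lambda>p. (of_bool (X (max 0 (snd p)) (fst p) = x) :: real) = 1)"
    by measurable
  then show ?thesis by (simp add: case_prod_beta')
qed

lemma measurable_process_at:
  fixes X :: "real \<Rightarrow> 'w \<Rightarrow> 's::finite"
  assumes meas: "\<And>t. 0 \<le> t \<Longrightarrow> X t \<in> measurable F (count_space UNIV)"
    and path: "\<And>w. w \<in> space F \<Longrightarrow> right_continuous_path (\<lambda>t. X t w)"
    and T [measurable]: "T \<in> borel_measurable F"
  shows "(\<lambda>w. X (max 0 (T w)) w) \<in> measurable F (count_space UNIV)"
proof (subst measurable_count_space_eq2)
  have "{w \<in> space F. X (max 0 (T w)) w = x} \<in> sets F" for x
  proof -
    have "Measurable.pred F (\<lambda>w. (\<lambda>(w, t). X (max 0 t) w = x) (w, T w))"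
      by (rule measurable_compose[OF _ measurable_process_pair[OF meas path]]) measurable
    then show ?thesis by (simp add: pred_def)
  qed
  moreover have "(\<lambda>w. X (max 0 (T w)) w) -` {x} \<inter> space F = {w \<in> space F. X (max 0 (T w)) w = x}" for x by auto
  ultimately show "(\<lambda>w. X (max 0 (T w)) w) \<in> space F \<rightarrow> UNIV \<and>
      (\<forall>x\<in>UNIV. (\<lambda>w. X (max 0 (T w)) w) -` {x} \<inter> space F \<in> sets F)" by auto
qed simp

lemma measurable_process_integrand:
  fixes X :: "real \<Rightarrow> 'w \<Rightarrow> 's::finite" and f :: "real \<Rightarrow> 's \<Rightarrow> real"
  assumes meas: "\<And>t. 0 \<le> t \<Longrightarrow> X t \<in> measurable F (count_space UNIV)"
    and path: "\<And>w. w \<in> space F \<Longrightarrow> right_continuous_path (\<lambda>t. X t w)"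
    and f: "\<And>x. measurable_in_time (\<lambda>t. f t x)"
  shows "(\<lambda>(w, t). f (max 0 t) (X (max 0 t) w)) \<in> borel_measurable (F \<Otimes>\<^sub>M borel)"
proof -
  have [measurable]: "(\<lambda>t. f (max 0 t) x) \<in> borel_measurable borel" for x
    by (rule measurable_compose[OF _ f]) (auto intro!: measurable_restrict_space2)
  note [measurable] = measurable_process_pair[OF meas path]
  have "(\<lambda>(w, t). \<Sum>x\<in>UNIV. (if X (max 0 t) w = x then f (max 0 t) x else 0)) \<in> borel_measurable (F \<Otimes>\<^sub>M borel)"
    unfolding case_prod_beta'
  proof (rule borel_measurable_sum)
    fix x
    have [measurable]: "Measurable.pred (F \<Otimes>\<^sub>M borel) (\<lambda>p. X (max 0 (snd p)) (fst p) = x)"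
      using measurable_process_pair[OF meas path, of x] by (simp add: case_prod_beta')
    show "(\<lambda>p. if X (max 0 (snd p)) (fst p) = x then f (max 0 (snd p)) x else 0) \<in> borel_measurable (F \<Otimes>\<^sub>M borel)"
      by measurable
  qed
  moreover have "(\<Sum>x\<in>UNIV. (if X (max 0 t) w = x then f (max 0 t) x else 0)) = f (max 0 t) (X (max 0 t) w)" for w t
    by simp
  ultimately show ?thesis by simp
qed

lemma num_jumps_grid:
  assumes p: "jump_path p" and ab: "0 \<le> a" "a \<le> b"
  shows "\<forall>\<^sub>F n in sequentially. num_jumps p b - num_jumps p a
      = (\<Sum>i<Suc n. of_bool (p (grid a b n i) \<noteq> p (grid a b n (Suc i))))"
proof -
  have b: "0 \<le> b" using ab by simp
  note C = counting_path_num_jumps[OF p]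
  obtain d where d: "0 < d" and "\<And>s t l. 0 \<le> s \<Longrightarrow> s \<le> t \<Longrightarrow> t \<le> b \<Longrightarrow> t - s < d \<Longrightarrow>
      label_count (num_jumps p) (jump_label p) l s t = of_bool (p s \<noteq> p t \<and> l = (p s, p t)) \<and>
      num_jumps p t - num_jumps p s = of_bool (p s \<noteq> p t)"
    by (rule label_count_short_cells_jumps[OF p b]) blast
  then have cell: "0 \<le> s \<Longrightarrow> s \<le> t \<Longrightarrow> t \<le> b \<Longrightarrow> t - s < d \<Longrightarrow>
      num_jumps p t - num_jumps p s = of_bool (p s \<noteq> p t)" for s t by blast
  obtain n0 where n0: "\<And>n i. n0 \<le> n \<Longrightarrow> grid a b n (Suc i) - grid a b n i < d"
    using grid_fine[OF d] by metis
  show ?thesis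
  proof (intro eventually_sequentiallyI)
    fix n assume n: "n0 \<le> n"
    have "m \<le> Suc n \<Longrightarrow> num_jumps p (grid a b n m) = num_jumps p a
        + (\<Sum>i<m. of_bool (p (grid a b n i) \<noteq> p (grid a b n (Suc i))))" for m
    proof (induct m)
      case (Suc m)
      have s: "0 \<le> grid a b n m" "grid a b n m \<le> grid a b n (Suc m)" "grid a b n (Suc m) \<le> b"
        using grid_bounds[of a b m n] grid_bounds[of a b "Suc m" n] grid_mono[of a b m "Suc m" n] ab Suc(2) by auto
      have "num_jumps p (grid a b n (Suc m)) - num_jumps p (grid a b n m)
          = of_bool (p (grid a b n m) \<noteq> p (grid a b n (Suc m)))"
        by (rule cell[OF s n0[OF n]])
      moreover have "num_jumps p (grid a b n m) \<le> num_jumps p (grid a b n (Suc m))"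
        by (rule counting_path_mono[OF C s(1,2)])
      ultimately show ?case using Suc by simp
    qed simp
    from this[of "Suc n"] show "num_jumps p b - num_jumps p a
      = (\<Sum>i<Suc n. of_bool (p (grid a b n i) \<noteq> p (grid a b n (Suc i))))" by simp
  qed
qed

lemma pred_neq_process:
  fixes f g :: "'w \<Rightarrow> 's::finite"
  assumes f: "f \<in> measurable F (count_space UNIV)" and g: "g \<in> measurable F (count_space UNIV)"
  shows "Measurable.pred F (\<lambda>w. f w \<noteq> g w)"
proof -
  have "Measurable.pred F (\<lambda>w. \<exists>x. f w = x \<and> g w \<noteq> x)"
  proof (intro pred_intros_countable)
    fix x
    have [measurable]: "Measurable.pred F (\<lambda>w. f w = x)" "Measurable.pred F (\<lambda>w. g w \<noteq> x)"
      using f g by (auto intro: measurable_count_space_pred)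
    show "Measurable.pred F (\<lambda>w. f w = x \<and> g w \<noteq> x)" by measurable
  qed
  then show ?thesis by (simp add: eq_commute)
qed

text \<open>On every path the number of jumps is eventually the number of changes seen along a grid,
  and each grid involves finitely many of the coordinates \<open>X t\<close>. Hence it is measurable
  with respect to any sigma-algebra that contains the information on \<open>X\<close>.\<close>

lemma measurable_num_jumps:
  fixes X :: "real \<Rightarrow> 'w \<Rightarrow> 's::finite"
  assumes meas: "\<And>t. 0 \<le> t \<Longrightarrow> X t \<in> measurable F (count_space UNIV)"
    and path: "\<And>w. w \<in> space F \<Longrightarrow> jump_path (\<lambda>t. X t w)" and t: "0 \<le> t"
  shows "(\<lambda>w. num_jumps (\<lambda>t. X t w) t) \<in> measurable F (count_space UNIV)"
proof -
  let ?u = "\<lambda>n w. (\<Sum>i<Suc n. of_bool (X (grid 0 t n i) w \<noteq> X (grid 0 t n (Suc i)) w)) :: nat"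
  have "(\<lambda>w. real (num_jumps (\<lambda>t. X t w) t)) \<in> borel_measurable F"
  proof (rule borel_measurable_LIMSEQ_real)
    fix w assume w: "w \<in> space F"
    have z: "num_jumps (\<lambda>t. X t w) 0 = 0"
      using counting_path_num_jumps[OF path[OF w]] by (simp add: counting_path_def)
    have "\<forall>\<^sub>F n in sequentially. real (?u n w) = real (num_jumps (\<lambda>t. X t w) t)"
      using num_jumps_grid[OF path[OF w] order.refl t] unfolding z by eventually_elim simp
    then show "(\<lambda>n. real (?u n w)) \<longlonglongrightarrow> real (num_jumps (\<lambda>t. X t w) t)" by (rule tendsto_eventually)
  next
    fix n
    have [measurable]: "Measurable.pred F (\<lambda>w. X (grid 0 t n i) w \<noteq> X (grid 0 t n (Suc i)) w)" if "i \<in> {..<Suc n}" for i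
      using grid_bounds[of 0 t i n] grid_bounds[of 0 t "Suc i" n] t that by (intro pred_neq_process meas) auto
    have "(\<lambda>w. \<Sum>i<Suc n. (if X (grid 0 t n i) w \<noteq> X (grid 0 t n (Suc i)) w then 1 else 0) :: real) \<in> borel_measurable F"
      by (rule borel_measurable_sum) measurable
    then show "(\<lambda>w. real (?u n w)) \<in> borel_measurable F"
      by (simp only: of_nat_sum of_bool_def of_nat_1 of_nat_0 if_distrib)
  qed
  then have "Measurable.pred F (\<lambda>w. real (num_jumps (\<lambda>t. X t w) t) = real k)" for k by measurable
  then show ?thesis
    by (subst measurable_count_space_eq_countable) (auto simp: pred_def vimage_def Int_def conj_commute)
qed

section \<open>Integrals of separated functionals\<close>

text \<open>By Fubini both sides are double integrals over pairs of times, and the hypothesis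
  compares the integrands. It is used for the running reward and, with the integrated intensity, for
  the Poisson events.\<close>

lemma (in prob_space) nn_integral_integral_mixing:
  fixes h h' :: "'a \<Rightarrow> real \<Rightarrow> ennreal"
  assumes h: "(\<lambda>(w, u). h w u) \<in> borel_measurable (M \<Otimes>\<^sub>M borel)"
    and h': "(\<lambda>(w, u). h' w u) \<in> borel_measurable (M \<Otimes>\<^sub>M borel)"
    and S: "S \<in> sets borel" "S' \<in> sets borel"
    and mix: "\<And>u u'. u \<in> S \<Longrightarrow> u' \<in> S' \<Longrightarrow>
      (\<integral>\<^sup>+w. h w u * h' w u' \<partial>M) \<le> \<kappa> * (\<integral>\<^sup>+w. h w u \<partial>M) * (\<integral>\<^sup>+w. h' w u' \<partial>M)"
  shows "(\<integral>\<^sup>+w. (\<integral>\<^sup>+u\<in>S. h w u \<partial>lborel) * (\<integral>\<^sup>+u\<in>S'. h' w u \<partial>lborel) \<partial>M)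
    \<le> \<kappa> * (\<integral>\<^sup>+w. (\<integral>\<^sup>+u\<in>S. h w u \<partial>lborel) \<partial>M) * (\<integral>\<^sup>+w. (\<integral>\<^sup>+u\<in>S'. h' w u \<partial>lborel) \<partial>M)"
proof -
  interpret P: pair_sigma_finite M lborel ..
  note [measurable] = h h' S
  have [measurable]: "(\<lambda>(w, u). h w u) \<in> borel_measurable (M \<Otimes>\<^sub>M lborel)"
    "(\<lambda>(w, u). h' w u) \<in> borel_measurable (M \<Otimes>\<^sub>M lborel)" using h h' by simp_all
  have h1: "(\<lambda>u. h w u) \<in> borel_measurable lborel" "(\<lambda>u. h' w u) \<in> borel_measurable lborel" if "w \<in> space M" for w
    using measurable_Pair2[OF h that] measurable_Pair2[OF h' that] by simp_all
  have h2 [measurable]: "(\<lambda>w. h w u) \<in> borel_measurable M" "(\<lambda>w. h' w u) \<in> borel_measurable M" for u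
    using measurable_Pair1[OF h, of u] measurable_Pair1[OF h', of u] by simp_all
  let ?H' = "\<lambda>w. \<integral>\<^sup>+u\<in>S'. h' w u \<partial>lborel"
  have [measurable]: "?H' \<in> borel_measurable M" by measurable
  have [measurable]: "(\<lambda>u. \<integral>\<^sup>+w. h w u \<partial>M) \<in> borel_measurable lborel" "(\<lambda>u. \<integral>\<^sup>+w. h' w u \<partial>M) \<in> borel_measurable lborel"
    by measurable
  have int': "(\<integral>\<^sup>+w. h w u * ?H' w \<partial>M) = (\<integral>\<^sup>+u'\<in>S'. (\<integral>\<^sup>+w. h w u * h' w u' \<partial>M) \<partial>lborel)" for u
  proof -
    have "(\<integral>\<^sup>+w. h w u * ?H' w \<partial>M) = (\<integral>\<^sup>+w. (\<integral>\<^sup>+u'. h w u * h' w u' * indicator S' u' \<partial>lborel) \<partial>M)"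
      using h1 by (intro nn_integral_cong) (simp add: nn_integral_cmult mult.assoc)
    also have "\<dots> = (\<integral>\<^sup>+u'. (\<integral>\<^sup>+w. h w u * h' w u' * indicator S' u' \<partial>M) \<partial>lborel)"
      by (intro P.Fubini'[symmetric]) measurable
    finally show ?thesis by (simp add: nn_integral_multc)
  qed
  have "(\<integral>\<^sup>+w. (\<integral>\<^sup>+u\<in>S. h w u \<partial>lborel) * ?H' w \<partial>M)
      = (\<integral>\<^sup>+w. (\<integral>\<^sup>+u. h w u * ?H' w * indicator S u \<partial>lborel) \<partial>M)"
  proof (intro nn_integral_cong)
    fix w assume w: "w \<in> space M"
    have "(\<integral>\<^sup>+u. h w u * ?H' w * indicator S u \<partial>lborel) = (\<integral>\<^sup>+u. ?H' w * (h w u * indicator S u) \<partial>lborel)"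
      by (simp add: ac_simps)
    also have "\<dots> = ?H' w * (\<integral>\<^sup>+u\<in>S. h w u \<partial>lborel)" using h1(1)[OF w] S(1)
      by (intro nn_integral_cmult borel_measurable_times_ennreal borel_measurable_indicator) simp_all
    finally show "(\<integral>\<^sup>+u\<in>S. h w u \<partial>lborel) * ?H' w = (\<integral>\<^sup>+u. h w u * ?H' w * indicator S u \<partial>lborel)"
      by (simp add: mult.commute)
  qed
  also have "\<dots> = (\<integral>\<^sup>+u. (\<integral>\<^sup>+w. h w u * ?H' w * indicator S u \<partial>M) \<partial>lborel)"
    by (intro P.Fubini'[symmetric]) measurable
  also have "\<dots> = (\<integral>\<^sup>+u\<in>S. (\<integral>\<^sup>+u'\<in>S'. (\<integral>\<^sup>+w. h w u * h' w u' \<partial>M) \<partial>lborel) \<partial>lborel)"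
    by (simp add: nn_integral_multc int')
  also have "\<dots> \<le> (\<integral>\<^sup>+u\<in>S. (\<integral>\<^sup>+u'\<in>S'. \<kappa> * (\<integral>\<^sup>+w. h w u \<partial>M) * (\<integral>\<^sup>+w. h' w u' \<partial>M) \<partial>lborel) \<partial>lborel)"
    using mix by (auto intro!: nn_integral_mono split: split_indicator)
  also have "\<dots> = (\<integral>\<^sup>+u. \<kappa> * (\<integral>\<^sup>+w. h w u \<partial>M) * indicator S u * (\<integral>\<^sup>+u'\<in>S'. (\<integral>\<^sup>+w. h' w u' \<partial>M) \<partial>lborel) \<partial>lborel)"
  proof (intro nn_integral_cong)
    fix u
    have "(\<integral>\<^sup>+u'\<in>S'. \<kappa> * (\<integral>\<^sup>+w. h w u \<partial>M) * (\<integral>\<^sup>+w. h' w u' \<partial>M) \<partial>lborel)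
        = \<kappa> * (\<integral>\<^sup>+w. h w u \<partial>M) * (\<integral>\<^sup>+u'\<in>S'. (\<integral>\<^sup>+w. h' w u' \<partial>M) \<partial>lborel)"
      by (simp add: mult.assoc nn_integral_cmult)
    then show "(\<integral>\<^sup>+u'\<in>S'. \<kappa> * (\<integral>\<^sup>+w. h w u \<partial>M) * (\<integral>\<^sup>+w. h' w u' \<partial>M) \<partial>lborel) * indicator S u
        = \<kappa> * (\<integral>\<^sup>+w. h w u \<partial>M) * indicator S u * (\<integral>\<^sup>+u'\<in>S'. (\<integral>\<^sup>+w. h' w u' \<partial>M) \<partial>lborel)"
      by (simp add: ac_simps)
  qed
  also have "\<dots> = \<kappa> * (\<integral>\<^sup>+u\<in>S. (\<integral>\<^sup>+w. h w u \<partial>M) \<partial>lborel) * (\<integral>\<^sup>+u'\<in>S'. (\<integral>\<^sup>+w. h' w u' \<partial>M) \<partial>lborel)"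
    by (subst nn_integral_multc) (simp_all add: mult.assoc nn_integral_cmult)
  also have "(\<integral>\<^sup>+u\<in>S. (\<integral>\<^sup>+w. h w u \<partial>M) \<partial>lborel) = (\<integral>\<^sup>+w. (\<integral>\<^sup>+u\<in>S. h w u \<partial>lborel) \<partial>M)"
  proof -
    have "(\<integral>\<^sup>+w. (\<integral>\<^sup>+u. h w u * indicator S u \<partial>lborel) \<partial>M) = (\<integral>\<^sup>+u. (\<integral>\<^sup>+w. h w u * indicator S u \<partial>M) \<partial>lborel)"
      by (intro P.Fubini'[symmetric]) measurable
    then show ?thesis by (simp add: nn_integral_multc)
  qed
  also have "(\<integral>\<^sup>+u\<in>S'. (\<integral>\<^sup>+w. h' w u \<partial>M) \<partial>lborel) = (\<integral>\<^sup>+w. (\<integral>\<^sup>+u\<in>S'. h' w u \<partial>lborel) \<partial>M)"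
  proof -
    have "(\<integral>\<^sup>+w. (\<integral>\<^sup>+u. h' w u * indicator S' u \<partial>lborel) \<partial>M) = (\<integral>\<^sup>+u. (\<integral>\<^sup>+w. h' w u * indicator S' u \<partial>M) \<partial>lborel)"
      by (intro P.Fubini'[symmetric]) measurable
    then show ?thesis by (simp add: nn_integral_multc)
  qed
  finally show ?thesis .
qed

section \<open>Counting the jumps\<close>

lemma label_count_cong:
  assumes c: "counting_path c" and t: "0 \<le> t" and eq: "\<And>k. 1 \<le> k \<Longrightarrow> k \<le> c t \<Longrightarrow> L k = L' k"
  shows "label_count c L l s t = label_count c L' l s t"
proof -
  have "{k \<in> {c s<..c t}. L k = l} = {k \<in> {c s<..c t}. L' k = l}" using eq by auto
  then show ?thesis by (simp add: label_count_def)
qed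

lemma set_integral_Icc_split:
  fixes f :: "real \<Rightarrow> real"
  assumes "set_integrable lborel {s..t} f" "set_integrable lborel {t..u} f" "s \<le> t" "t \<le> u"
  shows "(LBINT v:{s..u}. f v) = (LBINT v:{s..t}. f v) + (LBINT v:{t..u}. f v)"
proof -
  have "AE v in lborel. v \<noteq> t" by (rule AE_lborel_singleton)
  then have "AE v in lborel. \<not> (v \<in> {s..t} \<and> v \<in> {t..u})" by eventually_elim auto
  from set_integral_Un_AE[OF this _ _ assms(1,2)] have "(LBINT v:{s..t} \<union> {t..u}. f v) = (LBINT v:{s..t}. f v) + (LBINT v:{t..u}. f v)"
    by simp
  moreover have "{s..t} \<union> {t..u} = {s..u}" using assms by auto
  ultimately show ?thesis by simp
qed

section \<open>Labels, second moments, mixing and lower bounds for the number of jumps\<close>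

context bounded_jump_process
begin

definition "J t w = num_jumps (\<lambda>u. X u w) t"
text \<open>Agrees with \<open>jump_label\<close> wherever the \<open>k\<close>th jump occurs.
  Elsewhere \<open>max 0\<close> keeps the evaluation at nonnegative times, which makes the label
  measurable on the whole space.\<close>

definition "JL k w = (X (max 0 (event_time (\<lambda>t. J t w) (k - 1))) w, X (max 0 (event_time (\<lambda>t. J t w) k)) w)"
definition "ZJ l s t w = (if X s w \<noteq> X t w \<and> l = (X s w, X t w) then 1 else (0::ennreal))"

lemma J_fun: "(\<lambda>t. J t w) = num_jumps (\<lambda>u. X u w)"
  by (simp add: J_def fun_eq_iff)

lemma J_path: "w \<in> space M \<Longrightarrow> counting_path (\<lambda>t. J t w)"
  unfolding J_fun by (rule counting_path_num_jumps[OF X_path])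

lemma X_rc: "w \<in> space M \<Longrightarrow> right_continuous_path (\<lambda>t. X t w)"
  using X_path by (simp add: jump_path_def)

lemma JL_occ:
  assumes w: "w \<in> space M" and k: "event_occurs (\<lambda>t. J t w) k"
  shows "JL k w = jump_label (\<lambda>u. X u w) k"
proof -
  have "event_occurs (\<lambda>t. J t w) (k - 1)" using k unfolding event_occurs_def by (meson diff_le_self order.trans)
  then have "0 \<le> event_time (\<lambda>t. J t w) (k - 1)" "0 \<le> event_time (\<lambda>t. J t w) k"
    using event_time_le_iff(1)[OF J_path[OF w]] k by auto
  then show ?thesis by (simp add: JL_def embedded_def jump_time_def J_fun max_def)
qed

lemma label_count_JL:
  assumes w: "w \<in> space M" and t: "0 \<le> t"
  shows "label_count (\<lambda>t. J t w) (\<lambda>k. JL k w) l s t = label_count (num_jumps (\<lambda>u. X u w)) (jump_label (\<lambda>u. X u w)) l s t"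
  unfolding J_fun[symmetric]
proof (rule label_count_cong[OF J_path[OF w] t])
  fix k assume "k \<le> J t w"
  then have "event_occurs (\<lambda>t. J t w) k" by (rule event_occursI[OF t])
  then show "JL k w = jump_label (\<lambda>u. X u w) k" by (rule JL_occ[OF w])
qed

lemma J_meas:
  assumes "\<And>t. 0 \<le> t \<Longrightarrow> X t \<in> measurable F (count_space UNIV)" "space F = space M" "0 \<le> t"
  shows "J t \<in> measurable F (count_space UNIV)"
  unfolding J_def[abs_def] using assms X_path by (intro measurable_num_jumps) auto

lemma JL_meas:
  assumes X: "\<And>t. 0 \<le> t \<Longrightarrow> X t \<in> measurable F (count_space UNIV)" and F: "space F = space M"
  shows "JL k \<in> measurable F (count_space UNIV)"
proof -
  have T: "(\<lambda>w. event_time (\<lambda>t. J t w) j) \<in> borel_measurable F" for j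
  proof (rule measurable_event_time)
    show "J t \<in> measurable F (count_space UNIV)" if "0 \<le> t" for t using X F that by (rule J_meas)
    show "counting_path (\<lambda>t. J t w)" if "w \<in> space F" for w using that unfolding F by (rule J_path)
  qed
  have X': "(\<lambda>w. X (max 0 (event_time (\<lambda>t. J t w) j)) w) \<in> measurable F (count_space UNIV)" for j
    by (rule measurable_process_at[OF X _ T]) (simp_all add: F X_rc)
  have "Measurable.pred F (\<lambda>w. JL k w = l)" for l
  proof -
    have [measurable]: "Measurable.pred F (\<lambda>w. X (max 0 (event_time (\<lambda>t. J t w) j)) w = x)" for j x
      by (rule measurable_count_space_pred[OF X'])
    have "Measurable.pred F (\<lambda>w. X (max 0 (event_time (\<lambda>t. J t w) (k - 1))) w = fst l
        \<and> X (max 0 (event_time (\<lambda>t. J t w) k)) w = snd l)" by measurable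
    then show ?thesis by (simp add: JL_def prod_eq_iff)
  qed
  then show ?thesis
    by (subst measurable_count_space_eq2) (auto simp: pred_def vimage_def Int_def conj_commute)
qed

lemma change_past:
  assumes "0 \<le> s" "s \<le> t"
  shows "{w \<in> space M. X s w \<noteq> X t w} \<in> past t"
proof -
  have "Measurable.pred (generated M {0..t} X) (\<lambda>w. X s w \<noteq> X t w)"
    using assms by (intro pred_neq_process measurable_generated) auto
  then show ?thesis by (simp add: pred_def space_generated)
qed

text \<open>Given the past, a cell shows a change with probability at most \<open>\<Lambda>\<close>
  times its width. The second moment of the number of changes along a grid is thus bounded as for
  independent indicators, with a diagonal part and a squared mean, and Fatou passes to the number of
  jumps.\<close>

lemma J_second_moment:
  assumes ab: "0 \<le> a" "a \<le> b"
  shows "(\<integral>\<^sup>+w. (of_nat (J b w - J a w))\<^sup>2 \<partial>M) \<le> ennreal (\<Lambda> * (b - a) + (\<Lambda> * (b - a))\<^sup>2)"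
proof -
  let ?g = "grid a b"
  define ch where "ch n i = {w \<in> space M. X (?g n i) w \<noteq> X (?g n (Suc i)) w}" for n i
  have gr: "0 \<le> ?g n i" "?g n i \<le> ?g n (Suc i)" if "i < Suc n" for n i
    using grid_bounds[of a b i n] grid_mono[of a b i "Suc i" n] ab that by auto
  have ch_past: "ch n i \<in> past (?g n (Suc i))" if "i < Suc n" for n i
    unfolding ch_def by (rule change_past[OF gr[OF that]])
  have ch_sets: "ch n i \<in> sets M" if "i < Suc n" for n i by (rule past_sets[OF ch_past[OF that]])
  let ?h = "\<lambda>n. \<Lambda> * ((b - a) / real (Suc n))"
  have h0: "0 \<le> ?h n" for n using \<Lambda> ab by simp
  have ch1: "prob (A \<inter> ch n i) \<le> ?h n * prob A" if "i < Suc n" "A \<in> past (?g n i)" for A n i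
    using prob_change[OF gr[OF that(1)] that(2)] unfolding ch_def grid_width .
  have ch1': "prob (ch n i) \<le> ?h n" if "i < Suc n" for n i
    using ch1[OF that space_past] sets.sets_into_space[OF ch_sets[OF that]]
    by (simp add: prob_space Int_absorb1 del: of_nat_Suc)
  have ch2: "prob (ch n i \<inter> ch n j) \<le> (?h n)\<^sup>2" if ij: "i < j" "j < Suc n" for n i j
  proof -
    have i: "i < Suc n" using ij by simp
    have "?g n (Suc i) \<le> ?g n j" using ij ab by (intro grid_mono) auto
    from past_mono[OF this ch_past[OF i]] have "prob (ch n i \<inter> ch n j) \<le> ?h n * prob (ch n i)"
      by (rule ch1[OF ij(2)])
    also have "\<dots> \<le> ?h n * ?h n" using ch1'[OF i] h0 by (rule mult_left_mono)
    finally show ?thesis by (simp add: power2_eq_square)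
  qed
  \<comment> \<open>The term \<open>(?h n)\<^sup>2\<close> is granted on the diagonal as well, which
    makes the double sum a plain square.\<close>
  have ch2': "prob (ch n i \<inter> ch n j) \<le> (if i = j then ?h n else 0) + (?h n)\<^sup>2" if ij: "i < Suc n" "j < Suc n" for n i j
  proof -
    consider "i = j" | "i < j" | "j < i" by linarith
    then show ?thesis
    proof cases
      case 1
      then show ?thesis using ch1'[OF ij(1)] zero_le_power2[of "?h n"]
        by (simp only: 1 if_True Int_absorb)
    next
      case 2
      then show ?thesis using ch2[OF 2 ij(2)] by (simp del: of_nat_Suc)
    next
      case 3
      then show ?thesis using ch2[OF 3 ij(1)] by (simp add: Int_commute del: of_nat_Suc)
    qed
  qed
  let ?S = "\<lambda>n w. (\<Sum>i<Suc n. indicator (ch n i) w) :: ennreal"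
  have "(\<integral>\<^sup>+w. (of_nat (J b w - J a w))\<^sup>2 \<partial>M) = (\<integral>\<^sup>+w. liminf (\<lambda>n. ?S n w * ?S n w) \<partial>M)"
  proof (intro nn_integral_cong)
    fix w assume w: "w \<in> space M"
    have "\<forall>\<^sub>F n in sequentially. ?S n w * ?S n w = (of_nat (J b w - J a w))\<^sup>2"
      using num_jumps_grid[OF X_path[OF w] ab]
    proof eventually_elim
      case (elim n)
      have "?S n w = of_nat (\<Sum>i<Suc n. of_bool (X (?g n i) w \<noteq> X (?g n (Suc i)) w))"
        unfolding of_nat_sum using w by (intro sum.cong) (auto simp: ch_def split: split_indicator)
      then show ?case using elim by (simp add: J_def power2_eq_square)
    qed
    then have "(\<lambda>n. ?S n w * ?S n w) \<longlonglongrightarrow> (of_nat (J b w - J a w))\<^sup>2" by (rule tendsto_eventually)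
    then show "(of_nat (J b w - J a w))\<^sup>2 = liminf (\<lambda>n. ?S n w * ?S n w)"
      by (rule lim_imp_Liminf[OF sequentially_bot, symmetric])
  qed
  also have "\<dots> \<le> liminf (\<lambda>n. \<integral>\<^sup>+w. ?S n w * ?S n w \<partial>M)"
    by (intro nn_integral_liminf borel_measurable_times_ennreal borel_measurable_sum borel_measurable_indicator ch_sets)
      simp_all
  also have "\<dots> \<le> liminf (\<lambda>n. ennreal (\<Lambda> * (b - a) + (\<Lambda> * (b - a))\<^sup>2))"
  proof (intro Liminf_mono always_eventually allI)
    fix n
    have [measurable]: "ch n i \<inter> ch n j \<in> sets M" if "i \<in> {..<Suc n}" "j \<in> {..<Suc n}" for i j
      using that ch_sets by auto
    have "(\<integral>\<^sup>+w. ?S n w * ?S n w \<partial>M) = (\<integral>\<^sup>+w. (\<Sum>i<Suc n. \<Sum>j<Suc n. indicator (ch n i \<inter> ch n j) w) \<partial>M)"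
      unfolding sum_product by (simp only: indicator_inter_arith)
    also have "\<dots> = (\<Sum>i<Suc n. \<integral>\<^sup>+w. (\<Sum>j<Suc n. indicator (ch n i \<inter> ch n j) w) \<partial>M)"
      by (rule nn_integral_sum) measurable
    also have "\<dots> = (\<Sum>i<Suc n. \<Sum>j<Suc n. \<integral>\<^sup>+w. indicator (ch n i \<inter> ch n j) w \<partial>M)"
      by (intro sum.cong refl nn_integral_sum) measurable
    also have "\<dots> = (\<Sum>i<Suc n. \<Sum>j<Suc n. ennreal (prob (ch n i \<inter> ch n j)))"
      using ch_sets by (intro sum.cong refl) (auto simp: emeasure_eq_measure)
    also have "\<dots> = ennreal (\<Sum>i<Suc n. \<Sum>j<Suc n. prob (ch n i \<inter> ch n j))"
      by (simp only: sum_ennreal sum_nonneg measure_nonneg)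
    also have "\<dots> \<le> ennreal (\<Sum>i<Suc n. \<Sum>j<Suc n. (if i = j then ?h n else 0) + (?h n)\<^sup>2)"
      by (intro ennreal_leI sum_mono ch2') auto
    also have "(\<Sum>i<Suc n. \<Sum>j<Suc n. (if i = j then ?h n else 0) + (?h n)\<^sup>2)
        = real (Suc n) * ?h n + (real (Suc n) * ?h n)\<^sup>2"
    proof -
      have "(\<Sum>j<Suc n. (if i = j then ?h n else 0)) = ?h n" if "i \<in> {..<Suc n}" for i
        using that by (subst sum.delta') auto
      then have "(\<Sum>i<Suc n. \<Sum>j<Suc n. (if i = j then ?h n else 0) + (?h n)\<^sup>2)
          = (\<Sum>i<Suc n. ?h n + real (Suc n) * (?h n)\<^sup>2)"
        by (intro sum.cong refl) (simp only: sum.distrib sum_constant card_lessThan)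
      also have "\<dots> = real (Suc n) * ?h n + (real (Suc n) * ?h n)\<^sup>2"
        by (simp only: sum.distrib sum_constant card_lessThan power2_eq_square) (simp only: ac_simps)
      finally show ?thesis .
    qed
    also have "real (Suc n) * ?h n = \<Lambda> * (b - a)" by (simp del: of_nat_Suc)
    finally show "(\<integral>\<^sup>+w. ?S n w * ?S n w \<partial>M) \<le> ennreal (\<Lambda> * (b - a) + (\<Lambda> * (b - a))\<^sup>2)" .
  qed
  also have "\<dots> = ennreal (\<Lambda> * (b - a) + (\<Lambda> * (b - a))\<^sup>2)" by (simp add: Liminf_const)
  finally show ?thesis .
qed

lemma of_nat_le_square: "(of_nat n :: ennreal) \<le> (of_nat n)\<^sup>2"
proof -
  have "n \<le> n\<^sup>2" by (simp add: power2_eq_square)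
  then have "(of_nat n :: ennreal) \<le> of_nat (n\<^sup>2)" by (simp only: of_nat_le_iff)
  then show ?thesis by simp
qed

lemma J_fin: "0 \<le> s \<Longrightarrow> s \<le> t \<Longrightarrow> (\<integral>\<^sup>+w. of_nat (J t w - J s w) \<partial>M) < \<infinity>"
  using J_second_moment[of s t]
  by (intro order.strict_trans1[OF nn_integral_mono[OF of_nat_le_square]]) (auto intro: order.strict_trans1)

lemma ZJ_indicator:
  fixes x y :: 's
  assumes "w \<in> space M"
  shows "ZJ (x, y) s t w = (if x \<noteq> y then indicator (hit s x \<inter> hit t y) w else 0)"
  using assms by (auto simp: ZJ_def split: split_indicator)

sublocale JG: grid_counting M J JL ZJ
proof
  fix l :: "'s \<times> 's" and s t assume st: "(0::real) \<le> s" "s \<le> t"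
  obtain x y where l: "l = (x, y)" by (cases l)
  have "(\<lambda>w. if x \<noteq> y then indicator (hit s x \<inter> hit t y) w else 0 :: ennreal) \<in> borel_measurable M"
    using hit_sets st by (auto intro!: borel_measurable_indicator)
  then show "ZJ l s t \<in> borel_measurable M"
    unfolding l using ZJ_indicator[of _ x y s t] by (subst measurable_cong) auto
next
  fix l s t w assume w: "w \<in> space M" and st: "(0::real) \<le> s" "s \<le> t"
  show "ZJ l s t w \<le> of_nat (J t w - J s w)"
  proof (cases "X s w = X t w")
    case False
    have "J s w \<le> J t w" by (rule counting_path_mono[OF J_path[OF w] st])
    moreover have "J t w \<noteq> J s w" using num_jumps_eqD[OF X_path[OF w] st] False by (auto simp: J_def)
    ultimately have "1 \<le> J t w - J s w" by simp
    then have "(of_nat 1 :: ennreal) \<le> of_nat (J t w - J s w)" by (simp only: of_nat_le_iff)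
    then show ?thesis by (simp add: ZJ_def)
  qed (simp add: ZJ_def)
next
  fix w b assume w: "w \<in> space M" and b: "(0::real) \<le> b"
  obtain d where d: "0 < d" and "\<And>s t l. 0 \<le> s \<Longrightarrow> s \<le> t \<Longrightarrow> t \<le> b \<Longrightarrow> t - s < d \<Longrightarrow>
      label_count (num_jumps (\<lambda>u. X u w)) (jump_label (\<lambda>u. X u w)) l s t = of_bool (X s w \<noteq> X t w \<and> l = (X s w, X t w)) \<and>
      num_jumps (\<lambda>u. X u w) t - num_jumps (\<lambda>u. X u w) s = of_bool (X s w \<noteq> X t w)"
    by (rule label_count_short_cells_jumps[OF X_path[OF w] b]) blast
  then have cell: "0 \<le> s \<Longrightarrow> s \<le> t \<Longrightarrow> t \<le> b \<Longrightarrow> t - s < d \<Longrightarrow>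
      label_count (num_jumps (\<lambda>u. X u w)) (jump_label (\<lambda>u. X u w)) l s t = of_bool (X s w \<noteq> X t w \<and> l = (X s w, X t w))" for s t l
    by blast
  show "\<exists>d>0. \<forall>s t l. 0 \<le> s \<and> s \<le> t \<and> t \<le> b \<and> t - s < d \<longrightarrow>
      ZJ l s t w = of_nat (label_count (\<lambda>t. J t w) (\<lambda>k. JL k w) l s t)"
  proof (intro exI[of _ d] conjI allI impI d)
    fix s t l assume "0 \<le> s \<and> s \<le> t \<and> t \<le> b \<and> t - s < d"
    then show "ZJ l s t w = of_nat (label_count (\<lambda>t. J t w) (\<lambda>k. JL k w) l s t)"
      using label_count_JL[OF w, of t l s] cell[of s t l] by (simp add: ZJ_def)
  qed
next
  fix t :: real assume "0 \<le> t"
  then show "J t \<in> measurable M (count_space UNIV)" by (intro J_meas X_meas) auto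
qed (simp_all add: J_path J_fin[simplified])

text \<open>The bound is required at every \<open>u \<ge> t\<close> with one constant, so that it
  can be used at all times of a later block. \<open>A\<close> ranges over the whole past of
  \<open>s\<close> because cells contribute events involving two times.\<close>

definition "mixes \<kappa> s t \<longleftrightarrow> (0::real) \<le> \<kappa> \<and> 0 \<le> s \<and> s \<le> t \<and>
  (\<forall>u\<ge>t. \<forall>A\<in>past s. \<forall>x. prob (A \<inter> hit u x) \<le> \<kappa> * prob A * prob (hit u x))"

lemma mixesD: "mixes \<kappa> s t \<Longrightarrow> t \<le> u \<Longrightarrow> A \<in> past s \<Longrightarrow> prob (A \<inter> hit u x) \<le> \<kappa> * prob A * prob (hit u x)"
  by (auto simp: mixes_def)

text \<open>Given the state at \<open>u\<close>, the transition to \<open>v\<close> contributes the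
  same factor \<open>P u v x y\<close> on both sides. Events at two times are needed because a jump
  is seen only by comparing both ends of a cell.\<close>

lemma mixes2:
  assumes m: "mixes \<kappa> s t" and u: "t \<le> u" "u \<le> v" and A: "A \<in> past s"
  shows "prob (A \<inter> (hit u x \<inter> hit v y)) \<le> \<kappa> * prob A * prob (hit u x \<inter> hit v y)"
proof -
  have s: "0 \<le> s" "s \<le> u" "0 \<le> u" and \<kappa>: "0 \<le> \<kappa>" using m u by (auto simp: mixes_def)
  have A': "A \<in> past u" by (rule past_mono[OF s(2) A])
  note mk = markov[OF s(3) u(2) A', of x y] 
  note le = mixesD[OF m u(1) A, of x]
  show ?thesis
  proof (cases "prob (hit u x) > 0")
    case True
    have "prob (A \<inter> hit u x) * P u v x y \<le> \<kappa> * prob A * prob (hit u x) * P u v x y"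
      by (intro mult_right_mono le P_stochastic(1)[OF s(3) u(2) True])
    then show ?thesis unfolding markov1[OF s(3) u(2)] using mk by (simp add: Int_assoc mult.assoc)
  next
    case False
    then have "prob (hit u x) = 0" using measure_nonneg[of M "hit u x"] by linarith
    with le have "prob (A \<inter> hit u x) = 0" using measure_nonneg[of M "A \<inter> hit u x"] by simp
    with mk have "prob (A \<inter> (hit u x \<inter> hit v y)) = 0" by (simp add: Int_assoc)
    then show ?thesis using \<kappa> by simp
  qed
qed

theorem J_mixing:
  assumes m: "mixes \<kappa> b a'" and ab: "0 \<le> a" "a \<le> b" "a' \<le> b'"
  shows "(\<integral>\<^sup>+w. JG.cnt l a b w * JG.cnt l' a' b' w \<partial>M) \<le> ennreal \<kappa> * (\<integral>\<^sup>+w. JG.cnt l a b w \<partial>M) * (\<integral>\<^sup>+w. JG.cnt l' a' b' w \<partial>M)"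
proof (rule JG.cnt_mixing)
  show "0 \<le> a'" using m ab by (simp add: mixes_def)
  fix s t s' t' assume st: "a \<le> s" "s \<le> t" "t \<le> b" "a' \<le> s'" "s' \<le> t'"
  have pos: "0 \<le> s" "0 \<le> t" "0 \<le> s'" "0 \<le> t'" "0 \<le> \<kappa>" using st m ab by (auto simp: mixes_def)
  obtain x y x' y' where l: "l = (x, y)" "l' = (x', y')" by (cases l, cases l')
  let ?A = "hit s x \<inter> hit t y" and ?B = "hit s' x' \<inter> hit t' y'"
  have AB: "?A \<in> sets M" "?B \<in> sets M" using hit_sets pos by auto
  show "(\<integral>\<^sup>+w. ZJ l s t w * ZJ l' s' t' w \<partial>M) \<le> ennreal \<kappa> * (\<integral>\<^sup>+w. ZJ l s t w \<partial>M) * (\<integral>\<^sup>+w. ZJ l' s' t' w \<partial>M)"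
  proof (cases "x \<noteq> y \<and> x' \<noteq> y'")
    case True
    have "(\<integral>\<^sup>+w. ZJ l s t w * ZJ l' s' t' w \<partial>M) = (\<integral>\<^sup>+w. indicator (?A \<inter> ?B) w \<partial>M)"
      unfolding l using True by (intro nn_integral_cong) (simp add: ZJ_indicator indicator_inter_arith)
    also have "\<dots> = ennreal (prob (?A \<inter> ?B))" using AB by (simp add: emeasure_eq_measure)
    also have "\<dots> \<le> ennreal (\<kappa> * prob ?A * prob ?B)"
    proof (intro ennreal_leI mixes2[OF m st(4,5)])
      show "?A \<in> past b" using hit_past st pos by (intro sets.Int) auto
    qed
    also have "\<dots> = ennreal \<kappa> * ennreal (prob ?A) * ennreal (prob ?B)"
      using pos by (simp add: ennreal_mult)
    also have "ennreal (prob ?A) = (\<integral>\<^sup>+w. ZJ l s t w \<partial>M)"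
    proof -
      have "(\<integral>\<^sup>+w. ZJ l s t w \<partial>M) = (\<integral>\<^sup>+w. indicator ?A w \<partial>M)"
        unfolding l using True by (intro nn_integral_cong) (simp add: ZJ_indicator)
      then show ?thesis using AB by (simp add: emeasure_eq_measure)
    qed
    also have "ennreal (prob ?B) = (\<integral>\<^sup>+w. ZJ l' s' t' w \<partial>M)"
    proof -
      have "(\<integral>\<^sup>+w. ZJ l' s' t' w \<partial>M) = (\<integral>\<^sup>+w. indicator ?B w \<partial>M)"
        unfolding l using True by (intro nn_integral_cong) (simp add: ZJ_indicator)
      then show ?thesis using AB by (simp add: emeasure_eq_measure)
    qed
    finally show ?thesis .
  next
    case False
    then have "(\<integral>\<^sup>+w. ZJ l s t w * ZJ l' s' t' w \<partial>M) = (\<integral>\<^sup>+w. 0 \<partial>M)"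
      unfolding l by (intro nn_integral_cong) (auto simp: ZJ_indicator)
    then show ?thesis by simp
  qed
qed (use ab in auto)

lemma J_cnt_ge:
  assumes \<delta>: "0 < \<delta>" "\<And>t x. 1 \<le> t \<Longrightarrow> \<delta> \<le> prob (hit t x)" and ab: "1 \<le> a" "a \<le> b" and xy: "x \<noteq> y"
  shows "ennreal (\<delta> * (LBINT u:{a..b}. Q u x y)) \<le> (\<integral>\<^sup>+w. JG.cnt (x, y) a b w \<partial>M)"
\<comment> \<open>In a single cell this is \<open>P_move\<close>, started from a state of
  probability at least \<open>\<delta>\<close>; its second-order loss becomes
  \<open>K'\<close>.\<close>
proof (rule JG.cnt_ge[where K=\<Lambda> and K'="\<delta> * \<Lambda>\<^sup>2"])
  fix s t assume st: "a \<le> s" "s \<le> t" "t \<le> b"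
  have s: "0 \<le> s" "0 \<le> t" using st ab by auto
  have p: "\<delta> \<le> prob (hit s x)" using \<delta>(2)[of s x] st ab by simp
  let ?m = "(1 - \<Lambda> * (t - s)) * (LBINT u:{s..t}. Q u x y) - \<Lambda>\<^sup>2 * (t - s)\<^sup>2"
  have "\<delta> * ?m \<le> prob (hit s x) * P s t x y"
  \<comment> \<open>Replacing the probability by \<open>\<delta>\<close> is monotone only for
    nonnegative \<open>?m\<close>. A negative \<open>?m\<close> makes the left side negative and the
    claim trivial.\<close>
  proof (cases "0 \<le> ?m")
    case True
    have "\<delta> * ?m \<le> prob (hit s x) * ?m" using p True by (rule mult_right_mono)
    also have "\<dots> \<le> prob (hit s x) * P s t x y"
      using P_move[OF s(1) st(2) _ xy] p \<delta> by (intro mult_left_mono) auto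
    finally show ?thesis .
  next
    case False
    then have "\<delta> * ?m \<le> 0" using \<delta>(1) by (simp add: mult_le_0_iff)
    also have "0 \<le> prob (hit s x) * P s t x y" unfolding markov1[OF s(1) st(2), symmetric] by simp
    finally show ?thesis .
  qed
  also have "\<dots> = prob (hit s x \<inter> hit t y)" by (rule markov1[OF s(1) st(2), symmetric])
  finally have le: "\<delta> * ?m \<le> prob (hit s x \<inter> hit t y)" .
  have "ennreal (\<delta> * (1 - \<Lambda> * (t - s)) * (LBINT u:{s..t}. Q u x y) - \<delta> * \<Lambda>\<^sup>2 * (t - s)\<^sup>2) = ennreal (\<delta> * ?m)"
    by (simp add: algebra_simps)
  also have "\<dots> \<le> ennreal (prob (hit s x \<inter> hit t y))" using le by (rule ennreal_leI)
  also have "\<dots> = (\<integral>\<^sup>+w. indicator (hit s x \<inter> hit t y) w \<partial>M)"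
    using hit_sets s by (simp add: emeasure_eq_measure)
  also have "\<dots> = (\<integral>\<^sup>+w. ZJ (x, y) s t w \<partial>M)"
    using xy by (intro nn_integral_cong) (simp add: ZJ_indicator)
  finally show "ennreal (\<delta> * (1 - \<Lambda> * (t - s)) * (LBINT u:{s..t}. Q u x y) - \<delta> * \<Lambda>\<^sup>2 * (t - s)\<^sup>2) \<le> (\<integral>\<^sup>+w. ZJ (x, y) s t w \<partial>M)" .
next
  fix s t u assume st: "a \<le> s" "s \<le> t" "t \<le> u" "u \<le> b"
  then show "(LBINT v:{s..u}. Q v x y) = (LBINT v:{s..t}. Q v x y) + (LBINT v:{t..u}. Q v x y)"
    using ab by (intro set_integral_Icc_split set_integrable_Q) auto
qed (use ab in auto)

end

section \<open>Counting processes labelled by the current state\<close>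

locale state_counting = bounded_jump_process M X Q P \<Lambda> q B
  for M :: "'w measure" and X :: "real \<Rightarrow> 'w \<Rightarrow> 's::finite" and Q P \<Lambda> q B +
  fixes N :: "real \<Rightarrow> 'w \<Rightarrow> nat"
  assumes N_path: "\<And>w. w \<in> space M \<Longrightarrow> counting_path (\<lambda>t. N t w)"
    and N_meas: "\<And>t. 0 \<le> t \<Longrightarrow> N t \<in> measurable M (count_space UNIV)"
    and N_fin: "\<And>s t. 0 \<le> s \<Longrightarrow> s \<le> t \<Longrightarrow> (\<integral>\<^sup>+w. of_nat (N t w - N s w) \<partial>M) < \<infinity>"
begin

definition "SL k w = X (max 0 (event_time (\<lambda>t. N t w) k)) w"
text \<open>All events of a cell are attributed to the state at its right end. A change of state
  after an event of the same cell makes this wrong, but that is impossible on the short cells of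
  \<open>label_count_short_cells\<close>.\<close>

definition "ZS x s t w = (of_nat (N t w - N s w) * indicator (hit t x) w :: ennreal)"

lemma SL_occ:
  assumes w: "w \<in> space M" and k: "event_occurs (\<lambda>t. N t w) k"
  shows "SL k w = X (event_time (\<lambda>t. N t w) k) w"
  using event_time_le_iff(1)[OF N_path[OF w] k] by (simp add: SL_def max_def)

lemma SL_meas:
  assumes X: "\<And>t. 0 \<le> t \<Longrightarrow> X t \<in> measurable F (count_space UNIV)"
    and N: "\<And>t. 0 \<le> t \<Longrightarrow> N t \<in> measurable F (count_space UNIV)" and F: "space F = space M"
  shows "SL k \<in> measurable F (count_space UNIV)"
  unfolding SL_def[abs_def]
proof (rule measurable_process_at[OF X])
  show "(\<lambda>w. event_time (\<lambda>t. N t w) k) \<in> borel_measurable F"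
    by (rule measurable_event_time[OF N]) (simp_all add: F N_path)
qed (simp_all add: F X_rc)

sublocale SG: grid_counting M N SL ZS
proof
  fix l s t assume "(0::real) \<le> s" "s \<le> t"
  then have [measurable]: "N t \<in> measurable M (count_space UNIV)" "N s \<in> measurable M (count_space UNIV)" "hit t l \<in> sets M"
    using hit_sets by (auto intro: N_meas)
  show "ZS l s t \<in> borel_measurable M" unfolding ZS_def by measurable
next
  fix l s t w show "ZS l s t w \<le> of_nat (N t w - N s w)"
    by (auto simp: ZS_def split: split_indicator)
next
  fix w b assume w: "w \<in> space M" and b: "(0::real) \<le> b"
  obtain d where d: "0 < d" and "\<And>s t l. 0 \<le> s \<Longrightarrow> s \<le> t \<Longrightarrow> t \<le> b \<Longrightarrow> t - s < d \<Longrightarrow>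
      label_count (\<lambda>t. N t w) (\<lambda>k. X (event_time (\<lambda>t. N t w) k) w) l s t = (if X t w = l then N t w - N s w else 0)"
    by (rule label_count_short_cells[OF N_path[OF w] X_rc[OF w] b]) blast
  then have cell: "0 \<le> s \<Longrightarrow> s \<le> t \<Longrightarrow> t \<le> b \<Longrightarrow> t - s < d \<Longrightarrow>
      label_count (\<lambda>t. N t w) (\<lambda>k. X (event_time (\<lambda>t. N t w) k) w) l s t = (if X t w = l then N t w - N s w else 0)" for s t l
    by blast
  show "\<exists>d>0. \<forall>s t l. 0 \<le> s \<and> s \<le> t \<and> t \<le> b \<and> t - s < d \<longrightarrow>
      ZS l s t w = of_nat (label_count (\<lambda>t. N t w) (\<lambda>k. SL k w) l s t)"
  proof (intro exI[of _ d] conjI allI impI d)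
    fix s t l assume *: "0 \<le> s \<and> s \<le> t \<and> t \<le> b \<and> t - s < d"
    then have t: "0 \<le> t" by simp
    have "label_count (\<lambda>t. N t w) (\<lambda>k. SL k w) l s t = label_count (\<lambda>t. N t w) (\<lambda>k. X (event_time (\<lambda>t. N t w) k) w) l s t"
    proof (rule label_count_cong[OF N_path[OF w] t])
      fix k assume "k \<le> N t w"
      then have "event_occurs (\<lambda>t. N t w) k" by (rule event_occursI[OF t])
      then show "SL k w = X (event_time (\<lambda>t. N t w) k) w" by (rule SL_occ[OF w])
    qed
    then show "ZS l s t w = of_nat (label_count (\<lambda>t. N t w) (\<lambda>k. SL k w) l s t)"
      using cell[of s t l] * w by (simp add: ZS_def)
  qed
qed (simp_all add: N_path N_meas N_fin[simplified])

text \<open>For deterministic times the increments are constants that can be taken out of the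
  integrals; only the states at the right ends of the two cells are random.\<close>

theorem S_mixing_deterministic:
  assumes m: "mixes \<kappa> b a'" and ab: "0 \<le> a" "a \<le> b" "a' \<le> b'" and N: "\<And>t w. N t w = n t"
  shows "(\<integral>\<^sup>+w. SG.cnt x a b w * SG.cnt x' a' b' w \<partial>M) \<le> ennreal \<kappa> * (\<integral>\<^sup>+w. SG.cnt x a b w \<partial>M) * (\<integral>\<^sup>+w. SG.cnt x' a' b' w \<partial>M)"
proof (rule SG.cnt_mixing)
  show "0 \<le> a'" using m ab by (simp add: mixes_def)
  fix s t s' t' assume st: "a \<le> s" "s \<le> t" "t \<le> b" "a' \<le> s'" "s' \<le> t'"
  have pos: "0 \<le> s" "0 \<le> t" "a' \<le> t'" "0 \<le> t'" "0 \<le> \<kappa>" using st m ab by (auto simp: mixes_def)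
  let ?n = "of_nat (n t - n s) :: ennreal" and ?n' = "of_nat (n t' - n s') :: ennreal"
  have E: "(\<integral>\<^sup>+w. ZS x s t w \<partial>M) = ?n * ennreal (prob (hit t x))"
    using hit_sets[OF pos(2)] by (simp add: ZS_def N nn_integral_cmult emeasure_eq_measure)
  have E': "(\<integral>\<^sup>+w. ZS x' s' t' w \<partial>M) = ?n' * ennreal (prob (hit t' x'))"
    using hit_sets[OF pos(4)] by (simp add: ZS_def N nn_integral_cmult emeasure_eq_measure)
  have "(\<integral>\<^sup>+w. ZS x s t w * ZS x' s' t' w \<partial>M) = (\<integral>\<^sup>+w. (?n * ?n') * indicator (hit t x \<inter> hit t' x') w \<partial>M)"
    by (intro nn_integral_cong) (simp add: ZS_def N indicator_inter_arith ac_simps)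
  also have "\<dots> = ?n * ?n' * ennreal (prob (hit t x \<inter> hit t' x'))"
    using hit_sets[OF pos(2), of x] hit_sets[OF pos(4), of x']
    by (subst nn_integral_cmult) (auto simp: emeasure_eq_measure)
  also have "\<dots> \<le> ?n * ?n' * ennreal (\<kappa> * prob (hit t x) * prob (hit t' x'))"
  proof (intro mult_left_mono ennreal_leI mixesD[OF m pos(3)])
    show "hit t x \<in> past b" using hit_past pos st by auto
  qed simp
  also have "\<dots> = ennreal \<kappa> * (?n * ennreal (prob (hit t x))) * (?n' * ennreal (prob (hit t' x')))"
    using pos by (simp add: ennreal_mult ac_simps)
  finally show "(\<integral>\<^sup>+w. ZS x s t w * ZS x' s' t' w \<partial>M) \<le> ennreal \<kappa> * (\<integral>\<^sup>+w. ZS x s t w \<partial>M) * (\<integral>\<^sup>+w. ZS x' s' t' w \<partial>M)"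
    unfolding E E' .
qed (use ab in auto)

end

section \<open>Poisson counts given the path of \<open>X\<close>, and their integration over that
  path\<close>

section \<open>Poisson processes with modulated intensity\<close>

definition pois :: "real \<Rightarrow> nat \<Rightarrow> real" where "pois a k = exp (- a) * a ^ k / fact k"

lemma pois_nonneg: "0 \<le> a \<Longrightarrow> 0 \<le> pois a k"
  by (simp add: pois_def)

lemma pois_sums: "pois a sums 1"
proof -
  have "(\<lambda>k. exp (- a) * (a ^ k / fact k)) sums (exp (- a) * exp a)"
    using exp_converges[of a] by (intro sums_mult) (simp add: divide_inverse mult.commute)
  then show ?thesis by (simp add: pois_def[abs_def] exp_minus field_simps)
qed

lemma pois_Suc: "real (Suc k) * pois a (Suc k) = a * pois a k"
  by (simp add: pois_def field_simps del: of_nat_Suc)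

lemma pois_mean_sums: "(\<lambda>k. real k * pois a k) sums a"
proof -
  have "(\<lambda>k. a * pois a k) sums (a * 1)" by (intro sums_mult pois_sums)
  then have "(\<lambda>k. real (Suc k) * pois a (Suc k)) sums a" by (simp only: pois_Suc mult_1_right)
  then show ?thesis using sums_Suc[of "\<lambda>k. real k * pois a k" a] by simp
qed

lemma pois_second_sums: "(\<lambda>k. (real k)\<^sup>2 * pois a k) sums (a\<^sup>2 + a)"
proof -
  have "(\<lambda>k. a * (real k * pois a k + pois a k)) sums (a * (a + 1))"
    by (intro sums_mult sums_add pois_sums pois_mean_sums)
  moreover have "(real (Suc k))\<^sup>2 * pois a (Suc k) = a * (real k * pois a k + pois a k)" for k
  proof -
    have "(real (Suc k))\<^sup>2 * pois a (Suc k) = real (Suc k) * (a * pois a k)"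
      unfolding pois_Suc[symmetric] power2_eq_square by (simp only: mult.assoc)
    then show ?thesis by (simp add: algebra_simps)
  qed
  ultimately have "(\<lambda>k. (real (Suc k))\<^sup>2 * pois a (Suc k)) sums (a * (a + 1))" by (simp only:)
  from sums_Suc[of "\<lambda>k. (real k)\<^sup>2 * pois a k", OF this] show ?thesis
    by (simp add: power2_eq_square algebra_simps)
qed

lemma suminf_of_nat_single:
  "(\<Sum>k. f k * (if n = k then 1 else 0)) = (f n :: ennreal)"
proof -
  have "(\<Sum>k. f k * (if n = k then 1 else 0)) = (\<Sum>k\<in>{n}. f k * (if n = k then 1 else 0))"
    by (rule suminf_finite) auto
  then show ?thesis by simp
qed

text \<open>It is used twice: with the intensity of \<open>N\<close>, where \<open>A\<close> is the
  conditional mean of an increment, and with the reward rate \<open>r\<close>, where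
  \<open>A\<close> is the continuous part of the reward.\<close>

locale state_functional = bounded_jump_process M X Q P \<Lambda> q B
  for M :: "'w measure" and X :: "real \<Rightarrow> 'w \<Rightarrow> 's::finite" and Q P \<Lambda> q B +
  fixes \<beta> :: "real \<Rightarrow> 's \<Rightarrow> real" and b :: real
  assumes \<beta>_meas: "\<And>x. measurable_in_time (\<lambda>t. \<beta> t x)"
    and \<beta>_nonneg: "\<And>t x. 0 \<le> t \<Longrightarrow> 0 \<le> \<beta> t x" and \<beta>_le: "\<And>t x. 0 \<le> t \<Longrightarrow> \<beta> t x \<le> b"
begin

definition "A s t w = (LBINT u:{s..t}. \<beta> u (X u w))"
lemma b_nonneg: "0 \<le> b" using \<beta>_nonneg[of 0] \<beta>_le[of 0] by (rule order.trans) simp_all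

lemma \<beta>_joint: "(\<lambda>(w, t). \<beta> (max 0 t) (X (max 0 t) w)) \<in> borel_measurable (M \<Otimes>\<^sub>M borel)"
  by (rule measurable_process_integrand[OF X_meas X_rc \<beta>_meas])

lemma A_props:
  assumes w: "w \<in> space M" and st: "0 \<le> s" "s \<le> t"
  shows "ennreal (A s t w) = (\<integral>\<^sup>+u\<in>{s..t}. ennreal (\<beta> (max 0 u) (X (max 0 u) w)) \<partial>lborel)"
    and "0 \<le> A s t w" and "A s t w \<le> b * (t - s)"
proof -
  let ?f = "\<lambda>u. \<beta> (max 0 u) (X (max 0 u) w)"
  have [measurable]: "?f \<in> borel_measurable lborel"
    using measurable_Pair2[OF \<beta>_joint w] by simp
  have f: "0 \<le> ?f u" "?f u \<le> b" for u using \<beta>_nonneg \<beta>_le by auto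
  have A: "A s t w = (LBINT u:{s..t}. ?f u)"
    unfolding A_def set_lebesgue_integral_def using st
    by (intro Bochner_Integration.integral_cong refl) (auto split: split_indicator simp: max_def)
  have int: "set_integrable lborel {s..t} ?f"
    unfolding set_integrable_def
  proof (rule Bochner_Integration.integrable_bound[of _ "\<lambda>u. indicator {s..t} u *\<^sub>R b"])
    show "integrable lborel (\<lambda>u. indicat_real {s..t} u *\<^sub>R b)"
      using set_integrable_const_Icc[of s t b] by (simp add: set_integrable_def)
    show "AE u in lborel. norm (indicat_real {s..t} u *\<^sub>R ?f u) \<le> norm (indicat_real {s..t} u *\<^sub>R b)"
      using f b_nonneg by (auto split: split_indicator)
  qed measurable
  show "0 \<le> A s t w" unfolding A set_lebesgue_integral_def
    by (intro Bochner_Integration.integral_nonneg) (auto split: split_indicator intro: f)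
  have "A s t w \<le> (LBINT u:{s..t}. b)" unfolding A
    by (intro set_integral_mono int set_integrable_const_Icc f)
  then show "A s t w \<le> b * (t - s)" using st by (simp add: set_integral_const_Icc)
  have "ennreal (A s t w) = (\<integral>\<^sup>+u. ennreal (indicator {s..t} u *\<^sub>R ?f u) \<partial>lborel)"
    unfolding A set_lebesgue_integral_def using int f
    by (intro nn_integral_eq_integral[symmetric]) (auto simp: set_integrable_def split: split_indicator)
  also have "\<dots> = (\<integral>\<^sup>+u\<in>{s..t}. ennreal (?f u) \<partial>lborel)"
    by (intro nn_integral_cong) (auto split: split_indicator)
  finally show "ennreal (A s t w) = (\<integral>\<^sup>+u\<in>{s..t}. ennreal (?f u) \<partial>lborel)" .
qed

lemma A_meas: 
  assumes "0 \<le> s" "s \<le> t"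
  shows "A s t \<in> borel_measurable M"
proof -
  have [measurable]: "(\<lambda>(w, t). \<beta> (max 0 t) (X (max 0 t) w)) \<in> borel_measurable (M \<Otimes>\<^sub>M lborel)"
    using \<beta>_joint by simp
  have "(\<lambda>w. enn2real (\<integral>\<^sup>+u\<in>{s..t}. ennreal (\<beta> (max 0 u) (X (max 0 u) w)) \<partial>lborel)) \<in> borel_measurable M"
    by measurable
  moreover have "A s t w = enn2real (\<integral>\<^sup>+u\<in>{s..t}. ennreal (\<beta> (max 0 u) (X (max 0 u) w)) \<partial>lborel)" if "w \<in> space M" for w
    using A_props(1)[OF that assms, symmetric] A_props(2)[OF that assms] by simp
  ultimately show ?thesis by (simp cong: measurable_cong)
qed

end

locale modulated_poisson = state_functional M X Q P \<Lambda> q B \<beta> b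
  for M :: "'w measure" and X :: "real \<Rightarrow> 'w \<Rightarrow> 's::finite" and Q P \<Lambda> q B \<beta> b +
  fixes N :: "real \<Rightarrow> 'w \<Rightarrow> nat"
  assumes cpp: "conditional_poisson_process M \<beta> X N"
begin

abbreviation "F0 \<equiv> generated M {0..} X"

lemma N_path: "w \<in> space M \<Longrightarrow> counting_path (\<lambda>t. N t w)"
  and N_meas: "0 \<le> t \<Longrightarrow> N t \<in> measurable M (count_space UNIV)"
  using cpp by (auto simp: conditional_poisson_process_def)

lemma sub0: "subalgebra M F0" using X_meas by (intro subalgebra_generated) auto

lemma pois_meas: "0 \<le> s \<Longrightarrow> s \<le> t \<Longrightarrow> (\<lambda>w. pois (A s t w) k) \<in> borel_measurable M"
  unfolding pois_def using A_meas[of s t] by measurable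

definition "inc s t k = {w \<in> space M. N t w - N s w = k}"

lemma inc_sets: "0 \<le> s \<Longrightarrow> 0 \<le> t \<Longrightarrow> inc s t k \<in> sets M"
proof -
  assume "0 \<le> s" "0 \<le> t"
  then have [measurable]: "N s \<in> measurable M (count_space UNIV)" "N t \<in> measurable M (count_space UNIV)"
    by (auto intro: N_meas)
  show ?thesis unfolding inc_def by measurable
qed

text \<open>The conditional law of the increments is integrated over an event determined by
  \<open>X\<close>, so the almost sure identity turns into an equation between measures of
  events.\<close>

lemma pois_prob:
  assumes s: "0 \<le> s 0" "\<And>i. i < m \<Longrightarrow> s i \<le> s (Suc i)" and D: "D \<in> sets F0"
  shows "emeasure M (D \<inter> {w \<in> space M. \<forall>i<m. N (s (Suc i)) w - N (s i) w = k i})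
    = (\<integral>\<^sup>+w. indicator D w * ennreal (\<Prod>i<m. pois (A (s i) (s (Suc i)) w) (k i)) \<partial>M)"
proof -
  have DM: "D \<in> sets M" using D sub0 by (auto simp: subalgebra_def)
  have s0: "i \<le> m \<Longrightarrow> 0 \<le> s i" for i
  proof (induct i)
    case (Suc i)
    then show ?case using s(2)[of i] by force
  qed (rule s(1))
  have pos: "0 \<le> s i" "s i \<le> s (Suc i)" "0 \<le> s (Suc i)" if "i < m" for i
    using s0[of i] s0[of "Suc i"] s(2)[OF that] that by auto
  let ?S = "{w \<in> space M. \<forall>i<m. N (s (Suc i)) w - N (s i) w = k i}"
  have S: "?S \<in> sets M"
  proof -
    have "{w \<in> space M. \<forall>i\<in>{..<m}. N (s (Suc i)) w - N (s i) w = k i} \<in> sets M"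
    proof (rule sets.sets_Collect_finite_All)
      fix i assume "i \<in> {..<m}"
      then have i: "i < m" by simp
      have "inc (s i) (s (Suc i)) (k i) \<in> sets M" using pos(1,3)[OF i] by (rule inc_sets)
      then show "{w \<in> space M. N (s (Suc i)) w - N (s i) w = k i} \<in> sets M" unfolding inc_def .
    qed (rule finite_lessThan)
    then show ?thesis unfolding Ball_def lessThan_iff .
  qed
  interpret S: sigma_finite_subalgebra M F0
    by (intro finite_measure_subalgebra_is_sigma_finite) (simp add: finite_measure_subalgebra_def
        finite_measure_subalgebra_axioms_def sub0 finite_measure_axioms)
  let ?p = "\<lambda>w. \<Prod>i<m. pois (A (s i) (s (Suc i)) w) (k i)"
  have p0: "0 \<le> ?p w" if "w \<in> space M" for w
  proof (intro prod_nonneg ballI)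
    fix i assume "i \<in> {..<m}"
    then show "0 \<le> pois (A (s i) (s (Suc i)) w) (k i)"
      using A_props(2)[OF that pos(1,2)[of i]] by (intro pois_nonneg) simp
  qed
  have event_measure: "?p \<in> borel_measurable M"
  proof (rule borel_measurable_prod)
    fix i assume "i \<in> {..<m}"
    then show "(\<lambda>w. pois (A (s i) (s (Suc i)) w) (k i)) \<in> borel_measurable M"
      using pos[of i] by (intro pois_meas) simp_all
  qed
  have ae: "AE w in M. real_cond_exp M F0 (indicator ?S) w = ?p w"
  proof -
    have "0 \<le> s 0 \<and> (\<forall>i<m. s i \<le> s (Suc i))" using s by simp
    from cpp[unfolded conditional_poisson_process_def, THEN conjunct2, THEN conjunct2, THEN spec[where x=m],
        THEN spec[where x=s], THEN spec[where x=k], THEN mp, OF this]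
    show ?thesis unfolding pois_def A_def Let_def .
  qed
  have ind: "integrable M (indicat_real ?S)"
    using S by (rule integrable_real_indicator) (simp add: emeasure_eq_measure)
  have int: "integrable M (real_cond_exp M F0 (indicator ?S))"
    by (rule S.real_cond_exp_int(1)[OF ind])
  have intp: "integrable M ?p"
    using int event_measure ae by (rule integrable_cong_AE_imp)
  have "prob (D \<inter> ?S) = (\<integral>w. indicat_real (D \<inter> ?S) w \<partial>M)"
    using sets.Int[OF DM S] by simp
  also have "\<dots> = (\<integral>w\<in>D. indicat_real ?S w \<partial>M)"
    unfolding set_lebesgue_integral_def indicator_inter_arith real_scaleR_def ..
  also have "\<dots> = (\<integral>w\<in>D. real_cond_exp M F0 (indicat_real ?S) w \<partial>M)"
    by (rule S.real_cond_exp_intA[OF ind D])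
  also have "\<dots> = (\<integral>w. indicator D w * ?p w \<partial>M)"
    unfolding set_lebesgue_integral_def
  proof (rule integral_cong_AE)
    show "AE w in M. indicat_real D w *\<^sub>R real_cond_exp M F0 (indicat_real ?S) w = indicator D w * ?p w"
      using ae by eventually_elim simp
  qed (use DM event_measure in measurable)
  finally have "emeasure M (D \<inter> ?S) = ennreal (\<integral>w. indicator D w * ?p w \<partial>M)"
    by (simp add: emeasure_eq_measure)
  also have "\<dots> = (\<integral>\<^sup>+w. ennreal (indicator D w * ?p w) \<partial>M)"
  proof (rule nn_integral_eq_integral[symmetric])
    show "integrable M (\<lambda>w. indicat_real D w * ?p w)"
      using integrable_mult_indicator[OF DM intp] by simp
    show "AE w in M. 0 \<le> indicat_real D w * ?p w"
      by (intro AE_I2) (simp add: p0 split: split_indicator)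
  qed
  also have "\<dots> = (\<integral>\<^sup>+w. indicator D w * ennreal (?p w) \<partial>M)"
    by (intro nn_integral_cong) (simp split: split_indicator)
  finally show ?thesis .
qed

lemma pois_prob1:
  assumes st: "0 \<le> s" "s \<le> t" and D: "D \<in> sets F0"
  shows "emeasure M (D \<inter> inc s t k) = (\<integral>\<^sup>+w. indicator D w * ennreal (pois (A s t w) k) \<partial>M)"
  using pois_prob[of "\<lambda>i. if i = 0 then s else t" 1 D "\<lambda>_. k"] st D by (simp add: inc_def)

text \<open>The law of the increments is given for consecutive intervals. The gap from
  \<open>t\<close> to \<open>s'\<close> is therefore inserted as a third interval, and its increment
  is summed out with total mass one.\<close>

lemma pois_prob2:
  assumes st: "0 \<le> s" "s \<le> t" "t \<le> s'" "s' \<le> t'" and D: "D \<in> sets F0"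
  shows "emeasure M (D \<inter> (inc s t k \<inter> inc s' t' k'))
    = (\<integral>\<^sup>+w. indicator D w * ennreal (pois (A s t w) k) * ennreal (pois (A s' t' w) k') \<partial>M)"
proof -
  have DM [measurable]: "D \<in> sets M" using D sub0 by (auto simp: subalgebra_def)
  have pos: "0 \<le> t" "0 \<le> s'" "0 \<le> t'" using st by auto
  have incM[measurable]: "inc s t k \<in> sets M" "inc t s' j \<in> sets M" "inc s' t' k' \<in> sets M" for j
    using st pos by (auto intro: inc_sets)
  note [measurable] = pois_meas[OF st(1,2)] pois_meas[OF pos(1) st(3)] pois_meas[OF pos(2) st(4)]
  let ?sq = "\<lambda>i. if i = 0 then s else if i = 1 then t else if i = 2 then s' else t'"
  have three: "emeasure M (D \<inter> (inc s t k \<inter> inc s' t' k') \<inter> inc t s' j)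
      = (\<integral>\<^sup>+w. indicator D w * ennreal (pois (A s t w) k * pois (A t s' w) j * pois (A s' t' w) k') \<partial>M)" for j
  proof -
    let ?k = "\<lambda>i. if i = 0 then k else if i = 1 then j else k'"
    have all3: "(\<forall>i<3. R i) \<longleftrightarrow> R 0 \<and> R 1 \<and> R (2::nat)" for R
      by (auto simp: numeral_3_eq_3 numeral_2_eq_2 less_Suc_eq)
    have "(\<Prod>i<3. g i) = g 0 * g 1 * g (2::nat)" for g :: "nat \<Rightarrow> real"
      by (simp add: numeral_3_eq_3 numeral_2_eq_2)
    then have "emeasure M (D \<inter> {w \<in> space M. \<forall>i<3. N (?sq (Suc i)) w - N (?sq i) w = ?k i})
      = (\<integral>\<^sup>+w. indicator D w * ennreal (pois (A s t w) k * pois (A t s' w) j * pois (A s' t' w) k') \<partial>M)"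
      using pois_prob[of ?sq 3 D ?k] st D by (simp add: less_Suc_eq numeral_3_eq_3)
    moreover have "D \<inter> {w \<in> space M. \<forall>i<3. N (?sq (Suc i)) w - N (?sq i) w = ?k i} = D \<inter> (inc s t k \<inter> inc s' t' k') \<inter> inc t s' j"
      unfolding all3 inc_def by auto
    ultimately show ?thesis by simp
  qed
  have "emeasure M (D \<inter> (inc s t k \<inter> inc s' t' k')) = emeasure M (\<Union>j. D \<inter> (inc s t k \<inter> inc s' t' k') \<inter> inc t s' j)"
    by (intro arg_cong[where f="emeasure M"]) (auto simp: inc_def)
  also have "\<dots> = (\<Sum>j. emeasure M (D \<inter> (inc s t k \<inter> inc s' t' k') \<inter> inc t s' j))"
  proof (rule suminf_emeasure[symmetric])
    show "range (\<lambda>j. D \<inter> (inc s t k \<inter> inc s' t' k') \<inter> inc t s' j) \<subseteq> sets M" using DM incM by auto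
    show "disjoint_family (\<lambda>j. D \<inter> (inc s t k \<inter> inc s' t' k') \<inter> inc t s' j)"
      by (auto simp: disjoint_family_on_def inc_def)
  qed
  also have "\<dots> = (\<Sum>j. \<integral>\<^sup>+w. indicator D w * ennreal (pois (A s t w) k * pois (A t s' w) j * pois (A s' t' w) k') \<partial>M)"
    by (simp only: three)
  also have "\<dots> = (\<integral>\<^sup>+w. (\<Sum>j. indicator D w * ennreal (pois (A s t w) k * pois (A t s' w) j * pois (A s' t' w) k')) \<partial>M)"
    by (intro nn_integral_suminf[symmetric]) measurable
  also have "\<dots> = (\<integral>\<^sup>+w. indicator D w * ennreal (pois (A s t w) k) * ennreal (pois (A s' t' w) k') \<partial>M)"
  proof (intro nn_integral_cong)
    fix w assume w: "w \<in> space M"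
    have nn: "0 \<le> pois (A s t w) k" "0 \<le> pois (A t s' w) j" "0 \<le> pois (A s' t' w) k'" for j
      using A_props(2)[OF w] st pos by (auto intro: pois_nonneg)
    have "(\<Sum>j. indicator D w * ennreal (pois (A s t w) k * pois (A t s' w) j * pois (A s' t' w) k'))
        = (\<Sum>j. indicator D w * ennreal (pois (A s t w) k) * ennreal (pois (A s' t' w) k') * ennreal (pois (A t s' w) j))"
      using nn by (intro suminf_cong) (simp add: ennreal_mult ac_simps)
    also have "\<dots> = indicator D w * ennreal (pois (A s t w) k) * ennreal (pois (A s' t' w) k') * (\<Sum>j. ennreal (pois (A t s' w) j))"
      by (rule ennreal_suminf_cmult)
    also have "(\<Sum>j. ennreal (pois (A t s' w) j)) = ennreal 1"
      using nn by (intro suminf_ennreal_eq pois_sums) auto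
    finally show "(\<Sum>j. indicator D w * ennreal (pois (A s t w) k * pois (A t s' w) j * pois (A s' t' w) k'))
        = indicator D w * ennreal (pois (A s t w) k) * ennreal (pois (A s' t' w) k')" by simp
  qed
  finally show ?thesis .
qed

lemma indicator_inc: "w \<in> space M \<Longrightarrow> (indicator (inc s t k) w :: ennreal) = (if N t w - N s w = k then 1 else 0)"
  by (simp add: inc_def split: split_indicator)

lemma of_nat_pois_suminf:
  assumes "0 \<le> a"
  shows "(\<Sum>k. of_nat k * ennreal (pois a k)) = ennreal a"
    and "(\<Sum>k. (of_nat k)\<^sup>2 * ennreal (pois a k)) = ennreal (a\<^sup>2 + a)"
proof -
  have "(\<Sum>k. of_nat k * ennreal (pois a k)) = (\<Sum>k. ennreal (real k * pois a k))"
    using pois_nonneg[OF assms] by (intro suminf_cong) (simp add: ennreal_mult ennreal_of_nat_eq_real_of_nat)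
  also have "\<dots> = ennreal a"
    using pois_nonneg[OF assms] by (intro suminf_ennreal_eq pois_mean_sums) auto
  finally show "(\<Sum>k. of_nat k * ennreal (pois a k)) = ennreal a" .
  have "(\<Sum>k. (of_nat k)\<^sup>2 * ennreal (pois a k)) = (\<Sum>k. ennreal ((real k)\<^sup>2 * pois a k))"
    using pois_nonneg[OF assms]
    by (intro suminf_cong) (simp add: ennreal_mult ennreal_of_nat_eq_real_of_nat ennreal_power)
  also have "\<dots> = ennreal (a\<^sup>2 + a)"
    using pois_nonneg[OF assms] by (intro suminf_ennreal_eq pois_second_sums) auto
  finally show "(\<Sum>k. (of_nat k)\<^sup>2 * ennreal (pois a k)) = ennreal (a\<^sup>2 + a)" .
qed

lemma nn_integral_fun_inc:
  fixes f :: "nat \<Rightarrow> ennreal"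
  assumes st: "0 \<le> s" "s \<le> t" and D: "D \<in> sets F0"
  shows "(\<integral>\<^sup>+w. indicator D w * f (N t w - N s w) \<partial>M)
    = (\<integral>\<^sup>+w. indicator D w * (\<Sum>k. f k * ennreal (pois (A s t w) k)) \<partial>M)"
proof -
  have DM [measurable]: "D \<in> sets M" using D sub0 by (auto simp: subalgebra_def)
  have [measurable]: "inc s t k \<in> sets M" for k using st by (auto intro: inc_sets)
  note [measurable] = pois_meas[OF st]
  have "(\<integral>\<^sup>+w. indicator D w * f (N t w - N s w) \<partial>M)
      = (\<integral>\<^sup>+w. (\<Sum>k. f k * indicator (D \<inter> inc s t k) w) \<partial>M)"
  proof (intro nn_integral_cong)
    fix w assume w: "w \<in> space M"
    have "(\<Sum>k. f k * indicator (D \<inter> inc s t k) w) = (\<Sum>k. indicator D w * (f k * (if N t w - N s w = k then 1 else 0)))"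
      by (intro suminf_cong) (simp add: indicator_inter_arith indicator_inc[OF w] ac_simps)
    also have "\<dots> = indicator D w * f (N t w - N s w)"
      unfolding ennreal_suminf_cmult suminf_of_nat_single ..
    finally show "indicator D w * f (N t w - N s w) = (\<Sum>k. f k * indicator (D \<inter> inc s t k) w)" ..
  qed
  also have "\<dots> = (\<Sum>k. f k * emeasure M (D \<inter> inc s t k))"
    by (subst nn_integral_suminf) (auto simp: nn_integral_cmult)
  also have "\<dots> = (\<Sum>k. f k * (\<integral>\<^sup>+w. indicator D w * ennreal (pois (A s t w) k) \<partial>M))"
    by (simp only: pois_prob1[OF st D])
  also have "\<dots> = (\<Sum>k. \<integral>\<^sup>+w. indicator D w * (f k * ennreal (pois (A s t w) k)) \<partial>M)"
    by (intro suminf_cong) (subst nn_integral_cmult[symmetric], measurable, simp add: ac_simps)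
  also have "\<dots> = (\<integral>\<^sup>+w. (\<Sum>k. indicator D w * (f k * ennreal (pois (A s t w) k))) \<partial>M)"
    by (intro nn_integral_suminf[symmetric]) measurable
  finally show ?thesis by simp
qed

lemma nn_integral_inc:
  assumes st: "0 \<le> s" "s \<le> t" and D: "D \<in> sets F0"
  shows "(\<integral>\<^sup>+w. indicator D w * of_nat (N t w - N s w) \<partial>M) = (\<integral>\<^sup>+w. indicator D w * ennreal (A s t w) \<partial>M)"
  unfolding nn_integral_fun_inc[OF st D, of of_nat]
  by (intro nn_integral_cong) (simp add: of_nat_pois_suminf A_props(2)[OF _ st])

lemma N_second_moment:
  assumes st: "0 \<le> s" "s \<le> t"
  shows "(\<integral>\<^sup>+w. (of_nat (N t w - N s w))\<^sup>2 \<partial>M) \<le> ennreal ((b * (t - s))\<^sup>2 + b * (t - s))"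
proof -
  have sp: "space M \<in> sets F0" using sets.top[of F0] by (simp add: space_generated)
  have "(\<integral>\<^sup>+w. (of_nat (N t w - N s w))\<^sup>2 \<partial>M) = (\<integral>\<^sup>+w. indicator (space M) w * (of_nat (N t w - N s w))\<^sup>2 \<partial>M)"
    by (intro nn_integral_cong) simp
  also have "\<dots> = (\<integral>\<^sup>+w. indicator (space M) w * (\<Sum>k. (of_nat k)\<^sup>2 * ennreal (pois (A s t w) k)) \<partial>M)"
    by (rule nn_integral_fun_inc[OF st sp])
  also have "\<dots> \<le> (\<integral>\<^sup>+w. ennreal ((b * (t - s))\<^sup>2 + b * (t - s)) \<partial>M)"
  proof (rule nn_integral_mono)
    fix w assume w: "w \<in> space M"
    note a = A_props(2,3)[OF w st]
    have "(A s t w)\<^sup>2 + A s t w \<le> (b * (t - s))\<^sup>2 + b * (t - s)"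
      using a by (intro add_mono power_mono)
    then show "indicator (space M) w * (\<Sum>k. (of_nat k)\<^sup>2 * ennreal (pois (A s t w) k)) \<le> ennreal ((b * (t - s))\<^sup>2 + b * (t - s))"
      unfolding of_nat_pois_suminf(2)[OF a(1)] using w by (simp only: indicator_simps mult_1_left ennreal_leI)
  qed
  also have "\<dots> = ennreal ((b * (t - s))\<^sup>2 + b * (t - s))" by (simp add: emeasure_space_1)
  finally show ?thesis .
qed

lemma N_fin: "0 \<le> s \<Longrightarrow> s \<le> t \<Longrightarrow> (\<integral>\<^sup>+w. of_nat (N t w - N s w) \<partial>M) < \<infinity>"
  using N_second_moment[of s t]
  by (intro order.strict_trans1[OF nn_integral_mono[OF of_nat_le_square]]) (auto intro: order.strict_trans1)

lemma nn_integral_inc_inc: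
  assumes st: "0 \<le> s" "s \<le> t" "t \<le> s'" "s' \<le> t'" and D: "D \<in> sets F0"
  shows "(\<integral>\<^sup>+w. indicator D w * of_nat (N t w - N s w) * of_nat (N t' w - N s' w) \<partial>M)
    = (\<integral>\<^sup>+w. indicator D w * ennreal (A s t w) * ennreal (A s' t' w) \<partial>M)"
proof -
  have DM [measurable]: "D \<in> sets M" using D sub0 by (auto simp: subalgebra_def)
  have pos: "0 \<le> t" "0 \<le> s'" "0 \<le> t'" using st by auto
  have [measurable]: "inc s t k \<in> sets M" "inc s' t' k \<in> sets M" for k
    using st pos by (auto intro: inc_sets)
  note [measurable] = pois_meas[OF st(1,2)] pois_meas[OF pos(2) st(4)]
  let ?p = "\<lambda>k w. of_nat k * ennreal (pois (A s t w) k)" and ?p' = "\<lambda>k w. of_nat k * ennreal (pois (A s' t' w) k)"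
  have "(\<integral>\<^sup>+w. indicator D w * of_nat (N t w - N s w) * of_nat (N t' w - N s' w) \<partial>M)
      = (\<integral>\<^sup>+w. (\<Sum>k. indicator D w * (of_nat k * indicator (inc s t k) w)) * (\<Sum>k. of_nat k * indicator (inc s' t' k) w) \<partial>M)"
    by (intro nn_integral_cong) (simp only: indicator_inc ennreal_suminf_cmult suminf_of_nat_single)
  also have "\<dots> = (\<Sum>k. \<Sum>k'. \<integral>\<^sup>+w. (indicator D w * (of_nat k * indicator (inc s t k) w)) * (of_nat k' * indicator (inc s' t' k') w) \<partial>M)"
    by (intro nn_integral_suminf_times_suminf) measurable
  also have "\<dots> = (\<Sum>k. \<Sum>k'. \<integral>\<^sup>+w. (indicator D w * ?p k w) * ?p' k' w \<partial>M)"
  proof (intro suminf_cong)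
    fix k k'
    have "(\<integral>\<^sup>+w. (indicator D w * (of_nat k * indicator (inc s t k) w)) * (of_nat k' * indicator (inc s' t' k') w) \<partial>M)
        = (\<integral>\<^sup>+w. of_nat k * of_nat k' * indicator (D \<inter> (inc s t k \<inter> inc s' t' k')) w \<partial>M)"
      by (intro nn_integral_cong) (simp add: indicator_inter_arith ac_simps)
    also have "\<dots> = of_nat k * of_nat k' * emeasure M (D \<inter> (inc s t k \<inter> inc s' t' k'))"
      by (subst nn_integral_cmult) auto
    also have "\<dots> = of_nat k * of_nat k' * (\<integral>\<^sup>+w. indicator D w * ennreal (pois (A s t w) k) * ennreal (pois (A s' t' w) k') \<partial>M)"
      by (simp only: pois_prob2[OF st D])
    also have "\<dots> = (\<integral>\<^sup>+w. of_nat k * of_nat k' * (indicator D w * ennreal (pois (A s t w) k) * ennreal (pois (A s' t' w) k')) \<partial>M)"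
      by (intro nn_integral_cmult[symmetric]) measurable
    also have "\<dots> = (\<integral>\<^sup>+w. (indicator D w * ?p k w) * ?p' k' w \<partial>M)"
      by (intro nn_integral_cong) (simp add: ac_simps)
    finally show "(\<integral>\<^sup>+w. (indicator D w * (of_nat k * indicator (inc s t k) w)) * (of_nat k' * indicator (inc s' t' k') w) \<partial>M)
      = (\<integral>\<^sup>+w. (indicator D w * ?p k w) * ?p' k' w \<partial>M)" .
  qed
  also have "\<dots> = (\<integral>\<^sup>+w. (\<Sum>k. indicator D w * ?p k w) * (\<Sum>k. ?p' k w) \<partial>M)"
    by (intro nn_integral_suminf_times_suminf[symmetric]) measurable
  also have "\<dots> = (\<integral>\<^sup>+w. indicator D w * ennreal (A s t w) * ennreal (A s' t' w) \<partial>M)"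
    using A_props(2)[OF _ st(1,2)] A_props(2)[OF _ pos(2) st(4)]
    by (intro nn_integral_cong) (simp only: ennreal_suminf_cmult of_nat_pois_suminf)
  finally show ?thesis .
qed

sublocale state_counting M X Q P \<Lambda> q B N
  by unfold_locales (auto intro: N_path N_meas N_fin[simplified])

lemma hit_F0: "0 \<le> t \<Longrightarrow> hit t x \<in> sets F0"
  using measurable_count_space_pred[OF measurable_generated[of t "{0..}" X M], of "\<lambda>y. y = x"]
  by (simp add: pred_def space_generated)

text \<open>Integrated over \<open>u \<in> {s..t}\<close> this is the conditional mean, given
  \<open>X\<close>, of the cell count \<open>ZS x s t\<close>: the intensity is taken at time
  \<open>u\<close>, the label at the right end \<open>t\<close>.\<close>

definition "hb x t w u = (indicator (hit t x) w * ennreal (\<beta> (max 0 u) (X (max 0 u) w)) :: ennreal)"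

lemma hb_joint: "0 \<le> t \<Longrightarrow> (\<lambda>(w, u). hb x t w u) \<in> borel_measurable (M \<Otimes>\<^sub>M borel)"
proof -
  assume "0 \<le> t"
  then have [measurable]: "hit t x \<in> sets M" by (rule hit_sets)
  note [measurable] = \<beta>_joint
  show ?thesis unfolding hb_def by measurable
qed

lemma hb_integral:
  assumes "w \<in> space M" "0 \<le> s" "s \<le> t"
  shows "indicator (hit t x) w * ennreal (A s t w) = (\<integral>\<^sup>+u\<in>{s..t}. hb x t w u \<partial>lborel)"
proof -
  have [measurable]: "(\<lambda>u. \<beta> (max 0 u) (X (max 0 u) w)) \<in> borel_measurable lborel"
    using measurable_Pair2[OF \<beta>_joint assms(1)] by simp
  have "(\<integral>\<^sup>+u\<in>{s..t}. hb x t w u \<partial>lborel)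
      = (\<integral>\<^sup>+u. indicator (hit t x) w * (ennreal (\<beta> (max 0 u) (X (max 0 u) w)) * indicator {s..t} u) \<partial>lborel)"
    by (simp only: hb_def mult.assoc)
  also have "\<dots> = indicator (hit t x) w * (\<integral>\<^sup>+u\<in>{s..t}. ennreal (\<beta> (max 0 u) (X (max 0 u) w)) \<partial>lborel)"
    by (rule nn_integral_cmult) measurable
  finally show ?thesis using A_props(1)[OF assms] by simp
qed

lemma hb_sum:
  assumes "0 \<le> u" "w \<in> space M"
  shows "hb x t w u = (\<Sum>z\<in>UNIV. ennreal (\<beta> u z) * indicator (hit u z \<inter> hit t x) w)"
proof -
  have "(\<Sum>z\<in>UNIV. ennreal (\<beta> u z) * indicator (hit u z \<inter> hit t x) w)
      = (\<Sum>z\<in>UNIV. if z = X u w then ennreal (\<beta> u z) * indicator (hit t x) w else 0)"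
    using assms by (intro sum.cong) (auto split: split_indicator)
  then show ?thesis using assms by (simp add: hb_def max_def mult.commute)
qed

lemma nn_integral_hb:
  assumes "0 \<le> u" "0 \<le> t"
  shows "(\<integral>\<^sup>+w. hb x t w u \<partial>M) = (\<Sum>z\<in>UNIV. ennreal (\<beta> u z) * ennreal (prob (hit u z \<inter> hit t x)))"
proof -
  have [measurable]: "hit u z \<inter> hit t x \<in> sets M" for z using hit_sets assms by auto
  have "(\<integral>\<^sup>+w. hb x t w u \<partial>M) = (\<integral>\<^sup>+w. (\<Sum>z\<in>UNIV. ennreal (\<beta> u z) * indicator (hit u z \<inter> hit t x) w) \<partial>M)"
    by (intro nn_integral_cong hb_sum assms)
  also have "\<dots> = (\<Sum>z\<in>UNIV. \<integral>\<^sup>+w. ennreal (\<beta> u z) * indicator (hit u z \<inter> hit t x) w \<partial>M)"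
    by (rule nn_integral_sum) measurable
  also have "\<dots> = (\<Sum>z\<in>UNIV. ennreal (\<beta> u z) * ennreal (prob (hit u z \<inter> hit t x)))"
    by (intro sum.cong refl) (simp add: nn_integral_cmult_indicator emeasure_eq_measure)
  finally show ?thesis .
qed

text \<open>Given \<open>X\<close>, the increments over the two cells are independent, so the
  integrated intensities may replace them. What remains involves the states at the times
  \<open>u \<le> t\<close> in one cell and \<open>u' \<le> t'\<close> in the other, to which
  \<open>mixes2\<close> applies.\<close>

theorem N_mixing:
  assumes m: "mixes \<kappa> c a'" and ab: "0 \<le> a" "a \<le> c" "a' \<le> b'"
  shows "(\<integral>\<^sup>+w. SG.cnt x a c w * SG.cnt x' a' b' w \<partial>M) \<le> ennreal \<kappa> * (\<integral>\<^sup>+w. SG.cnt x a c w \<partial>M) * (\<integral>\<^sup>+w. SG.cnt x' a' b' w \<partial>M)"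
proof (rule SG.cnt_mixing)
  show "0 \<le> a'" using m ab by (simp add: mixes_def)
  fix s t s' t' assume st: "a \<le> s" "s \<le> t" "t \<le> c" "a' \<le> s'" "s' \<le> t'"
  have pos: "0 \<le> s" "0 \<le> t" "t \<le> s'" "0 \<le> s'" "0 \<le> t'" "0 \<le> \<kappa>" using st m ab by (auto simp: mixes_def)
  have F0: "hit t x \<in> sets F0" "hit t' x' \<in> sets F0" "hit t x \<inter> hit t' x' \<in> sets F0"
    using hit_F0 pos by auto
  have one: "(\<integral>\<^sup>+w. ZS y v v' w \<partial>M) = (\<integral>\<^sup>+w. (\<integral>\<^sup>+u\<in>{v..v'}. hb y v' w u \<partial>lborel) \<partial>M)" if "0 \<le> v" "v \<le> v'" for y v v'
  proof -
    have "(\<integral>\<^sup>+w. ZS y v v' w \<partial>M) = (\<integral>\<^sup>+w. indicator (hit v' y) w * of_nat (N v' w - N v w) \<partial>M)"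
      by (intro nn_integral_cong) (simp add: ZS_def mult.commute)
    also have "\<dots> = (\<integral>\<^sup>+w. indicator (hit v' y) w * ennreal (A v v' w) \<partial>M)"
      using that by (intro nn_integral_inc hit_F0) auto
    also have "\<dots> = (\<integral>\<^sup>+w. (\<integral>\<^sup>+u\<in>{v..v'}. hb y v' w u \<partial>lborel) \<partial>M)"
      using that by (intro nn_integral_cong hb_integral)
    finally show ?thesis .
  qed
  have "(\<integral>\<^sup>+w. ZS x s t w * ZS x' s' t' w \<partial>M)
      = (\<integral>\<^sup>+w. indicator (hit t x \<inter> hit t' x') w * of_nat (N t w - N s w) * of_nat (N t' w - N s' w) \<partial>M)"
    by (intro nn_integral_cong) (simp add: ZS_def indicator_inter_arith ac_simps)
  also have "\<dots> = (\<integral>\<^sup>+w. indicator (hit t x \<inter> hit t' x') w * ennreal (A s t w) * ennreal (A s' t' w) \<partial>M)"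
    by (rule nn_integral_inc_inc[OF pos(1) st(2) pos(3) st(5) F0(3)])
  also have "\<dots> = (\<integral>\<^sup>+w. (indicator (hit t x) w * ennreal (A s t w)) * (indicator (hit t' x') w * ennreal (A s' t' w)) \<partial>M)"
    by (intro nn_integral_cong) (simp add: indicator_inter_arith ac_simps)
  also have "\<dots> = (\<integral>\<^sup>+w. (\<integral>\<^sup>+u\<in>{s..t}. hb x t w u \<partial>lborel) * (\<integral>\<^sup>+u\<in>{s'..t'}. hb x' t' w u \<partial>lborel) \<partial>M)"
    using st pos by (intro nn_integral_cong arg_cong2[of _ _ _ _ "(*)"] hb_integral)
  also have "\<dots> \<le> ennreal \<kappa> * (\<integral>\<^sup>+w. (\<integral>\<^sup>+u\<in>{s..t}. hb x t w u \<partial>lborel) \<partial>M) * (\<integral>\<^sup>+w. (\<integral>\<^sup>+u\<in>{s'..t'}. hb x' t' w u \<partial>lborel) \<partial>M)"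
  proof (rule nn_integral_integral_mixing)
    fix u u' assume u: "u \<in> {s..t}" "u' \<in> {s'..t'}"
    then have u0: "0 \<le> u" "u \<le> t" "0 \<le> u'" "a' \<le> u'" "u' \<le> t'" using pos st by auto
    let ?E = "\<lambda>z. hit u z \<inter> hit t x" and ?E' = "\<lambda>z. hit u' z \<inter> hit t' x'"
    have [measurable]: "?E z \<inter> ?E' z' \<in> sets M" for z z' using hit_sets u0 pos by auto
    have "(\<integral>\<^sup>+w. hb x t w u * hb x' t' w u' \<partial>M)
        = (\<integral>\<^sup>+w. (\<Sum>z\<in>UNIV. \<Sum>z'\<in>UNIV. ennreal (\<beta> u z) * ennreal (\<beta> u' z') * indicator (?E z \<inter> ?E' z') w) \<partial>M)"
    proof (intro nn_integral_cong)
      fix w assume w: "w \<in> space M"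
      have "hb x t w u * hb x' t' w u' = (\<Sum>z\<in>UNIV. \<Sum>z'\<in>UNIV. (ennreal (\<beta> u z) * indicator (?E z) w) * (ennreal (\<beta> u' z') * indicator (?E' z') w))"
        unfolding hb_sum[OF u0(1) w] hb_sum[OF u0(3) w] by (rule sum_product)
      then show "hb x t w u * hb x' t' w u' = (\<Sum>z\<in>UNIV. \<Sum>z'\<in>UNIV. ennreal (\<beta> u z) * ennreal (\<beta> u' z') * indicator (?E z \<inter> ?E' z') w)"
        by (simp add: indicator_inter_arith ac_simps)
    qed
    also have "\<dots> = (\<Sum>z\<in>UNIV. \<integral>\<^sup>+w. (\<Sum>z'\<in>UNIV. ennreal (\<beta> u z) * ennreal (\<beta> u' z') * indicator (?E z \<inter> ?E' z') w) \<partial>M)"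
      by (rule nn_integral_sum) measurable
    also have "\<dots> = (\<Sum>z\<in>UNIV. \<Sum>z'\<in>UNIV. \<integral>\<^sup>+w. ennreal (\<beta> u z) * ennreal (\<beta> u' z') * indicator (?E z \<inter> ?E' z') w \<partial>M)"
      by (intro sum.cong refl nn_integral_sum) measurable
    also have "\<dots> = (\<Sum>z\<in>UNIV. \<Sum>z'\<in>UNIV. ennreal (\<beta> u z) * ennreal (\<beta> u' z') * ennreal (prob (?E z \<inter> ?E' z')))"
      by (intro sum.cong refl) (simp add: nn_integral_cmult_indicator emeasure_eq_measure)
    also have "\<dots> \<le> (\<Sum>z\<in>UNIV. \<Sum>z'\<in>UNIV. ennreal (\<beta> u z) * ennreal (\<beta> u' z') * ennreal (\<kappa> * prob (?E z) * prob (?E' z')))"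
    proof (intro sum_mono mult_left_mono ennreal_leI mixes2[OF m u0(4,5)])
      fix z show "?E z \<in> past c" using hit_past u0 pos st by (intro sets.Int) auto
    qed simp
    also have "\<dots> = (\<Sum>z\<in>UNIV. \<Sum>z'\<in>UNIV. ennreal \<kappa> * (ennreal (\<beta> u z) * ennreal (prob (?E z))) * (ennreal (\<beta> u' z') * ennreal (prob (?E' z'))))"
      using pos by (intro sum.cong refl) (simp add: ennreal_mult ac_simps)
    also have "\<dots> = ennreal \<kappa> * (\<integral>\<^sup>+w. hb x t w u \<partial>M) * (\<integral>\<^sup>+w. hb x' t' w u' \<partial>M)"
      unfolding nn_integral_hb[OF u0(1) pos(2)] nn_integral_hb[OF u0(3) pos(5)]
      by (simp only: sum_distrib_left[where r="ennreal \<kappa>"] sum_product)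
    finally show "(\<integral>\<^sup>+w. hb x t w u * hb x' t' w u' \<partial>M) \<le> ennreal \<kappa> * (\<integral>\<^sup>+w. hb x t w u \<partial>M) * (\<integral>\<^sup>+w. hb x' t' w u' \<partial>M)" .
  qed (use hb_joint pos in auto)
  finally show "(\<integral>\<^sup>+w. ZS x s t w * ZS x' s' t' w \<partial>M) \<le> ennreal \<kappa> * (\<integral>\<^sup>+w. ZS x s t w \<partial>M) * (\<integral>\<^sup>+w. ZS x' s' t' w \<partial>M)"
    unfolding one[OF pos(1) st(2)] one[OF pos(4) st(5)] .
qed (use ab in auto)

lemma set_integrable_\<beta>:
  assumes "0 \<le> s"
  shows "set_integrable lborel {s..t} (\<lambda>u. \<beta> u x)"
proof -
  have m: "(\<lambda>u. \<beta> (max 0 u) x) \<in> borel_measurable borel"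
    by (rule measurable_compose[OF _ \<beta>_meas]) (auto intro!: measurable_restrict_space2)
  have "set_integrable lborel {s..t} (\<lambda>u. \<beta> (max 0 u) x)"
    unfolding set_integrable_def
  proof (rule Bochner_Integration.integrable_bound[of _ "\<lambda>u. indicator {s..t} u *\<^sub>R b"])
    show "integrable lborel (\<lambda>u. indicat_real {s..t} u *\<^sub>R b)"
      using set_integrable_const_Icc[of s t b] by (simp add: set_integrable_def)
    show "AE u in lborel. norm (indicat_real {s..t} u *\<^sub>R \<beta> (max 0 u) x) \<le> norm (indicat_real {s..t} u *\<^sub>R b)"
      using \<beta>_nonneg[of "max 0 _"] \<beta>_le[of "max 0 _"] b_nonneg by (auto split: split_indicator)
  qed (use m in measurable)
  moreover have "set_integrable lborel {s..t} (\<lambda>u. \<beta> (max 0 u) x) = set_integrable lborel {s..t} (\<lambda>u. \<beta> u x)"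
    using assms by (intro set_integrable_cong) (auto simp: max_def)
  ultimately show ?thesis by simp
qed

text \<open>A state found at time \<open>u\<close> is found again at the end of the cell with
  probability at least \<open>1 - \<Lambda> * (t - u)\<close>. The loss is a factor and not an
  additive error, hence \<open>K' = 0\<close>.\<close>

lemma N_cnt_ge:
  assumes \<delta>: "0 < \<delta>" "\<And>t x. 1 \<le> t \<Longrightarrow> \<delta> \<le> prob (hit t x)" and ab: "1 \<le> a" "a \<le> c"
  shows "ennreal (\<delta> * (LBINT u:{a..c}. \<beta> u x)) \<le> (\<integral>\<^sup>+w. SG.cnt x a c w \<partial>M)"
proof (rule SG.cnt_ge[where K=\<Lambda> and K'=0])
  fix s t assume st: "a \<le> s" "s \<le> t" "t \<le> c"
  have s: "0 \<le> s" "0 \<le> t" "1 \<le> s" using st ab by auto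
  interpret P: pair_sigma_finite M lborel ..
  have [measurable]: "(\<lambda>(w, u). hb x t w u) \<in> borel_measurable (M \<Otimes>\<^sub>M lborel)"
    using hb_joint[OF s(2), of x] by simp
  show "ennreal (\<delta> * (1 - \<Lambda> * (t - s)) * (LBINT u:{s..t}. \<beta> u x) - 0 * (t - s)\<^sup>2) \<le> (\<integral>\<^sup>+w. ZS x s t w \<partial>M)"
  proof (cases "0 \<le> 1 - \<Lambda> * (t - s)")
    case True
    let ?k = "\<delta> * (1 - \<Lambda> * (t - s))"
    have k: "0 \<le> ?k" using True \<delta> by simp
    have int: "integrable lborel (\<lambda>u. ?k * (indicator {s..t} u *\<^sub>R \<beta> u x))"
      using set_integrable_\<beta>[OF s(1), of t x] by (simp add: set_integrable_def)
    have "ennreal (?k * (LBINT u:{s..t}. \<beta> u x)) = ennreal (LBINT u. ?k * (indicator {s..t} u *\<^sub>R \<beta> u x))"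
      by (simp add: set_lebesgue_integral_def)
    also have "\<dots> = (\<integral>\<^sup>+u. ennreal (?k * (indicator {s..t} u *\<^sub>R \<beta> u x)) \<partial>lborel)"
      using int k s \<beta>_nonneg
      by (intro nn_integral_eq_integral[symmetric]) (auto intro!: AE_I2 mult_nonneg_nonneg split: split_indicator)
    also have "\<dots> \<le> (\<integral>\<^sup>+u\<in>{s..t}. (\<integral>\<^sup>+w. hb x t w u \<partial>M) \<partial>lborel)"
    proof (rule nn_integral_mono)
      fix u
      show "ennreal (?k * (indicat_real {s..t} u *\<^sub>R \<beta> u x)) \<le> (\<integral>\<^sup>+w. hb x t w u \<partial>M) * indicator {s..t} u"
      proof (cases "u \<in> {s..t}")
        case u: True
        then have u0: "0 \<le> u" "u \<le> t" "1 \<le> u" using s by auto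
        have "(1 - \<Lambda> * (t - s)) * \<delta> \<le> (1 - \<Lambda> * (t - u)) * prob (hit u x)"
        proof (intro mult_mono)
          show "1 - \<Lambda> * (t - s) \<le> 1 - \<Lambda> * (t - u)" using u \<Lambda> by simp
          then show "0 \<le> 1 - \<Lambda> * (t - u)" using True by linarith
        qed (use \<delta> u0 in auto)
        also have "\<dots> \<le> prob (hit u x \<inter> hit t x)"
          using prob_stay[OF u0(1,2) space_past, of x] by (simp add: Int_absorb1 Collect_conj_eq[symmetric] Int_def)
        finally have "?k * \<beta> u x \<le> \<beta> u x * prob (hit u x \<inter> hit t x)"
          using \<beta>_nonneg[OF u0(1), of x] by (simp add: mult.commute mult_left_mono)
        then have "ennreal (?k * \<beta> u x) \<le> ennreal (\<beta> u x) * ennreal (prob (hit u x \<inter> hit t x))"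
          using \<beta>_nonneg[OF u0(1), of x] by (simp add: ennreal_mult[symmetric] ennreal_leI)
        also have "\<dots> \<le> (\<integral>\<^sup>+w. hb x t w u \<partial>M)"
          unfolding nn_integral_hb[OF u0(1) s(2)]
          by (rule member_le_sum[of x UNIV "\<lambda>z. ennreal (\<beta> u z) * ennreal (prob (hit u z \<inter> hit t x))"]) auto
        finally show ?thesis using u by simp
      qed simp
    qed
    also have "\<dots> = (\<integral>\<^sup>+w. (\<integral>\<^sup>+u\<in>{s..t}. hb x t w u \<partial>lborel) \<partial>M)"
    proof -
      have [measurable]: "(\<lambda>w. hb x t w u) \<in> borel_measurable M" for u
        using measurable_Pair1[OF hb_joint[OF s(2), of x], of u] by simp
      have "(\<integral>\<^sup>+w. (\<integral>\<^sup>+u. hb x t w u * indicator {s..t} u \<partial>lborel) \<partial>M) = (\<integral>\<^sup>+u. (\<integral>\<^sup>+w. hb x t w u * indicator {s..t} u \<partial>M) \<partial>lborel)"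
        by (intro P.Fubini'[symmetric]) measurable
      then show ?thesis by (simp add: nn_integral_multc)
    qed
    also have "\<dots> = (\<integral>\<^sup>+w. indicator (hit t x) w * ennreal (A s t w) \<partial>M)"
      using s st by (intro nn_integral_cong hb_integral[symmetric])
    also have "\<dots> = (\<integral>\<^sup>+w. indicator (hit t x) w * of_nat (N t w - N s w) \<partial>M)"
      using s st by (intro nn_integral_inc[symmetric] hit_F0)
    also have "\<dots> = (\<integral>\<^sup>+w. ZS x s t w \<partial>M)"
      by (intro nn_integral_cong) (simp add: ZS_def mult.commute)
    finally show ?thesis by simp
  next
    case False
    have "0 \<le> (LBINT u:{s..t}. \<beta> u x)"
      unfolding set_lebesgue_integral_def using \<beta>_nonneg s
      by (intro Bochner_Integration.integral_nonneg) (auto split: split_indicator)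
    then have "\<delta> * (1 - \<Lambda> * (t - s)) * (LBINT u:{s..t}. \<beta> u x) - 0 * (t - s)\<^sup>2 \<le> 0"
      using False \<delta> by (simp add: mult_nonpos_nonneg mult_nonneg_nonpos)
    then show ?thesis by (simp only: ennreal_neg) simp
  qed
next
  fix s t u assume "a \<le> s" "s \<le> t" "t \<le> u" "u \<le> c"
  then show "(LBINT v:{s..u}. \<beta> v x) = (LBINT v:{s..t}. \<beta> v x) + (LBINT v:{t..u}. \<beta> v x)"
    using ab by (intro set_integral_Icc_split set_integrable_\<beta>) auto
qed (use ab in auto)

end

section \<open>From a linear variance bound and monotonicity to almost sure convergence\<close>

section \<open>A strong law for monotone processes\<close>

text \<open>Between two consecutive squares monotonicity brackets \<open>f t / g t\<close> by
  \<open>?lo\<close> and \<open>?hi\<close>, that is, by the quotients along the squares divided or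
  multiplied by the ratio of consecutive values of \<open>g\<close>.\<close>

lemma ratio_tendsto_one_from_squares:
  fixes f g :: "real \<Rightarrow> real"
  assumes f: "\<And>s t. 0 \<le> s \<Longrightarrow> s \<le> t \<Longrightarrow> f s \<le> f t" "0 \<le> f 0"
    and g: "\<And>s t. 0 \<le> s \<Longrightarrow> s \<le> t \<Longrightarrow> g s \<le> g t" "\<And>n. 2 \<le> n \<Longrightarrow> 0 < g ((real n)\<^sup>2)"
    and lim: "(\<lambda>n. f ((real n)\<^sup>2) / g ((real n)\<^sup>2)) \<longlonglongrightarrow> 1"
    and ratio: "(\<lambda>n. g ((real (Suc n))\<^sup>2) / g ((real n)\<^sup>2)) \<longlonglongrightarrow> 1"
  shows "((\<lambda>t. f t / g t) \<longlongrightarrow> 1) at_top"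
proof -
  define m where "m t = nat \<lfloor>sqrt t\<rfloor>" for t
  have m: "filterlim m sequentially at_top"
    unfolding filterlim_at_top
  proof (intro allI)
    fix N
    show "\<forall>\<^sub>F t in at_top. N \<le> m t"
    proof (rule eventually_at_top_linorderI)
      fix t assume "(real N)\<^sup>2 \<le> t"
      then have "real N \<le> sqrt t" by (rule real_le_rsqrt)
      then show "N \<le> m t" by (simp add: m_def le_nat_floor)
    qed
  qed
  have m_le: "(real (m t))\<^sup>2 \<le> t" "t \<le> (real (Suc (m t)))\<^sup>2" if "4 \<le> t" for t
  proof -
    have s: "0 \<le> sqrt t" using that by simp
    have "real (m t) \<le> sqrt t" using s by (simp add: m_def)
    then have "(real (m t))\<^sup>2 \<le> (sqrt t)\<^sup>2" by (intro power_mono) auto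
    then show "(real (m t))\<^sup>2 \<le> t" using that by simp
    have "sqrt t \<le> real (Suc (m t))" using s unfolding m_def by linarith
    then have "(sqrt t)\<^sup>2 \<le> (real (Suc (m t)))\<^sup>2" using s by (intro power_mono)
    then show "t \<le> (real (Suc (m t)))\<^sup>2" using that by simp
  qed
  have m1: "2 \<le> m t" if "4 \<le> t" for t
  proof -
    have "2 \<le> sqrt t" using that by (intro real_le_rsqrt) simp
    then show ?thesis by (simp add: m_def le_nat_floor)
  qed
  have f0: "0 \<le> f t" if "0 \<le> t" for t using f(1)[of 0 t] f(2) that by simp
  let ?lo = "\<lambda>n. (f ((real n)\<^sup>2) / g ((real n)\<^sup>2)) / (g ((real (Suc n))\<^sup>2) / g ((real n)\<^sup>2))"
  let ?hi = "\<lambda>n. (f ((real (Suc n))\<^sup>2) / g ((real (Suc n))\<^sup>2)) * (g ((real (Suc n))\<^sup>2) / g ((real n)\<^sup>2))"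
  have lo: "?lo \<longlonglongrightarrow> 1" using tendsto_divide[OF lim ratio] by simp
  have hi: "?hi \<longlonglongrightarrow> 1" using tendsto_mult[OF LIMSEQ_Suc[OF lim] ratio] by simp
  have ev: "\<forall>\<^sub>F t in at_top. (4::real) \<le> t" by (rule eventually_ge_at_top)
  show ?thesis
  proof (rule tendsto_sandwich[OF _ _ filterlim_compose[OF lo m] filterlim_compose[OF hi m]])
    show "\<forall>\<^sub>F t in at_top. ?lo (m t) \<le> f t / g t"
      using ev
    proof eventually_elim
      case (elim t)
      let ?n = "m t"
      have gp: "0 < g ((real ?n)\<^sup>2)" "0 < g ((real (Suc ?n))\<^sup>2)" using m1[OF elim] g(2)[of ?n] g(2)[of "Suc ?n"] by auto
      have gt: "g ((real ?n)\<^sup>2) \<le> g t" "g t \<le> g ((real (Suc ?n))\<^sup>2)"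
        using m_le[OF elim] elim g(1) by auto
      have "?lo ?n = f ((real ?n)\<^sup>2) / g ((real (Suc ?n))\<^sup>2)" using gp by (simp del: of_nat_Suc)
      also have "\<dots> \<le> f t / g t"
        using m_le[OF elim] elim gp gt by (intro frac_le f f0) auto
      finally show ?case .
    qed
    show "\<forall>\<^sub>F t in at_top. f t / g t \<le> ?hi (m t)"
      using ev
    proof eventually_elim
      case (elim t)
      let ?n = "m t"
      have gp: "0 < g ((real ?n)\<^sup>2)" "0 < g ((real (Suc ?n))\<^sup>2)" using m1[OF elim] g(2)[of ?n] g(2)[of "Suc ?n"] by auto
      have gt: "g ((real ?n)\<^sup>2) \<le> g t"
        using m_le[OF elim] elim g(1) by auto
      have "f t / g t \<le> f ((real (Suc ?n))\<^sup>2) / g ((real ?n)\<^sup>2)"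
        using m_le[OF elim] elim gp gt by (intro frac_le f f0) auto
      also have "\<dots> = ?hi ?n" using gp by (simp del: of_nat_Suc)
      finally show "f t / g t \<le> ?hi ?n" .
    qed
  qed
qed

text \<open>Chebyshev and Borel-Cantelli merged into one step: the series of squared relative
  deviations along the squares has finite mean, so it converges almost surely and its terms tend to
  zero.\<close>

lemma (in prob_space) monotone_strong_law:
  fixes R :: "real \<Rightarrow> 'a \<Rightarrow> real"
  assumes meas: "\<And>t. 0 \<le> t \<Longrightarrow> R t \<in> borel_measurable M"
    and mono: "AE w in M. (\<forall>s t. 0 \<le> s \<longrightarrow> s \<le> t \<longrightarrow> R s w \<le> R t w) \<and> 0 \<le> R 0 w"
    and sq: "\<And>n::nat. integrable M (\<lambda>w. (R (real n) w)\<^sup>2)"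
    and var: "\<And>n::nat. expectation (\<lambda>w. (R (real n) w)\<^sup>2) \<le> (expectation (R (real n)))\<^sup>2 + K * real n"
    and low: "0 < c" "\<And>n::nat. c * (real n - 1) \<le> expectation (R (real n))"
    and inc: "\<And>n::nat. expectation (R (real (Suc n))) \<le> expectation (R (real n)) + Bd"
    and K: "0 \<le> K"
  shows "AE w in M. ((\<lambda>t. R t w / expectation (R t)) \<longlongrightarrow> 1) at_top"
proof -
  have int_n: "integrable M (R (real n))" for n :: nat
    by (rule square_integrable_imp_integrable[OF _ sq]) (simp add: meas)
  have int: "integrable M (R t)" if t: "0 \<le> t" for t
  proof (rule Bochner_Integration.integrable_bound[OF int_n[of "nat \<lceil>t\<rceil>"] meas[OF t]])
    have le: "t \<le> real (nat \<lceil>t\<rceil>)" using t by linarith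
    show "AE w in M. norm (R t w) \<le> norm (R (real (nat \<lceil>t\<rceil>)) w)"
      using mono
    proof eventually_elim
      case (elim w)
      then have "0 \<le> R 0 w" "R 0 w \<le> R t w" "R t w \<le> R (real (nat \<lceil>t\<rceil>)) w" using t le by auto
      then show ?case by simp
    qed
  qed
  define g where "g t = expectation (R t)" for t
  have g_mono: "g s \<le> g t" if "0 \<le> s" "s \<le> t" for s t
    unfolding g_def using mono that by (intro integral_mono_AE int) (auto elim: eventually_mono)
  have g_diff: "g (real (n + k)) \<le> g (real n) + Bd * real k" for n k
  proof (induct k)
    case (Suc k)
    then show ?case using inc[of "n + k"] by (simp add: g_def algebra_simps)
  qed simp
  have Bd: "0 \<le> Bd" using inc[of 0] g_mono[of 0 1] by (simp add: g_def)
  \<comment> \<open>For \<open>n \<ge> 2\<close> the number \<open>n^2 - 1\<close> is at least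
    \<open>n^2 / 2\<close>, which absorbs the shift by one in the lower bound
    \<open>low\<close>.\<close>
  have g_sq: "c * ((real n)\<^sup>2 / 2) \<le> g ((real n)\<^sup>2)" "0 < g ((real n)\<^sup>2)" if n: "2 \<le> n" for n
  proof -
    have "(2::real)\<^sup>2 \<le> (real n)\<^sup>2" using n by (intro power_mono) auto
    then have "(real n)\<^sup>2 / 2 \<le> real (n\<^sup>2) - 1" by simp
    then have "c * ((real n)\<^sup>2 / 2) \<le> c * (real (n\<^sup>2) - 1)" using low(1) by (intro mult_left_mono) auto
    also have "\<dots> \<le> g (real (n\<^sup>2))" unfolding g_def by (rule low(2))
    finally show le: "c * ((real n)\<^sup>2 / 2) \<le> g ((real n)\<^sup>2)" by simp
    have "0 < c * ((real n)\<^sup>2 / 2)" using low(1) n by simp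
    with le show "0 < g ((real n)\<^sup>2)" by linarith
  qed
  \<comment> \<open>Between consecutive squares lie \<open>2 * n + 1 \<le> 3 * n\<close> unit steps,
    each raising the mean by at most \<open>Bd\<close>, against a mean of at least
    \<open>c * n^2 / 2\<close>; this explains \<open>6 * Bd / c\<close>.\<close>
  have ratio: "(\<lambda>n. g ((real (Suc n))\<^sup>2) / g ((real n)\<^sup>2)) \<longlonglongrightarrow> 1"
  proof (rule tendsto_sandwich[OF _ _ tendsto_const])
    have ge2: "\<forall>\<^sub>F n in sequentially. 2 \<le> n" by (rule eventually_ge_at_top)
    show "\<forall>\<^sub>F n in sequentially. 1 \<le> g ((real (Suc n))\<^sup>2) / g ((real n)\<^sup>2)"
      using ge2
    proof eventually_elim
      case (elim n)
      have "g ((real n)\<^sup>2) \<le> g ((real (Suc n))\<^sup>2)" by (intro g_mono power_mono) auto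
      then show ?case using g_sq(2)[OF elim] by (simp add: le_divide_eq)
    qed
    show "\<forall>\<^sub>F n in sequentially. g ((real (Suc n))\<^sup>2) / g ((real n)\<^sup>2) \<le> 1 + (6 * Bd / c) / real n"
      using ge2
    proof eventually_elim
      case (elim n)
      have "g (real (n\<^sup>2 + (2 * n + 1))) \<le> g (real (n\<^sup>2)) + Bd * real (2 * n + 1)" by (rule g_diff)
      moreover have "real (n\<^sup>2 + (2 * n + 1)) = (real (Suc n))\<^sup>2" by (simp add: power2_eq_square algebra_simps)
      ultimately have "g ((real (Suc n))\<^sup>2) \<le> g ((real n)\<^sup>2) + Bd * real (2 * n + 1)" by simp
      also have "Bd * real (2 * n + 1) \<le> Bd * (3 * real n)" using Bd elim by (intro mult_left_mono) auto
      also have "Bd * (3 * real n) = (6 * Bd / c) / real n * (c * ((real n)\<^sup>2 / 2))"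
        using low(1) elim by (simp add: field_simps power2_eq_square)
      also have "\<dots> \<le> (6 * Bd / c) / real n * g ((real n)\<^sup>2)"
        using Bd low(1) by (intro mult_left_mono g_sq elim) auto
      finally have "g ((real (Suc n))\<^sup>2) \<le> (1 + (6 * Bd / c) / real n) * g ((real n)\<^sup>2)" by (simp add: algebra_simps)
      then show ?case using g_sq(2)[OF elim] by (simp add: pos_divide_le_eq)
    qed
    have "(\<lambda>n. 1 + (6 * Bd / c) / real n) \<longlonglongrightarrow> 1 + 0" by (intro tendsto_add tendsto_const lim_const_over_n)
    then show "(\<lambda>n. 1 + (6 * Bd / c) / real n) \<longlonglongrightarrow> 1" by simp
  qed
  let ?x = "\<lambda>n w. R ((real n)\<^sup>2) w / g ((real n)\<^sup>2) - 1"
  have U: "(\<integral>\<^sup>+w. ennreal ((?x n w)\<^sup>2) \<partial>M) \<le> ennreal (4 * K / c\<^sup>2 * inverse (real n ^ 2))" if n: "2 \<le> n" for n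
  proof -
    let ?g = "g ((real n)\<^sup>2)" and ?R = "R ((real n)\<^sup>2)"
    have gp: "0 < ?g" by (rule g_sq(2)[OF n])
    have i1: "integrable M ?R" using int_n[of "n\<^sup>2"] by simp
    have i2: "integrable M (\<lambda>w. (?R w)\<^sup>2)" using sq[of "n\<^sup>2"] by simp
    have e: "(?x n w)\<^sup>2 = (?R w)\<^sup>2 / ?g\<^sup>2 - 2 * (?R w / ?g) + 1" for w
      by (simp add: power2_diff power_divide)
    have int: "integrable M (\<lambda>w. (?x n w)\<^sup>2)" unfolding e using i1 i2 by simp
    have "expectation (\<lambda>w. (?x n w)\<^sup>2) = expectation (\<lambda>w. (?R w)\<^sup>2) / ?g\<^sup>2 - 2 * (?g / ?g) + 1"
      unfolding e using i1 i2 by (simp add: g_def prob_space)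
    also have "\<dots> = (expectation (\<lambda>w. (?R w)\<^sup>2) - ?g\<^sup>2) / ?g\<^sup>2"
      using gp by (simp add: field_simps)
    also have "\<dots> \<le> (K * (real n)\<^sup>2) / ?g\<^sup>2"
      using var[of "n\<^sup>2"] by (intro divide_right_mono) (simp_all add: g_def)
    also have "\<dots> \<le> (K * (real n)\<^sup>2) / (c * ((real n)\<^sup>2 / 2))\<^sup>2"
      using K low(1) n g_sq[OF n] by (intro divide_left_mono power_mono mult_nonneg_nonneg mult_pos_pos) auto
    also have "\<dots> = 4 * K / c\<^sup>2 * inverse (real n ^ 2)"
      using n low(1) by (simp add: field_simps power2_eq_square)
    finally have "expectation (\<lambda>w. (?x n w)\<^sup>2) \<le> 4 * K / c\<^sup>2 * inverse (real n ^ 2)" .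
    then show ?thesis using int by (subst nn_integral_eq_integral) (auto intro: ennreal_leI)
  qed
  have [measurable]: "R ((real n)\<^sup>2) \<in> borel_measurable M" for n by (rule meas) simp
  have "(\<integral>\<^sup>+w. (\<Sum>n. ennreal ((?x (n + 2) w)\<^sup>2)) \<partial>M) = (\<Sum>n. \<integral>\<^sup>+w. ennreal ((?x (n + 2) w)\<^sup>2) \<partial>M)"
    by (intro nn_integral_suminf) measurable
  also have "\<dots> \<le> (\<Sum>n. ennreal (4 * K / c\<^sup>2 * inverse (real (n + 2) ^ 2)))"
    by (intro suminf_le U) auto
  also have "\<dots> < \<infinity>"
  proof -
    have "summable (\<lambda>n. inverse (real n ^ 2))" by (rule inverse_power_summable) simp
    then have "summable (\<lambda>n. inverse (real (n + 2) ^ 2))" by (rule summable_ignore_initial_segment)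
    then have "summable (\<lambda>n. 4 * K / c\<^sup>2 * inverse (real (n + 2) ^ 2))" by (rule summable_mult)
    moreover have "0 \<le> 4 * K / c\<^sup>2 * inverse (real (i + 2) ^ 2)" for i using K by simp
    ultimately have "(\<Sum>n. ennreal (4 * K / c\<^sup>2 * inverse (real (n + 2) ^ 2))) \<noteq> top"
      by (rule ennreal_suminf_neq_top)
    then show ?thesis by (simp only: infinity_ennreal_def top.not_eq_extremum)
  qed
  finally have fin: "(\<integral>\<^sup>+w. (\<Sum>n. ennreal ((?x (n + 2) w)\<^sup>2)) \<partial>M) \<noteq> \<infinity>" by simp
  have "AE w in M. (\<Sum>n. ennreal ((?x (n + 2) w)\<^sup>2)) \<noteq> \<infinity>"
    by (rule nn_integral_PInf_AE[OF _ fin]) measurable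
  then show ?thesis
    using mono
  proof eventually_elim
    case (elim w)
    have "summable (\<lambda>n. (?x (n + 2) w)\<^sup>2)"
      using elim(1) by (intro summable_suminf_not_top) auto
    then have "(\<lambda>n. (?x (n + 2) w)\<^sup>2) \<longlonglongrightarrow> 0" by (rule summable_LIMSEQ_zero)
    then have "(\<lambda>n. sqrt ((?x (n + 2) w)\<^sup>2)) \<longlonglongrightarrow> sqrt 0" by (rule tendsto_real_sqrt)
    then have "(\<lambda>n. ?x (n + 2) w) \<longlonglongrightarrow> 0" by (simp add: tendsto_rabs_zero_iff)
    then have "(\<lambda>n. ?x n w) \<longlonglongrightarrow> 0" by (rule LIMSEQ_offset)
    from tendsto_add[OF this tendsto_const[of 1]]
    have lim: "(\<lambda>n. R ((real n)\<^sup>2) w / g ((real n)\<^sup>2)) \<longlonglongrightarrow> 1" by simp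
    have "((\<lambda>t. R t w / g t) \<longlongrightarrow> 1) at_top"
      using elim(2) g_mono g_sq(2) lim ratio by (intro ratio_tendsto_one_from_squares) auto
    then show ?case by (simp add: g_def)
  qed
qed

section \<open>Variance of sums of mixing blocks\<close>

lemma sum_geometric_dist_le:
  fixes \<rho> :: real
  assumes \<rho>: "0 < \<rho>" "\<rho> < 1"
  shows "(\<Sum>j<n. \<rho> ^ (if i \<le> j then j - i else i - j)) \<le> 2 / (1 - \<rho>)"
proof -
  have geo: "(\<Sum>k<m. \<rho> ^ k) \<le> 1 / (1 - \<rho>)" for m
    using sum_le_suminf[OF summable_geometric[of \<rho>], of "{..<m}"] suminf_geometric[of \<rho>] \<rho> by simp
  have "(\<Sum>j<n. \<rho> ^ (if i \<le> j then j - i else i - j))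
      \<le> (\<Sum>j<n. (if i \<le> j then \<rho> ^ (j - i) else 0) + (if j \<le> i then \<rho> ^ (i - j) else 0))"
    using \<rho> by (intro sum_mono) auto
  also have "\<dots> = (\<Sum>j<n. if i \<le> j then \<rho> ^ (j - i) else 0) + (\<Sum>j<n. if j \<le> i then \<rho> ^ (i - j) else 0)"
    by (rule sum.distrib)
  also have "(\<Sum>j<n. if i \<le> j then \<rho> ^ (j - i) else 0) \<le> (\<Sum>k<n. \<rho> ^ k)"
  proof -
    have "(\<Sum>j<n. if i \<le> j then \<rho> ^ (j - i) else 0) = (\<Sum>j\<in>{i..<n}. \<rho> ^ (j - i))"
      by (rule sum.mono_neutral_cong_right) auto
    also have "\<dots> = (\<Sum>k\<in>(\<lambda>j. j - i) ` {i..<n}. \<rho> ^ k)"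
      by (subst sum.reindex) (auto simp: inj_on_def)
    also have "\<dots> \<le> (\<Sum>k<n. \<rho> ^ k)" using \<rho> by (intro sum_mono2) auto
    finally show ?thesis .
  qed
  also have "(\<Sum>j<n. if j \<le> i then \<rho> ^ (i - j) else 0) \<le> (\<Sum>k<Suc i. \<rho> ^ k)"
  proof -
    have "(\<Sum>j<n. if j \<le> i then \<rho> ^ (i - j) else 0) = (\<Sum>j\<in>{..<n} \<inter> {..i}. \<rho> ^ (i - j))"
      by (rule sum.mono_neutral_cong_right) auto
    also have "\<dots> = (\<Sum>k\<in>(\<lambda>j. i - j) ` ({..<n} \<inter> {..i}). \<rho> ^ k)"
      by (subst sum.reindex) (auto simp: inj_on_def)
    also have "\<dots> \<le> (\<Sum>k<Suc i. \<rho> ^ k)" using \<rho> by (intro sum_mono2) auto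
    finally show ?thesis .
  qed
  also note geo[of "Suc i"]
  also note geo[of n]
  finally show ?thesis by simp
qed

context prob_space
begin

text \<open>Block \<open>i\<close> belongs to the \<open>i\<close>th unit of time, so
  \<open>j - i - 1\<close> is the length of the gap before block \<open>j\<close>. Adjacent blocks
  have no gap; their correlation is left to the bound on second moments.\<close>

definition mixing_blocks :: "(nat \<Rightarrow> 'a \<Rightarrow> real) \<Rightarrow> real \<Rightarrow> real \<Rightarrow> real \<Rightarrow> bool" where
  "mixing_blocks D B C \<rho> \<longleftrightarrow> 0 \<le> B \<and> 0 \<le> C \<and> 0 < \<rho> \<and> \<rho> < 1 \<and>
    (\<forall>i. D i \<in> borel_measurable M \<and> (AE w in M. 0 \<le> D i w) \<and> (\<integral>\<^sup>+w. (ennreal (D i w))\<^sup>2 \<partial>M) \<le> ennreal B) \<and>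
    (\<forall>i j. i + 2 \<le> j \<longrightarrow> (\<integral>\<^sup>+w. ennreal (D i w) * ennreal (D j w) \<partial>M)
      \<le> ennreal (1 + C * \<rho> ^ (j - i - 1)) * (\<integral>\<^sup>+w. ennreal (D i w) \<partial>M) * (\<integral>\<^sup>+w. ennreal (D j w) \<partial>M))"

text \<open>Everything follows from square integrability. The inequality
  \<open>x \<le> 1 + x^2\<close> bounds the mean without a root, and
  \<open>2 * x * y \<le> x^2 + y^2\<close> makes the products integrable.\<close>

lemma mixing_blocks_moments:
  assumes D: "mixing_blocks D B C \<rho>"
  shows "integrable M (\<lambda>w. (D i w)\<^sup>2)" "expectation (\<lambda>w. (D i w)\<^sup>2) \<le> B" "integrable M (D i)"
    "0 \<le> expectation (D i)" "expectation (D i) \<le> 1 + B" "integrable M (\<lambda>w. D i w * D j w)"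
    "(\<integral>\<^sup>+w. ennreal (D i w) \<partial>M) = ennreal (expectation (D i))"
proof -
  have m [measurable]: "D i \<in> borel_measurable M" for i using D by (simp add: mixing_blocks_def)
  have pos: "AE w in M. 0 \<le> D i w" for i using D by (simp add: mixing_blocks_def)
  have B: "0 \<le> B" using D by (simp add: mixing_blocks_def)
  have nn: "(\<integral>\<^sup>+w. ennreal ((D i w)\<^sup>2) \<partial>M) \<le> ennreal B" for i
  proof -
    have "(\<integral>\<^sup>+w. ennreal ((D i w)\<^sup>2) \<partial>M) = (\<integral>\<^sup>+w. (ennreal (D i w))\<^sup>2 \<partial>M)"
      using pos[of i] by (intro nn_integral_cong_AE) (auto elim!: eventually_mono simp: ennreal_power)
    then show ?thesis using D by (simp add: mixing_blocks_def)
  qed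
  show sq: "integrable M (\<lambda>w. (D i w)\<^sup>2)" for i
    using nn[of i] by (intro integrableI_nonneg) (auto intro: order.strict_trans1)
  have "ennreal (expectation (\<lambda>w. (D i w)\<^sup>2)) \<le> ennreal B" for i
    using nn[of i] sq[of i] by (subst nn_integral_eq_integral[symmetric]) auto
  then show EB: "expectation (\<lambda>w. (D i w)\<^sup>2) \<le> B" for i using B by simp
  show int: "integrable M (D i)" for i
    by (rule square_integrable_imp_integrable[OF m sq])
  show "0 \<le> expectation (D i)" by (rule integral_nonneg_AE[OF pos])
  have "expectation (D i) \<le> expectation (\<lambda>w. 1 + (D i w)\<^sup>2)"
  proof (rule integral_mono)
    fix w
    show "D i w \<le> 1 + (D i w)\<^sup>2"
    proof -
      have "0 \<le> (D i w - 1)\<^sup>2" by simp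
      then have "2 * D i w \<le> (D i w)\<^sup>2 + 1" by (simp add: power2_diff)
      then show ?thesis using zero_le_power2[of "D i w"] by linarith
    qed
  qed (use int sq in auto)
  also have "\<dots> = 1 + expectation (\<lambda>w. (D i w)\<^sup>2)" using sq by (simp add: prob_space)
  finally show "expectation (D i) \<le> 1 + B" using EB[of i] by simp
  show "integrable M (\<lambda>w. D i w * D j w)"
  proof (rule Bochner_Integration.integrable_bound)
    show "integrable M (\<lambda>w. (D i w)\<^sup>2 + (D j w)\<^sup>2)" using sq by simp
    show "AE w in M. norm (D i w * D j w) \<le> norm ((D i w)\<^sup>2 + (D j w)\<^sup>2)"
    proof (rule AE_I2)
      fix w
      have "0 \<le> (\<bar>D i w\<bar> - \<bar>D j w\<bar>)\<^sup>2" by simp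
      then have "2 * (\<bar>D i w\<bar> * \<bar>D j w\<bar>) \<le> (D i w)\<^sup>2 + (D j w)\<^sup>2" by (simp add: power2_diff)
      moreover have "0 \<le> \<bar>D i w\<bar> * \<bar>D j w\<bar>" by simp
      ultimately have "\<bar>D i w\<bar> * \<bar>D j w\<bar> \<le> (D i w)\<^sup>2 + (D j w)\<^sup>2" by linarith
      then show "norm (D i w * D j w) \<le> norm ((D i w)\<^sup>2 + (D j w)\<^sup>2)" by (simp add: abs_mult)
    qed
  qed measurable
  show "(\<integral>\<^sup>+w. ennreal (D i w) \<partial>M) = ennreal (expectation (D i))"
    by (rule nn_integral_eq_integral[OF int pos])
qed

lemma mixing_blocks_variance:
  assumes D: "mixing_blocks D B C \<rho>"
  obtains K where "0 \<le> K" "\<And>n. integrable M (\<lambda>w. (\<Sum>i<n. D i w)\<^sup>2)"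
    "\<And>n. expectation (\<lambda>w. (\<Sum>i<n. D i w)\<^sup>2) \<le> (\<Sum>i<n. expectation (D i))\<^sup>2 + K * real n"
proof -
  have c: "0 \<le> B" "0 \<le> C" "0 < \<rho>" "\<rho> < 1" using D by (auto simp: mixing_blocks_def)
  note mom = mixing_blocks_moments[OF D]
  have pos: "AE w in M. 0 \<le> D i w" for i using D by (simp add: mixing_blocks_def)
  \<comment> \<open>Division by \<open>\<rho>\<close> converts the exponent \<open>j - i - 1\<close>
    into the distance \<open>j - i\<close>, and it lets \<open>B\<close> cover equal and adjacent
    indices, for which \<open>\<rho> \<le> \<rho> ^ (j - i)\<close>.\<close>
  define K' where "K' = (B + C * (1 + B)\<^sup>2) / \<rho>"
  have K': "0 \<le> K'" using c by (simp add: K'_def)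
  have close: "expectation (\<lambda>w. D i w * D j w) \<le> B" for i j
  proof -
    have "expectation (\<lambda>w. D i w * D j w) \<le> expectation (\<lambda>w. ((D i w)\<^sup>2 + (D j w)\<^sup>2) / 2)"
    proof (rule integral_mono)
      show "integrable M (\<lambda>w. ((D i w)\<^sup>2 + (D j w)\<^sup>2) / 2)" using mom(1) by simp
      fix w
      have "0 \<le> (D i w - D j w)\<^sup>2" by simp
      then show "D i w * D j w \<le> ((D i w)\<^sup>2 + (D j w)\<^sup>2) / 2" by (simp add: power2_diff)
    qed (rule mom)
    also have "\<dots> = (expectation (\<lambda>w. (D i w)\<^sup>2) + expectation (\<lambda>w. (D j w)\<^sup>2)) / 2" using mom(1) by simp
    also have "\<dots> \<le> B" using mom(2)[of i] mom(2)[of j] by simp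
    finally show ?thesis .
  qed
  have cov: "expectation (\<lambda>w. D i w * D j w) \<le> expectation (D i) * expectation (D j) + K' * \<rho> ^ (j - i)"
    if ij: "i \<le> j" for i j
  proof (cases "i + 2 \<le> j")
    case True
    have AEp: "AE w in M. 0 \<le> D i w * D j w" using pos[of i] pos[of j] by eventually_elim simp
    have "ennreal (expectation (\<lambda>w. D i w * D j w)) = (\<integral>\<^sup>+w. ennreal (D i w * D j w) \<partial>M)"
      by (rule nn_integral_eq_integral[OF mom(6) AEp, symmetric])
    also have "\<dots> = (\<integral>\<^sup>+w. ennreal (D i w) * ennreal (D j w) \<partial>M)"
      using pos[of i] by (intro nn_integral_cong_AE) (auto elim!: eventually_mono simp: ennreal_mult')
    also have "\<dots> \<le> ennreal (1 + C * \<rho> ^ (j - i - 1)) * ennreal (expectation (D i)) * ennreal (expectation (D j))"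
      using D True unfolding mixing_blocks_def mom(7)[symmetric] by blast
    also have "\<dots> = ennreal ((1 + C * \<rho> ^ (j - i - 1)) * expectation (D i) * expectation (D j))"
      using c mom(4) by (simp add: ennreal_mult)
    finally have "expectation (\<lambda>w. D i w * D j w) \<le> (1 + C * \<rho> ^ (j - i - 1)) * expectation (D i) * expectation (D j)"
      using c mom(4) by (subst (asm) ennreal_le_iff) auto
    also have "\<dots> = expectation (D i) * expectation (D j) + C * \<rho> ^ (j - i - 1) * (expectation (D i) * expectation (D j))"
      by (simp add: algebra_simps)
    also have "C * \<rho> ^ (j - i - 1) * (expectation (D i) * expectation (D j)) \<le> C * \<rho> ^ (j - i - 1) * ((1 + B) * (1 + B))"
      using c mom(4,5) by (intro mult_left_mono mult_mono) auto
    also have "\<dots> = C * (1 + B)\<^sup>2 / \<rho> * \<rho> ^ (j - i)"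
    proof -
      have "\<rho> ^ (j - i) = \<rho> * \<rho> ^ (j - i - 1)" using True by (simp add: power_Suc[symmetric] Suc_diff_Suc del: power_Suc)
      then show ?thesis using c by (simp add: power2_eq_square)
    qed
    also have "\<dots> \<le> K' * \<rho> ^ (j - i)"
      using c unfolding K'_def by (intro mult_right_mono divide_right_mono) auto
    finally show ?thesis by simp
  next
    case False
    then have "j - i = 0 \<or> j - i = 1" using ij by auto
    then have "\<rho> \<le> \<rho> ^ (j - i)" using c by auto
    then have "B / \<rho> * \<rho> \<le> K' * \<rho> ^ (j - i)"
      using c unfolding K'_def by (intro mult_mono divide_right_mono) auto
    then have "B \<le> K' * \<rho> ^ (j - i)" using c by simp
    moreover have "0 \<le> expectation (D i) * expectation (D j)" using mom(4) by simp
    ultimately show ?thesis using close[of i j] by linarith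
  qed
  have cov': "expectation (\<lambda>w. D i w * D j w)
      \<le> expectation (D i) * expectation (D j) + K' * \<rho> ^ (if i \<le> j then j - i else i - j)" for i j
    using cov[of i j] cov[of j i] by (cases "i \<le> j") (auto simp: mult.commute)
  have sq: "(\<Sum>i<n. D i w)\<^sup>2 = (\<Sum>i<n. \<Sum>j<n. D i w * D j w)" for n w
    by (simp add: power2_eq_square sum_product)
  show ?thesis
  proof (rule that[of "K' * (2 / (1 - \<rho>))"])
    show "0 \<le> K' * (2 / (1 - \<rho>))" using K' c by simp
    show "integrable M (\<lambda>w. (\<Sum>i<n. D i w)\<^sup>2)" for n
      unfolding sq by (intro Bochner_Integration.integrable_sum mom(6))
    fix n
    have "expectation (\<lambda>w. (\<Sum>i<n. D i w)\<^sup>2) = (\<Sum>i<n. \<Sum>j<n. expectation (\<lambda>w. D i w * D j w))"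
      unfolding sq using mom(6) by (simp add: Bochner_Integration.integral_sum)
    also have "\<dots> \<le> (\<Sum>i<n. \<Sum>j<n. expectation (D i) * expectation (D j) + K' * \<rho> ^ (if i \<le> j then j - i else i - j))"
      by (intro sum_mono cov')
    also have "\<dots> = (\<Sum>i<n. expectation (D i))\<^sup>2 + (\<Sum>i<n. K' * (\<Sum>j<n. \<rho> ^ (if i \<le> j then j - i else i - j)))"
      unfolding power2_eq_square sum_product by (simp only: sum.distrib sum_distrib_left)
    also have "(\<Sum>i<n. K' * (\<Sum>j<n. \<rho> ^ (if i \<le> j then j - i else i - j))) \<le> (\<Sum>i<n. K' * (2 / (1 - \<rho>)))"
      using K' c by (intro sum_mono mult_left_mono sum_geometric_dist_le) auto
    also have "\<dots> = K' * (2 / (1 - \<rho>)) * real n" by (simp add: mult.commute)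
    finally show "expectation (\<lambda>w. (\<Sum>i<n. D i w)\<^sup>2) \<le> (\<Sum>i<n. expectation (D i))\<^sup>2 + K' * (2 / (1 - \<rho>)) * real n"
      by simp
  qed
qed

text \<open>The variance of \<open>f - g\<close> is nonnegative, so that of \<open>f + g\<close> is
  at most twice the sum of the two variances. The dependence between the parts of the reward
  therefore never has to be studied.\<close>

lemma second_moment_add:
  fixes f g :: "'a \<Rightarrow> real"
  assumes m: "f \<in> borel_measurable M" "g \<in> borel_measurable M"
    and sq: "integrable M (\<lambda>w. (f w)\<^sup>2)" "integrable M (\<lambda>w. (g w)\<^sup>2)"
    and v: "expectation (\<lambda>w. (f w)\<^sup>2) \<le> (expectation f)\<^sup>2 + v" "expectation (\<lambda>w. (g w)\<^sup>2) \<le> (expectation g)\<^sup>2 + v'"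
  shows "integrable M (\<lambda>w. (f w + g w)\<^sup>2)"
    "expectation (\<lambda>w. (f w + g w)\<^sup>2) \<le> (expectation (\<lambda>w. f w + g w))\<^sup>2 + 2 * (v + v')"
proof -
  have i: "integrable M f" "integrable M g"
    using square_integrable_imp_integrable m sq by blast+
  have fg: "integrable M (\<lambda>w. f w * g w)"
  proof (rule Bochner_Integration.integrable_bound)
    show "integrable M (\<lambda>w. (f w)\<^sup>2 + (g w)\<^sup>2)" using sq by simp
    show "AE w in M. norm (f w * g w) \<le> norm ((f w)\<^sup>2 + (g w)\<^sup>2)"
    proof (rule AE_I2)
      fix w
      have "0 \<le> (\<bar>f w\<bar> - \<bar>g w\<bar>)\<^sup>2" by simp
      then have "2 * (\<bar>f w\<bar> * \<bar>g w\<bar>) \<le> (f w)\<^sup>2 + (g w)\<^sup>2" by (simp add: power2_diff)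
      moreover have "0 \<le> \<bar>f w\<bar> * \<bar>g w\<bar>" by simp
      ultimately have "\<bar>f w\<bar> * \<bar>g w\<bar> \<le> (f w)\<^sup>2 + (g w)\<^sup>2" by linarith
      then show "norm (f w * g w) \<le> norm ((f w)\<^sup>2 + (g w)\<^sup>2)" by (simp add: abs_mult)
    qed
  qed (use m in measurable)
  have e: "(f w + g w)\<^sup>2 = (f w)\<^sup>2 + (g w)\<^sup>2 + 2 * (f w * g w)" "(f w - g w)\<^sup>2 = (f w)\<^sup>2 + (g w)\<^sup>2 - 2 * (f w * g w)" for w
    by (simp_all add: power2_sum power2_diff)
  show "integrable M (\<lambda>w. (f w + g w)\<^sup>2)" unfolding e using sq fg by simp
  have "0 \<le> variance (\<lambda>w. f w - g w)" by (rule variance_positive)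
  also have "\<dots> = expectation (\<lambda>w. (f w - g w)\<^sup>2) - (expectation (\<lambda>w. f w - g w))\<^sup>2"
    using i sq fg by (intro variance_eq) (simp_all add: e)
  also have "\<dots> = expectation (\<lambda>w. (f w)\<^sup>2) + expectation (\<lambda>w. (g w)\<^sup>2) - 2 * expectation (\<lambda>w. f w * g w)
      - (expectation f - expectation g)\<^sup>2"
    unfolding e using i sq fg by simp
  finally have 1: "2 * expectation (\<lambda>w. f w * g w) \<le> expectation (\<lambda>w. (f w)\<^sup>2) + expectation (\<lambda>w. (g w)\<^sup>2)
      - (expectation f - expectation g)\<^sup>2" by simp
  have "expectation (\<lambda>w. (f w + g w)\<^sup>2) = expectation (\<lambda>w. (f w)\<^sup>2) + expectation (\<lambda>w. (g w)\<^sup>2) + 2 * expectation (\<lambda>w. f w * g w)"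
    unfolding e using sq fg by simp
  also have "\<dots> \<le> 2 * expectation (\<lambda>w. (f w)\<^sup>2) + 2 * expectation (\<lambda>w. (g w)\<^sup>2) - (expectation f - expectation g)\<^sup>2"
    using 1 by simp
  also have "\<dots> \<le> 2 * ((expectation f)\<^sup>2 + v) + 2 * ((expectation g)\<^sup>2 + v') - (expectation f - expectation g)\<^sup>2"
    using v by simp
  also have "\<dots> = (expectation f + expectation g)\<^sup>2 + 2 * (v + v')"
    by (simp add: power2_sum power2_diff)
  finally show "expectation (\<lambda>w. (f w + g w)\<^sup>2) \<le> (expectation (\<lambda>w. f w + g w))\<^sup>2 + 2 * (v + v')"
    using i by simp
qed

end

section \<open>Lump-sum rewards in unit blocks\<close>

context marked_counting
begin

definition "block_reward i w = (\<Sum>k\<in>{C (real i) w<..C (real (Suc i)) w}. W k w)"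

lemma AE_all_rewards: "AE w in M. \<forall>k. 1 \<le> k \<longrightarrow> event_occurs (\<lambda>t. C t w) k \<longrightarrow> 0 \<le> W k w \<and> W k w \<le> c"
  unfolding AE_all_countable
proof
  fix k
  show "AE w in M. 1 \<le> k \<longrightarrow> event_occurs (\<lambda>t. C t w) k \<longrightarrow> 0 \<le> W k w \<and> W k w \<le> c"
  proof (cases "1 \<le> k")
    case True
    with AE_reward_bounds[OF True] show ?thesis by simp
  qed simp
qed

text \<open>Only events that occur enter a block, so the cap in \<open>V\<close> is almost surely
  ineffective and the real-valued sum may be identified with the extended one.\<close>

lemma AE_block_reward: "AE w in M. \<forall>i. 0 \<le> block_reward i w \<and> ennreal (block_reward i w) = reward_sum (real i) (real (Suc i)) w"
  using AE_all_rewards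
proof eventually_elim
  case (elim w)
  show ?case
  proof
    fix i
    have W: "0 \<le> W k w \<and> W k w \<le> c" if "k \<in> {C (real i) w<..C (real (Suc i)) w}" for k
    proof -
      have "event_occurs (\<lambda>t. C t w) k" using that by (intro event_occursI[of "real (Suc i)"]) auto
      then show ?thesis using elim that by auto
    qed
    have "0 \<le> block_reward i w" unfolding block_reward_def using W by (intro sum_nonneg) auto
    moreover have "ennreal (block_reward i w) = (\<Sum>k\<in>{C (real i) w<..C (real (Suc i)) w}. ennreal (W k w))"
      unfolding block_reward_def using W by (intro sum_ennreal[symmetric]) auto
    moreover have "\<dots> = reward_sum (real i) (real (Suc i)) w"
      unfolding reward_sum_def V_def using W by (intro sum.cong refl arg_cong[where f=ennreal]) (auto simp: min_absorb2)
    ultimately show "0 \<le> block_reward i w \<and> ennreal (block_reward i w) = reward_sum (real i) (real (Suc i)) w" by simp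
  qed
qed

lemma block_reward_meas: "block_reward i \<in> borel_measurable M"
proof -
  have [measurable]: "C (real i) \<in> measurable M (count_space UNIV)" "C (real (Suc i)) \<in> measurable M (count_space UNIV)"
    by (intro C_meas'; simp)+
  have "(\<lambda>w. (\<lambda>(a, b) w. \<Sum>k\<in>{a<..b}. W k w) (C (real i) w, C (real (Suc i)) w) w) \<in> borel_measurable M"
  proof (rule measurable_compose_countable)
    fix ab :: "nat \<times> nat"
    obtain a b where ab: "ab = (a, b)" by (cases ab)
    show "(\<lambda>w. (\<lambda>(a, b) w. \<Sum>k\<in>{a<..b}. W k w) ab w) \<in> borel_measurable M"
      unfolding ab prod.case by (intro borel_measurable_sum W_meas) auto
  qed measurable
  then show ?thesis by (simp add: block_reward_def[abs_def])
qed

lemma nn_integral_block_reward: "(\<integral>\<^sup>+w. ennreal (block_reward i w) \<partial>M) = (\<integral>\<^sup>+w. reward_sum (real i) (real (Suc i)) w \<partial>M)"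
  using AE_block_reward by (intro nn_integral_cong_AE) (auto elim: eventually_mono)

lemma reward_sum_le: "reward_sum s t w \<le> ennreal c * of_nat (C t w - C s w)"
proof -
  have "reward_sum s t w \<le> (\<Sum>k\<in>{C s w<..C t w}. ennreal c)" unfolding reward_sum_def by (intro sum_mono V_le)
  then show ?thesis by (simp add: mult.commute)
qed

text \<open>Rewards are at most \<open>c\<close>, so second moments of the counts control those of
  the blocks. Beyond that only mixing of the counts by label has to be supplied, separately for
  jumps, Poisson events and deterministic times.\<close>

theorem block_reward_mixing_blocks:
  assumes S: "0 \<le> S" "\<And>i. (\<integral>\<^sup>+w. (of_nat (C (real (Suc i)) w - C (real i) w))\<^sup>2 \<partial>M) \<le> ennreal S"
    and C\<rho>: "0 \<le> Cm" "0 < \<rho>" "\<rho> < 1"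
    and mix: "\<And>i j l l' a b a' b'. i + 2 \<le> j \<Longrightarrow> real i \<le> a \<Longrightarrow> a \<le> b \<Longrightarrow> b \<le> real (Suc i) \<Longrightarrow>
      real j \<le> a' \<Longrightarrow> a' \<le> b' \<Longrightarrow> b' \<le> real (Suc j) \<Longrightarrow>
      (\<integral>\<^sup>+w. LC l a b w * LC l' a' b' w \<partial>M)
        \<le> ennreal (1 + Cm * \<rho> ^ (j - i - 1)) * (\<integral>\<^sup>+w. LC l a b w \<partial>M) * (\<integral>\<^sup>+w. LC l' a' b' w \<partial>M)"
  shows "mixing_blocks block_reward (c\<^sup>2 * S) Cm \<rho>"
proof -
  let ?\<Delta> = "\<lambda>i w. of_nat (C (real (Suc i)) w - C (real i) w) :: ennreal"
  have [measurable]: "C (real i) \<in> measurable M (count_space UNIV)" "C (1 + real i) \<in> measurable M (count_space UNIV)" for i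
    by (intro C_meas'; simp)+
  have \<Delta>m [measurable]: "?\<Delta> i \<in> borel_measurable M" for i by simp
  have sqm: "(\<integral>\<^sup>+w. (?\<Delta> i w)\<^sup>2 \<partial>M) < \<infinity>" for i using S(2)[of i] by (rule order.strict_trans1) simp
  have n_le: "(of_nat n :: ennreal) \<le> (of_nat n)\<^sup>2" for n :: nat
  proof -
    have "n \<le> n\<^sup>2" by (simp add: power2_eq_square)
    then have "(of_nat n :: ennreal) \<le> of_nat (n\<^sup>2)" by (simp only: of_nat_le_iff)
    then show ?thesis by simp
  qed
  have \<Delta>fin: "(\<integral>\<^sup>+w. ?\<Delta> i w \<partial>M) < \<infinity>" for i
    by (rule order.strict_trans1[OF nn_integral_mono[OF n_le] sqm])
  have prod_fin: "(\<integral>\<^sup>+w. ?\<Delta> i w * ?\<Delta> j w \<partial>M) < \<infinity>" for i j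
  proof -
    have "(\<integral>\<^sup>+w. ?\<Delta> i w * ?\<Delta> j w \<partial>M) \<le> (\<integral>\<^sup>+w. (?\<Delta> i w)\<^sup>2 + (?\<Delta> j w)\<^sup>2 \<partial>M)"
    proof (rule nn_integral_mono)
      fix w
      have "m * n \<le> m\<^sup>2 + n\<^sup>2" for m n :: nat
        by (cases "m \<le> n") (auto simp: power2_eq_square intro: trans_le_add1 trans_le_add2 mult_le_mono)
      then have "(of_nat ((C (real (Suc i)) w - C (real i) w) * (C (real (Suc j)) w - C (real j) w)) :: ennreal)
          \<le> of_nat ((C (real (Suc i)) w - C (real i) w)\<^sup>2 + (C (real (Suc j)) w - C (real j) w)\<^sup>2)"
        by (simp only: of_nat_le_iff)
      then show "?\<Delta> i w * ?\<Delta> j w \<le> (?\<Delta> i w)\<^sup>2 + (?\<Delta> j w)\<^sup>2" by (simp only: of_nat_mult of_nat_add of_nat_power)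
    qed
    also have "\<dots> = (\<integral>\<^sup>+w. (?\<Delta> i w)\<^sup>2 \<partial>M) + (\<integral>\<^sup>+w. (?\<Delta> j w)\<^sup>2 \<partial>M)" by (rule nn_integral_add) measurable
    also have "\<dots> < \<infinity>" using sqm[of i] sqm[of j] by simp
    finally show ?thesis .
  qed
  show ?thesis
    unfolding mixing_blocks_def
  proof (intro conjI allI impI block_reward_meas C\<rho>)
    show "0 \<le> c\<^sup>2 * S" using S by simp
    fix i :: nat
    show "AE w in M. 0 \<le> block_reward i w" using AE_block_reward by (auto elim: eventually_mono)
    have "(\<integral>\<^sup>+w. (ennreal (block_reward i w))\<^sup>2 \<partial>M) \<le> (\<integral>\<^sup>+w. (ennreal c)\<^sup>2 * (?\<Delta> i w)\<^sup>2 \<partial>M)"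
      using AE_block_reward
    proof (intro nn_integral_mono_AE, eventually_elim)
      case (elim w)
      then have "ennreal (block_reward i w) \<le> ennreal c * ?\<Delta> i w" using reward_sum_le by simp
      then have "(ennreal (block_reward i w))\<^sup>2 \<le> (ennreal c * ?\<Delta> i w)\<^sup>2" by (intro power_mono) auto
      then show ?case by (simp only: power_mult_distrib)
    qed
    also have "\<dots> = (ennreal c)\<^sup>2 * (\<integral>\<^sup>+w. (?\<Delta> i w)\<^sup>2 \<partial>M)" by (rule nn_integral_cmult) measurable
    also have "\<dots> \<le> (ennreal c)\<^sup>2 * ennreal S" by (intro mult_left_mono S) simp
    also have "\<dots> = ennreal (c\<^sup>2 * S)" using c S(1) by (simp add: ennreal_power ennreal_mult)
    finally show "(\<integral>\<^sup>+w. (ennreal (block_reward i w))\<^sup>2 \<partial>M) \<le> ennreal (c\<^sup>2 * S)" .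
  next
    fix i j :: nat assume ij: "i + 2 \<le> j"
    have "(\<integral>\<^sup>+w. ennreal (block_reward i w) * ennreal (block_reward j w) \<partial>M) = (\<integral>\<^sup>+w. reward_sum (real i) (real (Suc i)) w * reward_sum (real j) (real (Suc j)) w \<partial>M)"
      using AE_block_reward by (intro nn_integral_cong_AE) (auto elim: eventually_mono)
    also have "\<dots> \<le> ennreal (1 + Cm * \<rho> ^ (j - i - 1)) * (\<integral>\<^sup>+w. reward_sum (real i) (real (Suc i)) w \<partial>M) * (\<integral>\<^sup>+w. reward_sum (real j) (real (Suc j)) w \<partial>M)"
    proof (rule reward_sum_mixing)
      show "real (Suc i) \<le> real j" using ij by simp
      show "ennreal (1 + Cm * \<rho> ^ (j - i - 1)) < \<infinity>" by simp
    qed (use \<Delta>fin prod_fin mix[OF ij] in auto)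
    finally show "(\<integral>\<^sup>+w. ennreal (block_reward i w) * ennreal (block_reward j w) \<partial>M)
      \<le> ennreal (1 + Cm * \<rho> ^ (j - i - 1)) * (\<integral>\<^sup>+w. ennreal (block_reward i w) \<partial>M) * (\<integral>\<^sup>+w. ennreal (block_reward j w) \<partial>M)"
      unfolding nn_integral_block_reward .
  qed
qed

end

section \<open>Accumulated state rewards\<close>

context state_functional
begin

definition "block_integral i w = A (real i) (real (Suc i)) w"

lemma nn_integral_rate:
  assumes "0 \<le> u"
  shows "(\<integral>\<^sup>+w. ennreal (\<beta> (max 0 u) (X (max 0 u) w)) \<partial>M) = (\<Sum>z\<in>UNIV. ennreal (\<beta> u z) * ennreal (prob (hit u z)))"
proof -
  have [measurable]: "hit u z \<in> sets M" for z using hit_sets assms by auto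
  have "(\<integral>\<^sup>+w. ennreal (\<beta> (max 0 u) (X (max 0 u) w)) \<partial>M) = (\<integral>\<^sup>+w. (\<Sum>z\<in>UNIV. ennreal (\<beta> u z) * indicator (hit u z) w) \<partial>M)"
  proof (intro nn_integral_cong)
    fix w assume "w \<in> space M"
    then have "(\<Sum>z\<in>UNIV. ennreal (\<beta> u z) * indicator (hit u z) w) = (\<Sum>z\<in>UNIV. if z = X u w then ennreal (\<beta> u z) else 0)"
      by (intro sum.cong) (auto split: split_indicator)
    then show "ennreal (\<beta> (max 0 u) (X (max 0 u) w)) = (\<Sum>z\<in>UNIV. ennreal (\<beta> u z) * indicator (hit u z) w)"
      using assms by (simp add: max_def)
  qed
  also have "\<dots> = (\<Sum>z\<in>UNIV. \<integral>\<^sup>+w. ennreal (\<beta> u z) * indicator (hit u z) w \<partial>M)"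
    by (rule nn_integral_sum) measurable
  also have "\<dots> = (\<Sum>z\<in>UNIV. ennreal (\<beta> u z) * ennreal (prob (hit u z)))"
    by (intro sum.cong refl) (simp add: nn_integral_cmult_indicator emeasure_eq_measure)
  finally show ?thesis .
qed

lemma rate_joint: "(\<lambda>(w, u). ennreal (\<beta> (max 0 u) (X (max 0 u) w))) \<in> borel_measurable (M \<Otimes>\<^sub>M borel)"
  using \<beta>_joint by measurable

lemma nn_integral_block_integral: "(\<integral>\<^sup>+w. ennreal (block_integral i w) \<partial>M)
    = (\<integral>\<^sup>+w. (\<integral>\<^sup>+u\<in>{real i..real (Suc i)}. ennreal (\<beta> (max 0 u) (X (max 0 u) w)) \<partial>lborel) \<partial>M)"
  unfolding block_integral_def by (intro nn_integral_cong A_props(1)) auto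

theorem block_integral_mixing_blocks:
  assumes C\<rho>: "0 \<le> Cm" "0 < \<rho>" "\<rho> < 1"
    and mix: "\<And>i j. i + 2 \<le> j \<Longrightarrow> mixes (1 + Cm * \<rho> ^ (j - i - 1)) (real (Suc i)) (real j)"
  shows "mixing_blocks block_integral (b\<^sup>2) Cm \<rho>"
  unfolding mixing_blocks_def
proof (intro conjI allI impI C\<rho>)
  show "0 \<le> b\<^sup>2" by simp
  fix i :: nat
  show "block_integral i \<in> borel_measurable M" unfolding block_integral_def by (intro A_meas) auto
  show "AE w in M. 0 \<le> block_integral i w" unfolding block_integral_def by (intro AE_I2 A_props(2)) auto
  have "(\<integral>\<^sup>+w. (ennreal (block_integral i w))\<^sup>2 \<partial>M) \<le> (\<integral>\<^sup>+w. ennreal (b\<^sup>2) \<partial>M)"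
  proof (rule nn_integral_mono)
    fix w assume w: "w \<in> space M"
    have "0 \<le> block_integral i w" "block_integral i w \<le> b" using A_props(2,3)[OF w, of "real i" "real (Suc i)"] by (auto simp: block_integral_def)
    then show "(ennreal (block_integral i w))\<^sup>2 \<le> ennreal (b\<^sup>2)" by (simp add: ennreal_power power_mono ennreal_leI)
  qed
  then show "(\<integral>\<^sup>+w. (ennreal (block_integral i w))\<^sup>2 \<partial>M) \<le> ennreal (b\<^sup>2)" by (simp add: emeasure_space_1)
next
  fix i j :: nat assume ij: "i + 2 \<le> j"
  let ?\<kappa> = "1 + Cm * \<rho> ^ (j - i - 1)"
  have \<kappa>: "0 \<le> ?\<kappa>" using C\<rho> by simp
  let ?h = "\<lambda>w u. ennreal (\<beta> (max 0 u) (X (max 0 u) w))"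
  have "(\<integral>\<^sup>+w. ennreal (block_integral i w) * ennreal (block_integral j w) \<partial>M)
      = (\<integral>\<^sup>+w. (\<integral>\<^sup>+u\<in>{real i..real (Suc i)}. ?h w u \<partial>lborel) * (\<integral>\<^sup>+u\<in>{real j..real (Suc j)}. ?h w u \<partial>lborel) \<partial>M)"
    unfolding block_integral_def by (intro nn_integral_cong arg_cong2[of _ _ _ _ "(*)"] A_props(1)) auto
  also have "\<dots> \<le> ennreal ?\<kappa> * (\<integral>\<^sup>+w. ennreal (block_integral i w) \<partial>M) * (\<integral>\<^sup>+w. ennreal (block_integral j w) \<partial>M)"
    unfolding nn_integral_block_integral
  proof (rule nn_integral_integral_mixing[OF rate_joint rate_joint])
    fix u u' assume u: "u \<in> {real i..real (Suc i)}" "u' \<in> {real j..real (Suc j)}"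
    then have u0: "0 \<le> u" "u \<le> real (Suc i)" "0 \<le> u'" "real j \<le> u'" by auto
    have [measurable]: "hit u z \<inter> hit u' z' \<in> sets M" for z z' using hit_sets u0 by auto
    have "(\<integral>\<^sup>+w. ?h w u * ?h w u' \<partial>M)
        = (\<integral>\<^sup>+w. (\<Sum>z\<in>UNIV. \<Sum>z'\<in>UNIV. ennreal (\<beta> u z) * ennreal (\<beta> u' z') * indicator (hit u z \<inter> hit u' z') w) \<partial>M)"
    proof (intro nn_integral_cong)
      fix w assume w: "w \<in> space M"
      have "(\<Sum>z\<in>UNIV. \<Sum>z'\<in>UNIV. ennreal (\<beta> u z) * ennreal (\<beta> u' z') * indicator (hit u z \<inter> hit u' z') w)
          = (\<Sum>z\<in>UNIV. if z = X u w then \<Sum>z'\<in>UNIV. if z' = X u' w then ennreal (\<beta> u z) * ennreal (\<beta> u' z') else 0 else 0)"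
        using w by (intro sum.cong refl) (auto intro!: sum.cong sum.neutral split: split_indicator)
      then show "?h w u * ?h w u' = (\<Sum>z\<in>UNIV. \<Sum>z'\<in>UNIV. ennreal (\<beta> u z) * ennreal (\<beta> u' z') * indicator (hit u z \<inter> hit u' z') w)"
        using u0 by (simp add: max_def)
    qed
    also have "\<dots> = (\<Sum>z\<in>UNIV. \<integral>\<^sup>+w. (\<Sum>z'\<in>UNIV. ennreal (\<beta> u z) * ennreal (\<beta> u' z') * indicator (hit u z \<inter> hit u' z') w) \<partial>M)"
      by (rule nn_integral_sum) measurable
    also have "\<dots> = (\<Sum>z\<in>UNIV. \<Sum>z'\<in>UNIV. \<integral>\<^sup>+w. ennreal (\<beta> u z) * ennreal (\<beta> u' z') * indicator (hit u z \<inter> hit u' z') w \<partial>M)"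
      by (intro sum.cong refl nn_integral_sum) measurable
    also have "\<dots> = (\<Sum>z\<in>UNIV. \<Sum>z'\<in>UNIV. ennreal (\<beta> u z) * ennreal (\<beta> u' z') * ennreal (prob (hit u z \<inter> hit u' z')))"
      by (intro sum.cong refl) (simp add: nn_integral_cmult_indicator emeasure_eq_measure)
    also have "\<dots> \<le> (\<Sum>z\<in>UNIV. \<Sum>z'\<in>UNIV. ennreal (\<beta> u z) * ennreal (\<beta> u' z') * ennreal (?\<kappa> * prob (hit u z) * prob (hit u' z')))"
      by (intro sum_mono mult_left_mono ennreal_leI mixesD[OF mix[OF ij] u0(4)] hit_past u0(1,2)) simp
    also have "\<dots> = (\<Sum>z\<in>UNIV. \<Sum>z'\<in>UNIV. ennreal ?\<kappa> * (ennreal (\<beta> u z) * ennreal (prob (hit u z))) * (ennreal (\<beta> u' z') * ennreal (prob (hit u' z'))))"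
    proof (intro sum.cong refl)
      fix z z'
      have "ennreal (?\<kappa> * prob (hit u z) * prob (hit u' z')) = ennreal ?\<kappa> * ennreal (prob (hit u z)) * ennreal (prob (hit u' z'))"
        using \<kappa> by (simp only: ennreal_mult measure_nonneg mult_nonneg_nonneg)
      then show "ennreal (\<beta> u z) * ennreal (\<beta> u' z') * ennreal (?\<kappa> * prob (hit u z) * prob (hit u' z'))
        = ennreal ?\<kappa> * (ennreal (\<beta> u z) * ennreal (prob (hit u z))) * (ennreal (\<beta> u' z') * ennreal (prob (hit u' z')))"
        by (simp only: ac_simps)
    qed
    also have "\<dots> = ennreal ?\<kappa> * (\<integral>\<^sup>+w. ?h w u \<partial>M) * (\<integral>\<^sup>+w. ?h w u' \<partial>M)"
      unfolding nn_integral_rate[OF u0(1)] nn_integral_rate[OF u0(3)]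
      by (simp only: sum_distrib_left[where r="ennreal ?\<kappa>"] sum_product)
    finally show "(\<integral>\<^sup>+w. ?h w u * ?h w u' \<partial>M) \<le> ennreal ?\<kappa> * (\<integral>\<^sup>+w. ?h w u \<partial>M) * (\<integral>\<^sup>+w. ?h w u' \<partial>M)" .
  qed auto
  finally show "(\<integral>\<^sup>+w. ennreal (block_integral i w) * ennreal (block_integral j w) \<partial>M)
    \<le> ennreal ?\<kappa> * (\<integral>\<^sup>+w. ennreal (block_integral i w) \<partial>M) * (\<integral>\<^sup>+w. ennreal (block_integral j w) \<partial>M)" .
qed

text \<open>From time one on, \<open>x\<close> is occupied at each instant with probability at least
  \<open>\<delta>\<close>; Fubini integrates this over the block.\<close>

lemma block_integral_ge:
  assumes \<delta>: "0 \<le> \<delta>" "\<And>t x. 1 \<le> t \<Longrightarrow> \<delta> \<le> prob (hit t x)" and i: "1 \<le> i" and low: "0 \<le> k" "\<And>t. 0 \<le> t \<Longrightarrow> k \<le> \<beta> t x"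
  shows "ennreal (\<delta> * k) \<le> (\<integral>\<^sup>+w. ennreal (block_integral i w) \<partial>M)"
proof -
  interpret P: pair_sigma_finite M lborel ..
  have [measurable]: "(\<lambda>(w, u). ennreal (\<beta> (max 0 u) (X (max 0 u) w))) \<in> borel_measurable (M \<Otimes>\<^sub>M lborel)"
    using rate_joint by simp
  have [measurable]: "(\<lambda>w. ennreal (\<beta> (max 0 u) (X (max 0 u) w))) \<in> borel_measurable M" for u
    using measurable_Pair1[OF rate_joint, of u] by simp
  have "ennreal (\<delta> * k) = (\<integral>\<^sup>+u\<in>{real i..real (Suc i)}. ennreal (\<delta> * k) \<partial>lborel)"
    by (simp add: nn_integral_cmult_indicator)
  also have "\<dots> \<le> (\<integral>\<^sup>+u\<in>{real i..real (Suc i)}. (\<integral>\<^sup>+w. ennreal (\<beta> (max 0 u) (X (max 0 u) w)) \<partial>M) \<partial>lborel)"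
  proof (rule nn_integral_mono)
    fix u
    show "ennreal (\<delta> * k) * indicator {real i..real (Suc i)} u
        \<le> (\<integral>\<^sup>+w. ennreal (\<beta> (max 0 u) (X (max 0 u) w)) \<partial>M) * indicator {real i..real (Suc i)} u"
    proof (cases "u \<in> {real i..real (Suc i)}")
      case True
      then have u: "0 \<le> u" "1 \<le> u" using i by auto
      have "\<delta> * k \<le> prob (hit u x) * \<beta> u x" using \<delta> low u by (intro mult_mono) auto
      then have "ennreal (\<delta> * k) \<le> ennreal (\<beta> u x) * ennreal (prob (hit u x))"
        using \<beta>_nonneg[OF u(1), of x] by (simp add: ennreal_mult[symmetric] ennreal_leI mult.commute)
      also have "\<dots> \<le> (\<Sum>z\<in>UNIV. ennreal (\<beta> u z) * ennreal (prob (hit u z)))"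
        by (rule member_le_sum[of x UNIV "\<lambda>z. ennreal (\<beta> u z) * ennreal (prob (hit u z))"]) auto
      finally show ?thesis
        using True by (simp only: nn_integral_rate[OF u(1)] indicator_simps mult_1_right)
    qed simp
  qed
  also have "\<dots> = (\<integral>\<^sup>+w. ennreal (block_integral i w) \<partial>M)"
  proof -
    have "(\<integral>\<^sup>+w. (\<integral>\<^sup>+u. ennreal (\<beta> (max 0 u) (X (max 0 u) w)) * indicator {real i..real (Suc i)} u \<partial>lborel) \<partial>M)
        = (\<integral>\<^sup>+u. (\<integral>\<^sup>+w. ennreal (\<beta> (max 0 u) (X (max 0 u) w)) * indicator {real i..real (Suc i)} u \<partial>M) \<partial>lborel)"
      by (intro P.Fubini'[symmetric]) measurable
    then show ?thesis unfolding nn_integral_block_integral by (simp add: nn_integral_multc)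
  qed
  finally show ?thesis .
qed

lemma A_split:
  assumes w: "w \<in> space M" and st: "0 \<le> s" "s \<le> t" "t \<le> u"
  shows "A s u w = A s t w + A t u w"
proof -
  let ?f = "\<lambda>u. \<beta> (max 0 u) (X (max 0 u) w)"
  have m: "?f \<in> borel_measurable borel" using measurable_Pair2[OF \<beta>_joint w] by simp
  have int: "set_integrable lborel {a..c} ?f" for a c
    unfolding set_integrable_def
  proof (rule Bochner_Integration.integrable_bound[of _ "\<lambda>u. indicator {a..c} u *\<^sub>R b"])
    show "integrable lborel (\<lambda>u. indicat_real {a..c} u *\<^sub>R b)"
      using set_integrable_const_Icc[of a c b] by (simp add: set_integrable_def)
    show "AE u in lborel. norm (indicat_real {a..c} u *\<^sub>R ?f u) \<le> norm (indicat_real {a..c} u *\<^sub>R b)"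
      using \<beta>_nonneg[of "max 0 _"] \<beta>_le[of "max 0 _"] b_nonneg by (auto split: split_indicator)
  qed (use m in measurable)
  have A: "A a c w = (LBINT u:{a..c}. ?f u)" if "0 \<le> a" for a c
    unfolding A_def set_lebesgue_integral_def using that
    by (intro Bochner_Integration.integral_cong refl) (auto split: split_indicator simp: max_def)
  show ?thesis
    using set_integral_Icc_split[OF int int st(2,3)] st by (simp add: A)
qed

lemma A_eq_sum_block_integral:
  assumes w: "w \<in> space M"
  shows "A 0 (real n) w = (\<Sum>i<n. block_integral i w)"
proof (induct n)
  case 0
  show ?case using A_split[OF w, of 0 0 0] by simp
next
  case (Suc n)
  then show ?case using A_split[OF w, of 0 "real n" "real (Suc n)"] by (simp add: block_integral_def del: of_nat_Suc)
qed

end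

section \<open>Sums of rewards over a counting process\<close>

lemma sum_counting_blocks:
  fixes f :: "nat \<Rightarrow> real"
  assumes c: "counting_path c"
  shows "(\<Sum>k=1..c (real n). f k) = (\<Sum>i<n. \<Sum>k\<in>{c (real i)<..c (real (Suc i))}. f k)"
proof (induct n)
  case 0
  then show ?case using c by (simp add: counting_path_def)
next
  case (Suc n)
  have le: "c (real n) \<le> c (real (Suc n))" by (intro counting_path_mono[OF c]) auto
  have eq: "{1..c (real (Suc n))} = {1..c (real n)} \<union> {c (real n)<..c (real (Suc n))}" using le by auto
  have "(\<Sum>k=1..c (real (Suc n)). f k) = (\<Sum>k=1..c (real n). f k) + (\<Sum>k\<in>{c (real n)<..c (real (Suc n))}. f k)"
    unfolding eq by (rule sum.union_disjoint) auto
  then show ?case using Suc by (simp del: of_nat_Suc)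
qed

context marked_counting
begin

definition "total_reward t w = (\<Sum>k=1..C t w. W k w)"

lemma total_reward_meas:
  assumes "0 \<le> t"
  shows "total_reward t \<in> borel_measurable M"
proof -
  have "(\<lambda>w. \<Sum>k=1..n. W k w) \<in> borel_measurable M" for n
    by (intro borel_measurable_sum W_meas) auto
  from measurable_compose_countable[where f="\<lambda>n w. \<Sum>k=1..n. W k w", OF this C_meas'[OF assms]]
  show ?thesis by (simp add: total_reward_def[abs_def])
qed

lemma total_reward_eq_sum_block_reward: "w \<in> space M \<Longrightarrow> total_reward (real n) w = (\<Sum>i<n. block_reward i w)"
  unfolding total_reward_def block_reward_def by (rule sum_counting_blocks[OF C_path])

text \<open>One exceptional null set serves all real times, because the almost sure bounds concern
  countably many rewards and only occurring events enter the sums.\<close>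

lemma AE_total_reward_mono: "AE w in M. (\<forall>s t. 0 \<le> s \<longrightarrow> s \<le> t \<longrightarrow> total_reward s w \<le> total_reward t w) \<and> 0 \<le> total_reward 0 w"
  using AE_all_rewards AE_space
proof eventually_elim
  case (elim w)
  note path = C_path[OF elim(2)]
  have W: "0 \<le> W k w" if "1 \<le> k" "k \<le> C t w" "0 \<le> t" for k t
    using elim(1) that event_occursI[of t k "\<lambda>t. C t w"] by blast
  show ?case
  proof (intro conjI allI impI)
    fix s t :: real assume st: "0 \<le> s" "s \<le> t"
    show "total_reward s w \<le> total_reward t w"
      unfolding total_reward_def using counting_path_mono[OF path st] W[of _ t] st by (intro sum_mono2) auto
  next
    show "0 \<le> total_reward 0 w" unfolding total_reward_def using W[of _ 0] by (intro sum_nonneg) auto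
  qed
qed

end

section \<open>Deterministic reward times\<close>

context
  fixes ts :: "nat \<Rightarrow> real"
  assumes ts: "reward_times ts"
begin

text \<open>As a counting path with event times \<open>ts k\<close>, the deterministic reward times
  fall under \<open>marked_counting\<close> like the random ones.\<close>

definition "num_before t = Sup {i. ts i \<le> t}"

lemma ts_mono: "ts i \<le> ts j \<longleftrightarrow> i \<le> j"
  using ts by (simp add: reward_times_def strict_mono_less_eq)

lemma ts_nonneg: "0 \<le> ts i"
  using ts_mono[of 0 i] ts by (simp add: reward_times_def)

lemma le_num_before_iff:
  assumes t: "0 \<le> t"
  shows "i \<le> num_before t \<longleftrightarrow> ts i \<le> t"
proof -
  let ?S = "{i. ts i \<le> t}"
  have "filterlim ts at_top sequentially" using ts by (simp add: reward_times_def)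
  then have "\<forall>\<^sub>F i in sequentially. t < ts i" by (simp add: filterlim_at_top_dense)
  then obtain n0 where n0: "\<And>i. n0 \<le> i \<Longrightarrow> t < ts i" by (auto simp: eventually_sequentially)
  have fin: "finite ?S"
    by (rule finite_subset[of _ "{..<n0}"]) (use n0 in \<open>force simp: not_less[symmetric]\<close>, simp)
  have ne: "?S \<noteq> {}" using t ts by (auto simp: reward_times_def intro: exI[of _ 0])
  have S: "Sup ?S = Max ?S" using fin ne by (rule cSup_eq_Max)
  have "Max ?S \<in> ?S" by (rule Max_in[OF fin ne])
  then show ?thesis unfolding num_before_def S
    using Max_ge[OF fin, of i] ts_mono[of i "Max ?S"] by auto
qed

lemma counting_path_num_before: "counting_path num_before"
  unfolding counting_path_def
proof (intro conjI)
  have "num_before 0 \<le> num_before 0" by simp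
  then have "ts (num_before 0) \<le> ts 0" using le_num_before_iff[of 0 "num_before 0"] ts by (simp add: reward_times_def)
  then show "num_before 0 = 0" by (simp add: ts_mono)
  show "mono_on {0..} num_before"
  proof (rule mono_onI)
    fix r s :: real assume rs: "r \<in> {0..}" "s \<in> {0..}" "r \<le> s"
    have "ts (num_before r) \<le> r" using le_num_before_iff[of r "num_before r"] rs by simp
    then show "num_before r \<le> num_before s" using le_num_before_iff[of s "num_before r"] rs by simp
  qed
  show "right_continuous_path num_before"
    unfolding right_continuous_path_def
  proof (intro allI impI)
    fix t :: real assume t: "0 \<le> t"
    have nx: "t < ts (Suc (num_before t))"
      using le_num_before_iff[OF t, of "Suc (num_before t)"] by auto
    show "\<forall>\<^sub>F s in at_right t. num_before s = num_before t"
      unfolding eventually_at_right_field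
    proof (intro exI[of _ "ts (Suc (num_before t))"] conjI allI impI nx)
      fix s assume s: "t < s" "s < ts (Suc (num_before t))"
      have "num_before t \<le> num_before s"
        using le_num_before_iff[of t "num_before t"] le_num_before_iff[of s "num_before t"] s t by simp
      moreover have "\<not> Suc (num_before t) \<le> num_before s"
        using le_num_before_iff[of s "Suc (num_before t)"] s t by simp
      ultimately show "num_before s = num_before t" by simp
    qed
  qed
qed

lemma event_occurs_num_before: "event_occurs num_before k"
  using le_num_before_iff[OF ts_nonneg, of k k] ts_nonneg[of k] by (intro event_occursI[of "ts k"]) auto

lemma event_time_num_before: "event_time num_before k = ts k"
proof (rule antisym)
  note E = event_time_le_iff[OF counting_path_num_before event_occurs_num_before[of k]]
  show "event_time num_before k \<le> ts k"
    using E(3)[OF ts_nonneg[of k]] le_num_before_iff[OF ts_nonneg, of k k] by simp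
  show "ts k \<le> event_time num_before k"
    using E(1,2) le_num_before_iff[of "event_time num_before k" k] by simp
qed

text \<open>With gaps of at least \<open>e\<close>, a unit interval contains at most
  \<open>1 + 1 / e\<close> reward times: each one after the first is preceded by a gap inside the
  interval.\<close>

lemma num_before_increment:
  assumes "assumption_A5 ts"
  obtains S :: real where "0 \<le> S" "\<And>i. real (num_before (real (Suc i)) - num_before (real i)) \<le> S"
proof -
  have "0 < (INF i\<in>{1..}. ereal (ts i - ts (i - 1)))" using assms by (simp add: assumption_A5_def)
  then obtain e where e: "0 < ereal e" "ereal e < (INF i\<in>{1..}. ereal (ts i - ts (i - 1)))"
    by (rule ereal_dense2[THEN exE]) auto
  have gap: "e \<le> ts (Suc i) - ts i" for i
  proof -
    have "(INF i\<in>{1..}. ereal (ts i - ts (i - 1))) \<le> ereal (ts (Suc i) - ts (Suc i - 1))"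
      by (rule INF_lower) simp
    from order.strict_trans2[OF e(2) this] show ?thesis by simp
  qed
  have gaps: "real k * e \<le> ts (i + k) - ts i" for i k
  proof (induct k)
    case (Suc k)
    then show ?case using gap[of "i + k"] by (simp add: algebra_simps)
  qed simp
  have e0: "0 < e" using e by simp
  show ?thesis
  proof (rule that[of "1 + 1 / e"])
    show "0 \<le> 1 + 1 / e" using e0 by simp
    fix i
    let ?a = "num_before (real i)" and ?b = "num_before (real (Suc i))"
    show "real (?b - ?a) \<le> 1 + 1 / e"
    proof (cases "?a < ?b")
      case True
      have "real i < ts (Suc ?a)" using le_num_before_iff[of "real i" "Suc ?a"] by simp
      moreover have "ts ?b \<le> real (Suc i)" using le_num_before_iff[of "real (Suc i)" ?b] by simp
      moreover have "real (?b - Suc ?a) * e \<le> ts (Suc ?a + (?b - Suc ?a)) - ts (Suc ?a)" by (rule gaps)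
      moreover have "Suc ?a + (?b - Suc ?a) = ?b" using True by simp
      ultimately have "real (?b - Suc ?a) * e \<le> 1" by simp
      then have "real (?b - Suc ?a) \<le> 1 / e" using e0 by (simp add: pos_le_divide_eq)
      moreover have "real (?b - ?a) = 1 + real (?b - Suc ?a)" using True by simp
      ultimately show ?thesis by simp
    qed (use e0 in simp)
  qed
qed

end

section \<open>Uniform constants from the assumptions, and the assembly of the four parts\<close>

section \<open>Consequences of the assumptions\<close>

lemma inf_time_ge: "ereal a \<le> inf_time f \<Longrightarrow> 0 \<le> t \<Longrightarrow> a \<le> f t"
proof -
  assume a: "ereal a \<le> inf_time f" and t: "0 \<le> t"
  have "inf_time f \<le> ereal (f t)" using t by (intro INF_lower) auto
  with a have "ereal a \<le> ereal (f t)" by (rule order.trans)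
  then show ?thesis by simp
qed

lemma sup_time_le: "sup_time f \<le> ereal a \<Longrightarrow> 0 \<le> t \<Longrightarrow> f t \<le> a"
proof -
  assume a: "sup_time f \<le> ereal a" and t: "0 \<le> t"
  have "ereal (f t) \<le> sup_time f" using t by (intro SUP_upper) auto
  from this a have "ereal (f t) \<le> ereal a" by (rule order.trans)
  then show ?thesis by simp
qed

lemma sup_time_bounded:
  assumes "sup_time f < \<infinity>"
  obtains b where "\<And>t. 0 \<le> t \<Longrightarrow> f t \<le> b"
proof -
  obtain b where "sup_time f < ereal b" using ereal_dense2[OF assms] by auto
  then have "sup_time f \<le> ereal b" by simp
  then show ?thesis using that sup_time_le by blast
qed

lemma inf_time_pos:
  assumes "0 < inf_time f"
  obtains e where "0 < e" "\<And>t. 0 \<le> t \<Longrightarrow> e \<le> f t"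
proof -
  obtain e where e: "0 < ereal e" "ereal e < inf_time f" using ereal_dense2[OF assms] by auto
  then have "ereal e \<le> inf_time f" by simp
  then show ?thesis using that[of e] e inf_time_ge by auto
qed

text \<open>The conditional probability is integrated over an event of the past on which
  \<open>X s\<close> has the fixed value \<open>x\<close>; there the random factor
  \<open>P s t (X s w) y\<close> is a constant, and the exceptional null set disappears.\<close>

lemma markov_jump_process_events:
  fixes X :: "real \<Rightarrow> 'w \<Rightarrow> 's::finite"
  assumes "prob_space M" and mjp: "markov_jump_process M Q \<mu> X"
  obtains P where "transition_matrices Q P"
    "\<And>s t x y A. 0 \<le> s \<Longrightarrow> s \<le> t \<Longrightarrow> A \<in> sets (generated M {0..s} X) \<Longrightarrow>
      measure M (A \<inter> {w \<in> space M. X s w = x} \<inter> {w \<in> space M. X t w = y})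
        = measure M (A \<inter> {w \<in> space M. X s w = x}) * P s t x y"
proof -
  interpret prob_space M by fact
  obtain P where P: "transition_matrices Q P"
    "\<And>s t y. 0 \<le> s \<Longrightarrow> s \<le> t \<Longrightarrow> AE w in M. real_cond_exp M (generated M {0..s} X)
             (indicator {w' \<in> space M. X t w' = y}) w = P s t (X s w) y"
    using mjp unfolding markov_jump_process_def by blast
  have X: "X t \<in> measurable M (count_space UNIV)" if "0 \<le> t" for t
    using mjp that by (simp add: markov_jump_process_def)
  show ?thesis
  proof (rule that[OF P(1)])
    fix s t x y A assume st: "0 \<le> s" "s \<le> t" and A: "A \<in> sets (generated M {0..s} X)"
    let ?F = "generated M {0..s} X"
    let ?E = "{w \<in> space M. X t w = y}" and ?B = "A \<inter> {w \<in> space M. X s w = x}"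
    have sub: "subalgebra M ?F" using X by (intro subalgebra_generated) auto
    interpret S: sigma_finite_subalgebra M ?F
      by (intro finite_measure_subalgebra_is_sigma_finite) (simp add: finite_measure_subalgebra_def
          finite_measure_subalgebra_axioms_def sub finite_measure_axioms)
    have E: "?E \<in> sets M"
      using measurable_count_space_pred[OF X, of t "\<lambda>z. z = y"] st by simp
    have "{w \<in> space M. X s w = x} \<in> sets ?F"
      using measurable_count_space_pred[OF measurable_generated[of s "{0..s}" X M], of "\<lambda>z. z = x"] st
      by (simp add: pred_def space_generated)
    then have B: "?B \<in> sets ?F" using A by auto
    have BM: "?B \<in> sets M" using B sub by (auto simp: subalgebra_def)
    have ind: "integrable M (indicat_real ?E)"
      using E by (rule integrable_real_indicator) (simp add: emeasure_eq_measure)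
    have "prob (?B \<inter> ?E) = (\<integral>w. indicat_real (?B \<inter> ?E) w \<partial>M)" using sets.Int[OF BM E] by simp
    also have "\<dots> = (\<integral>w\<in>?B. indicat_real ?E w \<partial>M)"
      unfolding set_lebesgue_integral_def indicator_inter_arith real_scaleR_def ..
    also have "\<dots> = (\<integral>w\<in>?B. real_cond_exp M ?F (indicat_real ?E) w \<partial>M)"
      by (rule S.real_cond_exp_intA[OF ind B])
    also have "\<dots> = (\<integral>w. indicator ?B w * P s t x y \<partial>M)"
      unfolding set_lebesgue_integral_def
    proof (rule integral_cong_AE)
      show "AE w in M. indicat_real ?B w *\<^sub>R real_cond_exp M ?F (indicat_real ?E) w = indicator ?B w * P s t x y"
        using P(2)[OF st, of y] by eventually_elim (auto split: split_indicator)
    qed (use BM in measurable)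
    also have "\<dots> = prob ?B * P s t x y" using BM by simp
    finally show "prob (?B \<inter> ?E) = prob ?B * P s t x y" .
  qed
qed

text \<open>There are finitely many pairs, so bounds for each of them are uniform. An off-diagonal
  rate is either bounded through \<open>assumption_A3\<close> or zero, as
  \<open>assumption_A2\<close> keeps the set of positive pairs fixed; a diagonal entry is minus the
  rest of its row, whence the factor \<open>CARD('s)\<close>.\<close>

lemma rate_bounds:
  fixes Q :: "real \<Rightarrow> 's::finite \<Rightarrow> 's \<Rightarrow> real"
  assumes rate: "\<And>t. 0 \<le> t \<Longrightarrow> rate_matrix (Q t)" and A2: "assumption_A2 Q" and A3: "assumption_A3 Q"
  obtains \<Lambda> q where "0 < q" "0 < \<Lambda>" "\<And>t x y. 0 \<le> t \<Longrightarrow> \<bar>Q t x y\<bar> \<le> \<Lambda>"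
    "\<And>t x y. 0 \<le> t \<Longrightarrow> (x, y) \<in> positive_pairs (Q 1) \<Longrightarrow> q \<le> Q t x y"
proof -
  let ?B = "positive_pairs (Q 1)"
  have B: "positive_pairs (Q t) = ?B" if "0 \<le> t" for t
  proof -
    have "\<forall>s\<ge>0. \<forall>t\<ge>0. positive_pairs (Q s) = positive_pairs (Q t)"
      using A2 unfolding assumption_A2_def by (rule conjunct1)
    from this[rule_format, OF that zero_le_one] show ?thesis .
  qed
  have nonneg: "0 \<le> Q t x y" if "0 \<le> t" "x \<noteq> y" for t x y using rate[OF that(1)] that by (simp add: rate_matrix_def)
  have "\<exists>e u. 0 < e \<and> (\<forall>t\<ge>0. e \<le> Q t (fst p) (snd p) \<and> Q t (fst p) (snd p) \<le> u)" if "p \<in> ?B" for p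
  proof -
    have pos: "0 < inf_time (\<lambda>t. Q t (fst p) (snd p))" "sup_time (\<lambda>t. Q t (fst p) (snd p)) < \<infinity>"
      using A3 that unfolding assumption_A3_def by (auto simp: case_prod_beta)
    obtain e where "0 < e" "\<And>t. 0 \<le> t \<Longrightarrow> e \<le> Q t (fst p) (snd p)"
      by (rule inf_time_pos[OF pos(1)]) blast
    moreover obtain u where "\<And>t. 0 \<le> t \<Longrightarrow> Q t (fst p) (snd p) \<le> u"
      by (rule sup_time_bounded[OF pos(2)]) blast
    ultimately show ?thesis by blast
  qed
  then obtain e u where eu: "\<And>p. p \<in> ?B \<Longrightarrow> 0 < e p"
    "\<And>p t. p \<in> ?B \<Longrightarrow> 0 \<le> t \<Longrightarrow> e p \<le> Q t (fst p) (snd p) \<and> Q t (fst p) (snd p) \<le> u p"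
    by metis
  define q where "q = Min (insert 1 (e ` ?B))"
  define U where "U = 1 + (\<Sum>p\<in>?B. \<bar>u p\<bar>)"
  have fin: "finite ?B" by simp
  have q: "0 < q" unfolding q_def using eu(1) fin by (subst Min_gr_iff) auto
  have qe: "q \<le> e p" if "p \<in> ?B" for p unfolding q_def using that fin by (intro Min_le) auto
  have U: "1 \<le> U" unfolding U_def by (simp add: sum_nonneg)
  have uU: "u p \<le> U" if "p \<in> ?B" for p
  proof -
    have "\<bar>u p\<bar> \<le> (\<Sum>p\<in>?B. \<bar>u p\<bar>)" using that fin by (intro member_le_sum) auto
    then show ?thesis by (simp add: U_def)
  qed
  have off: "Q t x y \<le> U" if t: "0 \<le> t" and xy: "x \<noteq> y" for t x y
  proof (cases "(x, y) \<in> ?B")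
    case True
    then show ?thesis using eu(2)[OF True t] uU[OF True] by simp
  next
    case False
    then have "\<not> 0 < Q t x y" using B[OF t] by (auto simp: positive_pairs_def)
    then show ?thesis using U by simp
  qed
  define \<Lambda> where "\<Lambda> = real CARD('s) * U"
  have card: "1 \<le> real CARD('s)" by (simp add: Suc_le_eq)
  have U\<Lambda>: "U \<le> \<Lambda>" unfolding \<Lambda>_def using card U by (simp add: mult_le_cancel_right1)
  show ?thesis
  proof (rule that[OF q])
    show "0 < \<Lambda>" using U\<Lambda> U by simp
    fix t :: real and x y :: 's assume t: "0 \<le> t"
    show "\<bar>Q t x y\<bar> \<le> \<Lambda>"
    proof (cases "x = y")
      case False
      then show ?thesis using off[OF t False] nonneg[OF t False] U\<Lambda> by simp
    next
      case True
      have s0: "(\<Sum>z\<in>UNIV. Q t x z) = 0" using rate[OF t] by (simp add: rate_matrix_def)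
      have "(\<Sum>z\<in>UNIV. Q t x z) = Q t x x + (\<Sum>z\<in>UNIV - {x}. Q t x z)" by (rule sum.remove) auto
      moreover have "0 \<le> (\<Sum>z\<in>UNIV - {x}. Q t x z)" using nonneg[OF t] by (intro sum_nonneg) auto
      moreover have "(\<Sum>z\<in>UNIV - {x}. Q t x z) \<le> (\<Sum>z\<in>UNIV - {x}. U)" using off[OF t] by (intro sum_mono) auto
      moreover have "(\<Sum>z\<in>UNIV - {x}. U) \<le> (\<Sum>z\<in>(UNIV::'s set). U)" using U by (intro sum_mono2) auto
      moreover have "(\<Sum>z\<in>(UNIV::'s set). U) = \<Lambda>" by (simp add: \<Lambda>_def)
      ultimately show ?thesis using s0 True by simp
    qed
    show "q \<le> Q t x y" if "(x, y) \<in> ?B"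
      using qe[OF that] eu(2)[OF that t] by simp
  qed
qed

lemma reward_bounds:
  fixes r \<beta> :: "real \<Rightarrow> 's::finite \<Rightarrow> real"
  assumes A4: "assumption_A4 Q r \<beta> G H K"
    and G: "\<And>t x y. 0 \<le> t \<Longrightarrow> distribution_function (G t x y)"
    and H: "\<And>t x. 0 \<le> t \<Longrightarrow> distribution_function (H t x)"
    and K: "\<And>t x. 0 \<le> t \<Longrightarrow> distribution_function (K t x)"
  obtains C rb b where "0 \<le> (C::real)"
    "\<And>t x. 0 \<le> t \<Longrightarrow> 0 \<le> r t x" "\<And>t x. 0 \<le> t \<Longrightarrow> r t x \<le> rb"
    "\<And>t x. 0 \<le> t \<Longrightarrow> 0 \<le> \<beta> t x" "\<And>t x. 0 \<le> t \<Longrightarrow> \<beta> t x \<le> b"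
    "\<And>t x y. 0 \<le> t \<Longrightarrow> left_limit (G t x y) 0 \<le> 0" "\<And>t x y. 0 \<le> t \<Longrightarrow> 1 \<le> G t x y C"
    "\<And>t x. 0 \<le> t \<Longrightarrow> left_limit (H t x) 0 \<le> 0" "\<And>t x. 0 \<le> t \<Longrightarrow> 1 \<le> H t x C"
    "\<And>t x. 0 \<le> t \<Longrightarrow> left_limit (K t x) 0 \<le> 0" "\<And>t x. 0 \<le> t \<Longrightarrow> 1 \<le> K t x C"
proof -
  obtain c :: "'s \<Rightarrow> real" where c: "\<And>x y.
       0 \<le> inf_time (\<lambda>t. r t x) \<and> inf_time (\<lambda>t. r t x) \<le> sup_time (\<lambda>t. r t x) \<and>
       sup_time (\<lambda>t. r t x) < \<infinity> \<and>
       0 \<le> inf_time (\<lambda>t. \<beta> t x) \<and> inf_time (\<lambda>t. \<beta> t x) \<le> sup_time (\<lambda>t. \<beta> t x) \<and>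
       sup_time (\<lambda>t. \<beta> t x) < \<infinity> \<and>
       sup_time (\<lambda>t. left_limit (G t x y) 0) = 0 \<and> inf_time (\<lambda>t. G t x y (c x)) = 1 \<and>
       sup_time (\<lambda>t. left_limit (H t x) 0) = 0 \<and> inf_time (\<lambda>t. H t x (c x)) = 1 \<and>
       sup_time (\<lambda>t. left_limit (K t x) 0) = 0 \<and> inf_time (\<lambda>t. K t x (c x)) = 1"
    using A4 unfolding assumption_A4_def by blast
  \<comment> \<open>One bound for all states: a distribution function that reaches one at
    \<open>c x\<close> is still one at the larger \<open>C\<close>.\<close>
  define C where "C = (\<Sum>x\<in>UNIV. \<bar>c x\<bar>)"
  have cC: "c x \<le> C" for x
  proof -
    have "\<bar>c x\<bar> \<le> C" unfolding C_def by (intro member_le_sum) auto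
    then show ?thesis by simp
  qed
  have bound: "\<exists>b. \<forall>t x. 0 \<le> t \<longrightarrow> f t x \<le> b" if "\<And>x. sup_time (\<lambda>t. f t x) < \<infinity>" for f :: "real \<Rightarrow> 's \<Rightarrow> real"
  proof -
    have "\<exists>b. \<forall>t\<ge>0. f t x \<le> b" for x by (rule sup_time_bounded[OF that[of x]]) blast
    then obtain bb where bb: "\<And>x t. 0 \<le> t \<Longrightarrow> f t x \<le> bb x" by metis
    show ?thesis
    proof (intro exI[of _ "\<Sum>x\<in>UNIV. \<bar>bb x\<bar>"] allI impI)
      fix t :: real and x assume "0 \<le> t"
      then have "f t x \<le> \<bar>bb x\<bar>" using bb[of t x] by simp
      also have "\<dots> \<le> (\<Sum>x\<in>UNIV. \<bar>bb x\<bar>)" by (intro member_le_sum) auto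
      finally show "f t x \<le> (\<Sum>x\<in>UNIV. \<bar>bb x\<bar>)" .
    qed
  qed
  obtain rb where rb: "\<forall>t x. 0 \<le> t \<longrightarrow> r t x \<le> rb" using bound[of r] c by blast
  obtain b where b: "\<forall>t x. 0 \<le> t \<longrightarrow> \<beta> t x \<le> b" using bound[of \<beta>] c by blast
  have up: "1 \<le> F C" if "distribution_function F" "1 \<le> F (c x)" for F x
    using monoD[OF distribution_function_bounds(3)[OF that(1)] cC[of x]] that(2) by simp
  show ?thesis
  proof (rule that[of C rb b])
    show "0 \<le> C" unfolding C_def by (simp add: sum_nonneg)
    fix t :: real and x y assume t: "0 \<le> t"
    have "ereal 0 \<le> inf_time (\<lambda>t. r t x)" "ereal 0 \<le> inf_time (\<lambda>t. \<beta> t x)"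
      using c[of x y] by (simp_all add: zero_ereal_def)
    then show "0 \<le> r t x" "0 \<le> \<beta> t x"
      using inf_time_ge[of 0 "\<lambda>t. r t x", OF _ t] inf_time_ge[of 0 "\<lambda>t. \<beta> t x", OF _ t] by simp_all
    show "r t x \<le> rb" "\<beta> t x \<le> b" using rb b t by auto
    have "sup_time (\<lambda>t. left_limit (G t x y) 0) \<le> ereal 0" "sup_time (\<lambda>t. left_limit (H t x) 0) \<le> ereal 0"
      "sup_time (\<lambda>t. left_limit (K t x) 0) \<le> ereal 0"
      using c[of x y] by (simp_all add: zero_ereal_def)
    then show "left_limit (G t x y) 0 \<le> 0" "left_limit (H t x) 0 \<le> 0" "left_limit (K t x) 0 \<le> 0"
      using sup_time_le[of "\<lambda>t. left_limit (G t x y) 0" 0, OF _ t] sup_time_le[of "\<lambda>t. left_limit (H t x) 0" 0, OF _ t]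
        sup_time_le[of "\<lambda>t. left_limit (K t x) 0" 0, OF _ t] by simp_all
    have "ereal 1 \<le> inf_time (\<lambda>t. G t x y (c x))" "ereal 1 \<le> inf_time (\<lambda>t. H t x (c x))"
      "ereal 1 \<le> inf_time (\<lambda>t. K t x (c x))"
      using c[of x y] by (simp_all add: one_ereal_def)
    then have "1 \<le> G t x y (c x)" "1 \<le> H t x (c x)" "1 \<le> K t x (c x)"
      using inf_time_ge[of 1 "\<lambda>t. G t x y (c x)", OF _ t] inf_time_ge[of 1 "\<lambda>t. H t x (c x)", OF _ t]
        inf_time_ge[of 1 "\<lambda>t. K t x (c x)", OF _ t] by simp_all
    then show "1 \<le> G t x y C" "1 \<le> H t x C" "1 \<le> K t x C"
      using up[OF G[OF t, of x y], of x] up[OF H[OF t, of x], of x] up[OF K[OF t, of x], of x] by simp_all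
  qed
qed

text \<open>Both infima are nonnegative and at most the value at time \<open>0\<close>, hence real
  numbers, and the positivity in \<open>assumption_A4\<close> becomes an inequality between
  reals.\<close>

lemma positive_reward_rate:
  assumes A4: "assumption_A4 Q r \<beta> G H K"
    and r: "\<And>t x. 0 \<le> t \<Longrightarrow> 0 \<le> r t x"
    and \<gamma>: "\<And>t. 0 \<le> t \<Longrightarrow> 0 \<le> jump_reward_rate Q G t x + event_reward_rate \<beta> K t x"
  obtains r0 \<gamma>0 where "0 \<le> r0" "0 \<le> \<gamma>0" "0 < r0 + \<gamma>0"
    "\<And>t. 0 \<le> t \<Longrightarrow> r0 \<le> r t x"
    "\<And>t. 0 \<le> t \<Longrightarrow> \<gamma>0 \<le> jump_reward_rate Q G t x + event_reward_rate \<beta> K t x"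
proof -
  let ?r = "inf_time (\<lambda>t. r t x)" and ?g = "inf_time (\<lambda>t. jump_reward_rate Q G t x + event_reward_rate \<beta> K t x)"
  have real: "\<exists>a. inf_time f = ereal a \<and> 0 \<le> a" if "\<And>t. 0 \<le> t \<Longrightarrow> 0 \<le> f t" for f
  proof -
    have "inf_time f \<le> ereal (f 0)" by (intro INF_lower) simp
    moreover have "0 \<le> inf_time f" using that by (intro INF_greatest) auto
    ultimately show ?thesis by (cases "inf_time f") auto
  qed
  obtain r0 where r0: "?r = ereal r0" "0 \<le> r0" using real[of "\<lambda>t. r t x"] r by blast
  obtain \<gamma>0 where \<gamma>0: "?g = ereal \<gamma>0" "0 \<le> \<gamma>0" using real[of "\<lambda>t. jump_reward_rate Q G t x + event_reward_rate \<beta> K t x", OF \<gamma>] by blast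
  have "0 < ?r + ?g" using A4 by (simp add: assumption_A4_def)
  then have "0 < r0 + \<gamma>0" using r0 \<gamma>0 by simp
  then show ?thesis
    using that[of r0 \<gamma>0] r0 \<gamma>0 inf_time_ge[of r0 "\<lambda>t. r t x"]
      inf_time_ge[of \<gamma>0 "\<lambda>t. jump_reward_rate Q G t x + event_reward_rate \<beta> K t x"] by simp
qed

lemma lump_sum_rewardsD:
  assumes "lump_sum_rewards M X N ts G H K GG HH KK"
    and "finite A" "finite B" "finite C" "A \<subseteq> {1..}" "B \<subseteq> {1..}" "C \<subseteq> {1..}"
  shows "AE w in M.
         (\<forall>j\<in>A. event_occurs (num_jumps (\<lambda>t. X t w)) j) \<and>
         (\<forall>k\<in>C. event_occurs (\<lambda>t. N t w) k) \<longrightarrow>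
         real_cond_exp M (generated M {0..} (\<lambda>t w'. (X t w', N t w')))
           (indicator {w' \<in> space M. (\<forall>j\<in>A. GG j w' \<le> zg j) \<and> (\<forall>i\<in>B. HH i w' \<le> zh i) \<and>
                                     (\<forall>k\<in>C. KK k w' \<le> zk k)}) w =
         (\<Prod>j\<in>A. G (jump_time (\<lambda>t. X t w) j) (embedded (\<lambda>t. X t w) (j - 1))
                   (embedded (\<lambda>t. X t w) j) (zg j)) *
         (\<Prod>i\<in>B. H (ts i) (X (ts i) w) (zh i)) *
         (\<Prod>k\<in>C. K (event_time (\<lambda>t. N t w) k) (X (event_time (\<lambda>t. N t w) k) w) (zk k))"
  by (rule assms(1)[unfolded lump_sum_rewards_def, THEN conjunct2, THEN spec[where x=A], THEN spec[where x=B],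
        THEN spec[where x=C], THEN spec[where x=zg], THEN spec[where x=zh], THEN spec[where x=zk], THEN mp])
    (use assms(2-) in simp)

lemma nn_set_integral_Icc:
  fixes f :: "real \<Rightarrow> real"
  assumes int: "set_integrable lborel {a..b} f" and nn: "\<And>x. x \<in> {a..b} \<Longrightarrow> 0 \<le> f x"
  shows "(\<integral>\<^sup>+x\<in>{a..b}. ennreal (f x) \<partial>lborel) = ennreal (LBINT x:{a..b}. f x)"
proof -
  have "(\<integral>\<^sup>+x\<in>{a..b}. ennreal (f x) \<partial>lborel) = (\<integral>\<^sup>+x. ennreal (indicator {a..b} x *\<^sub>R f x) \<partial>lborel)"
    by (intro nn_integral_cong) (auto split: split_indicator)
  also have "\<dots> = ennreal (LBINT x:{a..b}. f x)"
    unfolding set_lebesgue_integral_def using int nn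
    by (intro nn_integral_eq_integral) (auto simp: set_integrable_def split: split_indicator)
  finally show ?thesis .
qed

lemma nn_integral_Ioc_scaled_le:
  fixes f :: "real \<Rightarrow> real"
  assumes a: "0 \<le> a" and k: "0 \<le> k" and int: "set_integrable lborel {a..b} f" and nn: "\<And>x. 0 \<le> x \<Longrightarrow> 0 \<le> f x"
  shows "(\<integral>\<^sup>+x\<in>{a<..b}. ennreal (k * f (max 0 x)) \<partial>lborel) \<le> ennreal (k * (LBINT x:{a..b}. f x))"
proof -
  have "(\<integral>\<^sup>+x\<in>{a<..b}. ennreal (k * f (max 0 x)) \<partial>lborel) \<le> (\<integral>\<^sup>+x\<in>{a..b}. ennreal (k * f x) \<partial>lborel)"
    using a by (intro nn_integral_mono) (auto split: split_indicator simp: max_def)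
  also have "\<dots> = ennreal (LBINT x:{a..b}. k * f x)"
    using int nn k a by (intro nn_set_integral_Icc) auto
  finally show ?thesis by simp
qed

lemma (in bounded_jump_process) mixes_mono:
  assumes m: "mixes \<kappa> s t" and st: "0 \<le> s'" "s' \<le> s" "t \<le> t'"
  shows "mixes \<kappa> s' t'"
  using m st past_mono[OF st(2)] unfolding mixes_def by auto

lemma point_mass_distribution_function: "distribution_function (\<lambda>z. if 0 \<le> z then 1 else 0)"
  unfolding distribution_function_def
proof (intro exI conjI)
  show "real_distribution (return borel 0)"
    by (simp add: real_distribution_def real_distribution_axioms_def prob_space_return)
  show "(\<lambda>z. if 0 \<le> z then 1 else 0) = cdf (return borel 0)"
    by (rule ext) (simp add: cdf_def measure_return split: split_indicator)
qed

text \<open>The growth of the mean comes from \<open>D1\<close>, \<open>D2\<close> and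
  \<open>D4\<close>, to be used for the running reward, the jumps and the Poisson events; the
  nonnegative \<open>D3\<close> is for the deterministic times. Block \<open>0\<close> is given up
  in the lower bound, since probabilities of states are controlled from time one on.\<close>

lemma (in prob_space) four_blocks_strong_law:
  fixes R :: "real \<Rightarrow> 'a \<Rightarrow> real"
  assumes D: "mixing_blocks D1 B1 C \<rho>" "mixing_blocks D2 B2 C \<rho>" "mixing_blocks D3 B3 C \<rho>" "mixing_blocks D4 B4 C \<rho>"
    and meas: "\<And>t. 0 \<le> t \<Longrightarrow> R t \<in> borel_measurable M"
    and mono: "AE w in M. (\<forall>s t. 0 \<le> s \<longrightarrow> s \<le> t \<longrightarrow> R s w \<le> R t w) \<and> 0 \<le> R 0 w"
    and R: "\<And>n w. w \<in> space M \<Longrightarrow> R (real n) w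
      = ((\<Sum>i<n. D1 i w) + (\<Sum>i<n. D2 i w)) + ((\<Sum>i<n. D3 i w) + (\<Sum>i<n. D4 i w))"
    and low: "0 < k" "\<And>i. 1 \<le> i \<Longrightarrow> k \<le> expectation (D1 i) + expectation (D2 i) + expectation (D4 i)"
  shows "AE w in M. ((\<lambda>t. R t w / expectation (R t)) \<longlongrightarrow> 1) at_top"
proof -
  obtain K1 where K1: "0 \<le> K1" "\<And>n. integrable M (\<lambda>w. (\<Sum>i<n. D1 i w)\<^sup>2)"
    "\<And>n. expectation (\<lambda>w. (\<Sum>i<n. D1 i w)\<^sup>2) \<le> (\<Sum>i<n. expectation (D1 i))\<^sup>2 + K1 * real n"
    by (rule mixing_blocks_variance[OF D(1)]) blast
  obtain K2 where K2: "0 \<le> K2" "\<And>n. integrable M (\<lambda>w. (\<Sum>i<n. D2 i w)\<^sup>2)"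
    "\<And>n. expectation (\<lambda>w. (\<Sum>i<n. D2 i w)\<^sup>2) \<le> (\<Sum>i<n. expectation (D2 i))\<^sup>2 + K2 * real n"
    by (rule mixing_blocks_variance[OF D(2)]) blast
  obtain K3 where K3: "0 \<le> K3" "\<And>n. integrable M (\<lambda>w. (\<Sum>i<n. D3 i w)\<^sup>2)"
    "\<And>n. expectation (\<lambda>w. (\<Sum>i<n. D3 i w)\<^sup>2) \<le> (\<Sum>i<n. expectation (D3 i))\<^sup>2 + K3 * real n"
    by (rule mixing_blocks_variance[OF D(3)]) blast
  obtain K4 where K4: "0 \<le> K4" "\<And>n. integrable M (\<lambda>w. (\<Sum>i<n. D4 i w)\<^sup>2)"
    "\<And>n. expectation (\<lambda>w. (\<Sum>i<n. D4 i w)\<^sup>2) \<le> (\<Sum>i<n. expectation (D4 i))\<^sup>2 + K4 * real n"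
    by (rule mixing_blocks_variance[OF D(4)]) blast
  note i1 = mixing_blocks_moments(3)[OF D(1)] and i2 = mixing_blocks_moments(3)[OF D(2)]
    and i3 = mixing_blocks_moments(3)[OF D(3)] and i4 = mixing_blocks_moments(3)[OF D(4)]
  note e1 = mixing_blocks_moments(4,5)[OF D(1)] and e2 = mixing_blocks_moments(4,5)[OF D(2)]
    and e3 = mixing_blocks_moments(4,5)[OF D(3)] and e4 = mixing_blocks_moments(4,5)[OF D(4)]
  let ?S1 = "\<lambda>n w. \<Sum>i<n. D1 i w" and ?S2 = "\<lambda>n w. \<Sum>i<n. D2 i w"
    and ?S3 = "\<lambda>n w. \<Sum>i<n. D3 i w" and ?S4 = "\<lambda>n w. \<Sum>i<n. D4 i w"
  have s: "integrable M (?S1 n)" "integrable M (?S2 n)" "integrable M (?S3 n)" "integrable M (?S4 n)" for n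
    by (intro Bochner_Integration.integrable_sum i1 i2 i3 i4)+
  note m = borel_measurable_integrable[OF s(1)] borel_measurable_integrable[OF s(2)]
    borel_measurable_integrable[OF s(3)] borel_measurable_integrable[OF s(4)]
  have es: "expectation (?S1 n) = (\<Sum>i<n. expectation (D1 i))" "expectation (?S2 n) = (\<Sum>i<n. expectation (D2 i))"
    "expectation (?S3 n) = (\<Sum>i<n. expectation (D3 i))" "expectation (?S4 n) = (\<Sum>i<n. expectation (D4 i))" for n
    using i1 i2 i3 i4 by (simp_all add: Bochner_Integration.integral_sum)
  let ?R = "\<lambda>n w. (?S1 n w + ?S2 n w) + (?S3 n w + ?S4 n w)"
  have ER: "expectation (R (real n)) = expectation (?R n)" for n
    by (intro Bochner_Integration.integral_cong refl R)
  have ER': "expectation (?R n) = (\<Sum>i<n. expectation (D1 i) + expectation (D2 i) + expectation (D3 i) + expectation (D4 i))" for n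
    using s by (simp add: es sum.distrib)
  have v12: "integrable M (\<lambda>w. (?S1 n w + ?S2 n w)\<^sup>2)"
    "expectation (\<lambda>w. (?S1 n w + ?S2 n w)\<^sup>2) \<le> (expectation (\<lambda>w. ?S1 n w + ?S2 n w))\<^sup>2 + 2 * (K1 * real n + K2 * real n)" for n
    by (rule second_moment_add[OF m(1,2) K1(2) K2(2) K1(3)[folded es(1)] K2(3)[folded es(2)]])+
  have v34: "integrable M (\<lambda>w. (?S3 n w + ?S4 n w)\<^sup>2)"
    "expectation (\<lambda>w. (?S3 n w + ?S4 n w)\<^sup>2) \<le> (expectation (\<lambda>w. ?S3 n w + ?S4 n w))\<^sup>2 + 2 * (K3 * real n + K4 * real n)" for n
    by (rule second_moment_add[OF m(3,4) K3(2) K4(2) K3(3)[folded es(3)] K4(3)[folded es(4)]])+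
  have m12: "(\<lambda>w. ?S1 n w + ?S2 n w) \<in> borel_measurable M" for n by (rule borel_measurable_add[OF m(1,2)])
  have m34: "(\<lambda>w. ?S3 n w + ?S4 n w) \<in> borel_measurable M" for n by (rule borel_measurable_add[OF m(3,4)])
  note v = second_moment_add[OF m12 m34 v12(1) v34(1) v12(2) v34(2)]
  let ?K = "4 * (K1 + K2 + K3 + K4)"
  show ?thesis
  \<comment> \<open>The factor \<open>4\<close> in \<open>?K\<close> comes from adding the parts
    pairwise, with a factor two each time. \<open>Bd\<close> is the sum of the bounds
    \<open>1 + B\<close> for the four block means.\<close>
  proof (rule monotone_strong_law[OF meas mono, where K="?K" and c=k and Bd="4 + B1 + B2 + B3 + B4"])
    fix n
    show "integrable M (\<lambda>w. (R (real n) w)\<^sup>2)"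
      using v(1)[of n] R by (subst Bochner_Integration.integrable_cong[OF refl, of _ _ "\<lambda>w. (?R n w)\<^sup>2"]) auto
    have "expectation (\<lambda>w. (R (real n) w)\<^sup>2) = expectation (\<lambda>w. (?R n w)\<^sup>2)"
      by (intro Bochner_Integration.integral_cong refl) (simp add: R)
    also have "\<dots> \<le> (expectation (?R n))\<^sup>2 + 2 * (2 * (K1 * real n + K2 * real n) + 2 * (K3 * real n + K4 * real n))"
      by (rule v(2))
    also have "2 * (2 * (K1 * real n + K2 * real n) + 2 * (K3 * real n + K4 * real n)) = ?K * real n"
      by (simp add: algebra_simps)
    finally show "expectation (\<lambda>w. (R (real n) w)\<^sup>2) \<le> (expectation (R (real n)))\<^sup>2 + ?K * real n"
      unfolding ER .
    have "k * (real n - 1) \<le> (\<Sum>i<n. expectation (D1 i) + expectation (D2 i) + expectation (D3 i) + expectation (D4 i))"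
    proof (induct n)
      case 0
      then show ?case using low(1) by simp
    next
      case (Suc n)
      show ?case
      proof (cases "n = 0")
        case True
        then show ?thesis using e1(1)[of 0] e2(1)[of 0] e3(1)[of 0] e4(1)[of 0] by simp
      next
        case False
        then have "k \<le> expectation (D1 n) + expectation (D2 n) + expectation (D4 n)" by (intro low(2)) simp
        then show ?thesis using Suc e3(1)[of n] by (simp add: algebra_simps)
      qed
    qed
    then show "k * (real n - 1) \<le> expectation (R (real n))" unfolding ER ER' .
    show "expectation (R (real (Suc n))) \<le> expectation (R (real n)) + (4 + B1 + B2 + B3 + B4)"
      unfolding ER ER' using e1(2)[of n] e2(2)[of n] e3(2)[of n] e4(2)[of n] by simp
  qed (use low K1(1) K2(1) K3(1) K4(1) in auto)
qed

theorem theorem2: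
  fixes M :: "'w measure"
    and X :: "real \<Rightarrow> 'w \<Rightarrow> 's::finite"
    and N :: "real \<Rightarrow> 'w \<Rightarrow> nat"
    and Q :: "real \<Rightarrow> 's \<Rightarrow> 's \<Rightarrow> real"
    and \<mu> :: "'s pmf"
    and r \<beta> :: "real \<Rightarrow> 's \<Rightarrow> real"
    and G :: "real \<Rightarrow> 's \<Rightarrow> 's \<Rightarrow> real \<Rightarrow> real"
    and H K :: "real \<Rightarrow> 's \<Rightarrow> real \<Rightarrow> real"
    and ts :: "nat \<Rightarrow> real"
    and GG HH KK :: "nat \<Rightarrow> 'w \<Rightarrow> real"
  assumes "prob_space M"
    and "markov_jump_process M Q \<mu> X"
    and "conditional_poisson_process M \<beta> X N"
    and "reward_times ts"
    and "\<And>t x y. 0 \<le> t \<Longrightarrow> distribution_function (G t x y)"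
    and "\<And>t x. 0 \<le> t \<Longrightarrow> distribution_function (H t x)"
    and "\<And>t x. 0 \<le> t \<Longrightarrow> distribution_function (K t x)"
    and "lump_sum_rewards M X N ts G H K GG HH KK"
    and "assumption_A1 Q r G K \<beta>"
    and "assumption_A2 Q"
    and "assumption_A3 Q"
    and "assumption_A4 Q r \<beta> G H K"
    and "assumption_A5 ts"
  shows "AE w in M. ((\<lambda>t. cumulative_reward r ts X N GG HH KK t w /
           prob_space.expectation M (cumulative_reward r ts X N GG HH KK t)) \<longlongrightarrow> 1) at_top"
proof -
  interpret prob_space M by fact
  have rate: "rate_matrix (Q t)" and X_meas: "X t \<in> measurable M (count_space UNIV)" if "0 \<le> t" for t
    using assms(2) that by (simp_all add: markov_jump_process_def)
  have X_path: "jump_path (\<lambda>t. X t w)" if "w \<in> space M" for w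
    using assms(2) that by (simp add: markov_jump_process_def)
  obtain P where P: "transition_matrices Q P"
    "\<And>s t x y A. 0 \<le> s \<Longrightarrow> s \<le> t \<Longrightarrow> A \<in> sets (generated M {0..s} X) \<Longrightarrow>
      measure M (A \<inter> {w \<in> space M. X s w = x} \<inter> {w \<in> space M. X t w = y})
        = measure M (A \<inter> {w \<in> space M. X s w = x}) * P s t x y"
    by (rule markov_jump_process_events[OF assms(1,2)]) blast
  obtain \<Lambda> q where q: "0 < q" and \<Lambda>: "0 < \<Lambda>" and Q_le: "\<And>t x y. 0 \<le> t \<Longrightarrow> \<bar>Q t x y\<bar> \<le> \<Lambda>"
    and Q_ge: "\<And>t x y. 0 \<le> t \<Longrightarrow> (x, y) \<in> positive_pairs (Q 1) \<Longrightarrow> q \<le> Q t x y"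
    by (rule rate_bounds[OF _ assms(10,11)]) (rule rate, assumption, rule that)
  have A1: "measurable_in_time (\<lambda>t. Q t x y)" "measurable_in_time (\<lambda>t. r t x)" "measurable_in_time (\<lambda>t. G t x y z)"
    "measurable_in_time (\<lambda>t. K t x z)" "measurable_in_time (\<lambda>t. \<beta> t x)" for x y z
    using assms(9) by (simp_all add: assumption_A1_def)
  have Q_nonneg: "0 \<le> Q t x y" if "0 \<le> t" "x \<noteq> y" for t x y
    using rate[OF that(1)] that(2) by (simp add: rate_matrix_def)
  interpret Y: bounded_jump_process M X Q P \<Lambda> q "positive_pairs (Q 1)"
  proof
    show "(x, y) \<in> (positive_pairs (Q 1))\<^sup>*" for x y
      using assms(10) by (simp add: assumption_A2_def irreducible_rate_matrix_def)
    fix s t x y assume "(0::real) \<le> s" "s \<le> t"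
    then show "set_integrable lborel {s..t} (\<lambda>u. \<Sum>z\<in>UNIV. P s u x z * Q u z y)"
      "P s t x y = (if x = y then 1 else 0) + (LBINT u:{s..t}. \<Sum>z\<in>UNIV. P s u x z * Q u z y)"
      using P(1) unfolding transition_matrices_def by blast+
  qed (fact X_meas X_path P(2) A1(1) Q_nonneg Q_le Q_ge q \<Lambda>)+
  obtain \<delta> Cm \<rho> where \<delta>: "0 < \<delta>" and Cm: "0 \<le> Cm" and \<rho>: "0 < \<rho>" "\<rho> < 1"
    and low: "\<And>t x. 1 \<le> t \<Longrightarrow> \<delta> \<le> prob (Y.hit t x)"
    and psi: "\<And>s t A x k. 0 \<le> s \<Longrightarrow> s + real k \<le> t \<Longrightarrow> 1 \<le> t \<Longrightarrow> A \<in> Y.past s \<Longrightarrow>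
      prob (A \<inter> Y.hit t x) \<le> (1 + Cm * \<rho> ^ k) * prob A * prob (Y.hit t x)"
    by (rule Y.psi_mixing) blast
  \<comment> \<open>Block \<open>i\<close> ends at \<open>i + 1\<close> and block \<open>j\<close>
    starts at \<open>j \<ge> 2\<close>, so the gap is \<open>j - i - 1\<close> and the condition
    \<open>1 \<le> t\<close> of \<open>psi\<close> holds.\<close>
  have mixes: "Y.mixes (1 + Cm * \<rho> ^ (j - i - 1)) (real (Suc i)) (real j)" if "i + 2 \<le> j" for i j :: nat
    unfolding Y.mixes_def
  proof (intro conjI allI impI ballI)
    show "0 \<le> 1 + Cm * \<rho> ^ (j - i - 1)" using Cm \<rho> by simp
    show "0 \<le> real (Suc i)" "real (Suc i) \<le> real j" using that by auto
    fix u A x assume u: "real j \<le> u" and A: "A \<in> Y.past (real (Suc i))"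
    have "real (Suc i) + real (j - i - 1) = real j" using that by simp
    then show "prob (A \<inter> Y.hit u x) \<le> (1 + Cm * \<rho> ^ (j - i - 1)) * prob A * prob (Y.hit u x)"
      using u that by (intro psi[OF _ _ _ A]) auto
  qed
  have mixes': "Y.mixes (1 + Cm * \<rho> ^ (j - i - 1)) b a'"
    if "i + 2 \<le> j" "0 \<le> b" "b \<le> real (Suc i)" "real j \<le> a'" for i j :: nat and b a'
    by (rule Y.mixes_mono[OF mixes[OF that(1)] that(2-4)])
  obtain C rb b where C: "0 \<le> (C::real)"
    and r: "\<And>t x. 0 \<le> t \<Longrightarrow> 0 \<le> r t x" "\<And>t x. 0 \<le> t \<Longrightarrow> r t x \<le> rb"
    and \<beta>: "\<And>t x. 0 \<le> t \<Longrightarrow> 0 \<le> \<beta> t x" "\<And>t x. 0 \<le> t \<Longrightarrow> \<beta> t x \<le> b"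
    and G: "\<And>t x y. 0 \<le> t \<Longrightarrow> left_limit (G t x y) 0 \<le> 0" "\<And>t x y. 0 \<le> t \<Longrightarrow> 1 \<le> G t x y C"
    and H: "\<And>t x. 0 \<le> t \<Longrightarrow> left_limit (H t x) 0 \<le> 0" "\<And>t x. 0 \<le> t \<Longrightarrow> 1 \<le> H t x C"
    and K: "\<And>t x. 0 \<le> t \<Longrightarrow> left_limit (K t x) 0 \<le> 0" "\<And>t x. 0 \<le> t \<Longrightarrow> 1 \<le> K t x C"
    by (rule reward_bounds[OF assms(12)])
      ((rule assms(5), assumption | rule assms(6), assumption | rule assms(7), assumption)+, rule that)
  have Gp: "ennreal (positive_mean (G t x y)) = mean_below C (G t x y)"
    "z < 0 \<Longrightarrow> G t x y z = 0" "C \<le> z \<Longrightarrow> G t x y z = 1" if "0 \<le> t" for t x y z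
    by (rule positive_mean_eq_mean_below[OF assms(5)[OF that] C G[OF that]]; assumption)+
  have Hp: "z < 0 \<Longrightarrow> H t x z = 0" "C \<le> z \<Longrightarrow> H t x z = 1" if "0 \<le> t" for t x z
    by (rule positive_mean_eq_mean_below(2,3)[OF assms(6)[OF that] C H[OF that]]; assumption)+
  have Kp: "ennreal (positive_mean (K t x)) = mean_below C (K t x)"
    "z < 0 \<Longrightarrow> K t x z = 0" "C \<le> z \<Longrightarrow> K t x z = 1" if "0 \<le> t" for t x z
    by (rule positive_mean_eq_mean_below[OF assms(7)[OF that] C K[OF that]]; assumption)+
  have "state_functional_axioms r rb"
    by unfold_locales (fact A1(2) r)+
  then interpret T: state_functional M X Q P \<Lambda> q "positive_pairs (Q 1)" r rb
    by (intro state_functional.intro Y.bounded_jump_process_axioms)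
  interpret N: modulated_poisson M X Q P \<Lambda> q "positive_pairs (Q 1)" \<beta> b N
    by unfold_locales (fact A1(5) \<beta> assms(3))+
  let ?n = "num_before ts"
  \<comment> \<open>The deterministic reward times as a counting process that does not depend on the
    sample point, labelled by the current state.\<close>
  interpret S: state_counting M X Q P \<Lambda> q "positive_pairs (Q 1)" "\<lambda>t w. ?n t"
  proof
    show "(\<integral>\<^sup>+w. of_nat (?n t - ?n s) \<partial>M) < \<infinity>" for s t
      by (simp add: emeasure_space_1 ennreal_of_nat_eq_real_of_nat)
  qed (simp_all add: counting_path_num_before[OF assms(4)])
  \<comment> \<open>One sigma-algebra serves all three kinds of events: jumps and their labels are
    functions of \<open>X\<close>, Poisson events need \<open>N\<close> as well, and the
    deterministic times need only the states.\<close>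
  define F where "F = generated M {0..} (\<lambda>t w. (X t w, N t w))"
  have sub: "subalgebra M F"
    unfolding F_def
  proof (rule subalgebra_generated)
    fix t :: real assume "t \<in> {0..}"
    then have "X t \<in> measurable M (count_space UNIV)" "N t \<in> measurable M (count_space UNIV)"
      using X_meas N.N_meas by auto
    then have "(\<lambda>w. (X t w, N t w)) \<in> measurable M (count_space UNIV \<Otimes>\<^sub>M count_space UNIV)" by measurable
    then show "(\<lambda>w. (X t w, N t w)) \<in> measurable M (count_space UNIV)"
      by (simp add: pair_measure_countable)
  qed
  have F_XN: "(\<lambda>w. (X t w, N t w)) \<in> measurable F (count_space UNIV)" if "0 \<le> t" for t
    unfolding F_def using that by (intro measurable_generated[where Z="\<lambda>t w. (X t w, N t w)"]) auto
  have F_X: "X t \<in> measurable F (count_space UNIV)" if "0 \<le> t" for t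
    using measurable_compose[OF F_XN[OF that], of fst "count_space UNIV"] by simp
  have F_N: "N t \<in> measurable F (count_space UNIV)" if "0 \<le> t" for t
    using measurable_compose[OF F_XN[OF that], of snd "count_space UNIV"] by simp
  have F_space: "space F = space M" by (simp add: F_def space_generated)
  have fin: "finite ({}::nat set)" "({}::nat set) \<subseteq> {1..}" by auto
  have GHK_meas: "GG k \<in> borel_measurable M" "HH k \<in> borel_measurable M" "KK k \<in> borel_measurable M" if "1 \<le> k" for k
    using assms(8) that by (simp_all add: lump_sum_rewards_def)
  have FJ: "Y.J t \<in> measurable F (count_space UNIV)" if "0 \<le> t" for t
    using F_X F_space that by (rule Y.J_meas)
  have FJL: "Y.JL k \<in> measurable F (count_space UNIV)" for k
    using F_X F_space by (rule Y.JL_meas)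
  have FSL: "N.SL k \<in> measurable F (count_space UNIV)" for k
    using F_X F_N F_space by (rule N.SL_meas)
  \<comment> \<open>Rewards of a single kind are obtained from the joint conditional law by taking
    the other two index sets empty.\<close>
  interpret G: marked_counting M F Y.J Y.JL GG "\<lambda>t l. G t (fst l) (snd l)" C
  proof
    fix A :: "nat set" and z assume A: "finite A" "A \<subseteq> {1..}"
    from lump_sum_rewardsD[OF assms(8) A(1) fin(1) fin(1) A(2) fin(2) fin(2), of z z z, folded F_def] AE_space
    show "AE w in M. (\<forall>k\<in>A. event_occurs (\<lambda>t. Y.J t w) k) \<longrightarrow>
        real_cond_exp M F (indicator {w' \<in> space M. \<forall>k\<in>A. GG k w' \<le> z k}) w
          = (\<Prod>k\<in>A. G (event_time (\<lambda>t. Y.J t w) k) (fst (Y.JL k w)) (snd (Y.JL k w)) (z k))"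
    proof eventually_elim
      case (elim w)
      show ?case
      proof
        assume o: "\<forall>k\<in>A. event_occurs (\<lambda>t. Y.J t w) k"
        then have "real_cond_exp M F (indicator {w' \<in> space M. \<forall>k\<in>A. GG k w' \<le> z k}) w
          = (\<Prod>k\<in>A. G (jump_time (\<lambda>t. X t w) k) (embedded (\<lambda>t. X t w) (k - 1)) (embedded (\<lambda>t. X t w) k) (z k))"
          using elim(1) by (simp add: Y.J_fun)
        also have "\<dots> = (\<Prod>k\<in>A. G (event_time (\<lambda>t. Y.J t w) k) (fst (Y.JL k w)) (snd (Y.JL k w)) (z k))"
          using o Y.JL_occ[OF elim(2)] by (intro prod.cong refl) (simp add: jump_time_def Y.J_fun)
        finally show "real_cond_exp M F (indicator {w' \<in> space M. \<forall>k\<in>A. GG k w' \<le> z k}) w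
          = (\<Prod>k\<in>A. G (event_time (\<lambda>t. Y.J t w) k) (fst (Y.JL k w)) (snd (Y.JL k w)) (z k))" .
      qed
    qed
  qed (rule sub FJ Y.J_path FJL GHK_meas(1) A1(3) assms(5) Gp(2) Gp(3) C; assumption)+
  interpret K: marked_counting M F N N.SL KK K C
  proof
    fix A :: "nat set" and z assume A: "finite A" "A \<subseteq> {1..}"
    from lump_sum_rewardsD[OF assms(8) fin(1) fin(1) A(1) fin(2) fin(2) A(2), of z z z, folded F_def] AE_space
    show "AE w in M. (\<forall>k\<in>A. event_occurs (\<lambda>t. N t w) k) \<longrightarrow>
        real_cond_exp M F (indicator {w' \<in> space M. \<forall>k\<in>A. KK k w' \<le> z k}) w
          = (\<Prod>k\<in>A. K (event_time (\<lambda>t. N t w) k) (N.SL k w) (z k))"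
    proof eventually_elim
      case (elim w)
      then show ?case using N.SL_occ[OF elim(2)] by simp
    qed
  qed (rule sub F_N N.N_path FSL GHK_meas(3) A1(4) assms(7) Kp(2) Kp(3) C; assumption)+
  \<comment> \<open>(A1) does not make \<open>H\<close> measurable in time. Off the countable set of reward times its values are irrelevant.\<close>
  define H' where "H' t x z = (if t \<in> range ts then H t x z else if 0 \<le> z then 1 else 0)" for t x and z :: real
  have H'_meas: "measurable_in_time (\<lambda>t. H' t x z)" for x z
  proof (rule measurable_restrict_space1)
    show "(\<lambda>t. H' t x z) \<in> borel_measurable borel"
      by (rule measurable_discrete_difference[of "\<lambda>t. if 0 \<le> z then 1 else 0" _ _ "range ts"])
        (auto simp: H'_def)
  qed
  have H'_df: "distribution_function (H' t x)" if "0 \<le> t" for t x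
    using assms(6)[OF that] point_mass_distribution_function unfolding H'_def[abs_def] by (cases "t \<in> range ts") simp_all
  interpret H: marked_counting M F "\<lambda>t w. ?n t" S.SL HH H' C
  proof
    fix A :: "nat set" and z assume A: "finite A" "A \<subseteq> {1..}"
    from lump_sum_rewardsD[OF assms(8) fin(1) A(1) fin(1) fin(2) A(2) fin(2), of z z z, folded F_def] AE_space
    show "AE w in M. (\<forall>k\<in>A. event_occurs (\<lambda>t. ?n t) k) \<longrightarrow>
        real_cond_exp M F (indicator {w' \<in> space M. \<forall>k\<in>A. HH k w' \<le> z k}) w
          = (\<Prod>k\<in>A. H' (event_time (\<lambda>t. ?n t) k) (S.SL k w) (z k))"
    proof eventually_elim
      case (elim w)
      have "S.SL k w = X (ts k) w" for k
        using S.SL_occ[OF elim(2)] event_occurs_num_before[OF assms(4)] by (simp add: event_time_num_before[OF assms(4)])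
      then show ?case using elim by (simp add: event_time_num_before[OF assms(4)] H'_def)
    qed
  next
    show "S.SL k \<in> measurable F (count_space UNIV)" for k
      by (rule S.SL_meas[OF F_X _ F_space]) simp_all
    show "H' t x z = 0" if "0 \<le> t" "z < 0" for t x z
      using Hp(1)[OF that] that(2) by (simp add: H'_def)
    show "H' t x z = 1" if "0 \<le> t" "C \<le> z" for t x z
      using Hp(2)[OF that] that(2) C by (simp add: H'_def)
  qed ((rule sub counting_path_num_before[OF assms(4)] GHK_meas(2) H'_meas H'_df C; assumption) | simp)+
  \<comment> \<open>The counts of \<open>marked_counting\<close> and \<open>grid_counting\<close>
    coincide; through these identities the mixing obtained along grids feeds the estimates for
    rewards.\<close>
  have GLC: "G.LC = Y.JG.cnt" by (intro ext) (simp add: G.LC_def Y.JG.cnt_def)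
  have KLC: "K.LC = N.SG.cnt" by (intro ext) (simp add: K.LC_def N.SG.cnt_def)
  have HLC: "H.LC = S.SG.cnt" by (intro ext) (simp add: H.LC_def S.SG.cnt_def)
  have DT: "mixing_blocks T.block_integral (rb\<^sup>2) Cm \<rho>"
    by (rule T.block_integral_mixing_blocks[OF Cm \<rho> mixes])
  have DG: "mixing_blocks G.block_reward (C\<^sup>2 * (\<Lambda> + \<Lambda>\<^sup>2)) Cm \<rho>"
  proof (rule G.block_reward_mixing_blocks[OF _ _ Cm \<rho>])
    show "0 \<le> \<Lambda> + \<Lambda>\<^sup>2" using \<Lambda> by simp
    show "(\<integral>\<^sup>+w. (of_nat (Y.J (real (Suc i)) w - Y.J (real i) w))\<^sup>2 \<partial>M) \<le> ennreal (\<Lambda> + \<Lambda>\<^sup>2)" for i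
      using Y.J_second_moment[of "real i" "real (Suc i)"] by simp
    fix i j l l' a b a' b'
    assume "i + 2 \<le> j" "real i \<le> a" "a \<le> b" "b \<le> real (Suc i)" "real j \<le> a'" "a' \<le> b'"
    then show "(\<integral>\<^sup>+w. G.LC l a b w * G.LC l' a' b' w \<partial>M)
        \<le> ennreal (1 + Cm * \<rho> ^ (j - i - 1)) * (\<integral>\<^sup>+w. G.LC l a b w \<partial>M) * (\<integral>\<^sup>+w. G.LC l' a' b' w \<partial>M)"
      unfolding GLC by (intro Y.J_mixing mixes') auto
  qed
  have b0: "0 \<le> b" using \<beta>(1)[of 0] \<beta>(2)[of 0] by (rule order.trans) simp_all
  have DK: "mixing_blocks K.block_reward (C\<^sup>2 * (b\<^sup>2 + b)) Cm \<rho>"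
  proof (rule K.block_reward_mixing_blocks[OF _ _ Cm \<rho>])
    show "0 \<le> b\<^sup>2 + b" using b0 by simp
    show "(\<integral>\<^sup>+w. (of_nat (N (real (Suc i)) w - N (real i) w))\<^sup>2 \<partial>M) \<le> ennreal (b\<^sup>2 + b)" for i
      using N.N_second_moment[of "real i" "real (Suc i)"] by simp
    fix i j l l' a b a' b'
    assume "i + 2 \<le> j" "real i \<le> a" "a \<le> b" "b \<le> real (Suc i)" "real j \<le> a'" "a' \<le> b'"
    then show "(\<integral>\<^sup>+w. K.LC l a b w * K.LC l' a' b' w \<partial>M)
        \<le> ennreal (1 + Cm * \<rho> ^ (j - i - 1)) * (\<integral>\<^sup>+w. K.LC l a b w \<partial>M) * (\<integral>\<^sup>+w. K.LC l' a' b' w \<partial>M)"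
      unfolding KLC by (intro N.N_mixing mixes') auto
  qed
  obtain S0 where S0: "0 \<le> S0" "\<And>i. real (?n (real (Suc i)) - ?n (real i)) \<le> S0"
    by (rule num_before_increment[OF assms(4,13)]) blast
  have DH: "mixing_blocks H.block_reward (C\<^sup>2 * S0\<^sup>2) Cm \<rho>"
  proof (rule H.block_reward_mixing_blocks[OF _ _ Cm \<rho>])
    show "0 \<le> S0\<^sup>2" by simp
    show "(\<integral>\<^sup>+w. (of_nat (?n (real (Suc i)) - ?n (real i)))\<^sup>2 \<partial>M) \<le> ennreal (S0\<^sup>2)" for i
    proof -
      have "(real (?n (real (Suc i)) - ?n (real i)))\<^sup>2 \<le> S0\<^sup>2" using S0(2)[of i] by (intro power_mono) auto
      then have "ennreal ((real (?n (real (Suc i)) - ?n (real i)))\<^sup>2) \<le> ennreal (S0\<^sup>2)" by (rule ennreal_leI)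
      then have "(of_nat (?n (real (Suc i)) - ?n (real i)))\<^sup>2 \<le> ennreal (S0\<^sup>2)"
        by (simp only: ennreal_of_nat_eq_real_of_nat ennreal_power of_nat_0_le_iff)
      then show ?thesis by (simp add: emeasure_space_1)
    qed
    fix i j l l' a b a' b'
    assume "i + 2 \<le> j" "real i \<le> a" "a \<le> b" "b \<le> real (Suc i)" "real j \<le> a'" "a' \<le> b'"
    then show "(\<integral>\<^sup>+w. H.LC l a b w * H.LC l' a' b' w \<partial>M)
        \<le> ennreal (1 + Cm * \<rho> ^ (j - i - 1)) * (\<integral>\<^sup>+w. H.LC l a b w \<partial>M) * (\<integral>\<^sup>+w. H.LC l' a' b' w \<partial>M)"
      unfolding HLC by (intro S.S_mixing_deterministic[where n="?n"] mixes' refl) auto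
  qed
  have Htot: "H.total_reward t w = (\<Sum>i = 1..Sup {i. ts i \<le> t}. HH i w)" for t w
    unfolding H.total_reward_def unfolding num_before_def[OF assms(4)] ..
  have R_eq: "cumulative_reward r ts X N GG HH KK t w = T.A 0 t w + G.total_reward t w + H.total_reward t w + K.total_reward t w" for t w
    by (simp add: cumulative_reward_def T.A_def G.total_reward_def Htot K.total_reward_def Y.J_def)
  \<comment> \<open>Any single state will do: from time one on each is occupied with probability at
    least \<open>\<delta>\<close>, and \<open>assumption_A4\<close> makes rewards accrue in it at a
    positive rate.\<close>
  define x0 :: 's where "x0 = undefined"
  have pm0: "0 \<le> positive_mean f" for f
    unfolding positive_mean_def set_lebesgue_integral_def
    by (intro Bochner_Integration.integral_nonneg) (auto split: split_indicator)
  have jr0: "0 \<le> jump_reward_rate Q G t x0" for t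
    unfolding jump_reward_rate_def using pm0
    by (intro sum_nonneg mult_nonneg_nonneg) (auto simp: positive_pairs_def)
  have er0: "0 \<le> event_reward_rate \<beta> K t x0" if "0 \<le> t" for t
    unfolding event_reward_rate_def using pm0 \<beta>(1)[OF that] by (intro mult_nonneg_nonneg)
  obtain r0 \<gamma>0 where r0: "0 \<le> r0" and \<gamma>0: "0 \<le> \<gamma>0" and r\<gamma>: "0 < r0 + \<gamma>0"
    and r0_le: "\<And>t. 0 \<le> t \<Longrightarrow> r0 \<le> r t x0"
    and \<gamma>0_le: "\<And>t. 0 \<le> t \<Longrightarrow> \<gamma>0 \<le> jump_reward_rate Q G t x0 + event_reward_rate \<beta> K t x0"
    by (rule positive_reward_rate[OF assms(12) r(1), of x0])
      (assumption, rule add_nonneg_nonneg[OF jr0 er0], assumption, rule that)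
  \<comment> \<open>Lower bounds for the densities of the mean counts by label, to be used in
    \<open>reward_sum_ge\<close>. The diagonal is set to zero because a jump changes the
    state.\<close>
  define qG where "qG l u = (if fst l = snd l then 0 else ennreal (\<delta> * Q (max 0 u) (fst l) (snd l)))" for l u
  define qK where "qK x u = ennreal (\<delta> * \<beta> (max 0 u) x)" for x u
  have qG_meas: "qG l \<in> borel_measurable borel" for l
    unfolding qG_def using Y.Q_meas'[of "fst l" "snd l"] by measurable
  have \<beta>_meas': "(\<lambda>u. \<beta> (max 0 u) x) \<in> borel_measurable borel" for x
    by (rule measurable_compose[OF _ A1(5)]) (auto intro!: measurable_restrict_space2)
  have qK_meas: "qK x \<in> borel_measurable borel" for x
    unfolding qK_def using \<beta>_meas'[of x] by measurable
  have Q_diag: "Q t x x \<le> 0" if "0 \<le> t" for t x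
  proof -
    have "(\<Sum>z\<in>UNIV. Q t x z) = 0" using rate[OF that] by (simp add: rate_matrix_def)
    moreover have "(\<Sum>z\<in>UNIV. Q t x z) = Q t x x + (\<Sum>z\<in>UNIV - {x}. Q t x z)" by (rule sum.remove) auto
    moreover have "0 \<le> (\<Sum>z\<in>UNIV - {x}. Q t x z)" using Q_nonneg[OF that] by (intro sum_nonneg) auto
    ultimately show ?thesis by linarith
  qed
  \<comment> \<open>Only the sum of the two reward rates is bounded below, and which of them is
    positive may vary with time. Jumps and Poisson events are therefore combined pointwise in
    \<open>u\<close> before integrating over the block.\<close>
  have lump_low: "ennreal (\<delta> * \<gamma>0) \<le> ennreal (expectation (G.block_reward i)) + ennreal (expectation (K.block_reward i))"
    if i: "1 \<le> i" for i
  proof -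
    let ?I = "{real i<..real (Suc i)}"
    let ?g = "\<lambda>u. \<Sum>l\<in>UNIV. qG l u * mean_below C (G (max 0 u) (fst l) (snd l))"
    let ?k = "\<lambda>u. \<Sum>x\<in>UNIV. qK x u * mean_below C (K (max 0 u) x)"
    note [measurable] = qG_meas qK_meas G.mean_meas K.mean_meas
    have gk: "ennreal (\<delta> * \<gamma>0) \<le> ?g u + ?k u" if u: "0 \<le> u" for u
    proof -
      let ?Y = "{y. (x0, y) \<in> positive_pairs (Q u)}"
      have "\<delta> * \<gamma>0 \<le> \<delta> * (jump_reward_rate Q G u x0 + event_reward_rate \<beta> K u x0)"
        using \<delta> \<gamma>0_le[OF u] by (intro mult_left_mono) auto
      then have "ennreal (\<delta> * \<gamma>0) \<le> ennreal (\<delta> * jump_reward_rate Q G u x0 + \<delta> * event_reward_rate \<beta> K u x0)"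
        by (intro ennreal_leI) (simp add: distrib_left)
      also have "\<dots> = ennreal (\<delta> * jump_reward_rate Q G u x0) + ennreal (\<delta> * event_reward_rate \<beta> K u x0)"
        using \<delta> jr0 er0[OF u] by (intro ennreal_plus mult_nonneg_nonneg) auto
      also have "ennreal (\<delta> * jump_reward_rate Q G u x0) = (\<Sum>y\<in>?Y. qG (x0, y) u * mean_below C (G (max 0 u) x0 y))"
      proof -
        have "\<delta> * jump_reward_rate Q G u x0 = (\<Sum>y\<in>?Y. \<delta> * (Q u x0 y * positive_mean (G u x0 y)))"
          by (simp add: jump_reward_rate_def sum_distrib_left)
        also have "ennreal \<dots> = (\<Sum>y\<in>?Y. ennreal (\<delta> * (Q u x0 y * positive_mean (G u x0 y))))"
          using \<delta> pm0 by (intro sum_ennreal[symmetric] mult_nonneg_nonneg) (auto simp: positive_pairs_def)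
        also have "\<dots> = (\<Sum>y\<in>?Y. qG (x0, y) u * mean_below C (G (max 0 u) x0 y))"
        proof (intro sum.cong refl)
          fix y assume "y \<in> ?Y"
          then have Qp: "0 < Q u x0 y" by (simp add: positive_pairs_def)
          then have "x0 \<noteq> y" using Q_diag[OF u, of x0] by auto
          then show "ennreal (\<delta> * (Q u x0 y * positive_mean (G u x0 y))) = qG (x0, y) u * mean_below C (G (max 0 u) x0 y)"
            using Qp \<delta> pm0[of "G u x0 y"] u
            by (simp add: qG_def max_def Gp(1)[OF u, symmetric] ennreal_mult[symmetric] mult.assoc)
        qed
        finally show ?thesis .
      qed
      also have "\<dots> = (\<Sum>l\<in>Pair x0 ` ?Y. qG l u * mean_below C (G (max 0 u) (fst l) (snd l)))"
        by (subst sum.reindex) (auto simp: inj_on_def)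
      also have "\<dots> \<le> ?g u" by (intro sum_mono2) auto
      also have "ennreal (\<delta> * event_reward_rate \<beta> K u x0) = qK x0 u * mean_below C (K (max 0 u) x0)"
        using \<delta> pm0[of "K u x0"] \<beta>(1)[OF u, of x0] u
        by (simp add: event_reward_rate_def qK_def max_def Kp(1)[OF u, symmetric] ennreal_mult[symmetric] mult.assoc)
      also have "\<dots> \<le> ?k u" by (rule member_le_sum[of x0 UNIV "\<lambda>x. qK x u * mean_below C (K (max 0 u) x)"]) auto
      finally show ?thesis by (auto intro: add_mono)
    qed
    have G_ge: "(\<integral>\<^sup>+u\<in>?I. ?g u \<partial>lborel) \<le> (\<integral>\<^sup>+w. G.reward_sum (real i) (real (Suc i)) w \<partial>M)"
    proof -
      have "(\<integral>\<^sup>+u\<in>?I. (\<Sum>l\<in>UNIV. qG l u * mean_below C (G u (fst l) (snd l))) \<partial>lborel) \<le> (\<integral>\<^sup>+w. G.reward_sum (real i) (real (Suc i)) w \<partial>M)"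
      proof (rule G.reward_sum_ge[OF _ _ _ qG_meas])
        show "(\<integral>\<^sup>+w. of_nat (Y.J (real (Suc i)) w - Y.J (real i) w) \<partial>M) < \<infinity>" by (rule Y.J_fin) auto
        fix l a b assume ab: "real i \<le> a" "a \<le> b"
        then have a: "1 \<le> a" "0 \<le> a" using i by auto
        show "(\<integral>\<^sup>+u\<in>{a<..b}. qG l u \<partial>lborel) \<le> (\<integral>\<^sup>+w. G.LC l a b w \<partial>M)"
        proof (cases "fst l = snd l")
          case False
          have "(\<integral>\<^sup>+u\<in>{a<..b}. qG l u \<partial>lborel) = (\<integral>\<^sup>+u\<in>{a<..b}. ennreal (\<delta> * Q (max 0 u) (fst l) (snd l)) \<partial>lborel)"
            using False by (simp add: qG_def)
          also have "\<dots> \<le> ennreal (\<delta> * (LBINT u:{a..b}. Q u (fst l) (snd l)))"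
            using \<delta> False by (intro nn_integral_Ioc_scaled_le a Y.set_integrable_Q Q_nonneg) auto
          also have "\<dots> \<le> (\<integral>\<^sup>+w. Y.JG.cnt (fst l, snd l) a b w \<partial>M)"
            by (rule Y.J_cnt_ge[OF \<delta> low a(1) ab(2) False])
          finally show ?thesis by (simp add: GLC)
        qed (simp add: qG_def)
      qed auto
      moreover have "(\<integral>\<^sup>+u\<in>?I. (\<Sum>l\<in>UNIV. qG l u * mean_below C (G u (fst l) (snd l))) \<partial>lborel) = (\<integral>\<^sup>+u\<in>?I. ?g u \<partial>lborel)"
        by (intro nn_integral_cong) (auto simp: max_def split: split_indicator)
      ultimately show ?thesis by simp
    qed
    have K_ge: "(\<integral>\<^sup>+u\<in>?I. ?k u \<partial>lborel) \<le> (\<integral>\<^sup>+w. K.reward_sum (real i) (real (Suc i)) w \<partial>M)"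
    proof -
      have "(\<integral>\<^sup>+u\<in>?I. (\<Sum>x\<in>UNIV. qK x u * mean_below C (K u x)) \<partial>lborel) \<le> (\<integral>\<^sup>+w. K.reward_sum (real i) (real (Suc i)) w \<partial>M)"
      proof (rule K.reward_sum_ge[OF _ _ _ qK_meas])
        show "(\<integral>\<^sup>+w. of_nat (N (real (Suc i)) w - N (real i) w) \<partial>M) < \<infinity>" by (rule N.N_fin) auto
        fix x a c assume ab: "real i \<le> a" "a \<le> c"
        then have a: "1 \<le> a" "0 \<le> a" using i by auto
        have "(\<integral>\<^sup>+u\<in>{a<..c}. qK x u \<partial>lborel) \<le> ennreal (\<delta> * (LBINT u:{a..c}. \<beta> u x))"
          unfolding qK_def using \<delta> by (intro nn_integral_Ioc_scaled_le a N.set_integrable_\<beta> \<beta>(1)) auto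
        also have "\<dots> \<le> (\<integral>\<^sup>+w. N.SG.cnt x a c w \<partial>M)"
          by (rule N.N_cnt_ge[OF \<delta> low a(1) ab(2)])
        finally show "(\<integral>\<^sup>+u\<in>{a<..c}. qK x u \<partial>lborel) \<le> (\<integral>\<^sup>+w. K.LC x a c w \<partial>M)" by (simp add: KLC)
      qed auto
      moreover have "(\<integral>\<^sup>+u\<in>?I. (\<Sum>x\<in>UNIV. qK x u * mean_below C (K u x)) \<partial>lborel) = (\<integral>\<^sup>+u\<in>?I. ?k u \<partial>lborel)"
        by (intro nn_integral_cong) (auto simp: max_def split: split_indicator)
      ultimately show ?thesis by simp
    qed
    have "ennreal (\<delta> * \<gamma>0) = (\<integral>\<^sup>+u\<in>?I. ennreal (\<delta> * \<gamma>0) \<partial>lborel)" by (simp add: nn_integral_cmult_indicator)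
    also have "\<dots> \<le> (\<integral>\<^sup>+u. ?g u * indicator ?I u + ?k u * indicator ?I u \<partial>lborel)"
      using gk by (intro nn_integral_mono) (auto split: split_indicator)
    also have "\<dots> = (\<integral>\<^sup>+u\<in>?I. ?g u \<partial>lborel) + (\<integral>\<^sup>+u\<in>?I. ?k u \<partial>lborel)"
      by (rule nn_integral_add) measurable
    also have "\<dots> \<le> (\<integral>\<^sup>+w. ennreal (G.block_reward i w) \<partial>M) + (\<integral>\<^sup>+w. ennreal (K.block_reward i w) \<partial>M)"
      unfolding G.nn_integral_block_reward K.nn_integral_block_reward by (intro add_mono G_ge K_ge)
    finally show ?thesis
      unfolding mixing_blocks_moments(7)[OF DG] mixing_blocks_moments(7)[OF DK] .
  qed
  show ?thesis
  proof (rule four_blocks_strong_law[OF DT DG DH DK])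
    show "cumulative_reward r ts X N GG HH KK t \<in> borel_measurable M" if t: "0 \<le> t" for t
    proof -
      note [measurable] = T.A_meas[OF order.refl t] G.total_reward_meas[OF t] H.total_reward_meas[OF t] K.total_reward_meas[OF t]
      have "(\<lambda>w. T.A 0 t w + G.total_reward t w + H.total_reward t w + K.total_reward t w) \<in> borel_measurable M" by measurable
      then show ?thesis by (simp add: R_eq[abs_def])
    qed
    show "AE w in M. (\<forall>s t. 0 \<le> s \<longrightarrow> s \<le> t \<longrightarrow>
        cumulative_reward r ts X N GG HH KK s w \<le> cumulative_reward r ts X N GG HH KK t w)
        \<and> 0 \<le> cumulative_reward r ts X N GG HH KK 0 w"
      using G.AE_total_reward_mono H.AE_total_reward_mono K.AE_total_reward_mono AE_space
    proof eventually_elim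
      case (elim w)
      have "T.A 0 s w \<le> T.A 0 t w" if "0 \<le> s" "s \<le> t" for s t
        using T.A_split[OF elim(4) order.refl that] T.A_props(2)[OF elim(4) that] by simp
      moreover have "0 \<le> T.A 0 0 w" by (rule T.A_props(2)[OF elim(4)]) auto
      ultimately show ?case using elim(1-3) unfolding R_eq by (auto intro!: add_mono add_nonneg_nonneg)
    qed
    show "cumulative_reward r ts X N GG HH KK (real n) w
        = ((\<Sum>i<n. T.block_integral i w) + (\<Sum>i<n. G.block_reward i w)) + ((\<Sum>i<n. H.block_reward i w) + (\<Sum>i<n. K.block_reward i w))"
      if "w \<in> space M" for n w
      unfolding R_eq T.A_eq_sum_block_integral[OF that] G.total_reward_eq_sum_block_reward[OF that] H.total_reward_eq_sum_block_reward[OF that] K.total_reward_eq_sum_block_reward[OF that]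
      by simp
    \<comment> \<open>Either of \<open>r0\<close> and \<open>\<gamma>0\<close> may vanish, so the
      bound is for the sum of the three block means.\<close>
    show "0 < \<delta> * (r0 + \<gamma>0)" using \<delta> r\<gamma> by simp
    show "\<delta> * (r0 + \<gamma>0) \<le> expectation (T.block_integral i) + expectation (G.block_reward i) + expectation (K.block_reward i)"
      if i: "1 \<le> i" for i
    proof -
      have "ennreal (\<delta> * r0) \<le> ennreal (expectation (T.block_integral i))"
        unfolding mixing_blocks_moments(7)[OF DT, symmetric]
        using \<delta> low i r0 r0_le by (intro T.block_integral_ge[where x=x0]) auto
      then have 1: "\<delta> * r0 \<le> expectation (T.block_integral i)"
        using mixing_blocks_moments(4)[OF DT, of i] by (simp add: ennreal_le_iff)
      have "ennreal (\<delta> * \<gamma>0) \<le> ennreal (expectation (G.block_reward i) + expectation (K.block_reward i))"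
        using lump_low[OF i] mixing_blocks_moments(4)[OF DG, of i] mixing_blocks_moments(4)[OF DK, of i]
        by (simp add: ennreal_plus)
      then have "\<delta> * \<gamma>0 \<le> expectation (G.block_reward i) + expectation (K.block_reward i)"
        using mixing_blocks_moments(4)[OF DG, of i] mixing_blocks_moments(4)[OF DK, of i]
        by (subst (asm) ennreal_le_iff) auto
      with 1 show ?thesis by (simp add: distrib_left)
    qed
  qed
qed

end
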